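(* Let $n\ge2$, and for $\boldsymbol{\lambda}\in\mathbb{C}^n$ let $\nabla_{\boldsymbol{\lambda}}=d+A_{\boldsymbol{\lambda}}$ be the flat meromorphic connection on $\mathcal{O}_{\mathbb{P}^n}\oplus\mathcal{O}_{\mathbb{P}^n}$ over the complex projective space $\mathbb{P}^n$, and $D_n$ the divisor, given in the context. For generic $\boldsymbol{\lambda}$, the monodromy representation of $\nabla_{\boldsymbol{\lambda}}$ is conjugated to an explicit representation $$\rho_{\boldsymbol{\lambda}}\colon\pi_1(\mathbb{P}^n\setminus D_n)\longrightarrow\mathrm{SL}_2(\mathbb{C})$$ (namely the one given on generators at the end of the context), which is virtually abelian, i.e. abelian after a finite cover of $\mathbb{P}^n\setminus D_n$, and takes values in the infinite dihedral group $\boldsymbol{D}_\infty$.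
   Context: The infinite dihedral group is $$\boldsymbol{D}_\infty:=\left\langle\begin{pmatrix}0&\alpha\\-\alpha^{-1}&0\end{pmatrix},\begin{pmatrix}\beta&0\\0&\beta^{-1}\end{pmatrix}\ \middle|\ \alpha,\beta\in\mathbb{C}^*\right\rangle\le\mathrm{SL}_2(\mathbb{C}).$$ Let $[x:y:z_1:\dots:z_{n-2}:t]$ be homogeneous coordinates of $\mathbb{P}^n$, and $f(x,y,t):=x^2+y^2+t^2-2(xy+yt+tx)$. The divisor is $$D_n:=(x=0)+(y=0)+(t=0)+\mathcal{Q}_0+\mathcal{Q}_1+\dots+\mathcal{Q}_{n-2},$$ with $\mathcal{Q}_0:=(f(x,y,t)=0)$ and $\mathcal{Q}_i:=(f(x,y,t)-z_i^2=0)$ for $i=1,\dots,n-2$. The connection $\nabla_{\boldsymbol{\lambda}}$ is flat with polar divisor $D_n$, so it has a monodromy representation of $\pi_1(\mathbb{P}^n\setminus D_n)$; it is defined as follows. For $\boldsymbol{\lambda}=(\lambda_0,\dots,\lambda_{n-1})\in\mathbb{C}^n$ define rational $1$-forms on $\mathbb{P}^n$, written in the affine coordinates $[x:y:z_1:\dots:z_{n-2}:1]$, for $i=1,\dots,n-2$: $$\alpha_0:=-\frac{(2\lambda_0+\lambda_1)dx-(2\lambda_1+\lambda_0)dy}{2}-\frac{\lambda_1(y-1)}{2}\frac{dx}{x}+\frac{\lambda_0(x-1)}{2}\frac{dy}{y},$$ $$\alpha_1:=-\frac14\frac{df(x,y,1)}{f(x,y,1)},\qquad \alpha_2:=-\frac{\alpha_0}{f(x,y,1)},$$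 $$\alpha_0^i:=\lambda_{i+1}\left(dz_i-\frac{z_i\,d(f(x,y,1)-z_i^2)}{2(f(x,y,1)-z_i^2)}\right),\qquad \alpha_2^i:=-\frac{\alpha_0^i}{f(x,y,1)}.$$ Set $$\mathcal{A}_{11}:=(x-1)\alpha_2+\alpha_1+\frac12\frac{dy}{y},\quad \mathcal{A}_{12}:=\frac{dx+(x-1)^2\alpha_2+2(x-1)\alpha_1+\alpha_0}{y},\quad \mathcal{A}_{21}:=y\alpha_2,$$ $$\mathcal{A}^i_{11}:=(x-1)\alpha_2^i,\quad \mathcal{A}^i_{12}:=\frac{(x-1)^2\alpha_2^i+\alpha_0^i}{y},\quad \mathcal{A}^i_{21}:=y\alpha^i_2,$$ $$A_{\boldsymbol{\lambda}}:=\begin{pmatrix}\mathcal{A}_{11}&\mathcal{A}_{12}\\-\mathcal{A}_{21}&-\mathcal{A}_{11}\end{pmatrix}+\sum_{i=1}^{n-2}\begin{pmatrix}\mathcal{A}^i_{11}&\mathcal{A}^i_{12}\\-\mathcal{A}^i_{21}&-\mathcal{A}^i_{11}\end{pmatrix},\qquad \nabla_{\boldsymbol{\lambda}}:=d+A_{\boldsymbol{\lambda}}.$$ (For $n=2$ there are no $z_i$ and the sum is empty.) Generators of $\pi_1(\mathbb{P}^n\setminus D_n)$ (the loops below are called $\ell$, to distinguish them from the $1$-forms above). Cut $\mathbb{P}^n$ by the hyperplanes $z_i=a_ix+b_iy+c_it$ ($i=1,\dots,n-2$) with generic coefficients, $0<|a_i|\ll1$, $0<|b_i|\ll1$. This gives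 a plane $\mathbb{P}^2$ with coordinates $[x:y:t]$; let $\tilde D_n$, $\tilde{\mathcal{Q}}_i$ be the traces of $D_n$, $\mathcal{Q}_i$ on it. By Zariski's hyperplane section theorem $\pi_1(\mathbb{P}^n\setminus D_n,* )\cong\pi_1(\mathbb{P}^2\setminus\tilde D_n,* )$. Let $\pi([x:y:t])=[x:t]$, and let $a=[a:1]$ with $0<|a|\ll1$ and argument slightly negative. The fibre $\pi^{-1}(a)$, with coordinate $y$, meets $\tilde D_n$ in $0$, $\infty$ and the points $\{y_i^+,y_i^-\}=\tilde{\mathcal{Q}}_i\cap\pi^{-1}(a)$, $i=0,\dots,n-2$, labelled so that $0<\mathrm{Arg}\frac{y_1^+-(a+1)}{y_0^+-(a+1)}<\dots<\mathrm{Arg}\frac{y_{n-2}^+-(a+1)}{y_0^+-(a+1)}<\pi$ and so that $y_0^+$ is the point approaching $0$ when $a$ approaches $1$ along the real axis. For each such point $p$ let $\ell_p$ be a loop in the fibre around $p$, chosen so that $\ell_0\,\ell_{y_1^+}\cdots\ell_{y_{n-2}^+}\,\ell_{y_0^-}\ell_{y_1^-}\cdots\ell_{y_{n-2}^-}\,\ell_{y_0^+}\,\ell_\infty=1$. Let $\gamma_0$ be the image, under a continuous section of $\pi$ over $\mathbb{P}^1\setminus\{0,\infty\}$ through the base point, of a counter-clockwise loop around $0\in\mathbb{P}^1$ based at $a$; one has $\gamma_0^{-1}\ell_{y_0^+}\gamma_0=\ell_{y_0^-}$, and $\gamma_0$ commutes with $\ell_0$ and with $\ell_{y_i^+}$ ($i=1,\dots,n-2$).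 The group $\pi_1(\mathbb{P}^2\setminus\tilde D_n,* )$ is generated by $\ell_0,\ell_{y_0^+},\dots,\ell_{y_{n-2}^+},\gamma_0$. The explicit representation is $$\rho_{\boldsymbol{\lambda}}(\ell_0)=\begin{pmatrix}-e^{-\pi\sqrt{-1}\lambda_0}&0\\0&-e^{\pi\sqrt{-1}\lambda_0}\end{pmatrix},\quad \rho_{\boldsymbol{\lambda}}(\gamma_0)=\begin{pmatrix}e^{-\pi\sqrt{-1}\lambda_1}&0\\0&e^{\pi\sqrt{-1}\lambda_1}\end{pmatrix},$$ $$\rho_{\boldsymbol{\lambda}}(\ell_{y_0^+})=\begin{pmatrix}0&1\\-1&0\end{pmatrix},\quad \rho_{\boldsymbol{\lambda}}(\ell_{y_i^+})=\begin{pmatrix}e^{-\pi\sqrt{-1}\lambda_{i+1}}&0\\0&e^{\pi\sqrt{-1}\lambda_{i+1}}\end{pmatrix}\ (i=1,\dots,n-2).$$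
   Formalization: The loops around the points run clockwise, the relation used is γ0·ℓ_{y0+}·γ0^{-1}=ℓ_{y0-} (not γ0^{-1}·ℓ_{y0+}·γ0), and the generic c_i are taken in the open upper half plane with increasing arguments; otherwise the stated values of ρ_λ fail. *)

theory Defs
  imports "HOL-Complex_Analysis.Complex_Analysis" "HOL-Algebra.Generated_Groups"
begin

section \<open>Complex projective space and the divisor\<close>

text \<open>
  The dimension \<open>n\<close> is a variable, so all the spaces \<open>P\<^sup>n\<close> are realised inside one type
  \<open>cproj\<close> of lines in the space of complex sequences.  It carries the quotient topology;
  \<open>P\<^sup>n\<close> is the subset of the points all of whose coordinates beyond the \<open>n\<close>-th vanish.
  Since the projection from the nonzero vectors is open and this condition is saturated, the
  subspace topology on \<open>P\<^sup>n\<close> is the usual quotient topology.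
  The homogeneous coordinates \<open>[x : y : z_1 : \<dots> : z_{n-2} : t]\<close> are numbered \<open>0, \<dots>, n\<close>; thus
  \<open>x\<close>, \<open>y\<close>, \<open>t\<close> are the coordinates \<open>0\<close>, \<open>1\<close>, \<open>n\<close> and \<open>z_i\<close> is the coordinate \<open>i + 1\<close>.
\<close>

definition proportional :: "(nat \<Rightarrow> complex) \<Rightarrow> (nat \<Rightarrow> complex) \<Rightarrow> bool" where
  "proportional v w \<longleftrightarrow> v \<noteq> (\<lambda>_. 0) \<and> (\<exists>c. c \<noteq> 0 \<and> w = (\<lambda>k. c * v k))"

lemma part_equivp_proportional: "part_equivp proportional"
proof (rule part_equivpI)
  have "proportional (\<lambda>_. 1) (\<lambda>_. 1)"
    unfolding proportional_def by (auto simp: fun_eq_iff intro!: exI[of _ 1])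
  then show "\<exists>v. proportional v v" by blast
  show "symp proportional"
  proof (rule sympI)
    fix v w assume "proportional v w"
    then obtain c where c: "v \<noteq> (\<lambda>_. 0)" "c \<noteq> 0" "w = (\<lambda>k. c * v k)"
      unfolding proportional_def by blast
    then show "proportional w v"
      unfolding proportional_def by (auto simp: fun_eq_iff intro!: exI[of _ "inverse c"])
  qed
  show "transp proportional"
  proof (rule transpI)
    fix u v w assume "proportional u v" "proportional v w"
    then obtain c d where "u \<noteq> (\<lambda>_. 0)" "c \<noteq> 0" "v = (\<lambda>k. c * u k)" "d \<noteq> 0" "w = (\<lambda>k. d * v k)"
      unfolding proportional_def by blast
    then show "proportional u w"
      unfolding proportional_def by (auto intro!: exI[of _ "d * c"])
  qed
qed

quotient_type cproj = "nat \<Rightarrow> complex" / partial: proportional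
  by (rule part_equivp_proportional)

instantiation cproj :: topological_space
begin

definition open_cproj :: "cproj set \<Rightarrow> bool" where
  "open_cproj U \<longleftrightarrow> open {v :: nat \<Rightarrow> complex. v \<noteq> (\<lambda>_. 0) \<and> abs_cproj v \<in> U}"

instance
proof
  have "{v :: nat \<Rightarrow> complex. v \<noteq> (\<lambda>_. 0)} = - {\<lambda>_. 0}" by auto
  then show "open (UNIV :: cproj set)"
    unfolding open_cproj_def by (simp add: open_Compl)
next
  fix S T :: "cproj set" assume "open S" "open T"
  then have "open ({v :: nat \<Rightarrow> complex. v \<noteq> (\<lambda>_. 0) \<and> abs_cproj v \<in> S} \<inter>
                   {v. v \<noteq> (\<lambda>_. 0) \<and> abs_cproj v \<in> T})"
    unfolding open_cproj_def by (rule open_Int)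
  then show "open (S \<inter> T)"
    unfolding open_cproj_def by (rule back_subst[where P = "open"]) auto
next
  fix K :: "cproj set set" assume "\<forall>S\<in>K. open S"
  then have "open (\<Union>S\<in>K. {v :: nat \<Rightarrow> complex. v \<noteq> (\<lambda>_. 0) \<and> abs_cproj v \<in> S})"
    unfolding open_cproj_def by (intro open_UN) auto
  then show "open (\<Union>K)"
    unfolding open_cproj_def by (rule back_subst[where P = "open"]) auto
qed

end

definition projective_space :: "nat \<Rightarrow> cproj set" where
  "projective_space n = {abs_cproj v | v. v \<noteq> (\<lambda>_. 0) \<and> (\<forall>k>n. v k = 0)}"

definition conic :: "complex \<Rightarrow> complex \<Rightarrow> complex \<Rightarrow> complex" where
  "conic x y t = x\<^sup>2 + y\<^sup>2 + t\<^sup>2 - 2 * (x * y + y * t + t * x)"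

text \<open>The support of \<open>D_n\<close>.\<close>

definition divisor :: "nat \<Rightarrow> cproj set" where
  "divisor n = {abs_cproj v | v. v \<noteq> (\<lambda>_. 0) \<and> (\<forall>k>n. v k = 0) \<and>
     (v 0 = 0 \<or> v 1 = 0 \<or> v n = 0 \<or> conic (v 0) (v 1) (v n) = 0 \<or>
      (\<exists>i\<in>{1..n-2}. conic (v 0) (v 1) (v n) - (v (i + 1))\<^sup>2 = 0))}"

definition divisor_complement :: "nat \<Rightarrow> cproj set" where
  "divisor_complement n = projective_space n - divisor n"

text \<open>The point with affine coordinates \<open>(x, y, z_1, \<dots>, z_{n-2}) = (u 0, \<dots>, u (n-1))\<close>, \<open>t = 1\<close>.\<close>

definition affine_point :: "nat \<Rightarrow> (nat \<Rightarrow> complex) \<Rightarrow> cproj" where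
  "affine_point n u = abs_cproj (\<lambda>k. if k < n then u k else if k = n then 1 else 0)"


section \<open>Fundamental groups\<close>

definition loops_at :: "'a::topological_space set \<Rightarrow> 'a \<Rightarrow> (real \<Rightarrow> 'a) set" where
  "loops_at S b = {g. path g \<and> path_image g \<subseteq> S \<and> pathstart g = b \<and> pathfinish g = b}"

definition loop_class :: "'a::topological_space set \<Rightarrow> (real \<Rightarrow> 'a) \<Rightarrow> (real \<Rightarrow> 'a) set" where
  "loop_class S g = {h. homotopic_paths S g h}"

text \<open>As for \<open>(+++)\<close>, in a product the left factor is run through first.\<close>

definition fundamental_group ::
    "'a::topological_space set \<Rightarrow> 'a \<Rightarrow> (real \<Rightarrow> 'a) set monoid" where
  "fundamental_group S b =
     \<lparr>carrier = loop_class S ` loops_at S b,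
      mult = (\<lambda>G H. \<Union>g\<in>G. \<Union>h\<in>H. loop_class S (g +++ h)),
      one = loop_class S (\<lambda>_. b)\<rparr>"


section \<open>\<open>SL_2(C)\<close> and the infinite dihedral group\<close>

definition mat2 :: "complex \<Rightarrow> complex \<Rightarrow> complex \<Rightarrow> complex \<Rightarrow> complex^2^2" where
  "mat2 a b c d = vector [vector [a, b], vector [c, d]]"

definition SL2 :: "(complex^2^2) monoid" where
  "SL2 = \<lparr>carrier = {M. det M = 1}, mult = (**), one = mat 1\<rparr>"

definition D_infinity :: "(complex^2^2) set" where
  "D_infinity = generate SL2 ({mat2 0 \<alpha> (- inverse \<alpha>) 0 | \<alpha>. \<alpha> \<noteq> 0} \<union>
                              {mat2 \<beta> 0 0 (inverse \<beta>) | \<beta>. \<beta> \<noteq> 0})"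


section \<open>The connection\<close>

text \<open>
  A rational 1-form in the affine coordinates \<open>u\<close> is a function of the point \<open>u\<close> and of a
  tangent vector \<open>w\<close>; so \<open>dx\<close>, \<open>dy\<close>, \<open>dz_i\<close> are \<open>w 0\<close>, \<open>w 1\<close>, \<open>w (i + 1)\<close>.
\<close>

type_synonym one_form = "(nat \<Rightarrow> complex) \<Rightarrow> (nat \<Rightarrow> complex) \<Rightarrow> complex"

definition differential :: "((nat \<Rightarrow> complex) \<Rightarrow> complex) \<Rightarrow> one_form" where
  "differential h u w = deriv (\<lambda>e. h (\<lambda>k. u k + e * w k)) 0"

definition aff_conic :: "(nat \<Rightarrow> complex) \<Rightarrow> complex" where
  "aff_conic u = conic (u 0) (u 1) 1"

definition alpha0 :: "(nat \<Rightarrow> complex) \<Rightarrow> one_form" where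
  "alpha0 lam u w =
     - ((2 * lam 0 + lam 1) * w 0 - (2 * lam 1 + lam 0) * w 1) / 2
     - lam 1 * (u 1 - 1) / 2 * (w 0 / u 0)
     + lam 0 * (u 0 - 1) / 2 * (w 1 / u 1)"

definition alpha1 :: one_form where
  "alpha1 u w = - (1 / 4) * (differential aff_conic u w / aff_conic u)"

definition alpha2 :: "(nat \<Rightarrow> complex) \<Rightarrow> one_form" where
  "alpha2 lam u w = - alpha0 lam u w / aff_conic u"

definition alpha0_z :: "(nat \<Rightarrow> complex) \<Rightarrow> nat \<Rightarrow> one_form" where
  "alpha0_z lam i u w =
     lam (i + 1) *
       (w (i + 1) - u (i + 1) * differential (\<lambda>v. aff_conic v - (v (i + 1))\<^sup>2) u w
                    / (2 * (aff_conic u - (u (i + 1))\<^sup>2)))"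

definition alpha2_z :: "(nat \<Rightarrow> complex) \<Rightarrow> nat \<Rightarrow> one_form" where
  "alpha2_z lam i u w = - alpha0_z lam i u w / aff_conic u"

definition A11 :: "(nat \<Rightarrow> complex) \<Rightarrow> one_form" where
  "A11 lam u w = (u 0 - 1) * alpha2 lam u w + alpha1 u w + 1 / 2 * (w 1 / u 1)"

definition A12 :: "(nat \<Rightarrow> complex) \<Rightarrow> one_form" where
  "A12 lam u w =
     (w 0 + (u 0 - 1)\<^sup>2 * alpha2 lam u w + 2 * (u 0 - 1) * alpha1 u w + alpha0 lam u w) / u 1"

definition A21 :: "(nat \<Rightarrow> complex) \<Rightarrow> one_form" where
  "A21 lam u w = u 1 * alpha2 lam u w"

definition A11_z :: "(nat \<Rightarrow> complex) \<Rightarrow> nat \<Rightarrow> one_form" where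
  "A11_z lam i u w = (u 0 - 1) * alpha2_z lam i u w"

definition A12_z :: "(nat \<Rightarrow> complex) \<Rightarrow> nat \<Rightarrow> one_form" where
  "A12_z lam i u w = ((u 0 - 1)\<^sup>2 * alpha2_z lam i u w + alpha0_z lam i u w) / u 1"

definition A21_z :: "(nat \<Rightarrow> complex) \<Rightarrow> nat \<Rightarrow> one_form" where
  "A21_z lam i u w = u 1 * alpha2_z lam i u w"

definition connection_matrix ::
    "nat \<Rightarrow> (nat \<Rightarrow> complex) \<Rightarrow> (nat \<Rightarrow> complex) \<Rightarrow> (nat \<Rightarrow> complex) \<Rightarrow> complex^2^2" where
  "connection_matrix n lam u w =
     mat2 (A11 lam u w) (A12 lam u w) (- A21 lam u w) (- A11 lam u w)
     + (\<Sum>i\<in>{1..n-2}. mat2 (A11_z lam i u w) (A12_z lam i u w)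
                             (- A21_z lam i u w) (- A11_z lam i u w))"


section \<open>The monodromy representation\<close>

text \<open>Matrices \<open>F\<close> of flat sections on \<open>U\<close>: the columns are annihilated by \<open>d + A\<close>.\<close>

definition flat_on :: "nat \<Rightarrow> (nat \<Rightarrow> complex) \<Rightarrow> cproj set \<Rightarrow> (cproj \<Rightarrow> complex^2^2) \<Rightarrow> bool" where
  "flat_on n lam U F \<longleftrightarrow>
     continuous_on U F \<and>
     (\<forall>u w i j. affine_point n u \<in> U \<longrightarrow>
        ((\<lambda>e. F (affine_point n (\<lambda>k. u k + e * w k)) $ i $ j) has_field_derivative
           - (connection_matrix n lam u w ** F (affine_point n u)) $ i $ j) (at 0))"

definition flat_along ::
    "nat \<Rightarrow> (nat \<Rightarrow> complex) \<Rightarrow> (real \<Rightarrow> cproj) \<Rightarrow> (real \<Rightarrow> complex^2^2) \<Rightarrow> bool" where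
  "flat_along n lam g \<Phi> \<longleftrightarrow>
     (\<forall>\<tau>\<in>{0..1}. \<exists>U F. openin (top_of_set (divisor_complement n)) U \<and> g \<tau> \<in> U \<and>
        flat_on n lam U F \<and> \<Phi> \<tau> = F (g \<tau>) \<and>
        (\<forall>\<^sub>F s in at \<tau> within {0..1}. \<Phi> s = F (g s)))"

definition parallel_transport ::
    "nat \<Rightarrow> (nat \<Rightarrow> complex) \<Rightarrow> (real \<Rightarrow> cproj) \<Rightarrow> complex^2^2 \<Rightarrow> bool" where
  "parallel_transport n lam g P \<longleftrightarrow> (\<exists>\<Phi>. flat_along n lam g \<Phi> \<and> \<Phi> 0 = mat 1 \<and> \<Phi> 1 = P)"

text \<open>
  Transport along \<open>g +++ h\<close> is transport along \<open>g\<close> followed by transport along \<open>h\<close>, i.e. the matrix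
  product in the opposite order.  Taking inverses makes the monodromy a homomorphism.
\<close>

definition monodromy :: "nat \<Rightarrow> (nat \<Rightarrow> complex) \<Rightarrow> (real \<Rightarrow> cproj) set \<Rightarrow> complex^2^2" where
  "monodromy n lam G =
     (THE M. \<exists>g\<in>G. \<exists>P. parallel_transport n lam g P \<and> M = matrix_inv P)"

definition conjugate_on :: "'g set \<Rightarrow> ('g \<Rightarrow> complex^2^2) \<Rightarrow> ('g \<Rightarrow> complex^2^2) \<Rightarrow> bool" where
  "conjugate_on K \<mu> \<rho> \<longleftrightarrow> (\<exists>T. invertible T \<and> (\<forall>G\<in>K. \<rho> G = T ** \<mu> G ** matrix_inv T))"

text \<open>The pull-back of \<open>\<rho>\<close> to some connected finite covering space of \<open>X\<close> has abelian image.\<close>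

definition virtually_abelian ::
    "'a::topological_space set \<Rightarrow> 'a \<Rightarrow> ((real \<Rightarrow> 'a) set \<Rightarrow> complex^2^2) \<Rightarrow> bool" where
  "virtually_abelian X b \<rho> \<longleftrightarrow>
     (\<exists>(E :: (nat \<Rightarrow> complex) set) p c.
        covering_space E p X \<and> path_connected E \<and> (\<forall>x\<in>X. finite {y \<in> E. p y = x}) \<and>
        c \<in> E \<and> p c = b \<and>
        (\<forall>g\<in>loops_at E c. \<forall>h\<in>loops_at E c.
           \<rho> (loop_class X (p \<circ> g)) ** \<rho> (loop_class X (p \<circ> h)) =
           \<rho> (loop_class X (p \<circ> h)) ** \<rho> (loop_class X (p \<circ> g))))"


section \<open>Generic parameters\<close>

inductive_set polynomial_functions :: "nat \<Rightarrow> ((nat \<Rightarrow> complex) \<Rightarrow> complex) set" for n where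
  const: "(\<lambda>_. c) \<in> polynomial_functions n"
| var: "i < n \<Longrightarrow> (\<lambda>v. v i) \<in> polynomial_functions n"
| add: "p \<in> polynomial_functions n \<Longrightarrow> q \<in> polynomial_functions n \<Longrightarrow>
        (\<lambda>v. p v + q v) \<in> polynomial_functions n"
| mult: "p \<in> polynomial_functions n \<Longrightarrow> q \<in> polynomial_functions n \<Longrightarrow>
        (\<lambda>v. p v * q v) \<in> polynomial_functions n"

text \<open>\<open>Q\<close> holds on a nonempty Zariski open subset of \<open>C\<^sup>n\<close>.\<close>

definition generically :: "nat \<Rightarrow> ((nat \<Rightarrow> complex) \<Rightarrow> bool) \<Rightarrow> bool" where
  "generically n Q \<longleftrightarrow>
     (\<exists>p\<in>polynomial_functions n. (\<exists>v. p v \<noteq> 0) \<and> (\<forall>v. p v \<noteq> 0 \<longrightarrow> Q v))"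


section \<open>The loops\<close>

text \<open>The point \<open>[x : y : 1]\<close> of the plane \<open>z_i = a_i x + b_i y + c_i t\<close>, as a point of \<open>P\<^sup>n\<close>.\<close>

definition plane_point ::
    "nat \<Rightarrow> (nat \<Rightarrow> complex) \<Rightarrow> (nat \<Rightarrow> complex) \<Rightarrow> (nat \<Rightarrow> complex) \<Rightarrow> complex \<Rightarrow> complex \<Rightarrow> cproj" where
  "plane_point n A B C x y = affine_point n
     (\<lambda>k. if k = 0 then x else if k = 1 then y
          else A (k - 1) * x + B (k - 1) * y + C (k - 1))"

text \<open>The fibre over \<open>[x : 1]\<close> of the projection from \<open>[0 : 1 : 0]\<close>, minus the divisor.\<close>

definition punctured_fibre ::
    "nat \<Rightarrow> (nat \<Rightarrow> complex) \<Rightarrow> (nat \<Rightarrow> complex) \<Rightarrow> (nat \<Rightarrow> complex) \<Rightarrow> complex \<Rightarrow> complex set" where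
  "punctured_fibre n A B C x = {y. plane_point n A B C x y \<in> divisor_complement n}"

text \<open>
  Loops around a puncture \<open>p\<close>, respectively around \<open>\<infinity>\<close>, oriented clockwise around that puncture
  (around \<open>\<infinity>\<close> this is counter-clockwise in the coordinate of the fibre).
\<close>

definition loop_around :: "complex set \<Rightarrow> complex \<Rightarrow> complex \<Rightarrow> (real \<Rightarrow> complex) \<Rightarrow> bool" where
  "loop_around S b p g \<longleftrightarrow>
     (\<exists>r>0. \<exists>q. cball p r - {p} \<subseteq> S \<and> path q \<and> path_image q \<subseteq> S \<and>
        pathstart q = b \<and> pathfinish q = p + of_real r \<and>
        g = q +++ ((\<lambda>\<tau>. p + of_real r * cis (- 2 * pi * \<tau>)) +++ reversepath q))"

definition loop_around_infinity :: "complex set \<Rightarrow> complex \<Rightarrow> (real \<Rightarrow> complex) \<Rightarrow> bool" where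
  "loop_around_infinity S b g \<longleftrightarrow>
     (\<exists>r>0. \<exists>q. - ball 0 r \<subseteq> S \<and> path q \<and> path_image q \<subseteq> S \<and>
        pathstart q = b \<and> pathfinish q = of_real r \<and>
        g = q +++ ((\<lambda>\<tau>. of_real r * cis (2 * pi * \<tau>)) +++ reversepath q))"

text \<open>
  A condition on the constant coefficients of the cutting hyperplanes, all other coefficients being
  small.  For small \<open>a\<close> the points \<open>y_i\<^sup>\<plusminus>\<close> are close to \<open>1 \<minusplus> c_i\<close>, so increasing arguments
  are what the numbering of the \<open>y_i\<^sup>+\<close> requires.  The choice of the upper half plane fixes the sign
  of \<open>z_i\<close>: the hyperplanes \<open>z_i = \<dots>\<close> and \<open>- z_i = \<dots>\<close> have the same traces of the
  divisor, but the monodromies along the loops around \<open>y_i\<^sup>+\<close> in them are inverse to each other.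
\<close>

definition normalised_constants :: "nat \<Rightarrow> (nat \<Rightarrow> complex) \<Rightarrow> bool" where
  "normalised_constants n C \<longleftrightarrow>
     (\<forall>i\<in>{1..n-2}. 0 < Arg (C i) \<and> Arg (C i) < pi) \<and>
     (\<forall>i\<in>{1..n-2}. \<forall>j\<in>{1..n-2}. i < j \<longrightarrow> Arg (C i) < Arg (C j))"

text \<open>
  The data chosen in a fibre: the coordinate of the base point, the labelling of the punctures, a
  section of the projection through the base point, and loops in the fibre.
\<close>

record loop_system =
  base_y :: complex
  y_plus :: "nat \<Rightarrow> complex"
  y_minus :: "nat \<Rightarrow> complex"
  fibre_section :: "complex \<Rightarrow> complex"
  loop_zero :: "real \<Rightarrow> complex"
  loop_plus :: "nat \<Rightarrow> real \<Rightarrow> complex"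
  loop_minus :: "nat \<Rightarrow> real \<Rightarrow> complex"
  loop_infinity :: "real \<Rightarrow> complex"

definition base_point where
  "base_point n A B C a S = plane_point n A B C a (base_y S)"

text \<open>The class in \<open>\<pi>\<^sub>1(P\<^sup>n - D_n)\<close> of a loop in the fibre over \<open>a\<close>.\<close>

definition fibre_class where
  "fibre_class n A B C a g = loop_class (divisor_complement n) (plane_point n A B C a \<circ> g)"

definition gamma0_class where
  "gamma0_class n A B C a S = loop_class (divisor_complement n)
     (\<lambda>\<tau>. plane_point n A B C (a * cis (2 * pi * \<tau>))
             (fibre_section S (a * cis (2 * pi * \<tau>))))"

definition y_arg :: "complex \<Rightarrow> loop_system \<Rightarrow> nat \<Rightarrow> real" where
  "y_arg a S i = Arg ((y_plus S i - (a + 1)) / (y_plus S 0 - (a + 1)))"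

text \<open>
  The points of \<open>Q_0\<close> in the fibre are \<open>(1 \<plusminus> \<surd>a)\<^sup>2\<close>; with the principal branch of the square root,
  \<open>y_0\<^sup>+ = (1 - \<surd>a)\<^sup>2\<close> is the one that tends to \<open>0\<close> as \<open>a\<close> tends to \<open>1\<close>.
\<close>

definition labelled_points where
  "labelled_points n A B C a S \<longleftrightarrow>
     y_plus S 0 = (1 - csqrt a)\<^sup>2 \<and> y_minus S 0 = (1 + csqrt a)\<^sup>2 \<and>
     (\<forall>i\<in>{1..n-2}. {y_plus S i, y_minus S i} =
        {y. conic a y 1 - (A i * a + B i * y + C i)\<^sup>2 = 0}) \<and>
     (\<forall>i\<in>{1..n-2}. 0 < y_arg a S i \<and> y_arg a S i < pi) \<and>
     (\<forall>i\<in>{1..n-2}. \<forall>j\<in>{1..n-2}. i < j \<longrightarrow> y_arg a S i < y_arg a S j)"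

definition loops_around_points where
  "loops_around_points n A B C a S \<longleftrightarrow>
     (let fib = punctured_fibre n A B C a; b = base_y S; G = fundamental_group fib b in
        b \<in> fib \<and>
        loop_around fib b 0 (loop_zero S) \<and>
        (\<forall>i\<in>{0..n-2}. loop_around fib b (y_plus S i) (loop_plus S i) \<and>
                        loop_around fib b (y_minus S i) (loop_minus S i)) \<and>
        loop_around_infinity fib b (loop_infinity S) \<and>
        foldr (mult G) (map (loop_class fib)
           ([loop_zero S] @ map (loop_plus S) [1..<n-1] @
            [loop_minus S 0] @ map (loop_minus S) [1..<n-1] @
            [loop_plus S 0, loop_infinity S])) (one G) = one G)"

text \<open>
  The last condition determines the direction in which conjugation by \<open>\<gamma>\<^sub>0\<close> moves the loop around
  \<open>y_0\<^sup>+\<close> to the one around \<open>y_0\<^sup>-\<close>: with clockwise loops in the fibre, in the order of the product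
  relation above, it is \<open>\<gamma>\<^sub>0 \<ell> \<gamma>\<^sub>0\<^sup>-\<^sup>1\<close>.
\<close>

definition gamma0_relations where
  "gamma0_relations n A B C a S \<longleftrightarrow>
     (let G = fundamental_group (divisor_complement n) (base_point n A B C a S);
          \<gamma> = gamma0_class n A B C a S;
          cl = fibre_class n A B C a in
        continuous_on (- {0}) (fibre_section S) \<and>
        (\<forall>x. x \<noteq> 0 \<longrightarrow> fibre_section S x \<in> punctured_fibre n A B C x) \<and>
        fibre_section S a = base_y S \<and>
        \<gamma> \<otimes>\<^bsub>G\<^esub> cl (loop_zero S) = cl (loop_zero S) \<otimes>\<^bsub>G\<^esub> \<gamma> \<and>
        (\<forall>i\<in>{1..n-2}. \<gamma> \<otimes>\<^bsub>G\<^esub> cl (loop_plus S i) = cl (loop_plus S i) \<otimes>\<^bsub>G\<^esub> \<gamma>) \<and>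
        \<gamma> \<otimes>\<^bsub>G\<^esub> cl (loop_plus S 0) \<otimes>\<^bsub>G\<^esub> inv\<^bsub>G\<^esub> \<gamma> = cl (loop_minus S 0))"

definition standard_loops where
  "standard_loops n A B C a S \<longleftrightarrow>
     labelled_points n A B C a S \<and> loops_around_points n A B C a S \<and> gamma0_relations n A B C a S"


section \<open>The explicit representation\<close>

definition explicit_representation where
  "explicit_representation n A B C a S lam \<rho> \<longleftrightarrow>
     \<rho> \<in> hom (fundamental_group (divisor_complement n) (base_point n A B C a S)) SL2 \<and>
     \<rho> (fibre_class n A B C a (loop_zero S)) =
       mat2 (- exp (- (of_real pi * \<i> * lam 0))) 0 0 (- exp (of_real pi * \<i> * lam 0)) \<and>
     \<rho> (gamma0_class n A B C a S) =
       mat2 (exp (- (of_real pi * \<i> * lam 1))) 0 0 (exp (of_real pi * \<i> * lam 1)) \<and>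
     \<rho> (fibre_class n A B C a (loop_plus S 0)) = mat2 0 1 (- 1) 0 \<and>
     (\<forall>i\<in>{1..n-2}. \<rho> (fibre_class n A B C a (loop_plus S i)) =
       mat2 (exp (- (of_real pi * \<i> * lam (i + 1)))) 0 0 (exp (of_real pi * \<i> * lam (i + 1))))"

end

theory Submission
  imports Defs
begin

text \<open>
  Put \<open>x = p q\<close> and \<open>y = (1 - p) (1 - q)\<close>; then \<open>f(x, y, 1) = (p - q)\<^sup>2\<close>, and \<open>f - z_i\<^sup>2\<close> factors into
  \<open>p - q - z_i\<close> and \<open>p - q + z_i\<close>.  On the double cover of the complement of \<open>D_n\<close> with coordinates
  \<open>p, q, z_1, \<dots>, z_{n-2}\<close> the connection splits: each of the two sheets carries a flat section that
  is an algebraic vector times a product of complex powers of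
  \<open>p, q, 1 - p, 1 - q, p - q, p - q \<minusplus> z_i\<close>, and the deck transformation \<open>(p, q) \<mapsto> (q, p)\<close> exchanges the two
  lines.  So a loop that lifts to a loop has diagonal monodromy, with entries read off from the winding
  numbers of these functions, and any other loop has antidiagonal monodromy, for all \<open>\<lambda>\<close>.

  For the loops, let \<open>x = a\<close> be small.  The fibre over \<open>a\<close> contains the complement \<open>S\<close> of small discs around
  the limit points \<open>0, 1, Yp i, Ym i\<close> of the punctures, and the fibres over all points of the circle
  \<open>|x| = |a|\<close> contain \<open>S\<close>, so loops in \<open>S\<close> commute with \<open>\<gamma>\<^sub>0\<close>.  Hurwitz moves put a system
  of such loops into the required order.  The loop around \<open>1\<close> is the product of loops around the two
  points \<open>(1 \<plusminus> \<surd>a)\<^sup>2\<close>, which are exchanged when \<open>x\<close> runs around \<open>0\<close>.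
\<close>

text \<open>Why the connection splits: a column with entries kappa c and kappa is flat if c solves a
  Riccati equation and kappa a scalar one. The parameters enter the Riccati equation only through
  the sum a of \<open>alpha0\<close> and the \<open>alpha0_z\<close>, multiplied by (y c + x - 1)^2
  - f. Hence c = (1 - x + w) / y, with w a root of the conic f, is a solution for all parameters,
  and kappa results from integrating logarithmic differentials. The matrix is traceless, so flat
  frames are compared by constant Wronskians. The obstacle is topological: the relations to be met
  are equalities of homotopy classes of concretely parametrised loops. Two scales help. The radius r
  of the discs about the limit points is fixed before a, while the two points of Q_0 have a distance
  of order sqrt |a|, far below r, inside the disc about 1. There the substitution y = 1 + x +
  \<zeta> sqrt x gives a model independent of x. Finally, the ratio k of the two columns is free. It
  does not affect diagonal matrices and is spent on giving the loop around y_0^+ its prescribed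
  matrix.\<close>

no_notation fps_nth (infixl "$" 75)

section \<open>Fundamental groups\<close>

definition path_in :: "'a::topological_space set \<Rightarrow> (real \<Rightarrow> 'a) \<Rightarrow> bool" where
  "path_in S g \<longleftrightarrow> path g \<and> path_image g \<subseteq> S"

text \<open>The product of the fundamental groupoid, made total: representatives that do not fit
  together contribute nothing. Associativity then holds without side conditions, and words in
  classes of paths, not only of loops, can be normalised by rewriting.\<close>

definition class_prod :: "'a::topological_space set \<Rightarrow> (real \<Rightarrow> 'a) set \<Rightarrow> (real \<Rightarrow> 'a) set \<Rightarrow> (real \<Rightarrow> 'a) set" where
  "class_prod S G H = {k. \<exists>g\<in>G. \<exists>h\<in>H. path_in S g \<and> path_in S h \<and> pathfinish g = pathstart h \<and>
      homotopic_paths S (g +++ h) k}"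

lemma path_in_join [simp]:
  "pathfinish g = pathstart h \<Longrightarrow> path_in S (g +++ h) \<longleftrightarrow> path_in S g \<and> path_in S h"
  by (auto simp: path_in_def path_image_join)

lemma path_in_reversepath [simp]: "path_in S (reversepath g) \<longleftrightarrow> path_in S g"
  by (simp add: path_in_def)

lemma path_in_subset: "path_in S g \<Longrightarrow> S \<subseteq> T \<Longrightarrow> path_in T g"
  by (auto simp: path_in_def)

lemma path_in_compose:
  "path_in S g \<Longrightarrow> continuous_on S f \<Longrightarrow> f ` S \<subseteq> T \<Longrightarrow> path_in T (f \<circ> g)"
  by (auto simp: path_in_def path_image_compose intro!: path_continuous_image intro: continuous_on_subset)

lemma path_in_D: "path_in S g \<Longrightarrow> t \<in> {0..1} \<Longrightarrow> g t \<in> S"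
  by (auto simp: path_in_def path_image_def)

lemma path_inI: "continuous_on {0..1} g \<Longrightarrow> (\<And>t. 0 \<le> t \<Longrightarrow> t \<le> 1 \<Longrightarrow> g t \<in> S) \<Longrightarrow> path_in S g"
  by (auto simp: path_in_def path_def path_image_def)

lemma path_in_const [simp]: "path_in S (\<lambda>_. x) \<longleftrightarrow> x \<in> S"
  by (auto simp: path_in_def path_def path_image_def)

lemma pathstart_const [simp]: "pathstart (\<lambda>_. x) = x"
  and pathfinish_const [simp]: "pathfinish (\<lambda>_. x) = x"
  by (simp_all add: pathstart_def pathfinish_def)

lemma loops_at_iff: "g \<in> loops_at S b \<longleftrightarrow> path_in S g \<and> pathstart g = b \<and> pathfinish g = b"
  by (auto simp: loops_at_def path_in_def)

lemma loop_class_eqI: "homotopic_paths S g h \<Longrightarrow> loop_class S g = loop_class S h"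
  unfolding loop_class_def using homotopic_paths_sym homotopic_paths_trans by blast

lemma loop_class_self: "path_in S g \<Longrightarrow> g \<in> loop_class S g"
  by (simp add: loop_class_def path_in_def)

lemma loop_class_eq_iff: "path_in S g \<Longrightarrow> loop_class S g = loop_class S h \<longleftrightarrow> homotopic_paths S g h"
  by (metis homotopic_paths_sym_eq loop_class_def loop_class_eqI loop_class_self mem_Collect_eq)

lemma homotopic_paths_path_in: "homotopic_paths S g h \<Longrightarrow> path_in S g \<and> path_in S h"
  by (simp add: homotopic_paths_imp_path homotopic_paths_imp_subset path_in_def)

lemma loop_class_join:
  assumes "path_in S g" "path_in S h" "pathfinish g = pathstart h"
  shows "loop_class S (g +++ h) = class_prod S (loop_class S g) (loop_class S h)"
proof -
  have "homotopic_paths S (g +++ h) k"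
    if "homotopic_paths S g g'" "homotopic_paths S h h'" "homotopic_paths S (g' +++ h') k" for g' h' k
    using that assms homotopic_paths_join homotopic_paths_trans by blast
  then show ?thesis
    using loop_class_self[OF assms(1)] loop_class_self[OF assms(2)] assms
    unfolding class_prod_def loop_class_def by blast
qed

lemma class_prod_assoc:
  "class_prod S (class_prod S A B) C = class_prod S A (class_prod S B C)"
proof -
  \<comment> \<open>Each bracketing is described by composable triples; the two descriptions then
    differ by \<open>homotopic_paths_assoc\<close> only.\<close>
  have 1: "k \<in> class_prod S (class_prod S A B) C \<longleftrightarrow>
     (\<exists>a\<in>A. \<exists>b\<in>B. \<exists>c\<in>C. path_in S a \<and> path_in S b \<and> path_in S c \<and>
        pathfinish a = pathstart b \<and> pathfinish b = pathstart c \<and> homotopic_paths S ((a +++ b) +++ c) k)" for k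
  proof
    assume "k \<in> class_prod S (class_prod S A B) C"
    then obtain x c a b where *: "a \<in> A" "b \<in> B" "c \<in> C" "path_in S a" "path_in S b" "path_in S c" "path_in S x"
      "pathfinish a = pathstart b" "homotopic_paths S (a +++ b) x" "pathfinish x = pathstart c"
      "homotopic_paths S (x +++ c) k"
      unfolding class_prod_def by blast
    moreover have "pathfinish b = pathstart c"
      using homotopic_paths_imp_pathfinish[OF *(9)] * by simp
    moreover have "homotopic_paths S ((a +++ b) +++ c) (x +++ c)"
      using * \<open>pathfinish b = pathstart c\<close> by (intro homotopic_paths_join) (auto simp: path_in_def)
    ultimately show "\<exists>a\<in>A. \<exists>b\<in>B. \<exists>c\<in>C. path_in S a \<and> path_in S b \<and> path_in S c \<and>
        pathfinish a = pathstart b \<and> pathfinish b = pathstart c \<and> homotopic_paths S ((a +++ b) +++ c) k"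
      using homotopic_paths_trans by blast
  next
    assume "\<exists>a\<in>A. \<exists>b\<in>B. \<exists>c\<in>C. path_in S a \<and> path_in S b \<and> path_in S c \<and>
        pathfinish a = pathstart b \<and> pathfinish b = pathstart c \<and> homotopic_paths S ((a +++ b) +++ c) k"
    then obtain a b c where *: "a\<in>A" "b\<in>B" "c\<in>C" "path_in S a" "path_in S b" "path_in S c"
        "pathfinish a = pathstart b" "pathfinish b = pathstart c" "homotopic_paths S ((a +++ b) +++ c) k" by blast
    then have "a +++ b \<in> class_prod S A B"
      unfolding class_prod_def using homotopic_paths_refl[of S "a +++ b"] path_in_join[of a b S, unfolded path_in_def] path_in_def by blast
    with * show "k \<in> class_prod S (class_prod S A B) C"
      unfolding class_prod_def[of S "class_prod S A B"] mem_Collect_eq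
      by (intro bexI[of _ "a +++ b"] bexI[of _ c] conjI) simp_all
  qed
  have 2: "k \<in> class_prod S A (class_prod S B C) \<longleftrightarrow>
     (\<exists>a\<in>A. \<exists>b\<in>B. \<exists>c\<in>C. path_in S a \<and> path_in S b \<and> path_in S c \<and>
        pathfinish a = pathstart b \<and> pathfinish b = pathstart c \<and> homotopic_paths S (a +++ (b +++ c)) k)" for k
  proof
    assume "k \<in> class_prod S A (class_prod S B C)"
    then obtain x c a b where *: "a \<in> A" "b \<in> B" "c \<in> C" "path_in S a" "path_in S b" "path_in S c" "path_in S x"
      "pathfinish b = pathstart c" "homotopic_paths S (b +++ c) x" "pathfinish a = pathstart x"
      "homotopic_paths S (a +++ x) k"
      unfolding class_prod_def by blast
    moreover have "pathfinish a = pathstart b"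
      using homotopic_paths_imp_pathstart[OF *(9)] * by simp
    moreover have "homotopic_paths S (a +++ (b +++ c)) (a +++ x)"
      using * \<open>pathfinish a = pathstart b\<close> by (intro homotopic_paths_join) (auto simp: path_in_def)
    ultimately show "\<exists>a\<in>A. \<exists>b\<in>B. \<exists>c\<in>C. path_in S a \<and> path_in S b \<and> path_in S c \<and>
        pathfinish a = pathstart b \<and> pathfinish b = pathstart c \<and> homotopic_paths S (a +++ (b +++ c)) k"
      using homotopic_paths_trans by blast
  next
    assume "\<exists>a\<in>A. \<exists>b\<in>B. \<exists>c\<in>C. path_in S a \<and> path_in S b \<and> path_in S c \<and>
        pathfinish a = pathstart b \<and> pathfinish b = pathstart c \<and> homotopic_paths S (a +++ (b +++ c)) k"
    then obtain a b c where *: "a\<in>A" "b\<in>B" "c\<in>C" "path_in S a" "path_in S b" "path_in S c"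
        "pathfinish a = pathstart b" "pathfinish b = pathstart c" "homotopic_paths S (a +++ (b +++ c)) k" by blast
    then have "b +++ c \<in> class_prod S B C"
      unfolding class_prod_def using homotopic_paths_refl[of S "b +++ c"] path_in_join[of b c S, unfolded path_in_def] path_in_def by blast
    with * show "k \<in> class_prod S A (class_prod S B C)"
      unfolding class_prod_def[of S A] mem_Collect_eq
      by (intro bexI[of _ a] bexI[of _ "b +++ c"] conjI) simp_all
  qed
  have eqv: "homotopic_paths S ((a +++ b) +++ c) k \<longleftrightarrow> homotopic_paths S (a +++ (b +++ c)) k"
    if "path_in S a" "path_in S b" "path_in S c" "pathfinish a = pathstart b" "pathfinish b = pathstart c" for a b c k
    using homotopic_paths_assoc[of a S b c] that homotopic_paths_trans homotopic_paths_sym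
    unfolding path_in_def by blast
  show ?thesis
    unfolding set_eq_iff 1 2 by (simp add: eqv cong: conj_cong)
qed

text \<open>Joining a constant path is a reparametrisation that waits at one end.\<close>

lemma loop_class_join_const:
  assumes "path_in S g"
  shows "loop_class S ((\<lambda>_. pathstart g) +++ g) = loop_class S g"
    and "loop_class S (g +++ (\<lambda>_. pathfinish g)) = loop_class S g"
proof -
  have "homotopic_paths S g ((\<lambda>_. pathstart g) +++ g)"
  proof (rule homotopic_paths_reparametrize[where f = "\<lambda>t. max 0 (2 * t - 1)"])
    fix t :: real assume "t \<in> {0..1}"
    then show "((\<lambda>_. pathstart g) +++ g) t = g (max 0 (2 * t - 1))"
      by (cases "2 * t \<le> 1") (auto simp: joinpaths_def pathstart_def)
  qed (use assms in \<open>auto simp: path_in_def intro!: continuous_on_max continuous_intros\<close>)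
  then show "loop_class S ((\<lambda>_. pathstart g) +++ g) = loop_class S g"
    using loop_class_eqI by blast
  have "homotopic_paths S g (g +++ (\<lambda>_. pathfinish g))"
  proof (rule homotopic_paths_reparametrize[where f = "\<lambda>t. min 1 (2 * t)"])
    fix t :: real assume "t \<in> {0..1}"
    then show "(g +++ (\<lambda>_. pathfinish g)) t = g (min 1 (2 * t))"
      by (cases "2 * t \<le> 1") (auto simp: joinpaths_def pathfinish_def)
  qed (use assms in \<open>auto simp: path_in_def intro!: continuous_on_min continuous_intros\<close>)
  then show "loop_class S (g +++ (\<lambda>_. pathfinish g)) = loop_class S g"
    using loop_class_eqI by blast
qed

lemma homotopic_paths_join_reversepath:
  assumes "path_in S g"
  shows "homotopic_paths S (g +++ reversepath g) (\<lambda>_. pathstart g)"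
proof -
  have g: "continuous_on {0..1} g" and gS: "\<And>t. 0 \<le> t \<Longrightarrow> t \<le> 1 \<Longrightarrow> g t \<in> S"
    using assms by (auto simp: path_in_def path_def path_image_def)
  have bd: "0 \<le> (1 - s) * (1 - \<bar>1 - 2 * t\<bar>)" "(1 - s) * (1 - \<bar>1 - 2 * t\<bar>) \<le> 1"
    if "0 \<le> s" "s \<le> 1" "0 \<le> t" "t \<le> 1" for s t :: real
    using that by (intro mult_nonneg_nonneg mult_le_one; simp)+
  show ?thesis
    unfolding homotopic_paths
  proof (intro exI conjI ballI)
    \<comment> \<open>At stage s the path runs out along \<open>g\<close> only as far as the
      parameter 1 - s and then returns; 1 - |1 - 2 t| is the tent function.\<close>
    let ?h = "\<lambda>x. g ((1 - fst x) * (1 - \<bar>1 - 2 * snd x\<bar>))"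
    show "continuous_on ({0..1} \<times> {0..1}) ?h"
      by (intro continuous_on_compose2[OF g] continuous_intros) (use bd in auto)
    show "?h \<in> {0..1} \<times> {0..1} \<rightarrow> S"
      using gS bd by auto
  qed (auto simp: pathstart_def pathfinish_def joinpaths_def reversepath_def abs_if algebra_simps)
qed

lemma class_prod_lid [simp]:
  assumes "path_in S g" "pathstart g = x"
  shows "class_prod S (loop_class S (\<lambda>_. x)) (loop_class S g) = loop_class S g"
  using assms loop_class_join[of S "\<lambda>_. x" g] loop_class_join_const(1)[of S g] path_in_D[of S g 0]
  by (auto simp: pathstart_def)

lemma class_prod_rid [simp]:
  assumes "path_in S g" "pathfinish g = x"
  shows "class_prod S (loop_class S g) (loop_class S (\<lambda>_. x)) = loop_class S g"
  using assms loop_class_join[of S g "\<lambda>_. x"] loop_class_join_const(2)[of S g] path_in_D[of S g 1]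
  by (auto simp: pathfinish_def)

lemma class_prod_rinv [simp]:
  "path_in S g \<Longrightarrow> class_prod S (loop_class S g) (loop_class S (reversepath g)) =
     loop_class S (\<lambda>_. pathstart g)"
  using loop_class_eqI[OF homotopic_paths_join_reversepath[of S g]] loop_class_join[of S g "reversepath g"]
  by simp

lemma class_prod_linv [simp]:
  "path_in S g \<Longrightarrow> class_prod S (loop_class S (reversepath g)) (loop_class S g) =
     loop_class S (\<lambda>_. pathfinish g)"
  using class_prod_rinv[of S "reversepath g"] by simp

lemma class_prod_rinv_left [simp]:
  assumes "path_in S g" "path_in S h" "pathstart g = pathstart h"
  shows "class_prod S (loop_class S g) (class_prod S (loop_class S (reversepath g)) (loop_class S h)) = loop_class S h"
  unfolding class_prod_assoc[symmetric] class_prod_rinv[OF assms(1)] using assms by simp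

lemma class_prod_linv_left [simp]:
  assumes "path_in S g" "path_in S h" "pathfinish g = pathstart h"
  shows "class_prod S (loop_class S (reversepath g)) (class_prod S (loop_class S g) (loop_class S h)) = loop_class S h"
  unfolding class_prod_assoc[symmetric] class_prod_linv[OF assms(1)] using assms by simp

lemma class_prod_linv_left2 [simp]:
  assumes "path_in S g" "path_in S h" "pathfinish g = pathstart h"
  shows "class_prod S (loop_class S (reversepath g)) (class_prod S (loop_class S g) (class_prod S (loop_class S h) B))
    = class_prod S (loop_class S h) B"
  using class_prod_linv_left[OF assms] by (metis class_prod_assoc)

lemma class_prod_rinv_left2 [simp]:
  assumes "path_in S g" "path_in S h" "pathstart g = pathstart h"
  shows "class_prod S (loop_class S g) (class_prod S (loop_class S (reversepath g)) (class_prod S (loop_class S h) B))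
    = class_prod S (loop_class S h) B"
  using class_prod_rinv_left[OF assms] by (metis class_prod_assoc)

lemma fundamental_group_carrier:
  "carrier (fundamental_group S b) = loop_class S ` loops_at S b"
  by (simp add: fundamental_group_def)

text \<open>All representatives of two classes of loops at \<open>b\<close> are composable, so the
  union in the definition is the total product of the two classes.\<close>

lemma fundamental_group_mult:
  assumes "G \<in> carrier (fundamental_group S b)" "H \<in> carrier (fundamental_group S b)"
  shows "G \<otimes>\<^bsub>fundamental_group S b\<^esub> H = class_prod S G H"
proof -
  from assms obtain g h where gh: "G = loop_class S g" "H = loop_class S h" "g \<in> loops_at S b" "h \<in> loops_at S b"
    by (auto simp: fundamental_group_def)
  have "path_in S g' \<and> path_in S h' \<and> pathfinish g' = pathstart h'" if "g' \<in> G" "h' \<in> H" for g' h'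
    using that gh homotopic_paths_path_in homotopic_paths_imp_pathfinish homotopic_paths_imp_pathstart
    unfolding loop_class_def loops_at_def by (metis (mono_tags, lifting) mem_Collect_eq)
  then show ?thesis
    by (fastforce simp: fundamental_group_def class_prod_def loop_class_def)
qed

lemma fundamental_group_mult_class:
  assumes "g \<in> loops_at S b" "h \<in> loops_at S b"
  shows "loop_class S g \<otimes>\<^bsub>fundamental_group S b\<^esub> loop_class S h = loop_class S (g +++ h)"
  using assms by (subst fundamental_group_mult) (auto simp: fundamental_group_carrier loops_at_iff loop_class_join)

lemma fundamental_group_one:
  "\<one>\<^bsub>fundamental_group S b\<^esub> = loop_class S (\<lambda>_. b)"
  by (simp add: fundamental_group_def)

lemma loops_at_join: "g \<in> loops_at S b \<Longrightarrow> h \<in> loops_at S b \<Longrightarrow> g +++ h \<in> loops_at S b"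
  by (simp add: loops_at_iff)

lemma loops_at_reversepath: "g \<in> loops_at S b \<Longrightarrow> reversepath g \<in> loops_at S b"
  by (simp add: loops_at_iff)

lemma group_fundamental_group:
  assumes "b \<in> S" shows "group (fundamental_group S b)"
proof (rule groupI)
  show "\<one>\<^bsub>fundamental_group S b\<^esub> \<in> carrier (fundamental_group S b)"
    using assms unfolding fundamental_group_one fundamental_group_carrier by (intro imageI) (simp add: loops_at_iff)
next
  fix x y assume "x \<in> carrier (fundamental_group S b)" "y \<in> carrier (fundamental_group S b)"
  then show *: "x \<otimes>\<^bsub>fundamental_group S b\<^esub> y \<in> carrier (fundamental_group S b)"
    by (auto simp: fundamental_group_carrier fundamental_group_mult_class loops_at_join)
  fix z assume "z \<in> carrier (fundamental_group S b)"
  with \<open>x \<in> _\<close> \<open>y \<in> _\<close> show "x \<otimes>\<^bsub>fundamental_group S b\<^esub> y \<otimes>\<^bsub>fundamental_group S b\<^esub> z =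
    x \<otimes>\<^bsub>fundamental_group S b\<^esub> (y \<otimes>\<^bsub>fundamental_group S b\<^esub> z)"
    unfolding fundamental_group_carrier
    by (elim imageE) (simp add: fundamental_group_mult_class loops_at_join, simp add: loop_class_join loops_at_iff class_prod_assoc)
next
  fix x assume "x \<in> carrier (fundamental_group S b)"
  then show "\<one>\<^bsub>fundamental_group S b\<^esub> \<otimes>\<^bsub>fundamental_group S b\<^esub> x = x"
    using assms
    by (subst fundamental_group_mult) (auto simp: fundamental_group_carrier fundamental_group_one loops_at_iff)
next
  fix x assume "x \<in> carrier (fundamental_group S b)"
  then obtain g where g: "x = loop_class S g" "g \<in> loops_at S b"
    by (auto simp: fundamental_group_carrier)
  then show "\<exists>y\<in>carrier (fundamental_group S b). y \<otimes>\<^bsub>fundamental_group S b\<^esub> x = \<one>\<^bsub>fundamental_group S b\<^esub>"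
    by (intro bexI[of _ "loop_class S (reversepath g)"])
      (simp_all add: fundamental_group_carrier fundamental_group_mult_class loops_at_reversepath fundamental_group_one, simp add: loops_at_iff loop_class_join)
qed

lemma fundamental_group_inv:
  assumes "b \<in> S" "g \<in> loops_at S b"
  shows "inv\<^bsub>fundamental_group S b\<^esub> (loop_class S g) = loop_class S (reversepath g)"
proof -
  interpret group "fundamental_group S b" by (rule group_fundamental_group[OF assms(1)])
  show ?thesis
    using assms(2) by (intro inv_equality)
     (simp_all add: fundamental_group_carrier fundamental_group_mult_class loops_at_reversepath fundamental_group_one, simp add: loops_at_iff loop_class_join)
qed

section \<open>Maps induced on homotopy classes, and homotopies obtained from squares\<close>

definition induced :: "'a::topological_space set \<Rightarrow> 'b::topological_space set \<Rightarrow> ('a \<Rightarrow> 'b) \<Rightarrow> (real \<Rightarrow> 'a) set \<Rightarrow> (real \<Rightarrow> 'b) set" where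
  "induced S T f G = (\<Union>g\<in>G. loop_class T (f \<circ> g))"

lemma induced_class:
  assumes "continuous_on S f" "f ` S \<subseteq> T" "path_in S g"
  shows "induced S T f (loop_class S g) = loop_class T (f \<circ> g)"
proof -
  have "loop_class T (f \<circ> h) = loop_class T (f \<circ> g)" if "homotopic_paths S g h" for h
    using homotopic_paths_continuous_image[OF that assms(1), of T] assms(2)
    by (metis homotopic_paths_sym image_subset_iff_funcset loop_class_eqI)
  moreover have "g \<in> loop_class S g" using assms loop_class_self by blast
  ultimately show ?thesis unfolding induced_def loop_class_def by blast
qed

lemma induced_hom:
  assumes "continuous_on S f" "f ` S \<subseteq> T"
  shows "induced S T f \<in> hom (fundamental_group S b) (fundamental_group T (f b))"
proof (rule homI)
  have loop: "f \<circ> g \<in> loops_at T (f b)" if "g \<in> loops_at S b" for g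
    using that path_in_compose[OF _ assms] by (auto simp: loops_at_iff pathstart_compose pathfinish_compose)
  fix x assume x: "x \<in> carrier (fundamental_group S b)"
  then show "induced S T f x \<in> carrier (fundamental_group T (f b))"
    using loop by (auto simp: fundamental_group_carrier induced_class[OF assms] loops_at_iff)
  fix y assume "y \<in> carrier (fundamental_group S b)"
  with x obtain g h where "x = loop_class S g" "y = loop_class S h" "g \<in> loops_at S b" "h \<in> loops_at S b"
    by (auto simp: fundamental_group_carrier)
  then have "path_in S g" "path_in S h" "path_in S (g +++ h)" and fgh: "f \<circ> g \<in> loops_at T (f b)" "f \<circ> h \<in> loops_at T (f b)"
    and gh: "x = loop_class S g" "y = loop_class S h" "g \<in> loops_at S b" "h \<in> loops_at S b"
    using loop by (auto simp: loops_at_iff)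
  then show "induced S T f (x \<otimes>\<^bsub>fundamental_group S b\<^esub> y) =
           induced S T f x \<otimes>\<^bsub>fundamental_group T (f b)\<^esub> induced S T f y"
    unfolding gh fundamental_group_mult_class[OF gh(3,4)]
    by (simp only: induced_class[OF assms] path_compose_join fundamental_group_mult_class[OF fgh])
qed

text \<open>The unit square is convex, so the two ways round its boundary are homotopic.\<close>

lemma square_homotopy:
  fixes H :: "real \<times> real \<Rightarrow> 'a::topological_space"
  assumes "continuous_on ({0..1} \<times> {0..1}) H" "H ` ({0..1} \<times> {0..1}) \<subseteq> S"
  shows "homotopic_paths S ((\<lambda>s. H (s, 0)) +++ (\<lambda>t. H (1, t))) ((\<lambda>t. H (0, t)) +++ (\<lambda>s. H (s, 1)))"
proof -
  let ?Q = "{0..1} \<times> {0..1} :: (real \<times> real) set"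
  let ?a = "linepath (0, 0) (1, 0) +++ linepath (1, 0) (1, 1) :: real \<Rightarrow> real \<times> real"
  let ?b = "linepath (0, 0) (0, 1) +++ linepath (0, 1) (1, 1) :: real \<Rightarrow> real \<times> real"
  have conv: "convex ?Q" by (intro convex_Times) auto
  have sub: "path_image ?a \<subseteq> ?Q" "path_image ?b \<subseteq> ?Q"
    using conv by (simp_all add: subset_path_image_join closed_segment_subset)
  have "homotopic_paths ?Q ?a ?b"
  proof (rule homotopic_paths_linear)
    fix t :: real assume "t \<in> {0..1}"
    then show "closed_segment (?a t) (?b t) \<subseteq> ?Q"
      using sub by (intro closed_segment_subset conv) (auto simp: path_image_def simp del: mem_Times_iff)
  qed auto
  from homotopic_paths_continuous_image[OF this assms(1), of S] assms(2)
  have "homotopic_paths S (H \<circ> ?a) (H \<circ> ?b)" by auto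
  moreover have "H \<circ> ?a = (\<lambda>s. H (s, 0)) +++ (\<lambda>t. H (1, t))" "H \<circ> ?b = (\<lambda>t. H (0, t)) +++ (\<lambda>s. H (s, 1))"
    by (auto simp: fun_eq_iff joinpaths_def linepath_def)
  ultimately show ?thesis by simp
qed

lemma path_in_square:
  assumes "continuous_on ({0..1} \<times> {0..1}) H" "H ` ({0..1} \<times> {0..1}) \<subseteq> S" "0 \<le> c" "c \<le> 1"
  shows "path_in S (\<lambda>s. H (s, c))" "path_in S (\<lambda>t. H (c, t))"
proof -
  have "continuous_on {0..1} (\<lambda>s. H (s, c))" "continuous_on {0..1} (\<lambda>t. H (c, t))"
    using assms by (auto intro!: continuous_on_compose2[OF assms(1)] continuous_intros)
  then show "path_in S (\<lambda>s. H (s, c))" "path_in S (\<lambda>t. H (c, t))"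
    using assms by (auto simp: o_def intro!: path_inI)
qed

text \<open>The bracketing is that of \<open>loop_around\<close> and
  \<open>loop_around_infinity\<close>, so that loops built this way have the prescribed form
  literally.\<close>

definition lasso :: "(real \<Rightarrow> 'a::topological_space) \<Rightarrow> (real \<Rightarrow> 'a) \<Rightarrow> real \<Rightarrow> 'a" where
  "lasso q h = q +++ (h +++ reversepath q)"

lemma path_in_lasso [simp]:
  "pathfinish q = pathstart h \<Longrightarrow> pathfinish h = pathfinish q \<Longrightarrow> path_in S (lasso q h) \<longleftrightarrow> path_in S q \<and> path_in S h"
  by (auto simp: lasso_def)

lemma pathstart_lasso [simp]: "pathstart (lasso q h) = pathstart q"
  and pathfinish_lasso [simp]: "pathfinish (lasso q h) = pathstart q"
  by (simp_all add: lasso_def)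

lemma lasso_class:
  assumes "path_in S q" "path_in S h" "pathfinish q = pathstart h" "pathfinish h = pathfinish q"
  shows "loop_class S (lasso q h) = class_prod S (loop_class S q) (class_prod S (loop_class S h) (loop_class S (reversepath q)))"
  using assms by (simp add: lasso_def loop_class_join)

lemma lasso_join:
  assumes "path_in S p" "path_in S q" "path_in S h" "pathfinish p = pathstart q"
    "pathfinish q = pathstart h" "pathfinish h = pathfinish q"
  shows "loop_class S (lasso (p +++ q) h) = loop_class S (lasso p (lasso q h))"
  using assms by (simp add: lasso_class reversepath_joinpaths loop_class_join class_prod_assoc)

lemma lasso_cong:
  assumes "path_in S q" "pathfinish q = pathstart h" "pathfinish h = pathfinish q"
    "loop_class S h = loop_class S h'" "path_in S h"
  shows "loop_class S (lasso q h) = loop_class S (lasso q h')"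
proof -
  have "homotopic_paths S h h'" using assms by (simp add: loop_class_eq_iff)
  then have "path_in S h'" "pathstart h' = pathstart h" "pathfinish h' = pathfinish h"
    using homotopic_paths_path_in homotopic_paths_imp_pathstart homotopic_paths_imp_pathfinish by metis+
  then show ?thesis using assms by (simp add: lasso_class)
qed

text \<open>Conjugation by a loop only lengthens the tail of a lasso; hence loops around a puncture
  are stable under conjugation.\<close>

lemma lasso_conj:
  assumes "b \<in> S" "k \<in> loops_at S b" "path_in S q" "path_in S h" "pathstart q = b"
    "pathfinish q = pathstart h" "pathfinish h = pathfinish q"
  shows "loop_class S k \<otimes>\<^bsub>fundamental_group S b\<^esub> loop_class S (lasso q h) \<otimes>\<^bsub>fundamental_group S b\<^esub>
    inv\<^bsub>fundamental_group S b\<^esub> (loop_class S k) = loop_class S (lasso (k +++ q) h)"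
proof -
  have l: "lasso q h \<in> loops_at S b" using assms by (auto simp: loops_at_iff)
  have "loop_class S k \<otimes>\<^bsub>fundamental_group S b\<^esub> loop_class S (lasso q h) \<otimes>\<^bsub>fundamental_group S b\<^esub>
    inv\<^bsub>fundamental_group S b\<^esub> (loop_class S k) = loop_class S ((k +++ lasso q h) +++ reversepath k)"
    using assms l by (simp add: fundamental_group_mult_class fundamental_group_inv[OF assms(1)] loops_at_join loops_at_reversepath)
  also have "\<dots> = loop_class S (lasso k (lasso q h))"
    using assms l by (simp add: loop_class_join loops_at_iff lasso_class class_prod_assoc lasso_def[of k])
  also have "\<dots> = loop_class S (lasso (k +++ q) h)"
    using assms by (intro lasso_join[symmetric]) (auto simp: loops_at_iff)
  finally show ?thesis .
qed

text \<open>A free homotopy from h0 to h1 whose base point travels along a path beta makes beta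
  followed by h1 homotopic to h0 followed by beta; so beta can be absorbed into the tail.\<close>

lemma lasso_move_base:
  assumes H: "continuous_on ({0..1} \<times> {0..1}) H" "H ` ({0..1} \<times> {0..1}) \<subseteq> S"
    and loop: "\<And>s. s \<in> {0..1} \<Longrightarrow> H (s, 0) = H (s, 1)"
    and q: "path_in S q" "pathfinish q = H (0, 0)"
  shows "loop_class S (lasso q (\<lambda>t. H (0, t))) = loop_class S (lasso (q +++ (\<lambda>s. H (s, 0))) (\<lambda>t. H (1, t)))"
proof -
  let ?\<beta> = "\<lambda>s. H (s, 0)" and ?h0 = "\<lambda>t. H (0, t)" and ?h1 = "\<lambda>t. H (1, t)"
  have p: "path_in S ?\<beta>" "path_in S ?h0" "path_in S ?h1" "path_in S (\<lambda>s. H (s, 1))"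
    using path_in_square[OF H] by auto
  have ends [simp]: "pathstart ?\<beta> = H (0,0)" "pathfinish ?\<beta> = H (1,0)" "pathstart ?h0 = H (0,0)"
    "pathfinish ?h0 = H (0,0)" "pathstart ?h1 = H (1,0)" "pathfinish ?h1 = H (1,0)"
    using loop by (auto simp: pathstart_def pathfinish_def)
  have "homotopic_paths S (\<lambda>s. H (s, 1)) ?\<beta>"
    using p loop by (intro homotopic_paths_eq) (auto simp: path_in_def)
  then have "loop_class S (\<lambda>s. H (s, 1)) = loop_class S ?\<beta>" by (rule loop_class_eqI)
  moreover have "loop_class S (?\<beta> +++ ?h1) = loop_class S (?h0 +++ (\<lambda>s. H (s, 1)))"
    by (rule loop_class_eqI) (rule square_homotopy[OF H])
  ultimately have "class_prod S (loop_class S ?\<beta>) (loop_class S ?h1) = class_prod S (loop_class S ?h0) (loop_class S ?\<beta>)"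
    using p loop[of 0] by (simp add: loop_class_join pathstart_def pathfinish_def)
  then have "class_prod S (class_prod S (loop_class S ?\<beta>) (loop_class S ?h1)) (loop_class S (reversepath ?\<beta>)) =
      class_prod S (class_prod S (loop_class S ?h0) (loop_class S ?\<beta>)) (loop_class S (reversepath ?\<beta>))"
    by (rule arg_cong)
  then have "class_prod S (loop_class S ?\<beta>) (class_prod S (loop_class S ?h1) (loop_class S (reversepath ?\<beta>))) = loop_class S ?h0"
    using p by (simp add: class_prod_assoc)
  then have "loop_class S (lasso ?\<beta> ?h1) = loop_class S ?h0"
    using p by (simp add: lasso_class)
  then show ?thesis
    using p q lasso_join[of S q ?\<beta> ?h1] lasso_cong[of S q "lasso ?\<beta> ?h1" ?h0] by simp
qed

text \<open>Hurwitz moves: \<open>x \<otimes> y = (x \<otimes> y \<otimes> inv x) \<otimes> x\<close> swaps two factors at the cost of a conjugation.\<close>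

lemma (in group) foldr_mult_closed: "set xs \<subseteq> carrier G \<Longrightarrow> foldr (\<otimes>) xs \<one> \<in> carrier G"
  by (induction xs) auto

lemma (in group) foldr_mult_append:
  "set xs \<subseteq> carrier G \<Longrightarrow> set ys \<subseteq> carrier G \<Longrightarrow>
    foldr (\<otimes>) (xs @ ys) \<one> = foldr (\<otimes>) xs \<one> \<otimes> foldr (\<otimes>) ys \<one>"
  by (induction xs) (auto simp: m_assoc foldr_mult_closed[simplified])

lemma (in group) hurwitz_reorder:
  assumes conj: "\<And>c x k. P c x \<Longrightarrow> k \<in> carrier G \<Longrightarrow> P c (k \<otimes> x \<otimes> inv k)"
    and carr: "\<And>c x. P c x \<Longrightarrow> x \<in> carrier G"
  shows "distinct cs \<Longrightarrow> distinct ds \<Longrightarrow> set ds = set cs \<Longrightarrow> (\<And>c. c \<in> set cs \<Longrightarrow> P c (f c)) \<Longrightarrow>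
    \<exists>g. (\<forall>c\<in>set cs. P c (g c)) \<and> foldr (\<otimes>) (map g ds) \<one> = foldr (\<otimes>) (map f cs) \<one>"
proof (induction ds arbitrary: cs f)
  case Nil then show ?case by auto
next
  case (Cons d ds)
  then obtain us vs where cs: "cs = us @ d # vs" by (metis list.set_intros(1) split_list)
  have dist: "d \<notin> set us" "d \<notin> set vs" "distinct us" "distinct vs" "set us \<inter> set vs = {}" "d \<notin> set ds" "distinct ds"
    using Cons.prems cs by auto
  have sub: "set (map f us) \<subseteq> carrier G" "set (map f vs) \<subseteq> carrier G" "f d \<in> carrier G"
    using Cons.prems(4) carr cs by auto
  \<comment> \<open>The factor of \<open>d\<close> is moved in front of the product \<open>U\<close>
    of the factors before it and is conjugated by \<open>U\<close> on the way; the order of the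
    others is left to the induction hypothesis.\<close>
  define U where "U = foldr (\<otimes>) (map f us) \<one>"
  have U: "U \<in> carrier G" unfolding U_def by (rule foldr_mult_closed[OF sub(1)])
  have V: "foldr (\<otimes>) (map f vs) \<one> \<in> carrier G" by (rule foldr_mult_closed[OF sub(2)])
  obtain g where g: "\<forall>c\<in>set (us @ vs). P c (g c)"
    "foldr (\<otimes>) (map g ds) \<one> = foldr (\<otimes>) (map f (us @ vs)) \<one>"
  proof -
    have "set ds = set (us @ vs)" using Cons.prems(3) cs dist by auto
    then show ?thesis
      using that Cons.IH[of "us @ vs" f] Cons.prems(4) cs dist by auto
  qed
  let ?x = "U \<otimes> f d \<otimes> inv U"
  have "P d ?x" using conj U Cons.prems(4) cs by auto
  let ?g = "g(d := ?x)"
  have "map ?g ds = map g ds" using dist by auto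
  moreover have "foldr (\<otimes>) (map g ds) \<one> = U \<otimes> foldr (\<otimes>) (map f vs) \<one>"
    using g(2) sub foldr_mult_append[of "map f us" "map f vs"] by (simp add: U_def)
  ultimately have "foldr (\<otimes>) (map ?g (d # ds)) \<one> = ?x \<otimes> (U \<otimes> foldr (\<otimes>) (map f vs) \<one>)"
    by (simp del: map_eq_conv)
  also have "\<dots> = U \<otimes> (f d \<otimes> foldr (\<otimes>) (map f vs) \<one>)"
    using U V sub by (simp add: m_assoc) (simp add: m_assoc[symmetric])
  also have "\<dots> = foldr (\<otimes>) (map f cs) \<one>"
    using foldr_mult_append[of "map f us" "map f (d # vs)"] sub cs by (simp add: U_def)
  finally have eq: "foldr (\<otimes>) (map ?g (d # ds)) \<one> = foldr (\<otimes>) (map f cs) \<one>" .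
  have "\<forall>c\<in>set cs. P c (?g c)"
    using g(1) \<open>P d ?x\<close> cs by auto
  with eq show ?case by blast
qed

section \<open>Winding numbers and loops in the plane\<close>

lemma path_log:
  assumes "path g" "\<And>t. 0 \<le> t \<Longrightarrow> t \<le> 1 \<Longrightarrow> g t \<noteq> 0"
  obtains l :: "real \<Rightarrow> complex" where "continuous_on {0..1} l" "\<And>t. 0 \<le> t \<Longrightarrow> t \<le> 1 \<Longrightarrow> g t = exp (l t)"
proof (rule continuous_logarithm_on_contractible[of "{0..1}" g])
  show "contractible {0..1::real}" by (rule convex_imp_contractible) simp
qed (use assms that in \<open>auto simp: path_def\<close>)

text \<open>Valid for open paths too: their winding number is the increment of the logarithm over 2
  pi i. This is how the change of a complex power along an arc is recorded.\<close>

lemma winding_number_of_log: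
  assumes "continuous_on {0..1} l" "\<And>t. 0 \<le> t \<Longrightarrow> t \<le> 1 \<Longrightarrow> g t = exp (l t)"
  shows "winding_number g 0 = (l 1 - l 0) / (2 * of_real pi * \<i>)"
proof -
  have "winding_number g 0 = winding_number (exp \<circ> l) 0"
    by (rule winding_number_cong) (use assms in auto)
  then show ?thesis
    using winding_number_compose_exp[of l] assms by (simp add: path_def pathstart_def pathfinish_def)
qed

lemma winding_number_mult:
  assumes "path g" "path h" "\<And>t. 0 \<le> t \<Longrightarrow> t \<le> 1 \<Longrightarrow> g t \<noteq> 0" "\<And>t. 0 \<le> t \<Longrightarrow> t \<le> 1 \<Longrightarrow> h t \<noteq> 0"
  shows "winding_number (\<lambda>t. g t * h t) 0 = winding_number g 0 + winding_number h 0"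
proof -
  obtain l where l: "continuous_on {0..1} l" "\<And>t. 0 \<le> t \<Longrightarrow> t \<le> 1 \<Longrightarrow> g t = exp (l t)"
    using path_log[of g] assms by metis
  obtain k where k: "continuous_on {0..1} k" "\<And>t. 0 \<le> t \<Longrightarrow> t \<le> 1 \<Longrightarrow> h t = exp (k t)"
    using path_log[of h] assms by metis
  have "winding_number (\<lambda>t. g t * h t) 0 = (l 1 + k 1 - (l 0 + k 0)) / (2 * of_real pi * \<i>)"
    by (rule winding_number_of_log[where l = "\<lambda>t. l t + k t"]) (auto intro!: continuous_intros l k simp: l k exp_add)
  then show ?thesis
    using winding_number_of_log[OF l] winding_number_of_log[OF k] by (simp add: diff_divide_distrib add_divide_distrib)
qed

lemma winding_number_right_half_plane:
  assumes "path g" "pathfinish g = pathstart g" "\<And>t. 0 \<le> t \<Longrightarrow> t \<le> 1 \<Longrightarrow> Re (g t) > 0"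
  shows "winding_number g 0 = 0"
proof -
  have "winding_number g 0 = (Ln (g 1) - Ln (g 0)) / (2 * of_real pi * \<i>)"
  proof (rule winding_number_of_log)
    show "continuous_on {0..1} (\<lambda>t. Ln (g t))"
      using assms(1,3) by (intro continuous_on_Ln') (force simp: path_def complex_nonpos_Reals_iff)+
    fix t :: real assume "0 \<le> t" "t \<le> 1"
    then show "g t = exp (Ln (g t))" using assms(3)[of t] by (subst exp_Ln) auto
  qed
  then show ?thesis using assms(2) by (simp add: pathstart_def pathfinish_def)
qed

text \<open>The quotient \<open>h\<close> / \<open>g\<close> stays at distance less than 1 from 1,
  hence in the right half-plane, and contributes nothing. Exact functions are replaced by their
  leading terms in this way.\<close>

lemma winding_number_near:
  assumes "path g" "path h" "pathfinish h = pathstart h" "pathfinish g = pathstart g"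
    "\<And>t. 0 \<le> t \<Longrightarrow> t \<le> 1 \<Longrightarrow> norm (h t - g t) < norm (g t)"
  shows "winding_number h 0 = winding_number g 0"
proof -
  have nz: "g t \<noteq> 0" "h t \<noteq> 0" if "0 \<le> t" "t \<le> 1" for t
    using assms(5)[OF that] by auto
  have p: "path (\<lambda>t. h t / g t)"
    using assms(1,2) nz by (auto simp: path_def intro!: continuous_intros)
  have "winding_number h 0 = winding_number (\<lambda>t. g t * (h t / g t)) 0"
    by (rule winding_number_cong) (simp add: nz)
  also have "\<dots> = winding_number g 0 + winding_number (\<lambda>t. h t / g t) 0"
    using assms nz p by (intro winding_number_mult) auto
  also have "winding_number (\<lambda>t. h t / g t) 0 = 0"
  proof (rule winding_number_right_half_plane[OF p])
    fix t :: real assume t: "0 \<le> t" "t \<le> 1"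
    have "norm (h t / g t - 1) < 1"
      using assms(5)[OF t] nz[OF t] by (simp add: divide_simps norm_divide flip: norm_divide)
         (simp add: norm_divide divide_simps)
    then show "Re (h t / g t) > 0"
      using abs_Re_le_cmod[of "h t / g t - 1"] by (simp add: abs_if split: if_splits)
  qed (use assms in \<open>auto simp: pathstart_def pathfinish_def\<close>)
  finally show ?thesis by simp
qed

lemma winding_number_exp_ratio:
  assumes "path g" "\<And>t. 0 \<le> t \<Longrightarrow> t \<le> 1 \<Longrightarrow> g t \<noteq> 0"
  shows "exp (2 * of_real pi * \<i> * winding_number g 0) = pathfinish g / pathstart g"
proof -
  have "0 \<notin> path_image g" "pathstart g \<noteq> 0"
    using assms(2) assms(2)[of 0] by (force simp: path_image_def pathstart_def)+
  then show ?thesis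
    using winding_number_exp_2pi[OF assms(1), of 0] by (simp add: field_simps)
qed

text \<open>Clockwise, as \<open>loop_around\<close> demands; the complex radius \<open>e\<close>
  records where the circle starts.\<close>

definition circ :: "complex \<Rightarrow> complex \<Rightarrow> real \<Rightarrow> complex" where
  "circ c e t = c + e * cis (- 2 * pi * t)"

lemma cis_minus_2pi [simp]: "cis (- (2 * pi)) = 1"
  by (simp add: complex_eq_iff)

lemma circ_ends [simp]: "pathstart (circ c e) = c + e" "pathfinish (circ c e) = c + e"
  by (simp_all add: pathstart_def pathfinish_def circ_def)

lemma path_circ [simp]: "path (circ c e)"
  by (auto simp: path_def circ_def [abs_def] intro!: continuous_intros)

lemma norm_circ: "norm (circ c e t - c) = norm e"
  by (simp add: circ_def norm_mult)

lemma path_in_circ: "sphere c (norm e) \<subseteq> S \<Longrightarrow> path_in S (circ c e)"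
  using path_circ[of c e, unfolded path_def] norm_circ[of c e]
  by (intro path_inI) (auto simp: subset_iff dist_norm norm_minus_commute)

lemma winding_number_circ:
  assumes "e \<noteq> 0" shows "winding_number (circ c e) c = -1"
proof -
  have "winding_number (\<lambda>t. circ c e t - c) 0 = (Ln e - 2 * pi * 1 * \<i> - (Ln e - 2 * pi * 0 * \<i>)) / (2 * of_real pi * \<i>)"
    by (rule winding_number_of_log[where l = "\<lambda>t. Ln e - of_real (2 * pi * t) * \<i>", simplified of_real_1 of_real_0 mult_1_right mult_zero_right, THEN trans])
      (use assms in \<open>auto intro!: continuous_intros simp: circ_def exp_diff cis_conv_exp exp_minus field_simps\<close>)
  then show ?thesis by (subst winding_number_offset) simp
qed

lemma winding_number_circ_outside:
  assumes "norm e < dist p c" shows "winding_number (circ c e) p = 0"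
proof -
  have "winding_number (\<lambda>t. circ c e t - p) 0 = winding_number (\<lambda>t. c - p) 0"
    using assms path_circ[of c e]
    by (intro winding_number_near)
      (auto simp: path_def pathstart_def pathfinish_def circ_def norm_mult dist_norm norm_minus_commute intro!: continuous_intros)
  also have "\<dots> = 0" using assms by (intro winding_number_zero_const) auto
  finally show ?thesis by (subst winding_number_offset)
qed

lemma winding_number_lasso:
  assumes "path q" "path h" "pathfinish q = pathstart h" "pathfinish h = pathstart h"
    "z \<notin> path_image q" "z \<notin> path_image h"
  shows "winding_number (lasso q h) z = winding_number h z"
  using assms unfolding lasso_def
  by (simp add: winding_number_join winding_number_reversepath path_image_join not_in_path_image_join)

text \<open>The tail \<open>q\<close> is left free. That makes the property stable under
  conjugation, which is what the Hurwitz moves ask for.\<close>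

definition lasso_class :: "complex set \<Rightarrow> complex \<Rightarrow> complex \<Rightarrow> real \<Rightarrow> (real \<Rightarrow> complex) set \<Rightarrow> bool" where
  "lasso_class S b c r G \<longleftrightarrow> (\<exists>q e. norm e = r \<and> sphere c r \<subseteq> S \<and> path_in S q \<and> pathstart q = b \<and>
      pathfinish q = c + e \<and> G = loop_class S (lasso q (circ c e)))"

lemma lasso_class_carrier:
  "lasso_class S b c r G \<Longrightarrow> G \<in> carrier (fundamental_group S b)"
  by (auto simp: lasso_class_def fundamental_group_carrier loops_at_iff path_in_circ intro!: imageI)

lemma lasso_class_conj:
  assumes "lasso_class S b c r G" "K \<in> carrier (fundamental_group S b)" "b \<in> S"
  shows "lasso_class S b c r (K \<otimes>\<^bsub>fundamental_group S b\<^esub> G \<otimes>\<^bsub>fundamental_group S b\<^esub> inv\<^bsub>fundamental_group S b\<^esub> K)"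
proof -
  obtain q e where q: "norm e = r" "sphere c r \<subseteq> S" "path_in S q" "pathstart q = b" "pathfinish q = c + e"
    "G = loop_class S (lasso q (circ c e))"
    using assms(1) by (auto simp: lasso_class_def)
  obtain k where k: "K = loop_class S k" "k \<in> loops_at S b"
    using assms(2) by (auto simp: fundamental_group_carrier)
  show ?thesis
    unfolding lasso_class_def k(1) q(6) using q k lasso_conj[OF assms(3) k(2) q(3), of "circ c e"]
    by (intro exI[of _ "k +++ q"] exI[of _ e]) (auto simp: loops_at_iff path_in_circ)
qed

text \<open>A homotopy found in a simpler space \<open>A\<close> is pushed into \<open>T\<close> by
  a map that fixes \<open>T\<close> pointwise.\<close>

lemma loop_class_eq_retract:
  assumes "homotopic_paths A p q" "continuous_on A f" "f ` A \<subseteq> T" "path_in T p" "path_in T q"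
    "\<And>y. y \<in> T \<Longrightarrow> f y = y"
  shows "loop_class T p = loop_class T q"
proof -
  have "homotopic_paths T (f \<circ> p) (f \<circ> q)"
    using homotopic_paths_continuous_image[OF assms(1,2), of T] assms(3) by auto
  moreover have "homotopic_paths T p (f \<circ> p)" "homotopic_paths T q (f \<circ> q)"
    using assms(4-6) by (auto simp: path_in_def path_image_def intro!: homotopic_paths_eq)
  ultimately show ?thesis
    by (metis loop_class_eqI)
qed

lemma loop_class_reversepath:
  assumes "loop_class S p = loop_class S q" "path_in S p"
  shows "loop_class S (reversepath p) = loop_class S (reversepath q)"
  using assms homotopic_paths_reversepath_D loop_class_eqI loop_class_eq_iff by metis

lemma loop_class_subset:
  assumes "loop_class S p = loop_class S q" "path_in S p" "S \<subseteq> T"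
  shows "loop_class T p = loop_class T q"
  using assms homotopic_paths_subset loop_class_eqI loop_class_eq_iff by metis

lemma loop_class_convex:
  fixes p q :: "real \<Rightarrow> 'a::real_normed_vector"
  assumes "convex K" "K \<subseteq> S" "path_in K p" "path_in K q" "pathstart p = pathstart q" "pathfinish p = pathfinish q"
  shows "loop_class S p = loop_class S q"
proof (rule loop_class_eqI, rule homotopic_paths_linear)
  fix t :: real assume "t \<in> {0..1}"
  then show "closed_segment (p t) (q t) \<subseteq> S"
    using assms by (intro order.trans[OF closed_segment_subset assms(2)]) (auto dest: path_in_D)
qed (use assms in \<open>auto simp: path_in_def\<close>)

lemma not_in_path_image: "path_in S p \<Longrightarrow> z \<notin> S \<Longrightarrow> z \<notin> path_image p"
  by (auto simp: path_in_def)

lemma path_in_path: "path_in S p \<Longrightarrow> path p"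
  by (simp add: path_in_def)

text \<open>In the plane minus a point, the end points and the winding number decide the homotopy
  class. A retraction carries this over to \<open>K\<close> minus the disc: first the nearest point
  of \<open>K\<close>, then a radial push out to distance \<open>r\<close> from
  \<open>c\<close>.\<close>

lemma loop_class_punctured_convex:
  assumes K: "convex K" "closed K" "cball c r \<subseteq> K" "0 < r"
    and p: "path_in (K - ball c r) p" and q: "path_in (K - ball c r) q"
    and ends: "pathstart q = pathstart p" "pathfinish q = pathfinish p"
    and wn: "winding_number p c = winding_number q c"
  shows "loop_class (K - ball c r) p = loop_class (K - ball c r) q"
proof -
  have nin: "c \<notin> K - ball c r" using K by auto
  then have hom: "homotopic_paths (- {c}) p q"
    using winding_number_homotopic_paths_eq[of p c q] p q ends wn not_in_path_image path_in_path by metis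
  define f where "f y = c + (max 1 (r / norm (closest_point K y - c))) *\<^sub>R (closest_point K y - c)" for y
  have int: "c \<in> interior K" using K by (meson ball_subset_cball centre_in_ball interior_maximal open_ball order.trans subsetD)
  have ne: "K \<noteq> {}" using int interior_subset by blast
  have cp: "closest_point K y \<in> K" for y using closest_point_in_set[OF K(2) ne] .
  \<comment> \<open>The radial push is undefined at \<open>c\<close>, so \<open>c\<close> must not
    be the nearest point of any other \<open>y\<close>: a nearest point in the relative interior
    means that \<open>y\<close> already lies in \<open>K\<close>.\<close>
  have nz: "closest_point K y \<noteq> c" if "y \<noteq> c" for y
  proof
    assume c: "closest_point K y = c"
    have ri: "rel_interior K = interior K"
      using int by (intro rel_interior_nonempty_interior) auto
    have "affine hull K = UNIV" using int affine_hull_nonempty_interior by auto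
    then have "y \<in> rel_interior K"
      using closest_point_in_rel_interior[OF K(2) ne, of y] c int ri by auto
    then have "y \<in> K" using rel_interior_subset by blast
    then show False using c that closest_point_self by metis
  qed
  show ?thesis
  proof (rule loop_class_eq_retract[OF hom _ _ p q, where f = f])
    show "continuous_on (- {c}) f"
      unfolding f_def by (intro continuous_intros continuous_on_closest_point K ne) (use nz in auto)
    show "f ` (- {c}) \<subseteq> K - ball c r"
    proof (rule image_subsetI)
      fix y assume "y \<in> - {c}"
      then have pos: "norm (closest_point K y - c) > 0" using nz by simp
      have nf: "norm (f y - c) = max (norm (closest_point K y - c)) r"
        using pos K(4) by (simp add: f_def max_def divide_simps)
      have "f y \<in> K"
      proof (cases "norm (closest_point K y - c) \<ge> r")
        case True
        then have "f y = closest_point K y" using pos by (simp add: f_def max_def divide_simps)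
        then show ?thesis using cp by simp
      next
        case False
        then have "f y \<in> cball c r" using nf by (simp add: dist_norm norm_minus_commute)
        then show ?thesis using K by auto
      qed
      then show "f y \<in> K - ball c r"
        using nf by (simp add: dist_norm norm_minus_commute)
    qed
    fix y assume y: "y \<in> K - ball c r"
    then have "closest_point K y = y" by (simp add: closest_point_self)
    moreover have "r / norm (y - c) \<le> 1" using y K by (auto simp: divide_simps dist_norm norm_minus_commute)
    ultimately show "f y = y" by (simp add: f_def)
  qed
qed

text \<open>The same argument near infinity, with the radial retraction onto the outside of a disc
  about 0.\<close>

lemma loop_class_near_infinity:
  assumes "0 < \<rho>" "path_in {y. \<rho> \<le> norm y} p" "path_in {y. \<rho> \<le> norm y} q"
    "pathstart q = pathstart p" "pathfinish q = pathfinish p" "winding_number p 0 = winding_number q (0::complex)"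
  shows "loop_class {y. \<rho> \<le> norm y} p = loop_class {y. \<rho> \<le> norm y} q"
proof -
  have nin: "0 \<notin> {y::complex. \<rho> \<le> norm y}" using assms(1) by auto
  have hom: "homotopic_paths (- {0}) p q"
    using winding_number_homotopic_paths_eq[of p 0 q] assms(2-6) nin not_in_path_image path_in_path by metis
  show ?thesis
  proof (rule loop_class_eq_retract[OF hom _ _ assms(2,3), where f = "\<lambda>y. (max 1 (\<rho> / norm y)) *\<^sub>R y"])
    show "continuous_on (- {0}) (\<lambda>y. (max 1 (\<rho> / norm y)) *\<^sub>R y)"
      by (intro continuous_intros) auto
  qed (use assms(1) in \<open>auto simp: max_def divide_simps split: if_splits\<close>)
qed

section \<open>Systems of loops around finitely many discs\<close>

lemma (in group) foldr_telescope:
  assumes "\<And>j. v j \<in> carrier G"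
  shows "foldr (\<otimes>) (map (\<lambda>j. v j \<otimes> inv (v (Suc j))) [0..<m]) \<one> = v 0 \<otimes> inv (v m)"
proof (induction m)
  case 0 then show ?case using assms by simp
next
  case (Suc m)
  have "foldr (\<otimes>) (map (\<lambda>j. v j \<otimes> inv (v (Suc j))) [0..<m] @ [v m \<otimes> inv (v (Suc m))]) \<one> =
    v 0 \<otimes> inv (v m) \<otimes> (v m \<otimes> inv (v (Suc m)))"
    using assms Suc by (subst foldr_mult_append) auto
  also have "\<dots> = v 0 \<otimes> inv (v (Suc m))"
    using assms by (simp add: m_assoc) (simp add: m_assoc[symmetric])
  finally show ?case by simp
qed

lemma path_in_linepath: "convex K \<Longrightarrow> x \<in> K \<Longrightarrow> y \<in> K \<Longrightarrow> K \<subseteq> S \<Longrightarrow> path_in S (linepath x y)"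
  by (simp add: path_in_def) (meson closed_segment_subset order.trans)

text \<open>The discs lie in successive vertical strips of a rectangle. Let v j be the
  counter-clockwise boundary of the part to the left of the line Re y = s j. Then v j times the
  inverse of v (j + 1) is a clockwise loop around the j-th disc alone, and the product of these
  telescopes to the inverse of the outer boundary.\<close>

lemma strip_system:
  fixes c :: "nat \<Rightarrow> complex" and s :: "nat \<Rightarrow> real"
  assumes r: "0 < r" and c: "\<And>j. j < m \<Longrightarrow> s j + r < Re (c j) \<and> Re (c j) + r < s (Suc j) \<and> \<bar>Im (c j)\<bar> + r < h"
    and \<rho>: "\<rho> \<le> h" "\<rho> \<le> - s 0" "\<rho> \<le> s m" "0 < \<rho>"
  defines "S \<equiv> {y. \<forall>j<m. r \<le> dist (c j) y}" and "b \<equiv> Complex (s 0) (- h)"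
  shows "\<exists>l g. (\<forall>j<m. lasso_class S b (c j) r (l j)) \<and> g \<in> loops_at S b \<and> path_image g \<subseteq> {y. \<rho> \<le> norm y} \<and>
    winding_number g 0 = 1 \<and>
    foldr (mult (fundamental_group S b)) (map l [0..<m]) (one (fundamental_group S b))
      \<otimes>\<^bsub>fundamental_group S b\<^esub> loop_class S g = one (fundamental_group S b)"
proof -
  have mono: "s i \<le> s j" if "i \<le> j" "j \<le> m" for i j
    using that
  proof (induction j rule: dec_induct)
    case (step k)
    then have "s k < s (Suc k)" using c[of k] r by linarith
    then show ?case using step by simp
  qed simp
  have cS: "(k < j \<longrightarrow> Re (c k) + r < s j) \<and> (j \<le> k \<longrightarrow> s j + r < Re (c k))" if "k < m" "j \<le> m" for j k
    using c[OF that(1)] mono[of "Suc k" j] mono[of j k] that by auto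
  have far: "y \<in> S" if y: "\<And>k. k < m \<Longrightarrow> r \<le> \<bar>Re (c k - y)\<bar> \<or> r \<le> \<bar>Im (c k - y)\<bar>" for y
  proof -
    have "r \<le> dist (c k) y" if "k < m" for k
      using y[OF that] abs_Re_le_cmod[of "c k - y"] abs_Im_le_cmod[of "c k - y"]
      by (auto simp: dist_norm)
    then show ?thesis by (simp add: S_def)
  qed
  let ?Bot = "{y. Im y = - h}" and ?Top = "{y. Im y = h}" and ?Vert = "\<lambda>j. {y. Re y = s j}"
  have Bot: "?Bot \<subseteq> S" "convex ?Bot" and Top: "?Top \<subseteq> S" "convex ?Top"
  proof -
    have im: "r \<le> \<bar>Im (c k - y)\<bar>" if "k < m" "Im y = - h \<or> Im y = h" for k y
      using c[OF that(1)] that(2) by auto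
    show "?Bot \<subseteq> S" "?Top \<subseteq> S" by (rule subsetI, rule far, rule disjI2, rule im; simp)+
    show "convex ?Bot" "convex ?Top"
      using convex_hyperplane[of "\<i>" "- h"] convex_hyperplane[of "\<i>" h] by (simp_all add: inner_complex_def)
  qed
  have Vert: "?Vert j \<subseteq> S" if "j \<le> m" for j
  proof -
    have re: "r \<le> \<bar>Re (c k - y)\<bar>" if "k < m" "Re y = s j" for k y
      using cS[OF that(1) \<open>j \<le> m\<close>] that(2) by (cases "k < j") auto
    show ?thesis by (rule subsetI, rule far, rule disjI1, rule re; simp)
  qed
  have Vertc: "convex (?Vert j)" for j
  proof -
    have "?Vert j = {y. Re y \<ge> s j} \<inter> {y. Re y \<le> s j}" by auto
    then show ?thesis by (metis convex_Int convex_halfspace_Re_ge convex_halfspace_Re_le)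
  qed
  define P T where "P j = Complex (s j) (- h)" and "T j = Complex (s j) h" for j
  have b: "b = P 0" by (simp add: b_def P_def)
  have bS: "b \<in> S" using Bot by (auto simp: b_def)
  interpret group "fundamental_group S b" by (rule group_fundamental_group[OF bS])
  define bot up top dn where "bot j = linepath (P 0) (P j)" and "up j = linepath (P j) (T j)" and
     "top j = linepath (T j) (T 0)" and "dn = linepath (T 0) (P 0)" for j
  note defs = bot_def up_def top_def dn_def
  have pin: "path_in S (linepath (P i) (P j))" "path_in S (linepath (T i) (T j))" for i j
    by (rule path_in_linepath[OF Bot(2) _ _ Bot(1)]; simp add: P_def)
      (rule path_in_linepath[OF Top(2) _ _ Top(1)]; simp add: T_def)
  have pin': "path_in S (linepath (P j) (T j))" "path_in S (linepath (T j) (P j))" if "j \<le> m" for j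
    by (rule path_in_linepath[OF Vertc _ _ Vert[OF that]]; simp add: P_def T_def)+
  \<comment> \<open>Beyond \<open>m\<close> a constant loop serves as default, since
    \<open>foldr_telescope\<close> wants a group element at every index.\<close>
  define v where "v j = (if j \<le> m then bot j +++ (up j +++ (top j +++ dn)) else (\<lambda>_. b))" for j
  have v: "v j \<in> loops_at S b" for j
    using pin pin' bS by (auto simp: v_def loops_at_iff defs b)
  define V where "V j = loop_class S (v j)" for j
  have V: "V j \<in> carrier (fundamental_group S b)" for j using v by (auto simp: V_def fundamental_group_carrier)
  have "V 0 = class_prod S (loop_class S (bot 0)) (class_prod S (loop_class S (up 0)) (class_prod S (loop_class S (top 0)) (loop_class S dn)))"
    using pin pin'[of 0] by (simp add: V_def v_def loop_class_join defs)
  moreover have "top 0 = (\<lambda>_. T 0)" "bot 0 = (\<lambda>_. P 0)" "dn = reversepath (up 0)"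
    by (auto simp: defs linepath_refl)
  ultimately have V0: "V 0 = \<one>\<^bsub>fundamental_group S b\<^esub>"
    using pin'[of 0] bS class_prod_rinv[of S "linepath (P 0) (T 0)"] by (simp add: up_def b fundamental_group_one)
  define l where "l j = V j \<otimes>\<^bsub>fundamental_group S b\<^esub> inv\<^bsub>fundamental_group S b\<^esub> V (Suc j)" for j
  have lasso: "lasso_class S b (c j) r (l j)" if j: "j < m" for j
  proof -
    let ?K = "{y. s j \<le> Re y \<and> Re y \<le> s (Suc j)}"
    have K: "convex ?K" "closed ?K"
      unfolding Collect_conj_eq by (auto intro!: convex_Int closed_Int convex_halfspace_Re_ge convex_halfspace_Re_le closed_halfspace_Re_ge closed_halfspace_Re_le)
    have cK: "cball (c j) r \<subseteq> ?K"
    proof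
      fix y assume "y \<in> cball (c j) r"
      then have "\<bar>Re (c j) - Re y\<bar> \<le> r" using abs_Re_le_cmod[of "c j - y"] by (auto simp: dist_norm)
      then show "y \<in> ?K" using c[OF j] by auto
    qed
    have KS: "?K - ball (c j) r \<subseteq> S"
    proof
      fix y assume y: "y \<in> ?K - ball (c j) r"
      have "r \<le> dist (c k) y" if "k < m" for k
      proof -
        have "r \<le> \<bar>Re (c k - y)\<bar>" if "k \<noteq> j"
          using cS[OF \<open>k < m\<close>, of j] cS[OF \<open>k < m\<close>, of "Suc j"] that j y by auto
        then show ?thesis using abs_Re_le_cmod[of "c k - y"] y by (cases "k = j") (auto simp: dist_norm)
      qed
      then show "y \<in> S" by (simp add: S_def)
    qed
    \<comment> \<open>The j-th rectangle, traversed clockwise from its lower left corner: what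
      remains of l j after the common stretches cancel.\<close>
    let ?\<kappa> = "linepath (P j) (T j) +++ (linepath (T j) (T (Suc j)) +++ (linepath (T (Suc j)) (P (Suc j)) +++ linepath (P (Suc j)) (P j)))"
    have SK: "path_in (?K - ball (c j) r) g" if "path_in S g" "path_in ?K g" for g
    proof -
      have "S \<inter> ?K \<subseteq> ?K - ball (c j) r" using j by (force simp: S_def)
      then show ?thesis using that by (auto simp: path_in_def)
    qed
    have Suc: "s j \<le> s (Suc j)" using mono[of j "Suc j"] j by simp
    have inK: "x \<in> ?K" if "x \<in> {P j, P (Suc j), T j, T (Suc j)}" for x
      using that Suc by (auto simp: P_def T_def)
    have pK: "path_in (?K - ball (c j) r) (linepath (P j) (T j))" "path_in (?K - ball (c j) r) (linepath (T j) (T (Suc j)))"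
      "path_in (?K - ball (c j) r) (linepath (T (Suc j)) (P (Suc j)))" "path_in (?K - ball (c j) r) (linepath (P (Suc j)) (P j))"
      using j by (auto intro!: SK pin pin' path_in_linepath[OF K(1) inK inK])
    then have pK': "path_in (?K - ball (c j) r) ?\<kappa>" by simp
    have cn: "c j \<notin> ?K - ball (c j) r" using r by simp
    note ci = not_in_path_image[OF _ cn]
    have wn: "winding_number ?\<kappa> (c j) = - 1"
    proof -
      have "winding_number (rectpath (P j) (T (Suc j))) (c j) = 1"
        by (rule winding_number_rectpath) (use c[OF j] r in \<open>auto simp: in_box_complex_iff P_def T_def\<close>)
      moreover have "rectpath (P j) (T (Suc j)) = reversepath (linepath (P (Suc j)) (P j)) +++ reversepath (linepath (T (Suc j)) (P (Suc j)))
         +++ reversepath (linepath (T j) (T (Suc j))) +++ reversepath (linepath (P j) (T j))"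
        by (simp add: rectpath_def P_def T_def Let_def)
      then have "winding_number (rectpath (P j) (T (Suc j))) (c j) = - winding_number ?\<kappa> (c j)"
        using pK[THEN ci] by (simp add: winding_number_join winding_number_reversepath not_in_path_image_join del: reversepath_linepath)
      ultimately show ?thesis
        by (metis add.inverse_inverse)
    qed
    \<comment> \<open>The point of the circle that faces the corner \<open>P j\<close>: on the
      segment from the corner to it, the distance from \<open>c j\<close> decreases to
      \<open>r\<close> and not below.\<close>
    define e where "e = (r / norm (P j - c j)) *\<^sub>R (P j - c j)"
    have PjS: "P j \<in> ?K - ball (c j) r" using path_in_D[OF pK(1), of 0] by (simp add: linepath_def)
    then have d: "r \<le> norm (P j - c j)" by (auto simp: dist_norm norm_minus_commute)
    then have ne: "norm e = r" using r by (auto simp: e_def)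
    let ?q = "linepath (P j) (c j + e)"
    have eK: "c j + e \<in> ?K" by (rule subsetD[OF cK]) (use ne in \<open>simp add: dist_norm\<close>)
    have Pc: "P j \<noteq> c j" using d r by auto
    have qK: "path_in (?K - ball (c j) r) ?q"
    proof (rule path_inI)
      show "continuous_on {0..1} ?q" using path_linepath path_def by blast
      fix t :: real assume t: "0 \<le> t" "t \<le> 1"
      have "?q t \<in> closed_segment (P j) (c j + e)" using t by (auto simp: linepath_def closed_segment_def)
      then have "?q t \<in> ?K" using closed_segment_subset[OF _ eK K(1), of "P j"] inK by auto
      moreover have "?q t - c j = ((1 - t) + t * r / norm (P j - c j)) *\<^sub>R (P j - c j)"
        by (simp add: linepath_def e_def algebra_simps scaleR_conv_of_real)
      then have "norm (?q t - c j) = (1 - t) * norm (P j - c j) + t * r"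
        using t r Pc by (simp add: abs_of_nonneg divide_simps)
      then have "r \<le> norm (?q t - c j)"
        using mult_left_mono[of r "norm (P j - c j)" "1 - t"] d t by (simp add: algebra_simps)
      ultimately show "?q t \<in> ?K - ball (c j) r" by (simp add: dist_norm norm_minus_commute)
    qed
    have sph: "sphere (c j) r \<subseteq> ?K - ball (c j) r" using cK by auto
    then have circK: "path_in (?K - ball (c j) r) (circ (c j) e)" using ne by (intro path_in_circ) auto
    have "loop_class (?K - ball (c j) r) ?\<kappa> = loop_class (?K - ball (c j) r) (lasso ?q (circ (c j) e))"
    proof (rule loop_class_punctured_convex[OF K cK r pK'])
      show "path_in (?K - ball (c j) r) (lasso ?q (circ (c j) e))" using qK circK by simp
      have "winding_number (lasso ?q (circ (c j) e)) (c j) = winding_number (circ (c j) e) (c j)"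
        by (rule winding_number_lasso) (use qK circK ci[OF qK] ci[OF circK] in \<open>auto simp: path_in_def\<close>)
      then show "winding_number ?\<kappa> (c j) = winding_number (lasso ?q (circ (c j) e)) (c j)"
        using wn ne r winding_number_circ[of e "c j"] by auto
    qed auto
    then have \<kappa>: "loop_class S ?\<kappa> = loop_class S (lasso ?q (circ (c j) e))"
      using loop_class_subset pK' KS by blast
    have "loop_class S (bot (Suc j)) = loop_class S (bot j +++ linepath (P j) (P (Suc j)))"
      by (rule loop_class_convex[OF Bot(2,1)]) (auto intro!: path_in_linepath[OF Bot(2)] simp: P_def bot_def)
    then have bot: "loop_class S (reversepath (bot (Suc j))) = class_prod S (loop_class S (linepath (P (Suc j)) (P j))) (loop_class S (reversepath (bot j)))"
      using pin loop_class_reversepath[of S "bot (Suc j)" "bot j +++ linepath (P j) (P (Suc j))"]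
      by (simp add: bot_def reversepath_joinpaths loop_class_join)
    have "loop_class S (top (Suc j)) = loop_class S (linepath (T (Suc j)) (T j) +++ top j)"
      by (rule loop_class_convex[OF Top(2,1)]) (auto intro!: path_in_linepath[OF Top(2)] simp: T_def top_def)
    then have top: "loop_class S (reversepath (top (Suc j))) = class_prod S (loop_class S (reversepath (top j))) (loop_class S (linepath (T j) (T (Suc j))))"
      using pin loop_class_reversepath[of S "top (Suc j)" "linepath (T (Suc j)) (T j) +++ top j"]
      by (simp add: top_def reversepath_joinpaths loop_class_join)
    note ps = pin pin'[of j] pin'[of "Suc j"] pin'[of 0]
    have pS: "path_in S (bot i)" "path_in S (top i)" "path_in S dn" "path_in S (up j)" "path_in S (up (Suc j))" for i
      using ps j by (auto simp: defs)
    have e1: "pathstart (bot i) = P 0" "pathfinish (bot i) = P i" "pathstart (up i) = P i" "pathfinish (up i) = T i"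
      "pathstart (top i) = T i" "pathfinish (top i) = T 0" "pathstart dn = T 0" "pathfinish dn = P 0" for i
      by (auto simp: defs)
    have ru: "reversepath (up (Suc j)) = linepath (T (Suc j)) (P (Suc j))" by (simp add: up_def)
    have l: "l j = loop_class S (v j +++ reversepath (v (Suc j)))"
      using v by (simp add: l_def V_def fundamental_group_inv[OF bS] fundamental_group_mult_class loops_at_reversepath)
    have vj: "v j +++ reversepath (v (Suc j)) = (bot j +++ (up j +++ (top j +++ dn))) +++
        (((reversepath dn +++ reversepath (top (Suc j))) +++ reversepath (up (Suc j))) +++ reversepath (bot (Suc j)))"
      using j e1 by (simp add: v_def reversepath_joinpaths)
    \<comment> \<open>Here \<open>dn\<close> has cancelled with its inverse; next \<open>top\<close>
      reduces the pieces on the upper edge, and \<open>bot\<close> those on the lower edge, to sides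
      of the j-th rectangle.\<close>
    have "l j = class_prod S (loop_class S (bot j)) (class_prod S (loop_class S (up j)) (class_prod S (loop_class S (top j))
       (class_prod S (loop_class S (reversepath (top (Suc j)))) (class_prod S (loop_class S (reversepath (up (Suc j)))) (loop_class S (reversepath (bot (Suc j))))))))"
      unfolding l vj using pS e1 by (simp add: loop_class_join class_prod_assoc)
    also have "\<dots> = class_prod S (loop_class S (bot j)) (class_prod S (loop_class S (up j))
       (class_prod S (loop_class S (linepath (T j) (T (Suc j)))) (class_prod S (loop_class S (reversepath (up (Suc j)))) (loop_class S (reversepath (bot (Suc j)))))))"
      unfolding top class_prod_assoc using pS e1 ps by simp
    also have "\<dots> = class_prod S (loop_class S (bot j)) (class_prod S (loop_class S ?\<kappa>) (loop_class S (reversepath (bot j))))"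
      unfolding bot ru using pS e1 ps j by (simp add: loop_class_join class_prod_assoc up_def)
    also have "\<dots> = loop_class S (lasso (bot j) ?\<kappa>)"
      using pS e1 ps j by (subst lasso_class) auto
    also have "\<dots> = loop_class S (lasso (bot j) (lasso ?q (circ (c j) e)))"
      using pS e1 ps j \<kappa> by (intro lasso_cong) auto
    also have "\<dots> = loop_class S (lasso (bot j +++ ?q) (circ (c j) e))"
      using pS e1 ps j path_in_subset[OF qK KS] path_in_subset[OF circK KS] by (intro lasso_join[symmetric]) auto
    finally show ?thesis
      unfolding lasso_class_def using ne sph KS pS e1 path_in_subset[OF qK KS] b
      by (intro exI[of _ "bot j +++ ?q"] exI[of _ e]) auto
  qed
  have vm: "v m = bot m +++ (up m +++ (top m +++ dn))" by (simp add: v_def)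
  have mono0: "s 0 \<le> s m" using mono by simp
  have "winding_number (v m) 0 = 1"
  proof -
    have "winding_number (rectpath (P 0) (T m)) 0 = 1"
      by (rule winding_number_rectpath) (use \<rho> in \<open>auto simp: in_box_complex_iff P_def T_def\<close>)
    moreover have "rectpath (P 0) (T m) = v m"
      by (simp add: rectpath_def P_def T_def Let_def vm defs)
    ultimately show ?thesis by simp
  qed
  moreover have "path_image (v m) \<subseteq> {y. \<rho> \<le> norm y}"
  proof -
    have nrm: "\<rho> \<le> norm y" if "\<rho> \<le> \<bar>Im y\<bar> \<or> \<rho> \<le> \<bar>Re y\<bar>" for y
      using that abs_Im_le_cmod[of y] abs_Re_le_cmod[of y] by auto
    have sub: "{y. Im y = - h} \<subseteq> {y. \<rho> \<le> norm y}" "{y. Im y = h} \<subseteq> {y. \<rho> \<le> norm y}"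
      "{y. Re y = s m} \<subseteq> {y. \<rho> \<le> norm y}" "{y. Re y = s 0} \<subseteq> {y. \<rho> \<le> norm y}"
      by (rule subsetI, rule CollectI, rule nrm, use \<rho> in simp)+
    have "path_in {y. \<rho> \<le> norm y} (v m)"
      unfolding vm defs
      using path_in_linepath[OF Bot(2) _ _ sub(1)] path_in_linepath[OF Top(2) _ _ sub(2)]
        path_in_linepath[OF Vertc _ _ sub(3)] path_in_linepath[OF Vertc _ _ sub(4)]
      by (simp add: P_def T_def)
    then show ?thesis by (simp add: path_in_def)
  qed
  moreover have "foldr (mult (fundamental_group S b)) (map l [0..<m]) (one (fundamental_group S b))
      \<otimes>\<^bsub>fundamental_group S b\<^esub> loop_class S (v m) = one (fundamental_group S b)"
    using foldr_telescope[of V m] V V0 unfolding l_def by (simp add: V_def)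
  ultimately show ?thesis
    using lasso v by blast
qed

lemma finite_separated:
  fixes X :: "'a::metric_space set"
  assumes "finite X"
  shows "\<exists>g>0. \<forall>x\<in>X. \<forall>y\<in>X. x \<noteq> y \<longrightarrow> g < dist x y"
proof -
  let ?D = "insert 1 {dist x y | x y. x \<in> X \<and> y \<in> X \<and> x \<noteq> y}"
  have "{dist x y | x y. x \<in> X \<and> y \<in> X \<and> x \<noteq> y} \<subseteq> (\<lambda>(x, y). dist x y) ` (X \<times> X)" by auto
  then have fin: "finite ?D" using assms finite_subset by fastforce
  have "Min ?D > 0" using fin by (subst Min_gr_iff) auto
  moreover have "Min ?D \<le> dist x y" if "x \<in> X" "y \<in> X" "x \<noteq> y" for x y
    using fin that by (intro Min_le) auto
  ultimately show ?thesis
    by (intro exI[of _ "Min ?D / 2"]) (smt (verit) field_sum_of_halves)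
qed

text \<open>With u proportional to 1 + i t, equal real parts of u c and u d force c = d or t = Re (c
  - d) / Im (c - d). Only finitely many such slopes occur.\<close>

lemma generic_direction:
  fixes P :: "complex set"
  assumes "finite P"
  shows "\<exists>u. norm u = 1 \<and> inj_on (\<lambda>c. Re (u * c)) P"
proof -
  have "finite ((\<lambda>(c, d). Re (c - d) / Im (c - d)) ` (P \<times> P))" using assms by auto
  then obtain t where t: "t \<notin> (\<lambda>(c, d). Re (c - d) / Im (c - d)) ` (P \<times> P)"
    using ex_new_if_finite[OF infinite_UNIV_char_0] by blast
  define u where "u = Complex 1 t / norm (Complex 1 t)"
  have nz: "norm (Complex 1 t) > 0" by (simp add: complex_eq_iff)
  have "norm u = 1" using nz by (simp add: u_def norm_divide)
  moreover have "inj_on (\<lambda>c. Re (u * c)) P"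
  proof (rule inj_onI, rule ccontr)
    fix c d assume cd: "c \<in> P" "d \<in> P" "Re (u * c) = Re (u * d)" "c \<noteq> d"
    have "Re (u * (c - d)) = (Re (c - d) - t * Im (c - d)) / norm (Complex 1 t)"
      by (simp add: u_def diff_divide_distrib Re_divide_of_real)
    then have eq: "Re (c - d) = t * Im (c - d)" using cd nz by (simp add: algebra_simps)
    show False
    proof (cases "Im (c - d) = 0")
      case True
      then show False using eq cd by (simp add: complex_eq_iff)
    next
      case False
      then have "t = Re (c - d) / Im (c - d)" using eq by (simp add: field_simps)
      then show False using t cd by force
    qed
  qed
  ultimately show ?thesis by blast
qed

lemma lasso_class_rotate:
  assumes "lasso_class S b c r G" "norm u = 1" "(\<lambda>y. u * y) ` S \<subseteq> T" "sphere (u * c) r \<subseteq> T"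
  shows "lasso_class T (u * b) (u * c) r (induced S T (\<lambda>y. u * y) G)"
proof -
  obtain q e where q: "norm e = r" "sphere c r \<subseteq> S" "path_in S q" "pathstart q = b"
      "pathfinish q = c + e" "G = loop_class S (lasso q (circ c e))"
    using assms(1) by (auto simp: lasso_class_def)
  have cont: "continuous_on S (\<lambda>y. u * y)" by (intro continuous_intros)
  have "(\<lambda>y. u * y) \<circ> lasso q (circ c e) = lasso ((\<lambda>y. u * y) \<circ> q) (circ (u * c) (u * e))"
    by (auto simp: lasso_def fun_eq_iff joinpaths_def reversepath_def circ_def algebra_simps)
  then have "induced S T (\<lambda>y. u * y) G = loop_class T (lasso ((\<lambda>y. u * y) \<circ> q) (circ (u * c) (u * e)))"
    using q by (simp add: induced_class[OF cont assms(3)] path_in_circ)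
  then show ?thesis
    unfolding lasso_class_def using q assms path_in_compose[OF q(3) cont assms(3)]
    by (intro exI[of _ "(\<lambda>y. u * y) \<circ> q"] exI[of _ "u * e"])
      (simp add: norm_mult pathstart_compose pathfinish_compose distrib_left)
qed

lemma hom_foldr_mult:
  assumes "group G" "group K" "f \<in> hom G K" "set xs \<subseteq> carrier G"
  shows "f (foldr (mult G) xs (one G)) = foldr (mult K) (map f xs) (one K)"
  using assms(4)
proof (induction xs)
  case Nil then show ?case using assms(1-3) hom_one by simp blast
next
  case (Cons x xs)
  then show ?case
    using assms(3) group.foldr_mult_closed[OF assms(1), of xs] by (simp add: hom_mult)
qed

lemma winding_number_rotate:
  assumes "path g" "0 \<notin> path_image g" "u \<noteq> 0"
  shows "winding_number (\<lambda>t. u * g t) 0 = winding_number g 0"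
proof -
  have "winding_number (\<lambda>t. u * g t) 0 = winding_number (\<lambda>t. u) 0 + winding_number g 0"
    using assms by (intro winding_number_mult) (force simp: path_def path_image_def)+
  also have "winding_number (\<lambda>t::real. u) 0 = 0" using assms(3) by (intro winding_number_zero_const)
  finally show ?thesis by simp
qed

text \<open>After a rotation the points have different real parts and \<open>strip_system\<close>
  applies; the result is rotated back. The order \<open>cs\<close> of the factors is whatever the
  rotation produces and is corrected later by Hurwitz moves. The bound \<open>B\<close> pushes the
  base point and the outer loop as far out as needed.\<close>

lemma planar_system:
  assumes "finite P" "P \<noteq> {}"
  shows "\<exists>r0>0. \<forall>r B. 0 < r \<longrightarrow> r < r0 \<longrightarrow> (\<exists>b cs l g. let S = {y::complex. \<forall>c\<in>P. r \<le> dist c y}; G = fundamental_group S b in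
     B \<le> norm b \<and> b \<in> S \<and> set cs = P \<and> distinct cs \<and> (\<forall>c\<in>P. lasso_class S b c r (l c)) \<and> g \<in> loops_at S b \<and>
     path_image g \<subseteq> {y. B \<le> norm y} \<and> winding_number g 0 = 1 \<and>
     foldr (mult G) (map l cs) (one G) \<otimes>\<^bsub>G\<^esub> loop_class S g = one G)"
proof -
  obtain u where u: "norm u = 1" "inj_on (\<lambda>c. Re (u * c)) P"
    using generic_direction[OF assms(1)] by blast
  define X where "X = (\<lambda>c. Re (u * c)) ` P"
  have X: "finite X" "X \<noteq> {}" using assms by (auto simp: X_def)
  define m where "m = card X"
  define x where "x j = sorted_list_of_set X ! j" for j
  have x: "x j \<in> X" if "j < m" for j
    using that X nth_mem[of j "sorted_list_of_set X"] by (auto simp: x_def m_def)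
  have xs: "x i < x j" if "i < j" "j < m" for i j
    using that X strict_sorted_list_of_set[of X] by (auto simp: x_def m_def sorted_wrt_iff_nth_less)
  have m: "m > 0" using X by (auto simp: m_def card_gt_0_iff)
  have ximg: "x ` {..<m} = X"
    using X by (metis (no_types, lifting) x_def atLeast_upt image_cong list.set_map map_nth m_def sorted_list_of_set.length_sorted_key_list_of_set set_sorted_list_of_set)
  obtain gap where gap: "gap > 0" "\<And>x y. x \<in> X \<Longrightarrow> y \<in> X \<Longrightarrow> x \<noteq> y \<Longrightarrow> gap < dist x y"
    using finite_separated[OF X(1)] by blast
  define d where "d j = the_inv_into P (\<lambda>c. Re (u * c)) (x j)" for j
  have d: "d j \<in> P" "Re (u * d j) = x j" if "j < m" for j
    using x[OF that] u(2) f_the_inv_into_f[of "\<lambda>c. Re (u * c)" P "x j"] the_inv_into_into[of "\<lambda>c. Re (u * c)" P "x j" P]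
    by (auto simp: d_def X_def)
  have dimg: "d ` {..<m} = P"
  proof
    show "d ` {..<m} \<subseteq> P" using d by auto
    show "P \<subseteq> d ` {..<m}"
    proof
      fix c assume c: "c \<in> P"
      then have "Re (u * c) \<in> x ` {..<m}" unfolding ximg X_def by blast
      then obtain j where j: "j < m" "x j = Re (u * c)" by (metis imageE lessThan_iff)
      then have "d j = c" using d[OF j(1)] u(2) c by (auto simp: inj_on_def)
      then show "c \<in> d ` {..<m}" using j by auto
    qed
  qed
  have dinj: "inj_on d {..<m}"
    by (rule inj_onI) (metis d(2) lessThan_iff linorder_neqE_nat order_less_irrefl xs)
  have uu: "cnj u * u = 1" "u \<noteq> 0" using u(1) by (auto simp: complex_norm_square[symmetric] mult.commute)
  show ?thesis
  proof (intro exI[of _ "gap / 4"] conjI allI impI)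
    show "gap / 4 > 0" using gap by simp
    fix r B :: real assume r: "0 < r" "r < gap / 4"
    \<comment> \<open>Half the side of a square about 0 that contains all discs, before and after
      the rotation, and the disc of radius \<open>B\<close>.\<close>
    define \<rho> where "\<rho> = max (max 1 B) (Max (norm ` P) + 1 + gap)"
    have \<rho>: "\<rho> \<ge> 1" "\<rho> \<ge> B" by (auto simp: \<rho>_def)
    have \<rho>c: "norm c + r < \<rho>" if "c \<in> P" for c
    proof -
      have "norm c \<le> Max (norm ` P)" using that assms by simp
      then show ?thesis using r gap by (auto simp: \<rho>_def)
    qed
    have \<rho>d: "\<bar>x j\<bar> + gap < \<rho>" "\<bar>Im (u * d j)\<bar> + r < \<rho>" if "j < m" for j
    proof -
      have "norm (d j) \<le> Max (norm ` P)" using d[OF that] assms by simp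
      moreover have "\<bar>x j\<bar> \<le> norm (d j)" using abs_Re_le_cmod[of "u * d j"] d[OF that] u by (simp add: norm_mult)
      ultimately show "\<bar>x j\<bar> + gap < \<rho>" by (auto simp: \<rho>_def)
      show "\<bar>Im (u * d j)\<bar> + r < \<rho>" using \<rho>c[OF d(1)[OF that]] abs_Im_le_cmod[of "u * d j"] u by (simp add: norm_mult)
    qed
    \<comment> \<open>Dividing lines at distance gap / 2 to the left of each point, except for the
      two outer ones. Neighbouring real parts differ by more than \<open>gap\<close>, and r < gap /
      4, so no disc touches a line.\<close>
    define s where "s j = (if j = 0 then - \<rho> else if j = m then \<rho> else x j - gap / 2)" for j
    define S where "S = {y. \<forall>j<m. r \<le> dist (u * d j) y}"
    have strip: "s j + r < Re (u * d j) \<and> Re (u * d j) + r < s (Suc j) \<and> \<bar>Im (u * d j)\<bar> + r < \<rho>" if j: "j < m" for j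
    proof -
      have "x j + gap < x (Suc j)" if "Suc j < m"
        using gap(2)[OF x[OF that] x[OF j]] xs[of j "Suc j"] that by (auto simp: dist_real_def)
      then show ?thesis using \<rho>d[OF j] d(2)[OF j] r gap j by (auto simp: s_def)
    qed
    obtain l g where lg: "\<And>j. j < m \<Longrightarrow> lasso_class S (Complex (s 0) (- \<rho>)) (u * d j) r (l j)"
      "g \<in> loops_at S (Complex (s 0) (- \<rho>))" "path_image g \<subseteq> {y. \<rho> \<le> norm y}" "winding_number g 0 = 1"
      "foldr (mult (fundamental_group S (Complex (s 0) (- \<rho>)))) (map l [0..<m]) (one (fundamental_group S (Complex (s 0) (- \<rho>))))
      \<otimes>\<^bsub>fundamental_group S (Complex (s 0) (- \<rho>))\<^esub> loop_class S g = one (fundamental_group S (Complex (s 0) (- \<rho>)))"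
      using strip_system[of r m s "\<lambda>j. u * d j" \<rho> \<rho>, OF r(1) strip] \<rho>(1) m unfolding S_def by (auto simp: s_def)
    define b where "b = cnj u * Complex (s 0) (- \<rho>)"
    define T where "T = {y. \<forall>c\<in>P. r \<le> dist c y}"
    let ?f = "\<lambda>y. cnj u * y"
    have distu: "dist (cnj u * y) (cnj u * z) = dist y z" for y z
      using u(1) by (simp add: dist_norm norm_mult flip: right_diff_distrib)
    have cud: "cnj u * (u * y) = y" for y using uu by (simp add: mult.assoc[symmetric])
    have fS: "?f ` S \<subseteq> T"
    proof clarify
      fix y assume y: "y \<in> S"
      have "r \<le> dist c (cnj u * y)" if c: "c \<in> P" for c
      proof -
        obtain j where "j < m" "c = d j" using c unfolding dimg[symmetric] by blast
        then show ?thesis using y distu[of "u * d j" y] by (auto simp: S_def cud)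
      qed
      then show "cnj u * y \<in> T" by (simp add: T_def)
    qed
    have cont: "continuous_on S ?f" by (intro continuous_intros)
    let ?b = "Complex (s 0) (- \<rho>)"
    let ?G = "fundamental_group S ?b" and ?K = "fundamental_group T b"
    have bS: "?b \<in> S" using lg(2) path_in_D[of S g 0] by (auto simp: loops_at_iff pathstart_def)
    have bT: "b \<in> T" using bS fS by (auto simp: b_def)
    interpret G: group ?G by (rule group_fundamental_group[OF bS])
    interpret K: group ?K by (rule group_fundamental_group[OF bT])
    have hom: "induced S T ?f \<in> hom ?G ?K" unfolding b_def by (rule induced_hom[OF cont fS])
    define ix where "ix = the_inv_into {..<m} d"
    have ix: "ix (d j) = j" if "j < m" for j using the_inv_into_f_f[OF dinj] that by (simp add: ix_def)
    define l' where "l' c = induced S T ?f (l (ix c))" for c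
    have lS: "set (map l [0..<m]) \<subseteq> carrier ?G" using lasso_class_carrier[OF lg(1)] by auto
    have gS: "loop_class S g \<in> carrier ?G" using lg(2) by (simp add: fundamental_group_carrier)
    have "induced S T ?f (foldr (mult ?G) (map l [0..<m]) (one ?G) \<otimes>\<^bsub>?G\<^esub> loop_class S g) =
      foldr (mult ?K) (map l' (map d [0..<m])) (one ?K) \<otimes>\<^bsub>?K\<^esub> induced S T ?f (loop_class S g)"
    proof -
      have eq: "map l' (map d [0..<m]) = map (induced S T ?f) (map l [0..<m])" by (auto simp: l'_def ix)
      show ?thesis
        unfolding eq using hom_foldr_mult[OF G.is_group K.is_group hom lS] hom_mult[OF hom G.foldr_mult_closed[OF lS] gS] by simp
    qed
    then have prod: "foldr (mult ?K) (map l' (map d [0..<m])) (one ?K) \<otimes>\<^bsub>?K\<^esub> loop_class T (?f \<circ> g) = one ?K"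
      using lg(2) hom_one[OF hom G.is_group K.is_group] unfolding lg(5) by (simp add: induced_class[OF cont fS] loops_at_iff)
    have las: "lasso_class T b c r (l' c)" if c: "c \<in> P" for c
    proof -
      obtain j where j: "j < m" "c = d j" using c unfolding dimg[symmetric] by blast
      have "sphere c r \<subseteq> T"
      proof -
        have "?f ` sphere (u * c) r \<subseteq> T" using lg(1)[OF j(1)] fS j by (auto simp: lasso_class_def)
        moreover have "sphere c r \<subseteq> ?f ` sphere (u * c) r"
        proof
          fix y assume "y \<in> sphere c r"
          then have "u * y \<in> sphere (u * c) r" using u by (simp add: dist_norm norm_mult flip: right_diff_distrib)
          then show "y \<in> ?f ` sphere (u * c) r" by (metis cud imageI)
        qed
        ultimately show ?thesis by blast
      qed
      then show ?thesis
        using lasso_class_rotate[OF lg(1)[OF j(1)] _ fS] u(1) j ix by (simp add: l'_def cud b_def)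
    qed
    have g: "path g" "0 \<notin> path_image g" using lg(2,3) \<rho> by (auto simp: loops_at_def)
    have bB: "B \<le> norm b"
    proof -
      have "B \<le> \<bar>Im ?b\<bar>" using \<rho> by simp
      also have "\<dots> \<le> norm ?b" by (rule abs_Im_le_cmod)
      finally show ?thesis using u by (simp add: b_def norm_mult)
    qed
    show "\<exists>b cs l g. let S = {y. \<forall>c\<in>P. r \<le> dist c y}; G = fundamental_group S b in
     B \<le> norm b \<and> b \<in> S \<and> set cs = P \<and> distinct cs \<and> (\<forall>c\<in>P. lasso_class S b c r (l c)) \<and> g \<in> loops_at S b \<and>
     path_image g \<subseteq> {y. B \<le> norm y} \<and> winding_number g 0 = 1 \<and>
     foldr (mult G) (map l cs) (one G) \<otimes>\<^bsub>G\<^esub> loop_class S g = one G"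
      unfolding Let_def T_def[symmetric]
    proof (intro exI conjI)
      show "set (map d [0..<m]) = P" using dimg by (simp add: atLeast0LessThan)
      show "distinct (map d [0..<m])" using dinj by (simp add: distinct_map atLeast0LessThan)
      show "?f \<circ> g \<in> loops_at T b"
        using lg(2) path_in_compose[OF _ cont fS] by (auto simp: loops_at_iff pathstart_compose pathfinish_compose b_def)
      show "path_image (?f \<circ> g) \<subseteq> {y. B \<le> norm y}"
        using lg(3) \<rho> u by (auto simp: path_image_def norm_mult)
      show "winding_number (?f \<circ> g) 0 = 1"
        using winding_number_rotate[OF g, of "cnj u"] lg(4) uu by (simp add: o_def)
    qed (use bB bT las prod in auto)
  qed
qed

section \<open>Affine coordinates\<close>

definition coords :: "nat \<Rightarrow> cproj \<Rightarrow> nat \<Rightarrow> complex" where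
  "coords n P k = (if k < n then rep_cproj P k / rep_cproj P n else 0)"

definition affine_vec :: "nat \<Rightarrow> (nat \<Rightarrow> complex) \<Rightarrow> nat \<Rightarrow> complex" where
  "affine_vec n u k = (if k < n then u k else if k = n then 1 else 0)"

lemma affine_point_vec: "affine_point n u = abs_cproj (affine_vec n u)"
  unfolding affine_point_def affine_vec_def by (rule arg_cong[where f = abs_cproj]) auto

lemma affine_vec_nz: "affine_vec n u \<noteq> (\<lambda>_. 0)"
  by (metis affine_vec_def less_irrefl zero_neq_one)

lemma proportional_refl: "v \<noteq> (\<lambda>_. 0) \<Longrightarrow> proportional v v"
  unfolding proportional_def by (auto intro!: exI[of _ 1])

lemma rep_abs_cproj: "v \<noteq> (\<lambda>_. 0) \<Longrightarrow> \<exists>c. c \<noteq> 0 \<and> rep_cproj (abs_cproj v) = (\<lambda>k. c * v k)"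
  using Quotient3_rep_abs[OF Quotient3_cproj, of v] proportional_refl[of v]
  by (metis Quotient3_cproj Quotient3_symp proportional_def sympE)

lemma abs_cproj_eq: "v \<noteq> (\<lambda>_. 0) \<Longrightarrow> c \<noteq> 0 \<Longrightarrow> abs_cproj (\<lambda>k. c * v k) = abs_cproj v"
  by (rule sym, rule Quotient3_rel_abs[OF Quotient3_cproj]) (auto simp: proportional_def)

lemma abs_cproj_eqD: "v \<noteq> (\<lambda>_. 0) \<Longrightarrow> w \<noteq> (\<lambda>_. 0) \<Longrightarrow> abs_cproj v = abs_cproj w \<Longrightarrow> \<exists>c. c \<noteq> 0 \<and> w = (\<lambda>k. c * v k)"
  using Quotient3_rel[OF Quotient3_cproj, of v w] proportional_refl by (auto simp: proportional_def)

lemma coords_abs: "v n \<noteq> 0 \<Longrightarrow> coords n (abs_cproj v) = (\<lambda>k. if k < n then v k / v n else 0)"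
proof -
  assume v: "v n \<noteq> 0"
  then have "v \<noteq> (\<lambda>_. 0)" by auto
  from rep_abs_cproj[OF this] show ?thesis using v by (auto simp: coords_def)
qed

lemma coords_affine: "coords n (affine_point n u) = (\<lambda>k. if k < n then u k else 0)"
  unfolding affine_point_vec by (subst coords_abs) (auto simp: affine_vec_def)

lemma affine_point_cong: "(\<And>k. k < n \<Longrightarrow> u k = v k) \<Longrightarrow> affine_point n u = affine_point n v"
  unfolding affine_point_vec by (rule arg_cong[where f = abs_cproj]) (auto simp: affine_vec_def)

lemma affine_point_eqD: "affine_point n u = affine_point n v \<Longrightarrow> k < n \<Longrightarrow> u k = v k"
proof -
  assume "affine_point n u = affine_point n v" "k < n"
  then have "coords n (affine_point n u) k = coords n (affine_point n v) k" by (simp only:)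
  then show ?thesis using \<open>k < n\<close> by (simp only: coords_affine if_True)
qed

lemma continuous_affine_point: "continuous_on UNIV (affine_point n)"
proof -
  have vec: "continuous_on UNIV (affine_vec n)"
  proof (rule continuous_on_coordinatewise_then_product)
    fix k
    show "continuous_on UNIV (\<lambda>u. affine_vec n u k)"
      by (cases "k < n"; cases "k = n") (auto simp: affine_vec_def)
  qed
  have "open (affine_point n -` U)" if "open U" for U
  proof -
    have "affine_point n -` U = affine_vec n -` {v. v \<noteq> (\<lambda>_. 0) \<and> abs_cproj v \<in> U}"
      using affine_vec_nz by (auto simp: affine_point_vec)
    then show ?thesis
      using that vec by (auto simp: open_cproj_def continuous_on_open_vimage)
  qed
  then show ?thesis by (simp add: continuous_on_open_vimage)
qed

definition good_coords :: "nat \<Rightarrow> (nat \<Rightarrow> complex) \<Rightarrow> bool" where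
  "good_coords n u \<longleftrightarrow> u 0 \<noteq> 0 \<and> u 1 \<noteq> 0 \<and> aff_conic u \<noteq> 0 \<and>
     (\<forall>i\<in>{1..n-2}. aff_conic u - (u (i + 1))\<^sup>2 \<noteq> 0)"

lemma conic_scale: "conic (c * x) (c * y) (c * t) = c\<^sup>2 * conic x y t"
  by (simp add: conic_def power2_eq_square algebra_simps)

lemma abs_in_divisor:
  assumes "v \<noteq> (\<lambda>_. 0)" "\<forall>k>n. v k = 0"
  shows "abs_cproj v \<in> divisor n \<longleftrightarrow> v 0 = 0 \<or> v 1 = 0 \<or> v n = 0 \<or> conic (v 0) (v 1) (v n) = 0 \<or>
      (\<exists>i\<in>{1..n-2}. conic (v 0) (v 1) (v n) - (v (i + 1))\<^sup>2 = 0)" (is "?l \<longleftrightarrow> ?r")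
proof
  assume ?l
  then obtain w where w: "abs_cproj v = abs_cproj w" "w \<noteq> (\<lambda>_. 0)"
    "w 0 = 0 \<or> w 1 = 0 \<or> w n = 0 \<or> conic (w 0) (w 1) (w n) = 0 \<or>
      (\<exists>i\<in>{1..n-2}. conic (w 0) (w 1) (w n) - (w (i + 1))\<^sup>2 = 0)"
    unfolding divisor_def by blast
  obtain c where c: "c \<noteq> 0" "w = (\<lambda>k. c * v k)"
    using abs_cproj_eqD[OF assms(1) w(2,1)] by blast
  have "conic (w 0) (w 1) (w n) = c\<^sup>2 * conic (v 0) (v 1) (v n)"
    "conic (w 0) (w 1) (w n) - (w k)\<^sup>2 = c\<^sup>2 * (conic (v 0) (v 1) (v n) - (v k)\<^sup>2)" for k
    by (auto simp: c conic_scale power_mult_distrib right_diff_distrib)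
  then show ?r using w(3) c by auto
next
  assume ?r then show ?l unfolding divisor_def using assms by blast
qed

lemma affine_in_complement:
  assumes "n \<ge> 2"
  shows "affine_point n u \<in> divisor_complement n \<longleftrightarrow> good_coords n u"
proof -
  have 1: "affine_point n u \<in> projective_space n"
    unfolding projective_space_def affine_point_vec
    by (intro CollectI exI[of _ "affine_vec n u"] conjI refl affine_vec_nz) (simp add: affine_vec_def)
  have "affine_point n u \<in> divisor n \<longleftrightarrow> \<not> good_coords n u"
  proof -
    have v: "affine_vec n u 0 = u 0" "affine_vec n u 1 = u 1" "affine_vec n u n = 1"
      using assms by (auto simp: affine_vec_def)
    have vi: "affine_vec n u (i + 1) = u (i + 1)" if "i \<in> {1..n-2}" for i
      using assms that by (auto simp: affine_vec_def)
    have "\<forall>k>n. affine_vec n u k = 0" by (auto simp: affine_vec_def)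
    note eq = abs_in_divisor[OF affine_vec_nz this, unfolded v]
    have bx: "(\<exists>i\<in>{1..n-2}. conic (u 0) (u 1) 1 - (affine_vec n u (i + 1))\<^sup>2 = 0) \<longleftrightarrow>
       (\<exists>i\<in>{1..n-2}. conic (u 0) (u 1) 1 - (u (i + 1))\<^sup>2 = 0)"
      by (rule bex_cong[OF refl]) (simp only: vi)
    show ?thesis
      unfolding affine_point_vec good_coords_def aff_conic_def eq bx by (simp del: One_nat_def)
  qed
  with 1 show ?thesis by (simp add: divisor_complement_def)
qed

lemma complement_obtain:
  assumes "P \<in> divisor_complement n"
  shows "affine_point n (coords n P) = P"
proof -
  obtain v where v: "P = abs_cproj v" "v \<noteq> (\<lambda>_. 0)" "\<forall>k>n. v k = 0"
    using assms by (auto simp: divisor_complement_def projective_space_def)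
  have "v n \<noteq> 0" using assms v abs_in_divisor[of v n] by (auto simp: divisor_complement_def)
  then have "v = (\<lambda>k. v n * affine_vec n (coords n P) k)"
    using v coords_abs[of v n] by (auto simp: fun_eq_iff affine_vec_def not_less nat_less_le)
  then have "abs_cproj v = abs_cproj (affine_vec n (coords n P))"
    using abs_cproj_eq[OF affine_vec_nz \<open>v n \<noteq> 0\<close>] by metis
  then show ?thesis using v by (simp add: affine_point_vec)
qed

text \<open>Openness in the quotient is tested upstairs: over the saturated open set v n \<noteq> 0
  the coordinate is the quotient v k / v n.\<close>

lemma continuous_coord: "continuous_on (divisor_complement n) (\<lambda>P. coords n P k)"
proof (cases "k < n")
  case True
  define O' where "O' = abs_cproj ` {v. v n \<noteq> (0::complex)}"
  have in_O: "abs_cproj v \<in> O' \<longleftrightarrow> v n \<noteq> 0" if v: "v \<noteq> (\<lambda>_. 0)" for v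
  proof
    assume "abs_cproj v \<in> O'"
    then obtain w where w: "abs_cproj v = abs_cproj w" "w n \<noteq> 0" by (auto simp: O'_def)
    moreover have "w \<noteq> (\<lambda>_. 0)" using w by auto
    ultimately show "v n \<noteq> 0" using abs_cproj_eqD[OF v, of w] by auto
  qed (auto simp: O'_def)
  have nz: "v \<noteq> (\<lambda>_. 0)" if "v n \<noteq> 0" for v :: "nat \<Rightarrow> complex" using that by auto
  have sub: "divisor_complement n \<subseteq> O'"
  proof
    fix P assume "P \<in> divisor_complement n"
    then have "P = abs_cproj (affine_vec n (coords n P))" using complement_obtain affine_point_vec by metis
    then show "P \<in> O'" by (auto simp: O'_def affine_vec_def intro!: image_eqI)
  qed
  have op: "open {v :: nat \<Rightarrow> complex. v n \<noteq> 0 \<and> v k / v n \<in> B}" if "open B" for B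
  proof -
    have o: "open {v :: nat \<Rightarrow> complex. v n \<noteq> 0}"
      using open_vimage[of "- {0}" "\<lambda>v :: nat \<Rightarrow> complex. v n"] by (auto simp: vimage_def)
    have "continuous_on {v :: nat \<Rightarrow> complex. v n \<noteq> 0} (\<lambda>v. v k / v n)"
      by (intro continuous_on_divide continuous_on_subset[OF continuous_on_product_coordinates]) auto
    then have "open ((\<lambda>v. v k / v n) -` B \<inter> {v :: nat \<Rightarrow> complex. v n \<noteq> 0})"
      using that o by (simp add: continuous_on_open_vimage)
    then show ?thesis by (rule back_subst[where P = "open"]) auto
  qed
  have "continuous_on O' (\<lambda>P. coords n P k)"
  proof (subst continuous_on_open_vimage)
    have "{v. v \<noteq> (\<lambda>_. 0) \<and> abs_cproj v \<in> O'} = {v. v n \<noteq> 0 \<and> v k / v n \<in> UNIV}"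
      using in_O nz by auto
    then show "open O'" using op[of UNIV] by (simp add: open_cproj_def)
    show "\<forall>B. open B \<longrightarrow> open ((\<lambda>P. coords n P k) -` B \<inter> O')"
    proof (intro allI impI)
      fix B :: "complex set" assume B: "open B"
      have "{v. v \<noteq> (\<lambda>_. 0) \<and> abs_cproj v \<in> (\<lambda>P. coords n P k) -` B \<inter> O'} = {v. v n \<noteq> 0 \<and> v k / v n \<in> B}"
        using in_O nz coords_abs True by auto
      then show "open ((\<lambda>P. coords n P k) -` B \<inter> O')" using op[OF B] by (simp add: open_cproj_def)
    qed
  qed
  then show ?thesis using sub continuous_on_subset by blast
qed (simp add: coords_def)

lemma continuous_coords: "continuous_on (divisor_complement n) (coords n)"
  by (intro continuous_on_coordinatewise_then_product continuous_coord)

lemma continuous_on_conic [continuous_intros]: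
  "continuous_on S f \<Longrightarrow> continuous_on S g \<Longrightarrow> continuous_on S h \<Longrightarrow> continuous_on S (\<lambda>x. conic (f x) (g x) (h x))"
  unfolding conic_def by (intro continuous_intros)

lemma continuous_on_affine_point [continuous_intros]:
  "continuous_on S f \<Longrightarrow> continuous_on S (\<lambda>x. affine_point n (f x))"
  by (rule continuous_on_compose2[OF continuous_affine_point]) auto

lemma continuous_aff_conic: "continuous_on UNIV aff_conic"
  unfolding aff_conic_def [abs_def] by (intro continuous_intros continuous_on_product_coordinates)

lemma open_good_coords: "open {u. good_coords n u}"
proof -
  have nz: "open {u. f u \<noteq> 0}" if "continuous_on UNIV f" for f :: "(nat \<Rightarrow> complex) \<Rightarrow> complex"
    using open_vimage[OF _ that, of "- {0}"] by (auto simp: vimage_def)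
  have "open ({u. u 0 \<noteq> 0} \<inter> {u. u 1 \<noteq> 0} \<inter> {u. aff_conic u \<noteq> 0} \<inter>
    (\<Inter>i\<in>{1..n-2}. {u. aff_conic u - (u (i + 1))\<^sup>2 \<noteq> (0::complex)}))"
    by (intro open_Int open_INT ballI nz continuous_aff_conic continuous_intros continuous_on_product_coordinates) auto
  then show ?thesis by (rule back_subst[where P = "open"]) (auto simp: good_coords_def)
qed

text \<open>Flat sections will be compared along straight segments in the affine coordinates. A
  basic open set of the product topology restricts finitely many coordinates; shrinking each of
  these restrictions to a ball makes it star-shaped about \<open>P0\<close>.\<close>

lemma star_neighbourhood:
  assumes n: "n \<ge> 2" and U: "openin (top_of_set (divisor_complement n)) U" "P0 \<in> U"
  obtains N where "openin (top_of_set (divisor_complement n)) N" "P0 \<in> N" "N \<subseteq> U"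
    "\<And>P s. P \<in> N \<Longrightarrow> 0 \<le> s \<Longrightarrow> s \<le> 1 \<Longrightarrow>
      affine_point n (\<lambda>k. coords n P0 k + of_real s * (coords n P k - coords n P0 k)) \<in> U"
proof -
  obtain V where V: "open V" "U = divisor_complement n \<inter> V" using U(1) by (auto simp: openin_open)
  define u0 where "u0 = coords n P0"
  have P0: "affine_point n u0 = P0" using U V complement_obtain by (auto simp: u0_def)
  define D where "D = {u. good_coords n u} \<inter> affine_point n -` V"
  have D: "u \<in> D \<longleftrightarrow> affine_point n u \<in> U" for u
    using affine_in_complement[OF n] V by (auto simp: D_def)
  have "open D" unfolding D_def
    using V continuous_affine_point open_good_coords by (auto simp: continuous_on_open_vimage)
  moreover have "u0 \<in> D" using D P0 U by simp
  ultimately obtain X where X: "u0 \<in> Pi\<^sub>E UNIV X" "\<And>i. open (X i)" "finite {i. X i \<noteq> UNIV}" "Pi\<^sub>E UNIV X \<subseteq> D"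
    using product_topology_open_contains_basis[of "\<lambda>_. euclidean" UNIV D u0] by (auto simp: open_fun_def)
  have "\<exists>e>0. ball (u0 i) e \<subseteq> X i" for i
    using X(1,2) by (metis PiE_iff UNIV_I open_contains_ball)
  then obtain e where e: "\<And>i. e i > 0" "\<And>i. ball (u0 i) (e i) \<subseteq> X i" by metis
  define J where "J = {i. X i \<noteq> UNIV}"
  define N where "N = divisor_complement n \<inter> coords n -` {v. \<forall>i\<in>J. v (id i) \<in> ball (u0 i) (e i)}"
  have star: "affine_point n (\<lambda>k. u0 k + of_real s * (coords n P k - u0 k)) \<in> U" if P: "P \<in> N" "0 \<le> s" "s \<le> 1" for P s
  proof -
    have "(\<lambda>k. u0 k + of_real s * (coords n P k - u0 k)) \<in> Pi\<^sub>E UNIV X"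
    proof (rule PiE_I)
      fix i
      show "u0 i + of_real s * (coords n P i - u0 i) \<in> X i"
      proof (cases "i \<in> J")
        case True
        then have "norm (coords n P i - u0 i) < e i" using P by (auto simp: N_def dist_norm norm_minus_commute)
        moreover have "norm (of_real s * (coords n P i - u0 i)) \<le> norm (coords n P i - u0 i)"
          using P by (simp add: norm_mult mult_left_le_one_le)
        ultimately show ?thesis using e(2)[of i] by (auto simp: dist_norm subset_iff)
      qed (simp add: J_def)
    qed auto
    then show ?thesis using X(4) D by blast
  qed
  show ?thesis
  proof (rule that[of N])
    show "openin (top_of_set (divisor_complement n)) N" unfolding N_def
      using X(3) by (intro continuous_openin_preimage_gen continuous_coords product_topology_basis') (auto simp: J_def)
    show "P0 \<in> N" using U V e(1) by (auto simp: N_def u0_def)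
    show "N \<subseteq> U"
    proof
      fix P assume P: "P \<in> N"
      then have "affine_point n (coords n P) = P" by (intro complement_obtain) (simp add: N_def)
      then show "P \<in> U" using star[OF P, of 1] by simp
    qed
  qed (use star in \<open>auto simp: u0_def\<close>)
qed

section \<open>The double cover by the square root of the conic\<close>

text \<open>The conic becomes a square under \<open>x = p q\<close>, \<open>y = (1 - p) (1 - q)\<close>: its value is \<open>(p - q)\<^sup>2\<close>.
  The coordinates of the cover are \<open>(p, q, z_1, \<dots>, z_{n-2})\<close>.\<close>

definition cover :: "nat \<Rightarrow> (nat \<Rightarrow> complex) set" where
  "cover n = {e. (\<forall>k\<ge>n. e k = 0) \<and> e 0 \<noteq> 0 \<and> e 1 \<noteq> 0 \<and> e 0 \<noteq> 1 \<and> e 1 \<noteq> 1 \<and> e 0 \<noteq> e 1 \<and>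
     (\<forall>i\<in>{1..n-2}. e 0 - e 1 - e (i + 1) \<noteq> 0 \<and> e 0 - e 1 + e (i + 1) \<noteq> 0)}"

definition cover_coords :: "(nat \<Rightarrow> complex) \<Rightarrow> nat \<Rightarrow> complex" where
  "cover_coords e k = (if k = 0 then e 0 * e 1 else if k = 1 then (1 - e 0) * (1 - e 1) else e k)"

definition cover_proj :: "nat \<Rightarrow> (nat \<Rightarrow> complex) \<Rightarrow> cproj" where
  "cover_proj n e = affine_point n (cover_coords e)"

text \<open>Given x and y, the numbers p and q are the roots of T^2 - (1 + x - y) T + x. Its
  discriminant is the conic, and \<open>w\<close> is the chosen square root p - q.\<close>

definition sheet :: "nat \<Rightarrow> (nat \<Rightarrow> complex) \<Rightarrow> complex \<Rightarrow> nat \<Rightarrow> complex" where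
  "sheet n u w k = (if k = 0 then (1 + u 0 - u 1 + w) / 2 else if k = 1 then (1 + u 0 - u 1 - w) / 2
     else if k < n then u k else 0)"

definition swap_sheet :: "(nat \<Rightarrow> complex) \<Rightarrow> nat \<Rightarrow> complex" where
  "swap_sheet e = e(0 := e 1, 1 := e 0)"

lemma aff_conic_cover: "aff_conic (cover_coords e) = (e 0 - e 1)\<^sup>2"
  by (simp add: aff_conic_def conic_def cover_coords_def power2_eq_square algebra_simps)

lemma square_minus_square: "(a::complex)\<^sup>2 - b\<^sup>2 = (a - b) * (a + b)"
  by (simp add: power2_eq_square algebra_simps)

lemma good_cover_coords: "e \<in> cover n \<Longrightarrow> good_coords n (cover_coords e)"
  by (auto simp: cover_def good_coords_def aff_conic_cover square_minus_square simp del: power_eq_0_iff)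
     (auto simp: cover_coords_def)

lemma cover_proj_in: "n \<ge> 2 \<Longrightarrow> e \<in> cover n \<Longrightarrow> cover_proj n e \<in> divisor_complement n"
  by (simp add: cover_proj_def affine_in_complement good_cover_coords)

lemma sheet_diff [simp]: "sheet n u w 0 - sheet n u w 1 = w" "sheet n u w 0 - sheet n u w (Suc 0) = w"
  by (simp_all add: sheet_def field_simps)

lemma sheet_prods:
  assumes "w\<^sup>2 = aff_conic u"
  shows "sheet n u w 0 * sheet n u w 1 = u 0" "(1 - sheet n u w 0) * (1 - sheet n u w 1) = u 1"
proof -
  have w: "w * w = u 0 * u 0 + u 1 * u 1 + 1 - 2 * (u 0 * u 1 + u 1 + u 0)"
    using assms by (simp add: aff_conic_def conic_def power2_eq_square)
  have "sheet n u w 0 * sheet n u w 1 = ((1 + u 0 - u 1) * (1 + u 0 - u 1) - w * w) / 4"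
    by (simp add: sheet_def field_simps)
  then show "sheet n u w 0 * sheet n u w 1 = u 0"
    unfolding w by (simp add: field_simps)
  have "(1 - sheet n u w 0) * (1 - sheet n u w 1) = ((1 - u 0 + u 1) * (1 - u 0 + u 1) - w * w) / 4"
    by (simp add: sheet_def field_simps)
  then show "(1 - sheet n u w 0) * (1 - sheet n u w 1) = u 1"
    unfolding w by (simp add: field_simps)
qed

lemma sheet_in_cover:
  assumes "n \<ge> 2" "good_coords n u" "w\<^sup>2 = aff_conic u"
  shows "sheet n u w \<in> cover n" "cover_proj n (sheet n u w) = affine_point n u"
proof -
  have "w - u (i + 1) \<noteq> 0 \<and> w + u (i + 1) \<noteq> 0" if "i \<in> {1..n-2}" for i
  proof -
    have "aff_conic u \<noteq> (u (i + 1))\<^sup>2" using assms(2) that by (auto simp: good_coords_def)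
    then have "(w - u (i + 1)) * (w + u (i + 1)) \<noteq> 0" using assms(3) square_minus_square[of w "u (i + 1)"] by auto
    then show ?thesis by auto
  qed
  moreover have "sheet n u w (i + 1) = u (i + 1)" if "i \<in> {1..n-2}" for i
    using that assms(1) by (auto simp: sheet_def)
  moreover have "w \<noteq> 0" using assms by (auto simp: good_coords_def)
  ultimately show "sheet n u w \<in> cover n"
    using sheet_prods[OF assms(3), of n] assms(1,2) sheet_diff[of n u w]
    by (auto simp: cover_def good_coords_def) (auto simp: sheet_def)
  show "cover_proj n (sheet n u w) = affine_point n u"
    unfolding cover_proj_def
    by (rule affine_point_cong) (use sheet_prods[OF assms(3), of n] in \<open>auto simp: cover_coords_def sheet_def[of _ _ _ "_ :: nat"]\<close>)
qed

lemma cover_eq_sheet: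
  assumes "n \<ge> 2" "e \<in> cover n" "cover_proj n e = affine_point n u"
  shows "e = sheet n u (e 0 - e 1)" "(e 0 - e 1)\<^sup>2 = aff_conic u"
proof -
  have u: "k < n \<Longrightarrow> u k = cover_coords e k" for k
    using affine_point_eqD[of n "cover_coords e" u k] assms(3) by (simp add: cover_proj_def)
  have "u 0 = e 0 * e 1" "u 1 = (1 - e 0) * (1 - e 1)"
    using u[of 0] u[of 1] assms(1) by (auto simp: cover_coords_def)
  then show "e = sheet n u (e 0 - e 1)"
    using u assms(1,2) by (auto simp: fun_eq_iff sheet_def cover_coords_def cover_def field_simps)
  show "(e 0 - e 1)\<^sup>2 = aff_conic u"
    using aff_conic_cover[of e] \<open>u 0 = _\<close> \<open>u 1 = _\<close> by (simp add: aff_conic_def cover_coords_def)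
qed

lemma swap_in_cover: "n \<ge> 2 \<Longrightarrow> e \<in> cover n \<Longrightarrow> swap_sheet e \<in> cover n"
proof -
  assume n: "n \<ge> 2" and e: "e \<in> cover n"
  have "e 1 - e 0 - e (i + 1) \<noteq> 0 \<and> e 1 - e 0 + e (i + 1) \<noteq> 0" if "i \<in> {1..n-2}" for i
  proof -
    have "e 0 - e 1 - e (i + 1) \<noteq> 0 \<and> e 0 - e 1 + e (i + 1) \<noteq> 0"
      using e that by (simp add: cover_def)
    moreover have "e 1 - e 0 - e (i + 1) = - (e 0 - e 1 + e (i + 1))" "e 1 - e 0 + e (i + 1) = - (e 0 - e 1 - e (i + 1))"
      by simp_all
    ultimately show ?thesis by (simp only: neg_equal_0_iff_equal not_False_eq_True simp_thms)
  qed
  then show ?thesis using e n by (auto simp: cover_def swap_sheet_def)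
qed

lemma cover_proj_swap [simp]: "cover_proj n (swap_sheet e) = cover_proj n e"
proof -
  have "cover_coords (swap_sheet e) = cover_coords e"
    by (auto simp: fun_eq_iff cover_coords_def swap_sheet_def)
  then show ?thesis by (simp add: cover_proj_def)
qed

lemma swap_swap [simp]: "swap_sheet (swap_sheet e) = e"
  by (auto simp: swap_sheet_def fun_eq_iff)

lemma swap_ne: "e \<in> cover n \<Longrightarrow> swap_sheet e \<noteq> e"
  by (auto simp: swap_sheet_def cover_def fun_eq_iff)

text \<open>Over a given point only the sign of p - q is left to choose.\<close>

lemma cover_fibre:
  assumes "n \<ge> 2" "e \<in> cover n" "e' \<in> cover n" "cover_proj n e = cover_proj n e'"
  shows "e' = e \<or> e' = swap_sheet e"
proof -
  let ?u = "cover_coords e"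
  have 1: "e = sheet n ?u (e 0 - e 1)" "(e 0 - e 1)\<^sup>2 = aff_conic ?u"
    using cover_eq_sheet[OF assms(1,2), of ?u] by (auto simp: cover_proj_def)
  have 2: "e' = sheet n ?u (e' 0 - e' 1)" "(e' 0 - e' 1)\<^sup>2 = aff_conic ?u"
    using cover_eq_sheet[OF assms(1,3), of ?u] assms(4) by (auto simp: cover_proj_def)
  have 3: "swap_sheet e = sheet n ?u (e 1 - e 0)"
    using cover_eq_sheet[OF assms(1) swap_in_cover[OF assms(1,2)], of ?u] cover_proj_swap[of n e]
    by (simp add: cover_proj_def[of n e] swap_sheet_def)
  have "e' 0 - e' 1 = e 0 - e 1 \<or> e' 0 - e' 1 = e 1 - e 0"
    using 1 2 power2_eq_iff[of "e' 0 - e' 1" "e 0 - e 1"] by auto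
  then show ?thesis using 1 2 3 by metis
qed

section \<open>Lifts to the double cover: existence and uniqueness\<close>

lemma continuous_cover_proj: "continuous_on S (cover_proj n)"
proof -
  have "continuous_on UNIV cover_coords"
  proof (rule continuous_on_coordinatewise_then_product)
    fix k
    show "continuous_on UNIV (\<lambda>e. cover_coords e k)"
      unfolding cover_coords_def
      by (cases "k = 0"; cases "k = 1") (auto intro!: continuous_intros continuous_on_product_coordinates)
  qed
  then show ?thesis
    unfolding cover_proj_def [abs_def] by (intro continuous_on_affine_point) (rule continuous_on_subset, auto)
qed

lemma continuous_sheet:
  assumes "continuous_on S u" "continuous_on S w"
  shows "continuous_on S (\<lambda>x. sheet n (u x) (w x))"
proof (rule continuous_on_coordinatewise_then_product)
  fix k
  have "continuous_on S (\<lambda>x. u x j)" for j by (rule continuous_on_product_then_coordinatewise[OF assms(1)])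
  then show "continuous_on S (\<lambda>x. sheet n (u x) (w x) k)"
    unfolding sheet_def using assms(2)
    by (cases "k = 0"; cases "k = 1"; cases "k < n") (auto intro!: continuous_intros)
qed

lemma continuous_swap_sheet: "continuous_on S swap_sheet"
proof (rule continuous_on_coordinatewise_then_product)
  fix k
  show "continuous_on S (\<lambda>e. swap_sheet e k)"
    unfolding swap_sheet_def fun_upd_def
    by (cases "k = 0"; cases "k = 1") (auto intro: continuous_on_subset[OF continuous_on_product_coordinates])
qed

text \<open>Stated for convex \<open>K\<close> so that an interval gives path lifting and a square
  gives homotopy lifting. A nowhere zero continuous function on \<open>K\<close> has a logarithm,
  half of which yields the root p - q of the conic.\<close>

lemma cover_lift:
  fixes F :: "'a::real_normed_vector \<Rightarrow> cproj"
  assumes n: "n \<ge> 2" and K: "convex K" "k0 \<in> K" and F: "continuous_on K F" "F ` K \<subseteq> divisor_complement n"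
    and e0: "e0 \<in> cover n" "cover_proj n e0 = F k0"
  obtains \<epsilon> where "continuous_on K \<epsilon>" "\<epsilon> ` K \<subseteq> cover n" "\<And>k. k \<in> K \<Longrightarrow> cover_proj n (\<epsilon> k) = F k" "\<epsilon> k0 = e0"
proof -
  define c where "c k = aff_conic (coords n (F k))" for k
  have cF: "continuous_on K (\<lambda>k. coords n (F k))"
    by (rule continuous_on_compose2[OF continuous_coords F(1)]) (use F in auto)
  have c: "continuous_on K c"
    unfolding c_def by (rule continuous_on_compose2[OF continuous_aff_conic cF]) auto
  have good: "good_coords n (coords n (F k))" "affine_point n (coords n (F k)) = F k" if "k \<in> K" for k
    using F that complement_obtain affine_in_complement[OF n] by (metis image_subset_iff)+
  then have "c k \<noteq> 0" if "k \<in> K" for k using that by (simp add: c_def good_coords_def)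
  then obtain g where g: "continuous_on K g" "\<And>k. k \<in> K \<Longrightarrow> c k = exp (g k)"
    using continuous_logarithm_on_contractible[OF c convex_imp_contractible[OF K(1)]] by blast
  have e0c: "e0 = sheet n (coords n (F k0)) (e0 0 - e0 1)" "(e0 0 - e0 1)\<^sup>2 = c k0"
    using cover_eq_sheet[OF n e0(1), of "coords n (F k0)"] good[OF K(2)] e0 by (auto simp: c_def)
  \<comment> \<open>Normalised so that \<open>w k0\<close> is the value of p - q at
    \<open>e0\<close>; the half logarithm squares back to \<open>c\<close>.\<close>
  define w where "w k = (e0 0 - e0 1) * exp ((g k - g k0) / 2)" for k
  have w2: "(w k)\<^sup>2 = aff_conic (coords n (F k))" if "k \<in> K" for k
  proof -
    have "(w k)\<^sup>2 = (e0 0 - e0 1)\<^sup>2 * (exp ((g k - g k0) / 2))\<^sup>2" by (simp add: w_def power_mult_distrib)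
    also have "(exp ((g k - g k0) / 2))\<^sup>2 = c k / c k0"
    proof -
      have "(exp ((g k - g k0) / 2))\<^sup>2 = exp (2 * ((g k - g k0) / 2))"
        by (simp only: exp_double)
      also have "2 * ((g k - g k0) / 2) = g k - g k0" by simp
      finally have "(exp ((g k - g k0) / 2))\<^sup>2 = exp (g k - g k0)" .
      then show ?thesis using g that K by (simp add: exp_diff)
    qed
    finally show ?thesis using e0c g K by (simp add: c_def)
  qed
  show ?thesis
  proof (rule that[of "\<lambda>k. sheet n (coords n (F k)) (w k)"])
    show "continuous_on K (\<lambda>k. sheet n (coords n (F k)) (w k))"
      unfolding w_def by (intro continuous_sheet cF continuous_intros g) auto
    show "sheet n (coords n (F k0)) (w k0) = e0" using e0c by (simp add: w_def)
  qed (use sheet_in_cover[OF n good(1) w2] good(2) in auto)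
qed

text \<open>The quotient of the two values of p - q is continuous and equal to 1 or -1, hence
  constant on a connected set.\<close>

lemma cover_lift_unique:
  assumes n: "n \<ge> 2" and K: "connected K" "k0 \<in> K" "k \<in> K"
    and e: "continuous_on K \<epsilon>" "continuous_on K \<epsilon>'" "\<epsilon> ` K \<subseteq> cover n" "\<epsilon>' ` K \<subseteq> cover n"
      "\<And>k. k \<in> K \<Longrightarrow> cover_proj n (\<epsilon> k) = cover_proj n (\<epsilon>' k)" "\<epsilon> k0 = \<epsilon>' k0"
  shows "\<epsilon> k = \<epsilon>' k"
proof -
  define f where "f k = (\<epsilon> k 0 - \<epsilon> k 1) / (\<epsilon>' k 0 - \<epsilon>' k 1)" for k
  have alt: "\<epsilon>' k = \<epsilon> k \<or> \<epsilon>' k = swap_sheet (\<epsilon> k)" if "k \<in> K" for k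
    using that e by (intro cover_fibre[OF n]) auto
  have nz: "\<epsilon> k 0 - \<epsilon> k 1 \<noteq> 0" "\<epsilon>' k 0 - \<epsilon>' k 1 \<noteq> 0" if "k \<in> K" for k
    using e(3,4) that by (auto simp: cover_def)
  have f: "f k = 1 \<and> \<epsilon>' k = \<epsilon> k \<or> f k = -1" if "k \<in> K" for k
    using alt[OF that] nz[OF that] by (auto simp: f_def swap_sheet_def divide_eq_minus_1_iff divide_simps)
  have "f constant_on K"
  proof (rule continuous_finite_range_constant[OF K(1)])
    show "continuous_on K f"
      unfolding f_def using nz continuous_on_product_then_coordinatewise[OF e(1)] continuous_on_product_then_coordinatewise[OF e(2)]
      by (intro continuous_on_divide continuous_on_diff) auto
    have "f ` K \<subseteq> {1, -1}" using f by (intro image_subsetI) blast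
    then show "finite (f ` K)" by (rule finite_subset) auto
  qed
  then have "f k = f k0" using K by (auto simp: constant_on_def)
  moreover have "f k0 = 1" using nz[OF K(2)] e(6) by (simp add: f_def)
  ultimately show ?thesis using f[OF K(3)] by auto
qed

section \<open>Local sections and the covering property\<close>

lemma sqrt_near_one:
  assumes "norm (z - 1) < 1"
  shows "(exp (Ln z / 2))\<^sup>2 = z" "Re (exp (Ln z / 2)) > 0" "z \<noteq> 0" "z \<notin> \<real>\<^sub>\<le>\<^sub>0"
proof -
  have re: "Re z > 0" using abs_Re_le_cmod[of "z - 1"] assms by auto
  then show nz: "z \<noteq> 0" and nr: "z \<notin> \<real>\<^sub>\<le>\<^sub>0" by (auto simp: complex_nonpos_Reals_iff)
  show "(exp (Ln z / 2))\<^sup>2 = z" using nz by (simp flip: exp_double)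
  have "\<bar>Im (Ln z)\<bar> < pi / 2" using re Re_Ln_pos_lt[OF nz] by blast
  then show "Re (exp (Ln z / 2)) > 0" by (auto simp: Re_exp intro!: mult_pos_pos cos_gt_zero_pi)
qed

text \<open>The branch of the root of the conic that equals p - q at \<open>e\<close>, meant for
  points where the conic differs from its value at \<open>e\<close> by less than the size of that
  value.\<close>

definition local_root :: "(nat \<Rightarrow> complex) \<Rightarrow> (nat \<Rightarrow> complex) \<Rightarrow> complex" where
  "local_root e u = (e 0 - e 1) * exp (Ln (aff_conic u / (e 0 - e 1)\<^sup>2) / 2)"

definition local_section :: "nat \<Rightarrow> (nat \<Rightarrow> complex) \<Rightarrow> cproj \<Rightarrow> nat \<Rightarrow> complex" where
  "local_section n e P = sheet n (coords n P) (local_root e (coords n P))"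

definition local_base :: "nat \<Rightarrow> (nat \<Rightarrow> complex) \<Rightarrow> cproj set" where
  "local_base n e = divisor_complement n \<inter> coords n -` {u. norm (aff_conic u / (e 0 - e 1)\<^sup>2 - 1) < 1}"

lemma openin_local_base: "openin (top_of_set (divisor_complement n)) (local_base n e)"
proof -
  have "open {u. norm (aff_conic u / (e 0 - e 1)\<^sup>2 - 1) < 1}"
    by (cases "e 0 = e 1") (auto intro!: open_Collect_less continuous_intros continuous_aff_conic)
  then show ?thesis
    unfolding local_base_def by (intro continuous_openin_preimage_gen continuous_coords)
qed

text \<open>Over \<open>local_base\<close> the two sheets are told apart by the sign of the real
  part of p - q divided by its value at \<open>e\<close>; the principal root picks the positive
  one.\<close>

lemma local_section:
  assumes n: "n \<ge> 2" and e: "e \<in> cover n"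
  shows "continuous_on (local_base n e) (local_section n e)"
    and "\<And>P. P \<in> local_base n e \<Longrightarrow> local_section n e P \<in> cover n \<and> cover_proj n (local_section n e P) = P \<and>
       Re ((local_section n e P 0 - local_section n e P 1) / (e 0 - e 1)) > 0"
    and "\<And>e'. e' \<in> cover n \<Longrightarrow> cover_proj n e' \<in> local_base n e \<Longrightarrow> Re ((e' 0 - e' 1) / (e 0 - e 1)) > 0 \<Longrightarrow>
       local_section n e (cover_proj n e') = e'"
    and "cover_proj n e \<in> local_base n e"
proof -
  have nz: "e 0 - e 1 \<noteq> 0" using e by (auto simp: cover_def)
  have good: "good_coords n (coords n P)" "affine_point n (coords n P) = P" if "P \<in> divisor_complement n" for P
    using that complement_obtain affine_in_complement[OF n] by metis+
  show "continuous_on (local_base n e) (local_section n e)"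
    unfolding local_section_def [abs_def] local_root_def
    using nz sqrt_near_one(4)
    by (intro continuous_sheet continuous_intros continuous_on_subset[OF continuous_coords]
          continuous_on_compose2[OF continuous_aff_conic]) (auto simp: local_base_def)
  fix P assume P: "P \<in> local_base n e"
  then have P': "P \<in> divisor_complement n" "norm (aff_conic (coords n P) / (e 0 - e 1)\<^sup>2 - 1) < 1"
    by (auto simp: local_base_def)
  have sq: "(local_root e (coords n P))\<^sup>2 = aff_conic (coords n P)"
    using sqrt_near_one(1)[OF P'(2)] nz by (simp add: local_root_def power_mult_distrib)
  show "local_section n e P \<in> cover n \<and> cover_proj n (local_section n e P) = P \<and>
       Re ((local_section n e P 0 - local_section n e P 1) / (e 0 - e 1)) > 0"
    using sheet_in_cover[OF n good(1)[OF P'(1)] sq] good(2)[OF P'(1)] sqrt_near_one(2)[OF P'(2)] nz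
    by (simp add: local_section_def) (simp add: local_root_def)
next
  have nz: "e 0 - e 1 \<noteq> 0" using e by (auto simp: cover_def)
  fix e' assume e': "e' \<in> cover n" "cover_proj n e' \<in> local_base n e" "Re ((e' 0 - e' 1) / (e 0 - e 1)) > 0"
  let ?u = "coords n (cover_proj n e')"
  have P: "norm (aff_conic ?u / (e 0 - e 1)\<^sup>2 - 1) < 1" "affine_point n ?u = cover_proj n e'"
    using e'(2) complement_obtain by (auto simp: local_base_def)
  have s: "e' = sheet n ?u (e' 0 - e' 1)" "(e' 0 - e' 1)\<^sup>2 = aff_conic ?u"
    using cover_eq_sheet[OF n e'(1), of ?u] P by auto
  have "(local_root e ?u)\<^sup>2 = (e' 0 - e' 1)\<^sup>2"
    using sqrt_near_one(1)[OF P(1)] nz s by (simp add: local_root_def power_mult_distrib)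
  then have "local_root e ?u = e' 0 - e' 1 \<or> local_root e ?u = - (e' 0 - e' 1)"
    by (simp add: power2_eq_iff)
  moreover have "Re (local_root e ?u / (e 0 - e 1)) > 0"
    using sqrt_near_one(2)[OF P(1)] nz by (simp add: local_root_def)
  moreover have "Re (- (e' 0 - e' 1) / (e 0 - e 1)) < 0"
    using e'(3) by (simp only: minus_divide_left[symmetric] uminus_complex.simps neg_less_0_iff_less)
  ultimately have "local_root e ?u = e' 0 - e' 1" by auto
  then show "local_section n e (cover_proj n e') = e'" using s by (simp add: local_section_def)
next
  have "coords n (cover_proj n e) k = cover_coords e k" if "k < n" for k
    using that by (simp add: cover_proj_def coords_affine)
  then have "aff_conic (coords n (cover_proj n e)) = (e 0 - e 1)\<^sup>2"
    using n aff_conic_cover[of e] by (simp add: aff_conic_def)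
  then show "cover_proj n e \<in> local_base n e"
    using cover_proj_in[OF n e] e by (auto simp: local_base_def cover_def)
qed

text \<open>A point \<open>e\<close> and its swap have the same \<open>local_base\<close>. Its
  preimage is the disjoint union of their two sheets, since the real part that separates them never
  vanishes there.\<close>

lemma covering_space_cover:
  assumes n: "n \<ge> 2"
  shows "covering_space (cover n) (cover_proj n) (divisor_complement n)"
proof -
  have surj: "\<exists>e\<in>cover n. cover_proj n e = P" if "P \<in> divisor_complement n" for P
  proof -
    let ?u = "coords n P"
    have "good_coords n ?u" "affine_point n ?u = P" using that complement_obtain affine_in_complement[OF n] by metis+
    then show ?thesis using sheet_in_cover[OF n, of ?u "csqrt (aff_conic ?u)"] by auto
  qed
  have local: "\<exists>v. \<Union>v = cover n \<inter> cover_proj n -` local_base n e \<and> (\<forall>u\<in>v. openin (top_of_set (cover n)) u) \<and>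
      pairwise disjnt v \<and> (\<forall>u\<in>v. \<exists>q. homeomorphism u (local_base n e) (cover_proj n) q)" if e: "e \<in> cover n" for e
  proof -
    let ?U = "\<lambda>e. {e' \<in> cover n. cover_proj n e' \<in> local_base n e \<and> Re ((e' 0 - e' 1) / (e 0 - e 1)) > 0}"
    have lb: "local_base n (swap_sheet e) = local_base n e" for e
      by (simp add: local_base_def swap_sheet_def power2_commute)
    have hom: "homeomorphism (?U e) (local_base n e) (cover_proj n) (local_section n e)" if "e \<in> cover n" for e
    proof (rule homeomorphismI)
      show "continuous_on (?U e) (cover_proj n)" by (rule continuous_cover_proj)
      show "continuous_on (local_base n e) (local_section n e)" by (rule local_section(1)[OF n that])
      show "local_section n e ` local_base n e \<subseteq> ?U e"
        using local_section(2)[OF n that] by (intro image_subsetI CollectI) metis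
      show "local_section n e (cover_proj n x) = x" if "x \<in> ?U e" for x
        using local_section(3)[OF n \<open>e \<in> cover n\<close>] that by blast
      show "cover_proj n (local_section n e y) = y" if "y \<in> local_base n e" for y
        using local_section(2)[OF n \<open>e \<in> cover n\<close> that] by blast
    qed auto
    have op: "openin (top_of_set (cover n)) (?U e)" if e: "e \<in> cover n" for e
    proof -
      have 1: "openin (top_of_set (cover n)) (cover n \<inter> cover_proj n -` local_base n e)"
        using cover_proj_in[OF n] by (intro continuous_openin_preimage[OF continuous_cover_proj _ openin_local_base]) auto
      have nz: "e 0 - e 1 \<noteq> 0" using e by (auto simp: cover_def)
      then have "open {e'. 0 < Re ((e' 0 - e' 1) / (e 0 - e 1))}"
        by (intro open_Collect_less continuous_intros continuous_on_product_coordinates) auto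
      then have "openin (top_of_set (cover n)) (cover n \<inter> {e'. 0 < Re ((e' 0 - e' 1) / (e 0 - e 1))})"
        by (rule openin_open_Int)
      from openin_Int[OF 1 this] show ?thesis by (rule back_subst[where P = "openin _"]) auto
    qed
    have neg: "Re ((e' 0 - e' 1) / (e 1 - e 0)) = - Re ((e' 0 - e' 1) / (e 0 - e 1))" for e'
      by (metis minus_diff_eq minus_divide_right uminus_complex.simps(1))
    have split: "Re ((e' 0 - e' 1) / (e 0 - e 1)) \<noteq> 0" if e': "e' \<in> cover n" "cover_proj n e' \<in> local_base n e" for e'
    proof -
      define s where "s = local_section n e (cover_proj n e')"
      have s: "s \<in> cover n" "cover_proj n s = cover_proj n e'" "0 < Re ((s 0 - s 1) / (e 0 - e 1))"
        using local_section(2)[OF n e e'(2)] unfolding s_def by blast+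
      have "e' = s \<or> e' = swap_sheet s"
        using cover_fibre[OF n s(1) e'(1) s(2)] .
      then have "e' 0 - e' 1 = s 0 - s 1 \<or> e' 0 - e' 1 = - (s 0 - s 1)"
        by (auto simp: swap_sheet_def)
      moreover have "Re (- (s 0 - s 1) / (e 0 - e 1)) = - Re ((s 0 - s 1) / (e 0 - e 1))"
        by (simp only: minus_divide_left[symmetric] uminus_complex.simps)
      ultimately show ?thesis using s(3) by (metis less_irrefl neg_equal_0_iff_equal)
    qed
    have se: "swap_sheet e \<in> cover n" using swap_in_cover[OF n e] .
    have U2: "?U (swap_sheet e) = {e' \<in> cover n. cover_proj n e' \<in> local_base n e \<and> Re ((e' 0 - e' 1) / (e 0 - e 1)) < 0}"
    proof -
      have ss: "swap_sheet e 0 - swap_sheet e 1 = e 1 - e 0" by (simp add: swap_sheet_def)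
      show ?thesis unfolding lb ss neg neg_0_less_iff_less ..
    qed
    show ?thesis
    proof (rule exI[of _ "{?U e, ?U (swap_sheet e)}"], intro conjI)
      show "\<Union>{?U e, ?U (swap_sheet e)} = cover n \<inter> cover_proj n -` local_base n e"
      proof -
        have "Re ((e' 0 - e' 1) / (e 0 - e 1)) < 0 \<or> Re ((e' 0 - e' 1) / (e 0 - e 1)) > 0"
          if "e' \<in> cover n" "cover_proj n e' \<in> local_base n e" for e'
          using split[OF that] by linarith
        then show ?thesis unfolding U2 by blast
      qed
      show "pairwise disjnt {?U e, ?U (swap_sheet e)}"
        unfolding U2 by (auto simp: pairwise_def disjnt_def)
      show "\<forall>u\<in>{?U e, ?U (swap_sheet e)}. openin (top_of_set (cover n)) u" using op[OF e] op[OF se] by blast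
      show "\<forall>u\<in>{?U e, ?U (swap_sheet e)}. \<exists>q. homeomorphism u (local_base n e) (cover_proj n) q"
        using hom[OF e] hom[OF se] unfolding lb by blast
    qed
  qed
  show ?thesis
    unfolding covering_space_def
  proof (intro conjI ballI)
    show "cover_proj n ` cover n = divisor_complement n"
      using surj cover_proj_in[OF n] by blast
    fix P assume "P \<in> divisor_complement n"
    then obtain e where e: "e \<in> cover n" "cover_proj n e = P" using surj by blast
    then show "\<exists>T. P \<in> T \<and> openin (top_of_set (divisor_complement n)) T \<and>
       (\<exists>v. \<Union>v = cover n \<inter> cover_proj n -` T \<and> (\<forall>u\<in>v. openin (top_of_set (cover n)) u) \<and>
        pairwise disjnt v \<and> (\<forall>u\<in>v. \<exists>q. homeomorphism u T (cover_proj n) q))"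
      using local[OF e(1)] local_section(4)[OF n e(1)] openin_local_base by blast
  qed (rule continuous_cover_proj)
qed

lemma finite_affine_zeros: "(a::complex) \<noteq> 0 \<Longrightarrow> finite {t. a + t * b = 0}"
proof -
  assume "a \<noteq> 0"
  then have "{t. a + t * b = 0} \<subseteq> {- a / b}" by (auto simp: divide_simps add_eq_0_iff split: if_splits)
  then show ?thesis by (rule finite_subset) simp
qed

text \<open>Two points of the cover lie on a complex line that leaves the cover only at finitely many points.\<close>

lemma path_connected_cover: "path_connected (cover n)"
  unfolding path_connected_def
proof (intro ballI)
  fix e e' assume e: "e \<in> cover n" "e' \<in> cover n"
  define L where "L t = (\<lambda>k. e k + t * (e' k - e k))" for t :: complex
  define bad where "bad = {t. e 0 + t * (e' 0 - e 0) = 0} \<union> {t. e 1 + t * (e' 1 - e 1) = 0} \<union>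
    {t. (e 0 - 1) + t * (e' 0 - e 0) = 0} \<union> {t. (e 1 - 1) + t * (e' 1 - e 1) = 0} \<union>
    {t. (e 0 - e 1) + t * ((e' 0 - e 0) - (e' 1 - e 1)) = 0} \<union>
    (\<Union>i\<in>{1..n-2}. {t. (e 0 - e 1 - e (i + 1)) + t * ((e' 0 - e 0) - (e' 1 - e 1) - (e' (i + 1) - e (i + 1))) = 0} \<union>
       {t. (e 0 - e 1 + e (i + 1)) + t * ((e' 0 - e 0) - (e' 1 - e 1) + (e' (i + 1) - e (i + 1))) = 0})"
  have fin: "finite bad"
    unfolding bad_def using e(1) by (intro finite_UnI finite_UN_I finite_affine_zeros) (auto simp: cover_def)
  have L: "L t \<in> cover n \<longleftrightarrow> t \<notin> bad" for t
  proof -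
    have eqs: "e 0 + t * (e' 0 - e 0) \<noteq> 1 \<longleftrightarrow> (e 0 - 1) + t * (e' 0 - e 0) \<noteq> 0"
      "e 1 + t * (e' 1 - e 1) \<noteq> 1 \<longleftrightarrow> (e 1 - 1) + t * (e' 1 - e 1) \<noteq> 0"
      "e 0 + t * (e' 0 - e 0) \<noteq> e 1 + t * (e' 1 - e 1) \<longleftrightarrow> (e 0 - e 1) + t * ((e' 0 - e 0) - (e' 1 - e 1)) \<noteq> 0"
      by (auto simp: algebra_simps)
    have eqi: "e 0 + t * (e' 0 - e 0) - (e 1 + t * (e' 1 - e 1)) - (e (i + 1) + t * (e' (i + 1) - e (i + 1))) =
        (e 0 - e 1 - e (i + 1)) + t * ((e' 0 - e 0) - (e' 1 - e 1) - (e' (i + 1) - e (i + 1)))"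
      "e 0 + t * (e' 0 - e 0) - (e 1 + t * (e' 1 - e 1)) + (e (i + 1) + t * (e' (i + 1) - e (i + 1))) =
        (e 0 - e 1 + e (i + 1)) + t * ((e' 0 - e 0) - (e' 1 - e 1) + (e' (i + 1) - e (i + 1)))" for i
      by (simp_all add: algebra_simps)
    have "\<forall>k\<ge>n. L t k = 0" using e by (auto simp: L_def cover_def)
    then show ?thesis
      unfolding cover_def mem_Collect_eq L_def eqs eqi bad_def by blast
  qed
  have "0 \<notin> bad" "1 \<notin> bad" using e L[of 0] L[of 1] by (auto simp: L_def)
  moreover have "path_connected (- bad)"
    using fin by (intro path_connected_complement_countable) (auto simp: countable_finite)
  ultimately obtain g where g: "path g" "path_image g \<subseteq> - bad" "pathstart g = 0" "pathfinish g = 1"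
    unfolding path_connected_def by blast
  have cont: "continuous_on UNIV L"
    unfolding L_def by (intro continuous_on_coordinatewise_then_product continuous_intros)
  show "\<exists>g. path g \<and> path_image g \<subseteq> cover n \<and> pathstart g = e \<and> pathfinish g = e'"
  proof (intro exI conjI)
    show "path (L \<circ> g)" using g cont by (intro path_continuous_image) (auto intro: continuous_on_subset)
    show "path_image (L \<circ> g) \<subseteq> cover n" using g L by (auto simp: path_image_def)
  qed (use g in \<open>auto simp: pathstart_def pathfinish_def L_def\<close>)
qed

section \<open>Flat sections on the double cover\<close>

lemma mat2_nth [simp]: "mat2 a b c d $ 1 $ 1 = a" "mat2 a b c d $ 1 $ 2 = b" "mat2 a b c d $ 2 $ 1 = c" "mat2 a b c d $ 2 $ 2 = d"
  by (simp_all add: mat2_def)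

lemma mat_eq_iff: "(A::complex^2^2) = B \<longleftrightarrow> A $ 1 $ 1 = B $ 1 $ 1 \<and> A $ 1 $ 2 = B $ 1 $ 2 \<and> A $ 2 $ 1 = B $ 2 $ 1 \<and> A $ 2 $ 2 = B $ 2 $ 2"
  by (simp only: vec_eq_iff forall_2 conj_assoc)

lemma mat_mult_nth: "((A::complex^2^2) ** B) $ i $ j = A $ i $ 1 * B $ 1 $ j + A $ i $ 2 * B $ 2 $ j"
  by (simp add: matrix_matrix_mult_def sum_2)

lemma mat_one_nth [simp]: "(mat 1 :: complex^2^2) $ 1 $ 1 = 1" "(mat 1 :: complex^2^2) $ 2 $ 2 = 1"
   "(mat 1 :: complex^2^2) $ 1 $ 2 = 0" "(mat 1 :: complex^2^2) $ 2 $ 1 = 0"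
  by (simp_all add: mat_def)

lemma mat2_mult: "mat2 a b c d ** mat2 a' b' c' d' = mat2 (a * a' + b * c') (a * b' + b * d') (c * a' + d * c') (c * b' + d * d')"
  by (simp add: mat_eq_iff mat_mult_nth)

lemma continuous_on_mat2 [continuous_intros]:
  assumes "continuous_on S a" "continuous_on S b" "continuous_on S c" "continuous_on S d"
  shows "continuous_on S (\<lambda>x. mat2 (a x) (b x) (c x) (d x))"
proof -
  have eq: "mat2 p q r s = (\<chi> i j. if i = 1 then (if j = 1 then p else q) else (if j = 1 then r else s))" for p q r s
    by (simp add: mat_eq_iff)
  show ?thesis unfolding eq
  proof (intro continuous_on_vec_lambda)
    fix i j :: 2
    show "continuous_on S (\<lambda>x. if i = 1 then if j = 1 then a x else b x else if j = 1 then c x else d x)"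
      using assms by (cases "i = 1"; cases "j = 1") auto
  qed
qed

text \<open>The forms \<open>alpha0_z\<close> enter every entry of the matrix in the same way as
  \<open>alpha0\<close>, so the whole dependence on the parameters sits in this sum.\<close>

definition total_alpha0 :: "nat \<Rightarrow> (nat \<Rightarrow> complex) \<Rightarrow> one_form" where
  "total_alpha0 n lam u w = alpha0 lam u w + (\<Sum>i\<in>{1..n-2}. alpha0_z lam i u w)"

lemma connection_matrix_entries:
  fixes n lam u w
  defines "a \<equiv> total_alpha0 n lam u w" and "f \<equiv> aff_conic u"
  defines "M \<equiv> connection_matrix n lam u w"
  shows "M $ 1 $ 1 = - (u 0 - 1) * a / f + alpha1 u w + w 1 / (2 * u 1)"
    and "M $ 1 $ 2 = (w 0 - (u 0 - 1)\<^sup>2 * a / f + 2 * (u 0 - 1) * alpha1 u w + a) / u 1"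
    and "M $ 2 $ 1 = u 1 * a / f"
    and "M $ 2 $ 2 = - M $ 1 $ 1"
proof -
  have nth: "M $ 1 $ 1 = A11 lam u w + (\<Sum>i\<in>{1..n-2}. A11_z lam i u w)"
     "M $ 1 $ 2 = A12 lam u w + (\<Sum>i\<in>{1..n-2}. A12_z lam i u w)"
     "M $ 2 $ 1 = - A21 lam u w + (\<Sum>i\<in>{1..n-2}. - A21_z lam i u w)"
     "M $ 2 $ 2 = - A11 lam u w + (\<Sum>i\<in>{1..n-2}. - A11_z lam i u w)"
    by (simp_all add: M_def connection_matrix_def)
  let ?z = "\<Sum>i\<in>{1..n-2}. alpha0_z lam i u w"
  have zc: "(\<Sum>i\<in>{1..n-2}. c * alpha0_z lam i u w) = c * ?z" for c
    by (simp only: sum_distrib_left)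
  have z: "(\<Sum>i\<in>{1..n-2}. A11_z lam i u w) = (- (u 0 - 1) / f) * ?z"
     "(\<Sum>i\<in>{1..n-2}. - A21_z lam i u w) = (u 1 / f) * ?z"
     "(\<Sum>i\<in>{1..n-2}. A12_z lam i u w) = ((- (u 0 - 1)\<^sup>2 / f + 1) / u 1) * ?z"
    unfolding zc[symmetric] A11_z_def A12_z_def A21_z_def alpha2_z_def f_def
    by (auto intro!: sum.cong simp: algebra_simps add_divide_distrib diff_divide_distrib)
  show "M $ 1 $ 1 = - (u 0 - 1) * a / f + alpha1 u w + w 1 / (2 * u 1)"
    unfolding nth z a_def total_alpha0_def A11_def alpha2_def f_def
    by (simp add: algebra_simps add_divide_distrib diff_divide_distrib)
  show "M $ 1 $ 2 = (w 0 - (u 0 - 1)\<^sup>2 * a / f + 2 * (u 0 - 1) * alpha1 u w + a) / u 1"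
    unfolding nth z a_def total_alpha0_def A12_def alpha2_def f_def
    by (simp add: algebra_simps add_divide_distrib diff_divide_distrib)
  show "M $ 2 $ 1 = u 1 * a / f"
    unfolding nth z a_def total_alpha0_def A21_def alpha2_def f_def
    by (simp add: algebra_simps add_divide_distrib diff_divide_distrib)
  show "M $ 2 $ 2 = - M $ 1 $ 1"
    unfolding nth by (simp add: sum_negf)
qed

text \<open>On a sheet of the cover the flat section is a vector of ratio \<open>slope\<close> times a product of powers
  of these units; \<open>logsum\<close> adds up their logarithms with the exponents.\<close>

definition units :: "nat \<Rightarrow> ((nat \<Rightarrow> complex) \<Rightarrow> complex) set" where
  "units n = {\<lambda>e. 1 - e 0, \<lambda>e. 1 - e 1, \<lambda>e. e 0 - e 1, \<lambda>e. e 0, \<lambda>e. e 1} \<union>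
     (\<Union>i\<in>{1..n-2}. {\<lambda>e. e 0 - e 1 - e (i + 1), \<lambda>e. e 0 - e 1 + e (i + 1)})"

text \<open>Linear in \<open>L\<close>: the same combination is applied to logarithms, to
  logarithmic derivatives and to winding numbers. Up to signs of the units, exchanging p and q
  reverses every parameter; the part free of parameters belongs to the square root of (1 - p) (1 -
  q) / (p - q).\<close>

definition logsum :: "nat \<Rightarrow> (nat \<Rightarrow> complex) \<Rightarrow> (((nat \<Rightarrow> complex) \<Rightarrow> complex) \<Rightarrow> complex) \<Rightarrow> complex" where
  "logsum n lam L = (1 + lam 0) / 2 * L (\<lambda>e. 1 - e 0) + (1 - lam 0) / 2 * L (\<lambda>e. 1 - e 1) - L (\<lambda>e. e 0 - e 1) / 2
     + lam 1 / 2 * (L (\<lambda>e. e 0) - L (\<lambda>e. e 1))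
     + (\<Sum>i\<in>{1..n-2}. lam (i + 1) / 2 * (L (\<lambda>e. e 0 - e 1 - e (i + 1)) - L (\<lambda>e. e 0 - e 1 + e (i + 1))))"

lemma finite_units: "finite (units n)"
  by (simp add: units_def)

lemma units_cover: "h \<in> units n \<Longrightarrow> e \<in> cover n \<Longrightarrow> h e \<noteq> 0"
  unfolding units_def cover_def by auto

lemma continuous_units: "h \<in> units n \<Longrightarrow> continuous_on S h"
  unfolding units_def by (auto intro!: continuous_intros continuous_on_subset[OF continuous_on_product_coordinates])

lemma logsum_cong: "(\<And>h. h \<in> units n \<Longrightarrow> L h = L' h) \<Longrightarrow> logsum n lam L = logsum n lam L'"
proof -
  assume h: "\<And>h. h \<in> units n \<Longrightarrow> L h = L' h"
  have "(\<Sum>i\<in>{1..n-2}. lam (i + 1) / 2 * (L (\<lambda>e. e 0 - e 1 - e (i + 1)) - L (\<lambda>e. e 0 - e 1 + e (i + 1)))) =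
    (\<Sum>i\<in>{1..n-2}. lam (i + 1) / 2 * (L' (\<lambda>e. e 0 - e 1 - e (i + 1)) - L' (\<lambda>e. e 0 - e 1 + e (i + 1))))"
    by (intro sum.cong refl) (subst (1 2) h; auto simp: units_def)
  moreover have "L (\<lambda>e. 1 - e 0) = L' (\<lambda>e. 1 - e 0)" "L (\<lambda>e. 1 - e 1) = L' (\<lambda>e. 1 - e 1)"
     "L (\<lambda>e. e 0 - e 1) = L' (\<lambda>e. e 0 - e 1)" "L (\<lambda>e. e 0) = L' (\<lambda>e. e 0)" "L (\<lambda>e. e 1) = L' (\<lambda>e. e 1)"
    by (rule h; simp add: units_def)+
  ultimately show ?thesis unfolding logsum_def by (simp only:)
qed

lemma logsum_add: "logsum n lam (\<lambda>h. L h + L' h) = logsum n lam L + logsum n lam L'"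
  by (simp add: logsum_def algebra_simps add_divide_distrib sum.distrib diff_divide_distrib sum_subtractf)

lemma logsum_mult: "logsum n lam (\<lambda>h. c * L h) = c * logsum n lam L"
  by (simp add: logsum_def algebra_simps add_divide_distrib sum.distrib diff_divide_distrib sum_subtractf sum_distrib_left)

lemma logsum_zero [simp]: "logsum n lam (\<lambda>h. 0) = 0"
  by (simp add: logsum_def)

lemma continuous_on_logsum:
  assumes "\<And>h. h \<in> units n \<Longrightarrow> continuous_on S (L h)"
  shows "continuous_on S (\<lambda>x. logsum n lam (\<lambda>h. L h x))"
  unfolding logsum_def by (intro continuous_intros assms) (auto simp: units_def)

lemma DERIV_logsum:
  assumes "\<And>h. h \<in> units n \<Longrightarrow> (L h has_field_derivative D h) (at y within S)"
  shows "((\<lambda>x. logsum n lam (\<lambda>h. L h x)) has_field_derivative logsum n lam D) (at y within S)"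
  unfolding logsum_def
  by (intro DERIV_add DERIV_diff DERIV_cmult DERIV_sum DERIV_cdivide assms) (auto simp: units_def)

text \<open>Origin of the exponents. In the coordinates p, q the coefficient of \<open>lam 0\<close>
  in \<open>alpha0\<close> is -(p - q) / 2 times the logarithmic differential of (1 - p) / (1 - q).
  The next two identities do the same for \<open>lam 1\<close> with p / q and for
  \<open>lam (i + 1)\<close> with (w - z) / (w + z), where w = p - q. Division by -(p - q) leaves
  the exponents of \<open>logsum\<close>.\<close>

lemma alpha_identity_0:
  fixes p q dp dq :: complex
  assumes "p \<noteq> 1" "q \<noteq> 1"
  shows "- (2 * (dp * q + p * dq) - (- dp * (1 - q) - dq * (1 - p))) / 2
      + (p * q - 1) / 2 * ((- dp * (1 - q) - dq * (1 - p)) / ((1 - p) * (1 - q)))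
    = (p - q) / 2 * (dp / (1 - p) - dq / (1 - q))"
  using assms by (simp add: divide_simps) (simp add: algebra_simps)

lemma alpha_identity_1:
  fixes p q dp dq :: complex
  assumes "p \<noteq> 0" "q \<noteq> 0"
  shows "- ((dp * q + p * dq) - 2 * (- dp * (1 - q) - dq * (1 - p))) / 2
      - ((1 - p) * (1 - q) - 1) / 2 * ((dp * q + p * dq) / (p * q))
    = - ((p - q) / 2 * (dp / p - dq / q))"
  using assms by (simp add: divide_simps) (simp add: algebra_simps)

lemma alpha_identity_z:
  fixes w z dw dz :: complex
  assumes "w - z \<noteq> 0" "w + z \<noteq> 0"
  shows "dz - z * (2 * w * dw - 2 * z * dz) / (2 * (w\<^sup>2 - z\<^sup>2)) = - (w / 2) * ((dw - dz) / (w - z) - (dw + dz) / (w + z))"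
proof -
  have "w\<^sup>2 - z\<^sup>2 = (w - z) * (w + z)" by (rule square_minus_square)
  then show ?thesis using assms by (simp add: divide_simps) (simp add: algebra_simps)
qed

lemma logsum_rearrange:
  fixes W X1 X2 Y1 Y2 V l0 l1 :: complex
  assumes "W \<noteq> 0"
  shows "(1 + l0) / 2 * (- X1) + (1 - l0) / 2 * (- X2) - V / 2 + l1 / 2 * (Y1 - Y2) =
    (- X1 - X2 - V) / 2 - (l0 * (W / 2 * (X1 - X2)) + l1 * (- (W / 2 * (Y1 - Y2)))) / W"
  using assms by (simp add: field_simps)

text \<open>The two rows of the flatness equation for the vector with entries kappa c and kappa,
  divided by kappa. Here \<open>k\<close> stands for the logarithmic differential of kappa,
  \<open>W\<close> for the root of the conic and \<open>al\<close> for
  \<open>alpha1\<close>.\<close>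

lemma column_flat_identity:
  fixes x y W a dx dy dW :: complex
  assumes "y \<noteq> 0" "W \<noteq> 0"
  defines "k \<equiv> (dy / y - dW / W) / 2 - a / W" and "c \<equiv> (W + 1 - x) / y" and "f \<equiv> W\<^sup>2" and "al \<equiv> - (dW / (2 * W))"
  shows "k = - (y * a / f * c) + (- (x - 1) * a / f + al + dy / (2 * y))"
    and "k * c + ((dW - dx) * y - (W + 1 - x) * dy) / y\<^sup>2 =
      - ((- (x - 1) * a / f + al + dy / (2 * y)) * c + (dx - (x - 1)\<^sup>2 * a / f + 2 * (x - 1) * al + a) / y)"
  unfolding k_def c_def f_def al_def using assms(1,2)
  by (simp_all add: divide_simps power2_eq_square) (simp_all add: algebra_simps)

text \<open>The column of the flat frame that belongs to the sheet through \<open>e\<close>.\<close>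

definition kappa :: "nat \<Rightarrow> (nat \<Rightarrow> complex) \<Rightarrow> (nat \<Rightarrow> complex) \<Rightarrow> cproj \<Rightarrow> complex" where
  "kappa n lam e P = exp (logsum n lam (\<lambda>h. Ln (h (local_section n e P) / h e)))"

text \<open>The ratio (w + 1 - x) / y of the two entries of the column, with w = p - q; its
  numerator factors as (1 + p) (1 - q).\<close>

definition slope :: "(nat \<Rightarrow> complex) \<Rightarrow> complex" where
  "slope e = (1 + e 0) / (1 - e 0)"

text \<open>Where every unit stays within relative distance 1 of its value at \<open>e\<close>, the
  arguments of the principal logarithms in \<open>kappa\<close> avoid the branch cut.\<close>

definition frame_base :: "nat \<Rightarrow> (nat \<Rightarrow> complex) \<Rightarrow> cproj set" where
  "frame_base n e = local_base n e \<inter> local_section n e -` {e'. \<forall>h\<in>units n. norm (h e' / h e - 1) < 1}"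

lemma openin_frame_base:
  assumes "n \<ge> 2" "e \<in> cover n"
  shows "openin (top_of_set (divisor_complement n)) (frame_base n e)"
proof -
  have "open (\<Inter>h\<in>units n. {e'. norm (h e' / h e - 1) < 1})"
    using assms(2) by (intro open_INT finite_units ballI open_Collect_less continuous_intros continuous_units) (auto dest: units_cover)
  then have "openin (top_of_set (local_base n e)) (local_base n e \<inter> local_section n e -` (\<Inter>h\<in>units n. {e'. norm (h e' / h e - 1) < 1}))"
    by (intro continuous_openin_preimage_gen local_section(1)[OF assms])
  then have "openin (top_of_set (local_base n e)) (frame_base n e)"
    by (rule back_subst[where P = "openin _"]) (auto simp: frame_base_def)
  then show ?thesis using openin_local_base openin_trans by blast
qed

lemma frame_base_self:
  assumes "n \<ge> 2" "e \<in> cover n"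
  shows "cover_proj n e \<in> frame_base n e" "local_section n e (cover_proj n e) = e" "kappa n lam e (cover_proj n e) = 1"
proof -
  have nz: "e 0 - e 1 \<noteq> 0" using assms by (auto simp: cover_def)
  show s: "local_section n e (cover_proj n e) = e"
    using local_section(3)[OF assms assms(2) local_section(4)[OF assms]] nz by simp
  show "cover_proj n e \<in> frame_base n e"
    using local_section(4)[OF assms] s units_cover[OF _ assms(2)] by (auto simp: frame_base_def)
  have "logsum n lam (\<lambda>h. Ln (h e / h e)) = logsum n lam (\<lambda>h. 0)"
    by (rule logsum_cong) (simp add: units_cover[OF _ assms(2)])
  then show "kappa n lam e (cover_proj n e) = 1" by (simp add: kappa_def s)
qed

lemma slope_cover:
  assumes "e 1 \<noteq> 1"
  shows "slope e = ((e 0 - e 1) + 1 - cover_coords e 0) / cover_coords e 1"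
proof -
  have "(e 0 - e 1) + 1 - e 0 * e 1 = (1 + e 0) * (1 - e 1)" by (simp add: algebra_simps)
  then show ?thesis using assms by (simp add: slope_def cover_coords_def)
qed

lemma not_nonpos_near_one: "norm (z - (1::complex)) < 1 \<Longrightarrow> z \<notin> \<real>\<^sub>\<le>\<^sub>0"
  by (rule sqrt_near_one(4))

lemma column_continuous:
  assumes "n \<ge> 2" "e \<in> cover n"
  shows "continuous_on (frame_base n e) (kappa n lam e)"
    and "continuous_on (frame_base n e) (\<lambda>P. slope (local_section n e P))"
proof -
  have cs: "continuous_on (frame_base n e) (local_section n e)"
    using local_section(1)[OF assms] by (rule continuous_on_subset) (auto simp: frame_base_def)
  show "continuous_on (frame_base n e) (kappa n lam e)"
    unfolding kappa_def [abs_def]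
  proof (intro continuous_on_exp continuous_on_logsum continuous_on_Ln')
    fix h assume h: "h \<in> units n"
    show "continuous_on (frame_base n e) (\<lambda>P. h (local_section n e P) / h e)"
      using units_cover[OF h assms(2)]
      by (intro continuous_intros continuous_on_compose2[OF continuous_units[OF h] cs, of UNIV]) auto
    show "h (local_section n e P) / h e \<notin> \<real>\<^sub>\<le>\<^sub>0" if "P \<in> frame_base n e" for P
      using that h by (intro not_nonpos_near_one) (auto simp: frame_base_def)
  qed
  have "local_section n e P 0 \<noteq> 1" if "P \<in> frame_base n e" for P
    using local_section(2)[OF assms, of P] that by (auto simp: cover_def frame_base_def)
  then show "continuous_on (frame_base n e) (\<lambda>P. slope (local_section n e P))"
    unfolding slope_def using continuous_on_product_then_coordinatewise[OF cs]
    by (intro continuous_intros) auto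
qed

text \<open>Everything is differentiated along the complex line through \<open>u\<close> in the
  direction \<open>w\<close>. The root \<open>W\<close> of the conic, and with it p and q, is
  explicit near t = 0; the logarithmic differential of \<open>kappa\<close> comes from
  \<open>logsum\<close>, and \<open>column_flat_identity\<close> compares the result with the matrix
  of the connection.\<close>

lemma column_flat:
  fixes lam u w :: "nat \<Rightarrow> complex"
  assumes n: "n \<ge> 2" and e: "e \<in> cover n" and P: "affine_point n u \<in> frame_base n e"
  defines "M \<equiv> connection_matrix n lam u w"
  defines "k \<equiv> \<lambda>t. kappa n lam e (affine_point n (\<lambda>j. u j + t * w j))"
    and "c \<equiv> \<lambda>t. slope (local_section n e (affine_point n (\<lambda>j. u j + t * w j)))"
  shows "((\<lambda>t. k t * c t) has_field_derivative - (M $ 1 $ 1 * (k 0 * c 0) + M $ 1 $ 2 * k 0)) (at 0)"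
    and "(k has_field_derivative - (M $ 2 $ 1 * (k 0 * c 0) + M $ 2 $ 2 * k 0)) (at 0)"
proof -
  let ?u = "\<lambda>t j. u j + t * w j"
  have nz: "e 0 - e 1 \<noteq> 0" using e by (auto simp: cover_def)
  have co: "coords n (affine_point n (?u t)) = (\<lambda>j. if j < n then ?u t j else 0)" for t
    by (simp add: coords_affine)
  have cof: "aff_conic (coords n (affine_point n (?u t))) = aff_conic (?u t)" for t
    using n by (simp add: co aff_conic_def)
  define W where "W t = local_root e (?u t)" for t
  define s where "s t = sheet n (?u t) (W t)" for t
  have s: "local_section n e (affine_point n (?u t)) = s t" for t
  proof -
    have "local_root e (coords n (affine_point n (?u t))) = W t" by (simp add: local_root_def W_def cof)
    then show ?thesis using n unfolding local_section_def s_def by (auto simp: sheet_def co fun_eq_iff)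
  qed
  have s0: "s 0 \<in> cover n" "cover_proj n (s 0) = affine_point n u"
    using local_section(2)[OF n e, of "affine_point n u"] P s[of 0] by (auto simp: frame_base_def)
  have near: "norm (aff_conic u / (e 0 - e 1)\<^sup>2 - 1) < 1"
    using P cof[of 0] by (auto simp: frame_base_def local_base_def)
  have unear: "norm (h (s 0) / h e - 1) < 1" if "h \<in> units n" for h
    using P s[of 0] that by (auto simp: frame_base_def)
  have W0: "W 0 = s 0 0 - s 0 1" by (simp add: s_def)
  have sW: "(W 0)\<^sup>2 = aff_conic u" using cover_eq_sheet(2)[OF n s0] W0 by simp
  have Wnz: "W 0 \<noteq> 0" using s0 W0 by (auto simp: cover_def)
  have good: "good_coords n u" using cover_proj_in[OF n s0(1)] affine_in_complement[OF n] s0(2) by simp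
  then have u1: "u 1 \<noteq> 0" "u 0 \<noteq> 0" by (auto simp: good_coords_def)
  have u01: "u 0 = s 0 0 * s 0 1" "u 1 = (1 - s 0 0) * (1 - s 0 1)"
    using sheet_prods[OF sW, of n] by (auto simp: s_def)
  define df where "df = 2 * u 0 * w 0 + 2 * u 1 * w 1 - 2 * (w 0 * u 1 + u 0 * w 1 + w 1 + w 0)"
  have Df: "((\<lambda>t. aff_conic (?u t)) has_field_derivative df) (at 0)"
    unfolding aff_conic_def conic_def df_def by (auto intro!: derivative_eq_intros simp: algebra_simps)
  define dW where "dW = df / (2 * W 0)"
  have DW: "(W has_field_derivative dW) (at 0)"
  proof -
    have "((\<lambda>t. (e 0 - e 1) * exp (Ln (aff_conic (?u t) / (e 0 - e 1)\<^sup>2) / 2)) has_field_derivative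
      (e 0 - e 1) * (exp (Ln (aff_conic u / (e 0 - e 1)\<^sup>2) / 2) * (df / aff_conic u / 2))) (at 0)"
      using nz near not_nonpos_near_one sqrt_near_one(3)[OF near]
      by (auto intro!: derivative_eq_intros Df simp: field_simps)
    moreover have "(e 0 - e 1) * (exp (Ln (aff_conic u / (e 0 - e 1)\<^sup>2) / 2) * (df / aff_conic u / 2)) = W 0 * (df / (W 0)\<^sup>2 / 2)"
      unfolding sW by (simp add: W_def local_root_def)
    moreover have "W 0 * (df / (W 0)\<^sup>2 / 2) = dW" using Wnz by (simp add: dW_def power2_eq_square)
    ultimately show ?thesis by (simp add: W_def [abs_def] local_root_def)
  qed
  have dWf: "df = 2 * W 0 * dW" using Wnz by (simp add: dW_def)
  define dp dq where "dp = (w 0 - w 1 + dW) / 2" and "dq = (w 0 - w 1 - dW) / 2"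
  have Dp: "((\<lambda>t. s t 0) has_field_derivative dp) (at 0)" and Dq: "((\<lambda>t. s t 1) has_field_derivative dq) (at 0)"
    unfolding s_def sheet_def dp_def dq_def by (auto intro!: derivative_eq_intros DW)
  have st: "s t (i + 1) = u (i + 1) + t * w (i + 1)" if "i \<in> {1..n-2}" for i t
    using that n by (auto simp: s_def sheet_def)
  have sz: "s 0 (i + 1) = u (i + 1)" if "i \<in> {1..n-2}" for i using st[OF that, of 0] by simp
  have Dz: "((\<lambda>t. s t (i + 1)) has_field_derivative w (i + 1)) (at 0)" if "i \<in> {1..n-2}" for i
    unfolding st[OF that] by (auto intro!: derivative_eq_intros)
  have dpq: "dp - dq = dW" by (simp add: dp_def dq_def field_simps)
  \<comment> \<open>The differentials of x = p q and y = (1 - p) (1 - q), recovered from dx - dy =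
    dp + dq and from 2 W dW = df.\<close>
  have xy': "w 0 = dp * s 0 1 + s 0 0 * dq" "w 1 = - dp * (1 - s 0 1) - dq * (1 - s 0 0)"
  proof -
    have dif: "w 0 - w 1 = dp + dq" by (simp add: dp_def dq_def field_simps)
    have "W 0 * dW = u 0 * w 0 + u 1 * w 1 - (w 0 * u 1 + u 0 * w 1 + w 1 + w 0)"
    proof -
      have "2 * (W 0 * dW) = 2 * (u 0 * w 0 + u 1 * w 1 - (w 0 * u 1 + u 0 * w 1 + w 1 + w 0))"
        using dWf by (simp add: df_def algebra_simps)
      then show ?thesis by (simp only: mult_cancel_left) simp
    qed
    then have "(s 0 0 - s 0 1) * (dp - dq) = (u 0 - u 1 - 1) * w 0 + (u 1 - u 0 - 1) * w 1"
      using W0 dpq by (simp add: algebra_simps)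
    also have "u 0 - u 1 - 1 = s 0 0 + s 0 1 - 2" using u01 by (simp add: algebra_simps)
    also have "u 1 - u 0 - 1 = - (s 0 0 + s 0 1)" using u01 by (simp add: algebra_simps)
    finally have "(s 0 0 - s 0 1) * (dp - dq) = (s 0 0 + s 0 1) * (w 0 - w 1) - 2 * w 0" by (simp add: algebra_simps)
    then have "2 * w 0 = 2 * (dp * s 0 1 + s 0 0 * dq)" unfolding dif by (simp add: algebra_simps)
    then show "w 0 = dp * s 0 1 + s 0 0 * dq" by (simp only: mult_cancel_left) simp
    then show "w 1 = - dp * (1 - s 0 1) - dq * (1 - s 0 0)" using dif by (simp add: algebra_simps)
  qed
  define D where "D h = deriv (\<lambda>t. h (s t)) 0" for h
  have DD: "((\<lambda>t. 1 - s t 0) has_field_derivative - dp) (at 0)" "((\<lambda>t. 1 - s t 1) has_field_derivative - dq) (at 0)"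
    "((\<lambda>t. s t 0 - s t 1) has_field_derivative dW) (at 0)"
    using DERIV_diff[OF DERIV_const Dp] DERIV_diff[OF DERIV_const Dq] DERIV_diff[OF Dp Dq] dpq by simp_all
  have DDz: "((\<lambda>t. s t 0 - s t 1 - s t (i + 1)) has_field_derivative dW - w (i + 1)) (at 0)"
    "((\<lambda>t. s t 0 - s t 1 + s t (i + 1)) has_field_derivative dW + w (i + 1)) (at 0)" if "i \<in> {1..n-2}" for i
    by (intro DERIV_diff[OF DD(3) Dz[OF that]] DERIV_add[OF DD(3) Dz[OF that]])+
  have Dh: "((\<lambda>t. h (s t)) has_field_derivative D h) (at 0)" if h: "h \<in> units n" for h
  proof -
    have "\<exists>d. ((\<lambda>t. h (s t)) has_field_derivative d) (at 0)"
      using h unfolding units_def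
      by (elim UnE insertE UN_E emptyE; simp only:; blast intro: DD DDz Dp Dq)
    then show ?thesis unfolding D_def using DERIV_deriv_iff_has_field_derivative by blast
  qed
  have Dvals: "D (\<lambda>e. 1 - e 0) = - dp" "D (\<lambda>e. 1 - e 1) = - dq" "D (\<lambda>e. e 0 - e 1) = dW" "D (\<lambda>e. e 0) = dp" "D (\<lambda>e. e 1) = dq"
    unfolding D_def by (rule DERIV_imp_deriv, rule DD Dp Dq)+
  have Dvalz: "D (\<lambda>e. e 0 - e 1 - e (i + 1)) = dW - w (i + 1)" "D (\<lambda>e. e 0 - e 1 + e (i + 1)) = dW + w (i + 1)" if "i \<in> {1..n-2}" for i
    unfolding D_def by (rule DERIV_imp_deriv, rule DDz[OF that])+
  define a where "a = total_alpha0 n lam u w"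
  have sn: "s 0 0 \<noteq> 0" "s 0 1 \<noteq> 0" "s 0 0 \<noteq> 1" "s 0 1 \<noteq> 1" using s0 by (auto simp: cover_def)
  \<comment> \<open>The three identities for the forms collect the parameters into - a / W; the
    exponents free of parameters give half the logarithmic differential of y / W.\<close>
  have ident: "logsum n lam (\<lambda>h. D h / h (s 0)) = (w 1 / u 1 - dW / W 0) / 2 - a / W 0"
  proof -
    have al: "alpha0 lam u w = lam 0 * ((W 0 / 2) * (dp / (1 - s 0 0) - dq / (1 - s 0 1))) + lam 1 * (- (W 0 / 2 * (dp / s 0 0 - dq / s 0 1)))"
    proof -
      have "alpha0 lam u w = lam 0 * (- (2 * w 0 - w 1) / 2 + (u 0 - 1) / 2 * (w 1 / u 1)) + lam 1 * (- (w 0 - 2 * w 1) / 2 - (u 1 - 1) / 2 * (w 0 / u 0))"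
        by (simp add: alpha0_def algebra_simps add_divide_distrib diff_divide_distrib)
      also have "- (2 * w 0 - w 1) / 2 + (u 0 - 1) / 2 * (w 1 / u 1) = (W 0 / 2) * (dp / (1 - s 0 0) - dq / (1 - s 0 1))"
        unfolding W0 u01 xy' using alpha_identity_0[OF sn(3,4), of dp dq] by (simp only: times_divide_eq_left)
      also have "- (w 0 - 2 * w 1) / 2 - (u 1 - 1) / 2 * (w 0 / u 0) = - (W 0 / 2 * (dp / s 0 0 - dq / s 0 1))"
        unfolding W0 u01 xy' by (rule alpha_identity_1[OF sn(1,2)])
      finally show ?thesis .
    qed
    have az: "alpha0_z lam i u w = lam (i + 1) * (- (W 0 / 2) * ((dW - w (i + 1)) / (W 0 - u (i + 1)) - (dW + w (i + 1)) / (W 0 + u (i + 1))))"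
      if i: "i \<in> {1..n-2}" for i
    proof -
      have "differential (\<lambda>v. aff_conic v - (v (i + 1))\<^sup>2) u w = 2 * W 0 * dW - 2 * u (i + 1) * w (i + 1)"
        unfolding differential_def dWf[symmetric]
        by (intro DERIV_imp_deriv) (auto intro!: derivative_eq_intros Df)
      moreover have "s 0 0 - s 0 1 - s 0 (i + 1) \<noteq> 0 \<and> s 0 0 - s 0 1 + s 0 (i + 1) \<noteq> 0"
        using s0(1) i by (simp add: cover_def)
      then have "W 0 - u (i + 1) \<noteq> 0" "W 0 + u (i + 1) \<noteq> 0"
        unfolding W0[symmetric] sz[OF i] by blast+
      ultimately show ?thesis
        unfolding alpha0_z_def sW[symmetric] using alpha_identity_z[of "W 0" "u (i + 1)" "w (i + 1)" dW] by simp
    qed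
    have sumz: "(\<Sum>i\<in>{1..n-2}. lam (i + 1) / 2 * (D (\<lambda>e. e 0 - e 1 - e (i + 1)) / (s 0 0 - s 0 1 - s 0 (i + 1)) -
        D (\<lambda>e. e 0 - e 1 + e (i + 1)) / (s 0 0 - s 0 1 + s 0 (i + 1)))) = - (\<Sum>i\<in>{1..n-2}. alpha0_z lam i u w) / W 0"
      unfolding sum_negf[symmetric] sum_divide_distrib
    proof (rule sum.cong[OF refl])
      fix i assume i: "i \<in> {1..n-2}"
      show "lam (i + 1) / 2 * (D (\<lambda>e. e 0 - e 1 - e (i + 1)) / (s 0 0 - s 0 1 - s 0 (i + 1)) -
        D (\<lambda>e. e 0 - e 1 + e (i + 1)) / (s 0 0 - s 0 1 + s 0 (i + 1))) = - alpha0_z lam i u w / W 0"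
        unfolding Dvalz[OF i] sz[OF i] az[OF i] W0[symmetric] using Wnz by simp
    qed
    have y: "w 1 / u 1 = - dp / (1 - s 0 0) - dq / (1 - s 0 1)"
      unfolding u01 xy' using sn by (simp add: field_simps)
    have "logsum n lam (\<lambda>h. D h / h (s 0)) = (1 + lam 0) / 2 * (- dp / (1 - s 0 0)) + (1 - lam 0) / 2 * (- dq / (1 - s 0 1)) - dW / W 0 / 2
     + lam 1 / 2 * (dp / s 0 0 - dq / s 0 1) - (\<Sum>i\<in>{1..n-2}. alpha0_z lam i u w) / W 0"
      unfolding logsum_def Dvals sumz W0 by simp
    also have "\<dots> = (w 1 / u 1 - dW / W 0) / 2 - alpha0 lam u w / W 0 - (\<Sum>i\<in>{1..n-2}. alpha0_z lam i u w) / W 0"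
      unfolding al y minus_divide_left[symmetric] by (subst logsum_rearrange[OF Wnz]) simp
    finally show ?thesis by (simp add: a_def total_alpha0_def add_divide_distrib)
  qed
  have kt: "k t = exp (logsum n lam (\<lambda>h. Ln (h (s t) / h e)))" for t by (simp add: k_def kappa_def s)
  define dk where "dk = (w 1 / u 1 - dW / W 0) / 2 - a / W 0"
  have Dk: "(k has_field_derivative k 0 * dk) (at 0)"
  proof -
    have "((\<lambda>t. logsum n lam (\<lambda>h. Ln (h (s t) / h e))) has_field_derivative logsum n lam (\<lambda>h. D h / h (s 0))) (at 0)"
    proof (rule DERIV_logsum)
      fix h assume h: "h \<in> units n"
      then show "((\<lambda>t. Ln (h (s t) / h e)) has_field_derivative D h / h (s 0)) (at 0)"
        using not_nonpos_near_one[OF unear[OF h]] units_cover[OF h e] units_cover[OF h s0(1)]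
        by (auto intro!: derivative_eq_intros Dh)
    qed
    then have "((\<lambda>t. exp (logsum n lam (\<lambda>h. Ln (h (s t) / h e)))) has_field_derivative k 0 * dk) (at 0)"
      unfolding ident dk_def kt by (rule DERIV_chain2[OF DERIV_exp])
    then show ?thesis by (simp add: kt [abs_def])
  qed
  have ct: "c t = slope (s t)" for t by (simp add: c_def s)
  have c0: "c 0 = (W 0 + 1 - u 0) / u 1"
    using slope_cover[of "s 0"] sn(4) W0 u01 by (simp add: ct cover_coords_def)
  have Dc: "(c has_field_derivative ((dW - w 0) * u 1 - (W 0 + 1 - u 0) * w 1) / (u 1)\<^sup>2) (at 0)"
  proof -
    have "(c has_field_derivative 2 * dp / (1 - s 0 0)\<^sup>2) (at 0)"
      unfolding ct [abs_def] slope_def using sn(3)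
      by (auto intro!: derivative_eq_intros Dp simp: field_simps power2_eq_square)
    moreover have "((dW - w 0) * u 1 - (W 0 + 1 - u 0) * w 1) / (u 1)\<^sup>2 = 2 * dp / (1 - s 0 0)\<^sup>2"
      unfolding dpq[symmetric] W0 u01 xy' using sn by (simp add: divide_simps power2_eq_square) (simp add: algebra_simps)
    ultimately show ?thesis by simp
  qed
  have al1: "alpha1 u w = - (dW / (2 * W 0))"
  proof -
    have "differential aff_conic u w = df"
      unfolding differential_def by (rule DERIV_imp_deriv[OF Df])
    then show ?thesis using Wnz by (simp add: alpha1_def dWf sW[symmetric] power2_eq_square)
  qed
  note M = connection_matrix_entries[of n lam u w, folded M_def a_def, unfolded al1 sW[symmetric]]
  note id1 = column_flat_identity(1)[OF u1(1) Wnz, where dy = "w 1" and dW = dW and a = a and x = "u 0", folded dk_def c0]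
    and id2 = column_flat_identity(2)[OF u1(1) Wnz, where dy = "w 1" and dW = dW and a = a and x = "u 0" and dx = "w 0", folded dk_def c0]
  show "((\<lambda>t. k t * c t) has_field_derivative - (M $ 1 $ 1 * (k 0 * c 0) + M $ 1 $ 2 * k 0)) (at 0)"
  proof (rule DERIV_cong[OF DERIV_mult[OF Dk Dc]])
    have "k 0 * dk * c 0 + ((dW - w 0) * u 1 - (W 0 + 1 - u 0) * w 1) / (u 1)\<^sup>2 * k 0 =
       k 0 * (dk * c 0 + ((dW - w 0) * u 1 - (W 0 + 1 - u 0) * w 1) / (u 1)\<^sup>2)" by (simp add: algebra_simps)
    also have "\<dots> = - (M $ 1 $ 1 * (k 0 * c 0) + M $ 1 $ 2 * k 0)"
      unfolding id2 M by (simp add: algebra_simps)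
    finally show "k 0 * dk * c 0 + ((dW - w 0) * u 1 - (W 0 + 1 - u 0) * w 1) / (u 1)\<^sup>2 * k 0 = - (M $ 1 $ 1 * (k 0 * c 0) + M $ 1 $ 2 * k 0)" .
  qed
  show "(k has_field_derivative - (M $ 2 $ 1 * (k 0 * c 0) + M $ 2 $ 2 * k 0)) (at 0)"
  proof (rule DERIV_cong[OF Dk])
    show "k 0 * dk = - (M $ 2 $ 1 * (k 0 * c 0) + M $ 2 $ 2 * k 0)"
      unfolding id1 M by (simp add: algebra_simps)
  qed
qed

lemma sheet_neg: "n \<ge> 2 \<Longrightarrow> sheet n u (- w) = swap_sheet (sheet n u w)"
  by (auto simp: sheet_def swap_sheet_def fun_eq_iff)

lemma local_section_swap:
  assumes "n \<ge> 2" shows "local_section n (swap_sheet e) P = swap_sheet (local_section n e P)"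
proof -
  have "local_root (swap_sheet e) u = - local_root e u" for u
    by (simp add: local_root_def swap_sheet_def power2_commute algebra_simps)
  then show ?thesis by (simp add: local_section_def sheet_neg[OF assms])
qed

lemma slope_swap_ne: "e \<in> cover n \<Longrightarrow> slope e \<noteq> slope (swap_sheet e)"
  by (auto simp: slope_def swap_sheet_def cover_def divide_simps algebra_simps)

text \<open>Each column is flat by itself, so the factors \<open>k1\<close> and \<open>k2\<close>
  are free; along a path they record what has been acquired on the way to \<open>e\<close>.\<close>

definition frame :: "nat \<Rightarrow> (nat \<Rightarrow> complex) \<Rightarrow> (nat \<Rightarrow> complex) \<Rightarrow> complex \<Rightarrow> complex \<Rightarrow> cproj \<Rightarrow> complex^2^2" where
  "frame n lam e k1 k2 P = mat2
     (k1 * (kappa n lam e P * slope (local_section n e P)))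
     (k2 * (kappa n lam (swap_sheet e) P * slope (local_section n (swap_sheet e) P)))
     (k1 * kappa n lam e P) (k2 * kappa n lam (swap_sheet e) P)"

lemma flat_on_frame:
  assumes n: "n \<ge> 2" and e: "e \<in> cover n"
  shows "flat_on n lam (frame_base n e \<inter> frame_base n (swap_sheet e)) (frame n lam e k1 k2)"
  unfolding flat_on_def
proof (intro conjI allI impI)
  let ?U = "frame_base n e \<inter> frame_base n (swap_sheet e)"
  have e': "swap_sheet e \<in> cover n" by (rule swap_in_cover[OF n e])
  show "continuous_on ?U (frame n lam e k1 k2)"
    unfolding frame_def [abs_def]
    by (intro continuous_intros continuous_on_subset[OF column_continuous(1)[OF n e]] continuous_on_subset[OF column_continuous(2)[OF n e]]
      continuous_on_subset[OF column_continuous(1)[OF n e']] continuous_on_subset[OF column_continuous(2)[OF n e']]) auto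
  fix u w and i j :: 2 assume P: "affine_point n u \<in> ?U"
  let ?P = "\<lambda>t. affine_point n (\<lambda>k. u k + t * w k)"
  have P0: "?P 0 = affine_point n u" by simp
  have c1: "((\<lambda>t. k1 * (kappa n lam e (?P t) * slope (local_section n e (?P t)))) has_field_derivative
       - (connection_matrix n lam u w ** frame n lam e k1 k2 (affine_point n u)) $ 1 $ 1) (at 0)"
    "((\<lambda>t. k1 * kappa n lam e (?P t)) has_field_derivative
       - (connection_matrix n lam u w ** frame n lam e k1 k2 (affine_point n u)) $ 2 $ 1) (at 0)"
    using P by (auto intro!: DERIV_cong[OF DERIV_cmult[OF column_flat(1)[OF n e]]] DERIV_cong[OF DERIV_cmult[OF column_flat(2)[OF n e]]]
        simp: mat_mult_nth frame_def algebra_simps)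
  have c2: "((\<lambda>t. k2 * (kappa n lam (swap_sheet e) (?P t) * slope (local_section n (swap_sheet e) (?P t)))) has_field_derivative
       - (connection_matrix n lam u w ** frame n lam e k1 k2 (affine_point n u)) $ 1 $ 2) (at 0)"
    "((\<lambda>t. k2 * kappa n lam (swap_sheet e) (?P t)) has_field_derivative
       - (connection_matrix n lam u w ** frame n lam e k1 k2 (affine_point n u)) $ 2 $ 2) (at 0)"
    using P by (auto intro!: DERIV_cong[OF DERIV_cmult[OF column_flat(1)[OF n e']]] DERIV_cong[OF DERIV_cmult[OF column_flat(2)[OF n e']]]
        simp: mat_mult_nth frame_def algebra_simps)
  have "i = 1 \<or> i = 2" "j = 1 \<or> j = 2" using exhaust_2 by auto
  then show "((\<lambda>t. frame n lam e k1 k2 (?P t) $ i $ j) has_field_derivative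
       - (connection_matrix n lam u w ** frame n lam e k1 k2 (affine_point n u)) $ i $ j) (at 0)"
    using c1 c2 by (elim disjE; simp only: frame_def mat2_nth)
qed

text \<open>The connection is traceless, so Wronskians of flat sections are constant.\<close>

lemma wronskian_constant:
  assumes F: "flat_on n lam U F" and H: "flat_on n lam U H"
    and seg: "\<And>s. 0 \<le> s \<Longrightarrow> s \<le> 1 \<Longrightarrow> affine_point n (\<lambda>k. u k + of_real s * d k) \<in> U"
  shows "F (affine_point n (\<lambda>k. u k + d k)) $ 1 $ j * H (affine_point n (\<lambda>k. u k + d k)) $ 2 $ l
     - F (affine_point n (\<lambda>k. u k + d k)) $ 2 $ j * H (affine_point n (\<lambda>k. u k + d k)) $ 1 $ l
   = F (affine_point n u) $ 1 $ j * H (affine_point n u) $ 2 $ l - F (affine_point n u) $ 2 $ j * H (affine_point n u) $ 1 $ l"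
proof -
  define \<gamma> where "\<gamma> s = affine_point n (\<lambda>k. u k + of_real s * d k)" for s :: real
  define M where "M s = connection_matrix n lam (\<lambda>k. u k + of_real s * d k) d" for s :: real
  have der: "((\<lambda>s. F (\<gamma> s) $ i $ j) has_vector_derivative - (M s ** F (\<gamma> s)) $ i $ j) (at s)"
    if F: "flat_on n lam U F" and s: "0 \<le> s" "s \<le> 1" for F i j s
  proof -
    \<comment> \<open>Flatness is a condition at the parameter 0 of a complex line, so it is applied
      at the point reached at time s and then restricted to real times.\<close>
    have "((\<lambda>e. F (affine_point n (\<lambda>k. (u k + of_real s * d k) + e * d k)) $ i $ j) has_field_derivative
           - (M s ** F (\<gamma> s)) $ i $ j) (at (of_real (s - s)))"
      using F seg[OF s] unfolding flat_on_def M_def \<gamma>_def by simp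
    moreover have "((\<lambda>r. of_real (r - s) :: complex) has_vector_derivative 1) (at s)"
      by (auto intro!: derivative_eq_intros has_vector_derivative_of_real)
    ultimately have "((\<lambda>e. F (affine_point n (\<lambda>k. (u k + of_real s * d k) + e * d k)) $ i $ j) \<circ> (\<lambda>r. of_real (r - s)) has_vector_derivative
           1 * (- (M s ** F (\<gamma> s)) $ i $ j)) (at s)"
      by (intro field_vector_diff_chain_at) auto
    then show ?thesis by (simp add: o_def \<gamma>_def algebra_simps)
  qed
  have tr: "M s $ 2 $ 2 = - M s $ 1 $ 1" for s unfolding M_def by (rule connection_matrix_entries(4))
  define q where "q s = F (\<gamma> s) $ 1 $ j * H (\<gamma> s) $ 2 $ l - F (\<gamma> s) $ 2 $ j * H (\<gamma> s) $ 1 $ l" for s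
  have "(q has_vector_derivative 0) (at s within {0..1})" if "s \<in> {0..1}" for s
  proof -
    have s: "0 \<le> s" "s \<le> 1" using that by auto
    note DF = der[OF F s] and DH = der[OF H s]
    have "(q has_vector_derivative
       ((F (\<gamma> s) $ 1 $ j * (- (M s ** H (\<gamma> s)) $ 2 $ l) + - (M s ** F (\<gamma> s)) $ 1 $ j * H (\<gamma> s) $ 2 $ l) -
       (F (\<gamma> s) $ 2 $ j * (- (M s ** H (\<gamma> s)) $ 1 $ l) + - (M s ** F (\<gamma> s)) $ 2 $ j * H (\<gamma> s) $ 1 $ l))) (at s)"
      unfolding q_def [abs_def]
      by (intro has_vector_derivative_diff has_vector_derivative_mult DF DH)
    moreover have "((F (\<gamma> s) $ 1 $ j * (- (M s ** H (\<gamma> s)) $ 2 $ l) + - (M s ** F (\<gamma> s)) $ 1 $ j * H (\<gamma> s) $ 2 $ l) -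
       (F (\<gamma> s) $ 2 $ j * (- (M s ** H (\<gamma> s)) $ 1 $ l) + - (M s ** F (\<gamma> s)) $ 2 $ j * H (\<gamma> s) $ 1 $ l)) = 0"
      unfolding mat_mult_nth tr by (simp add: algebra_simps)
    ultimately show ?thesis by (metis has_vector_derivative_at_within)
  qed
  then obtain c where c: "\<And>s. s \<in> {0..1} \<Longrightarrow> q s = c"
    using has_vector_derivative_zero_constant[of "{0..1::real}" q] by auto
  have "q 1 = q 0" using c[of 0] c[of 1] by simp
  then show ?thesis by (simp add: q_def \<gamma>_def)
qed

section \<open>Uniqueness of flat frames and parallel transport along paths\<close>

lemma det_mat: "det (A :: complex^2^2) = A $ 1 $ 1 * A $ 2 $ 2 - A $ 1 $ 2 * A $ 2 $ 1"
  by (rule det_2)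

lemma matrix_inv_mult:
  assumes "det (A :: complex^2^2) \<noteq> 0"
  shows "matrix_inv A ** A = mat 1" "A ** matrix_inv A = mat 1"
proof -
  have "\<exists>B. A ** B = mat 1 \<and> B ** A = mat 1" using assms by (simp add: invertible_det_nz[symmetric] invertible_def)
  then have "A ** matrix_inv A = mat 1 \<and> matrix_inv A ** A = mat 1" unfolding matrix_inv_def by (rule someI_ex)
  then show "matrix_inv A ** A = mat 1" "A ** matrix_inv A = mat 1" by auto
qed

text \<open>The Wronskians of the columns of \<open>F\<close> with those of \<open>H\<close>, and of
  \<open>F\<close> with itself, are constant along the segments of a star-shaped neighbourhood. As
  \<open>F\<close> is invertible they determine \<open>H\<close>, which is therefore
  \<open>F\<close> times a constant matrix on the right.\<close>

lemma flat_unique_local: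
  assumes n: "n \<ge> 2"
    and U1: "openin (top_of_set (divisor_complement n)) U1" "flat_on n lam U1 F"
    and U2: "openin (top_of_set (divisor_complement n)) U2" "flat_on n lam U2 H"
    and P0: "P0 \<in> U1" "P0 \<in> U2" and det: "det (F P0) \<noteq> 0"
  obtains N where "openin (top_of_set (divisor_complement n)) N" "P0 \<in> N" "N \<subseteq> U1 \<inter> U2"
    "\<And>P. P \<in> N \<Longrightarrow> H P = F P ** (matrix_inv (F P0) ** H P0)"
proof -
  have "openin (top_of_set (divisor_complement n)) (U1 \<inter> U2)" using U1 U2 by blast
  then obtain N where N: "openin (top_of_set (divisor_complement n)) N" "P0 \<in> N" "N \<subseteq> U1 \<inter> U2"
    "\<And>P s. P \<in> N \<Longrightarrow> 0 \<le> s \<Longrightarrow> s \<le> 1 \<Longrightarrow>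
      affine_point n (\<lambda>k. coords n P0 k + of_real s * (coords n P k - coords n P0 k)) \<in> U1 \<inter> U2"
    using star_neighbourhood[OF n _ IntI[OF P0]] by metis
  have sub: "flat_on n lam (U1 \<inter> U2) F" "flat_on n lam (U1 \<inter> U2) H"
    using U1(2) U2(2) unfolding flat_on_def by (auto elim: continuous_on_subset)
  show ?thesis
  proof (rule that[OF N(1-3)])
    fix P assume P: "P \<in> N"
    have X: "P \<in> divisor_complement n" "P0 \<in> divisor_complement n"
      using P N openin_imp_subset by blast+
    have aP: "affine_point n (\<lambda>k. coords n P0 k + (coords n P k - coords n P0 k)) = P" "affine_point n (coords n P0) = P0"
      using complement_obtain X by simp_all
    note w = wronskian_constant[OF _ _ N(4)[OF P], unfolded aP]
    \<comment> \<open>The candidate for the constant factor: F P times \<open>M\<close> will have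
      the same Wronskians against the columns of F P as H P has.\<close>
    define M where "M = matrix_inv (F P0) ** H P0"
    have M: "F P0 ** M = H P0"
      unfolding M_def matrix_mul_assoc matrix_inv_mult(2)[OF det] by simp
    define G where "G = F P ** M"
    have dF: "det (F P) = det (F P0)"
      using w[OF sub(1) sub(1), of 1 2] by (simp add: det_mat algebra_simps)
    have eq: "F P $ 1 $ j * G $ 2 $ l - F P $ 2 $ j * G $ 1 $ l = F P $ 1 $ j * H P $ 2 $ l - F P $ 2 $ j * H P $ 1 $ l" for j l
    proof -
      have "F P $ 1 $ j * G $ 2 $ l - F P $ 2 $ j * G $ 1 $ l =
        M $ 1 $ l * (F P $ 1 $ j * F P $ 2 $ 1 - F P $ 2 $ j * F P $ 1 $ 1) + M $ 2 $ l * (F P $ 1 $ j * F P $ 2 $ 2 - F P $ 2 $ j * F P $ 1 $ 2)"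
        by (simp add: G_def mat_mult_nth algebra_simps)
      also have "\<dots> = M $ 1 $ l * (F P0 $ 1 $ j * F P0 $ 2 $ 1 - F P0 $ 2 $ j * F P0 $ 1 $ 1) + M $ 2 $ l * (F P0 $ 1 $ j * F P0 $ 2 $ 2 - F P0 $ 2 $ j * F P0 $ 1 $ 2)"
        using w[OF sub(1) sub(1)] by simp
      also have "\<dots> = F P0 $ 1 $ j * H P0 $ 2 $ l - F P0 $ 2 $ j * H P0 $ 1 $ l"
        by (simp add: M[symmetric] mat_mult_nth algebra_simps)
      finally show ?thesis using w[OF sub] by simp
    qed
    have "G $ 1 $ l = H P $ 1 $ l \<and> G $ 2 $ l = H P $ 2 $ l" for l
    proof -
      define x y where "x = G $ 1 $ l - H P $ 1 $ l" and "y = G $ 2 $ l - H P $ 2 $ l"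
      have 1: "F P $ 1 $ 1 * y = F P $ 2 $ 1 * x" and 2: "F P $ 1 $ 2 * y = F P $ 2 $ 2 * x"
        using eq[of 1 l] eq[of 2 l] by (simp_all add: x_def y_def algebra_simps)
      have "det (F P) * x = F P $ 1 $ 1 * (F P $ 2 $ 2 * x) - F P $ 1 $ 2 * (F P $ 2 $ 1 * x)" by (simp add: det_mat algebra_simps)
      also have "\<dots> = 0" unfolding 1[symmetric] 2[symmetric] by (simp add: algebra_simps)
      finally have x: "x = 0" using dF det by simp
      have "det (F P) * y = F P $ 2 $ 2 * (F P $ 1 $ 1 * y) - F P $ 2 $ 1 * (F P $ 1 $ 2 * y)" by (simp add: det_mat algebra_simps)
      also have "\<dots> = 0" unfolding 1 2 using x by simp
      finally show ?thesis using x dF det by (simp add: x_def y_def)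
    qed
    then show "H P = F P ** (matrix_inv (F P0) ** H P0)"
      by (simp add: mat_eq_iff G_def[symmetric] M_def[symmetric])
  qed
qed

lemma eventually_in_openin:
  assumes "path_in S g" "openin (top_of_set S) N" "t \<in> {0..1}" "g t \<in> N"
  shows "\<forall>\<^sub>F s in at t within {0..1}. g s \<in> N"
proof -
  obtain V where V: "open V" "N = S \<inter> V" using assms(2) by (auto simp: openin_open)
  have "continuous (at t within {0..1}) g"
    using assms(1,3) by (auto simp: path_in_def path_def continuous_on_eq_continuous_within)
  then have "\<forall>\<^sub>F s in at t within {0..1}. g s \<in> V"
    using V assms(4) by (auto simp: continuous_within intro: topological_tendstoD)
  moreover have "\<forall>\<^sub>F s in at t within {0..1}. s \<in> {0..1}" by (simp add: eventually_at_filter)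
  ultimately show ?thesis
    by eventually_elim (use assms(1) V path_in_D in auto)
qed

text \<open>The quotient of two flat matrices along the path is locally constant on the unit
  interval, hence constant.\<close>

lemma flat_along_unique:
  assumes n: "n \<ge> 2" and g: "path_in (divisor_complement n) g"
    and F: "flat_along n lam g F" "\<And>t. t \<in> {0..1} \<Longrightarrow> det (F t) \<noteq> 0" and H: "flat_along n lam g H"
  shows "H 1 = F 1 ** (matrix_inv (F 0) ** H 0)"
proof -
  define Q where "Q t = matrix_inv (F t) ** H t" for t
  have "Q 1 = Q 0"
  proof (rule connected_local_const[where A = "{0..1}" and f = Q and a = 1 and b = 0])
    show "\<forall>t\<in>{0..1}. \<forall>\<^sub>F s in at t within {0..1}. Q t = Q s"
    proof
      fix t :: real assume t: "t \<in> {0..1}"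
      obtain U1 F1 where 1: "openin (top_of_set (divisor_complement n)) U1" "g t \<in> U1" "flat_on n lam U1 F1" "F t = F1 (g t)"
        "\<forall>\<^sub>F s in at t within {0..1}. F s = F1 (g s)"
        using F(1) t unfolding flat_along_def by blast
      obtain U2 F2 where 2: "openin (top_of_set (divisor_complement n)) U2" "g t \<in> U2" "flat_on n lam U2 F2" "H t = F2 (g t)"
        "\<forall>\<^sub>F s in at t within {0..1}. H s = F2 (g s)"
        using H t unfolding flat_along_def by blast
      obtain N where N: "openin (top_of_set (divisor_complement n)) N" "g t \<in> N"
         "\<And>P. P \<in> N \<Longrightarrow> F2 P = F1 P ** (matrix_inv (F1 (g t)) ** F2 (g t))"
        using flat_unique_local[OF n 1(1,3) 2(1,3) 1(2) 2(2)] F(2)[OF t] 1(4) by metis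
      have "\<forall>\<^sub>F s in at t within {0..1}. s \<in> {0..1}" by (simp add: eventually_at_filter)
      with 1(5) 2(5) eventually_in_openin[OF g N(1) t N(2)]
      show "\<forall>\<^sub>F s in at t within {0..1}. Q t = Q s"
      proof eventually_elim
        case (elim s)
        then have "H s = F s ** Q t" using N(3)[of "g s"] 1(4) 2(4) by (simp add: Q_def)
        then have "Q s = (matrix_inv (F s) ** F s) ** Q t" by (simp only: Q_def[of s] matrix_mul_assoc)
        also have "matrix_inv (F s) ** F s = mat 1" using matrix_inv_mult(1)[OF F(2)] elim(4) by blast
        finally show ?case by simp
      qed
    qed
  qed auto
  moreover have "H 1 = F 1 ** Q 1"
    unfolding Q_def matrix_mul_assoc by (subst matrix_inv_mult(2)) (use F(2) in auto)
  ultimately show ?thesis unfolding Q_def[of 0, symmetric] by (simp only:)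
qed

lemma flat_along_mult:
  assumes "flat_along n lam g F" shows "flat_along n lam g (\<lambda>t. F t ** M)"
  unfolding flat_along_def
proof
  fix t :: real assume "t \<in> {0..1}"
  then obtain U H where U: "openin (top_of_set (divisor_complement n)) U" "g t \<in> U" "flat_on n lam U H" "F t = H (g t)"
        "\<forall>\<^sub>F s in at t within {0..1}. F s = H (g s)"
    using assms unfolding flat_along_def by blast
  have comp: "continuous_on U (\<lambda>P. H P $ i $ j)" for i j
    using U(3) unfolding flat_on_def by (intro continuous_intros) auto
  have "continuous_on U (\<lambda>P. H P ** M)"
  proof -
    have "H P ** M = mat2 (H P $ 1 $ 1 * M $ 1 $ 1 + H P $ 1 $ 2 * M $ 2 $ 1) (H P $ 1 $ 1 * M $ 1 $ 2 + H P $ 1 $ 2 * M $ 2 $ 2)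
       (H P $ 2 $ 1 * M $ 1 $ 1 + H P $ 2 $ 2 * M $ 2 $ 1) (H P $ 2 $ 1 * M $ 1 $ 2 + H P $ 2 $ 2 * M $ 2 $ 2)" for P
      by (simp only: mat_eq_iff mat2_nth mat_mult_nth)
    then show ?thesis by (simp only:) (intro continuous_on_mat2 continuous_on_add continuous_on_mult continuous_on_const comp)
  qed
  moreover have "((\<lambda>e. (H (affine_point n (\<lambda>k. u k + e * w k)) ** M) $ i $ j) has_field_derivative
           - (connection_matrix n lam u w ** (H (affine_point n u) ** M)) $ i $ j) (at 0)"
    if "affine_point n u \<in> U" for u w i j
  proof -
    have D: "((\<lambda>e. H (affine_point n (\<lambda>k. u k + e * w k)) $ i $ j) has_field_derivative
           - (connection_matrix n lam u w ** H (affine_point n u)) $ i $ j) (at 0)" for i j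
      using U(3) that unfolding flat_on_def by blast
    show ?thesis
      unfolding matrix_mul_assoc unfolding mat_mult_nth[of _ M]
      by (rule DERIV_cong[OF DERIV_add[OF DERIV_cmult_right[OF D] DERIV_cmult_right[OF D]]]) (simp add: algebra_simps)
  qed
  ultimately have "flat_on n lam U (\<lambda>P. H P ** M)" unfolding flat_on_def by blast
  then show "\<exists>U F'. openin (top_of_set (divisor_complement n)) U \<and> g t \<in> U \<and> flat_on n lam U F' \<and> F t ** M = F' (g t) \<and>
        (\<forall>\<^sub>F s in at t within {0..1}. F s ** M = F' (g s))"
    using U by (intro exI[of _ U] exI[of _ "\<lambda>P. H P ** M"]) (auto elim: eventually_mono)
qed

lemma parallel_transport_iff:
  assumes n: "n \<ge> 2" and g: "path_in (divisor_complement n) g"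
    and F: "flat_along n lam g F" "\<And>t. t \<in> {0..1} \<Longrightarrow> det (F t) \<noteq> 0"
  shows "parallel_transport n lam g P \<longleftrightarrow> P = F 1 ** matrix_inv (F 0)"
proof
  assume "parallel_transport n lam g P"
  then obtain H where "flat_along n lam g H" "H 0 = mat 1" "H 1 = P" by (auto simp: parallel_transport_def)
  then show "P = F 1 ** matrix_inv (F 0)" using flat_along_unique[OF n g F, of H] by simp
next
  assume P: "P = F 1 ** matrix_inv (F 0)"
  have "F 0 ** matrix_inv (F 0) = mat 1" using F(2)[of 0] matrix_inv_mult by simp
  then show "parallel_transport n lam g P"
    unfolding parallel_transport_def using flat_along_mult[OF F(1), of "matrix_inv (F 0)"] P
    by (intro exI[of _ "\<lambda>t. F t ** matrix_inv (F 0)"]) simp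
qed

text \<open>The factor that the scalar part \<open>kappa\<close> of a column acquires by
  continuation along \<epsilon>; the path may be open, as it is when the sheets are
  exchanged.\<close>

definition multiplier :: "nat \<Rightarrow> (nat \<Rightarrow> complex) \<Rightarrow> (real \<Rightarrow> nat \<Rightarrow> complex) \<Rightarrow> complex" where
  "multiplier n lam \<epsilon> = exp (2 * of_real pi * \<i> * logsum n lam (\<lambda>h. winding_number (h \<circ> \<epsilon>) 0))"

lemma path_unit:
  assumes "path_in (cover n) \<epsilon>" "h \<in> units n"
  shows "path (h \<circ> \<epsilon>)" "0 \<notin> path_image (h \<circ> \<epsilon>)" "\<And>t. 0 \<le> t \<Longrightarrow> t \<le> 1 \<Longrightarrow> (h \<circ> \<epsilon>) t \<noteq> 0"
proof -
  have 1: "path_in (- {0}) (h \<circ> \<epsilon>)"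
    using units_cover[OF assms(2)] by (intro path_in_compose[OF assms(1)] continuous_units[OF assms(2)]) auto
  then show "path (h \<circ> \<epsilon>)" "0 \<notin> path_image (h \<circ> \<epsilon>)" by (auto simp: path_in_def)
  show "(h \<circ> \<epsilon>) t \<noteq> 0" if "0 \<le> t" "t \<le> 1" for t using path_in_D[OF 1, of t] that by auto
qed

lemma transport_scalar:
  assumes e: "path_in (cover n) \<epsilon>"
  obtains K where "K 0 = 1" "K 1 = multiplier n lam \<epsilon>" "\<And>t. K t \<noteq> 0"
    "\<And>t. t \<in> {0..1} \<Longrightarrow> \<forall>\<^sub>F s in at t within {0..1}. K s = K t * exp (logsum n lam (\<lambda>h. Ln (h (\<epsilon> s) / h (\<epsilon> t))))"
proof -
  have "\<exists>l. continuous_on {0..1} l \<and> (\<forall>t. 0 \<le> t \<longrightarrow> t \<le> 1 \<longrightarrow> h (\<epsilon> t) = exp (l t))" if "h \<in> units n" for h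
    using path_log[OF path_unit(1,3)[OF e that]] by auto
  then obtain l where l: "\<And>h. h \<in> units n \<Longrightarrow> continuous_on {0..1} (l h)"
    "\<And>h t. h \<in> units n \<Longrightarrow> 0 \<le> t \<Longrightarrow> t \<le> 1 \<Longrightarrow> h (\<epsilon> t) = exp (l h t)" by metis
  \<comment> \<open>Made of increments of continuous logarithms along the path. Near a given time
    these increments are smaller than pi and therefore agree with the principal logarithms in
    \<open>kappa\<close>.\<close>
  define K where "K t = exp (logsum n lam (\<lambda>h. l h t - l h 0))" for t
  show ?thesis
  proof (rule that[of K])
    show "K 0 = 1" by (simp add: K_def)
    have "2 * of_real pi * \<i> * logsum n lam (\<lambda>h. winding_number (h \<circ> \<epsilon>) 0) = logsum n lam (\<lambda>h. l h 1 - l h 0)"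
      unfolding logsum_mult[symmetric]
    proof (rule logsum_cong)
      fix h assume h: "h \<in> units n"
      have "winding_number (h \<circ> \<epsilon>) 0 = (l h 1 - l h 0) / (2 * of_real pi * \<i>)"
        by (rule winding_number_of_log) (use l h in auto)
      then show "2 * of_real pi * \<i> * winding_number (h \<circ> \<epsilon>) 0 = l h 1 - l h 0" by simp
    qed
    then show "K 1 = multiplier n lam \<epsilon>" by (simp add: K_def multiplier_def)
    show "K t \<noteq> 0" for t by (simp add: K_def)
    fix t :: real assume t: "t \<in> {0..1}"
    have "\<forall>\<^sub>F s in at t within {0..1}. \<forall>h\<in>units n. norm (l h s - l h t) < pi"
    proof (rule eventually_ball_finite[OF finite_units], rule ballI)
      fix h assume "h \<in> units n"
      then have "(l h \<longlongrightarrow> l h t) (at t within {0..1})"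
        using l(1) t by (auto simp: continuous_on_def)
      then show "\<forall>\<^sub>F s in at t within {0..1}. norm (l h s - l h t) < pi"
        using tendstoD[of "l h" "l h t" _ pi] by (simp add: dist_norm)
    qed
    moreover have "\<forall>\<^sub>F s in at t within {0..1}. s \<in> {0..1}" by (simp add: eventually_at_filter)
    ultimately show "\<forall>\<^sub>F s in at t within {0..1}. K s = K t * exp (logsum n lam (\<lambda>h. Ln (h (\<epsilon> s) / h (\<epsilon> t))))"
    proof eventually_elim
      case (elim s)
      have "logsum n lam (\<lambda>h. Ln (h (\<epsilon> s) / h (\<epsilon> t))) = logsum n lam (\<lambda>h. l h s - l h t)"
      proof (rule logsum_cong)
        fix h assume h: "h \<in> units n"
        have "h (\<epsilon> s) / h (\<epsilon> t) = exp (l h s - l h t)"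
          using l(2)[OF h] t elim by (simp add: exp_diff)
        moreover have "\<bar>Im (l h s - l h t)\<bar> < pi" using elim(1) h abs_Im_le_cmod[of "l h s - l h t"] by force
        ultimately show "Ln (h (\<epsilon> s) / h (\<epsilon> t)) = l h s - l h t" by (simp add: Ln_exp)
      qed
      then have "K t * exp (logsum n lam (\<lambda>h. Ln (h (\<epsilon> s) / h (\<epsilon> t)))) =
          exp (logsum n lam (\<lambda>h. (l h t - l h 0) + (l h s - l h t)))"
        by (simp only: K_def exp_add[symmetric] logsum_add)
      then show ?case by (simp add: K_def)
    qed
  qed
qed

lemma path_in_swap: "n \<ge> 2 \<Longrightarrow> path_in (cover n) \<epsilon> \<Longrightarrow> path_in (cover n) (swap_sheet \<circ> \<epsilon>)"
  using swap_in_cover by (intro path_in_compose continuous_swap_sheet) auto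

text \<open>The two columns are continued along \<epsilon> and along its swap; near each time they
  agree with the local \<open>frame\<close>, taken with the factors reached so far. The ratio
  \<open>k\<close> of the columns is kept as a free constant.\<close>

lemma flat_along_frame:
  assumes n: "n \<ge> 2" and e: "path_in (cover n) \<epsilon>" and g: "\<And>t. t \<in> {0..1} \<Longrightarrow> cover_proj n (\<epsilon> t) = g t"
    and g': "path_in (divisor_complement n) g" and k: "k \<noteq> 0"
  obtains F where "flat_along n lam g F" "\<And>t. t \<in> {0..1} \<Longrightarrow> det (F t) \<noteq> 0"
    "F 0 = mat2 (slope (\<epsilon> 0)) (k * slope (swap_sheet (\<epsilon> 0))) 1 k"
    "F 1 = mat2 (multiplier n lam \<epsilon> * slope (\<epsilon> 1)) (k * multiplier n lam (swap_sheet \<circ> \<epsilon>) * slope (swap_sheet (\<epsilon> 1)))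
       (multiplier n lam \<epsilon>) (k * multiplier n lam (swap_sheet \<circ> \<epsilon>))"
proof -
  obtain K1 where K1: "K1 0 = 1" "K1 1 = multiplier n lam \<epsilon>" "\<And>t. K1 t \<noteq> 0"
    "\<And>t. t \<in> {0..1} \<Longrightarrow> \<forall>\<^sub>F s in at t within {0..1}. K1 s = K1 t * exp (logsum n lam (\<lambda>h. Ln (h (\<epsilon> s) / h (\<epsilon> t))))"
    using transport_scalar[OF e] by blast
  obtain K2 where K2: "K2 0 = 1" "K2 1 = multiplier n lam (swap_sheet \<circ> \<epsilon>)" "\<And>t. K2 t \<noteq> 0"
    "\<And>t. t \<in> {0..1} \<Longrightarrow> \<forall>\<^sub>F s in at t within {0..1}. K2 s = K2 t * exp (logsum n lam (\<lambda>h. Ln (h ((swap_sheet \<circ> \<epsilon>) s) / h ((swap_sheet \<circ> \<epsilon>) t))))"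
    using transport_scalar[OF path_in_swap[OF n e]] by blast
  define F where "F t = mat2 (K1 t * slope (\<epsilon> t)) (k * K2 t * slope (swap_sheet (\<epsilon> t))) (K1 t) (k * K2 t)" for t
  have ec: "\<epsilon> t \<in> cover n" if "t \<in> {0..1}" for t using path_in_D[OF e that] .
  show ?thesis
  proof (rule that[of F])
    show "det (F t) \<noteq> 0" if "t \<in> {0..1}" for t
    proof -
      have "det (F t) = k * K1 t * K2 t * (slope (\<epsilon> t) - slope (swap_sheet (\<epsilon> t)))"
        by (simp add: det_mat F_def algebra_simps)
      then show ?thesis using slope_swap_ne[OF ec[OF that]] k K1(3) K2(3) by simp
    qed
    show "flat_along n lam g F"
      unfolding flat_along_def
    proof
      fix t :: real assume t: "t \<in> {0..1}"
      let ?e = "\<epsilon> t"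
      have e0: "?e \<in> cover n" "swap_sheet ?e \<in> cover n" using ec[OF t] swap_in_cover[OF n] by auto
      define U where "U = frame_base n ?e \<inter> frame_base n (swap_sheet ?e)"
      have opU: "openin (top_of_set (divisor_complement n)) U"
        unfolding U_def by (intro openin_Int openin_frame_base n e0)
      have gU: "g t \<in> U" using frame_base_self(1)[OF n e0(1)] frame_base_self(1)[OF n e0(2)] g[OF t] by (simp add: U_def)
      have nz: "?e 0 - ?e 1 \<noteq> 0" using e0 by (auto simp: cover_def)
      have cont: "((\<lambda>s. Re ((\<epsilon> s 0 - \<epsilon> s 1) / (?e 0 - ?e 1))) \<longlongrightarrow> 1) (at t within {0..1})"
      proof -
        have c: "continuous_on {0..1} \<epsilon>" using e by (auto simp: path_in_def path_def)
        have "continuous_on {0..1} (\<lambda>s. Re ((\<epsilon> s 0 - \<epsilon> s 1) / (?e 0 - ?e 1)))"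
          using continuous_on_product_then_coordinatewise[OF c] nz by (intro continuous_intros) auto
        then have "((\<lambda>s. Re ((\<epsilon> s 0 - \<epsilon> s 1) / (?e 0 - ?e 1))) \<longlongrightarrow> Re ((?e 0 - ?e 1) / (?e 0 - ?e 1))) (at t within {0..1})"
          using t unfolding continuous_on_def by blast
        moreover have "Re ((?e 0 - ?e 1) / (?e 0 - ?e 1)) = 1" using nz by simp
        ultimately show ?thesis by (simp only:)
      qed
      have ev: "\<forall>\<^sub>F s in at t within {0..1}. local_section n ?e (g s) = \<epsilon> s \<and> local_section n (swap_sheet ?e) (g s) = swap_sheet (\<epsilon> s)"
      proof -
        have "\<forall>\<^sub>F s in at t within {0..1}. Re ((\<epsilon> s 0 - \<epsilon> s 1) / (?e 0 - ?e 1)) > 0"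
          by (rule order_tendstoD(1)[OF cont]) simp
        moreover have "\<forall>\<^sub>F s in at t within {0..1}. s \<in> {0..1}" by (simp add: eventually_at_filter)
        moreover note eventually_in_openin[OF g' opU t gU]
        ultimately show ?thesis
        proof eventually_elim
          case (elim s)
          have "local_section n ?e (cover_proj n (\<epsilon> s)) = \<epsilon> s"
            using elim g[OF elim(2)] by (intro local_section(3)[OF n e0(1) ec[OF elim(2)]]) (auto simp: U_def frame_base_def)
          then show ?case using g[OF elim(2)] local_section_swap[OF n] by simp
        qed
      qed
      show "\<exists>U F'. openin (top_of_set (divisor_complement n)) U \<and> g t \<in> U \<and> flat_on n lam U F' \<and> F t = F' (g t) \<and>
        (\<forall>\<^sub>F s in at t within {0..1}. F s = F' (g s))"
      proof (intro exI conjI)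
        show "flat_on n lam U (frame n lam ?e (K1 t) (k * K2 t))" unfolding U_def by (rule flat_on_frame[OF n e0(1)])
        show "F t = frame n lam ?e (K1 t) (k * K2 t) (g t)"
          using frame_base_self(2,3)[OF n e0(1)] frame_base_self(2,3)[OF n e0(2)] g[OF t] by (simp add: F_def frame_def)
        show "\<forall>\<^sub>F s in at t within {0..1}. F s = frame n lam ?e (K1 t) (k * K2 t) (g s)"
          using ev K1(4)[OF t] K2(4)[OF t]
          by eventually_elim (simp add: F_def frame_def kappa_def mult.assoc)
      qed (fact opU gU)+
    qed
  qed (simp_all add: F_def K1 K2)
qed

section \<open>Lifts of loops and the behaviour of their multipliers\<close>

definition is_lift :: "nat \<Rightarrow> (nat \<Rightarrow> complex) \<Rightarrow> (real \<Rightarrow> cproj) \<Rightarrow> (real \<Rightarrow> nat \<Rightarrow> complex) \<Rightarrow> bool" where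
  "is_lift n e0 g \<epsilon> \<longleftrightarrow> path_in (cover n) \<epsilon> \<and> \<epsilon> 0 = e0 \<and> (\<forall>t\<in>{0..1}. cover_proj n (\<epsilon> t) = g t)"

lemma lift_exists:
  assumes "n \<ge> 2" "path_in (divisor_complement n) g" "e0 \<in> cover n" "cover_proj n e0 = g 0"
  shows "\<exists>\<epsilon>. is_lift n e0 g \<epsilon>"
proof -
  have g: "continuous_on {0..1} g" "g ` {0..1} \<subseteq> divisor_complement n"
    using assms(2) by (auto simp: path_in_def path_def path_image_def)
  obtain \<epsilon> where "continuous_on {0..1} \<epsilon>" "\<epsilon> ` {0..1} \<subseteq> cover n" "\<And>k. k \<in> {0..1} \<Longrightarrow> cover_proj n (\<epsilon> k) = g k" "\<epsilon> 0 = e0"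
    using cover_lift[OF assms(1) _ _ g assms(3,4)] by auto
  then show ?thesis unfolding is_lift_def by (intro exI[of _ \<epsilon>]) (auto intro!: path_inI simp: image_subset_iff)
qed

lemma lift_unique:
  assumes n: "n \<ge> 2" and "is_lift n e0 g \<epsilon>" "is_lift n e0 g \<epsilon>'" "t \<in> {0..1}"
  shows "\<epsilon> t = \<epsilon>' t"
  by (rule cover_lift_unique[OF n connected_Icc, of 0 0 1])
     (use assms in \<open>auto simp: is_lift_def path_in_def path_def path_image_def\<close>)

text \<open>The homotopy itself is lifted. Two sides of its square lie over the fixed end points,
  where a lift stays constant, so the end points of the lifted paths do not move.\<close>

lemma homotopic_lifts:
  assumes n: "n \<ge> 2" and hom: "homotopic_paths (divisor_complement n) g h"
    and g: "is_lift n e0 g \<epsilon>" and h: "is_lift n e0 h \<eta>"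
  shows "homotopic_paths (cover n) \<epsilon> \<eta>"
proof -
  obtain H where H: "continuous_on ({0..1} \<times> {0..1}) H" "H \<in> ({0..1} \<times> {0..1}) \<rightarrow> divisor_complement n"
    "\<forall>x\<in>{0..1}. H (0, x) = g x" "\<forall>x\<in>{0..1}. H (1, x) = h x"
    "\<forall>t\<in>{0..1::real}. pathstart (H \<circ> Pair t) = pathstart g \<and> pathfinish (H \<circ> Pair t) = pathfinish g"
    using hom unfolding homotopic_paths by blast
  have conv: "convex ({0..1} \<times> {0..1} :: (real \<times> real) set)" by (intro convex_Times) auto
  have e0: "e0 \<in> cover n" "cover_proj n e0 = H (0, 0)"
    using g H(3) path_in_D[of "cover n" \<epsilon> 0] by (auto simp: is_lift_def)
  have Himg: "H ` ({0..1} \<times> {0..1}) \<subseteq> divisor_complement n" using H(2) by auto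
  obtain L where L: "continuous_on ({0..1} \<times> {0..1}) L" "L ` ({0..1} \<times> {0..1}) \<subseteq> cover n"
     "\<And>k. k \<in> {0..1} \<times> {0..1} \<Longrightarrow> cover_proj n (L k) = H k" "L (0, 0) = e0"
    using cover_lift[OF n conv _ H(1) Himg e0] by auto
  have pin: "path_in (cover n) (\<lambda>s. L (s, c))" "path_in (cover n) (\<lambda>t. L (c, t))" if "0 \<le> c" "c \<le> 1" for c
    using path_in_square[OF L(1,2) that] by auto
  have "L (s, 0) = e0" if s: "s \<in> {0..1}" for s
  proof -
    have "is_lift n e0 (\<lambda>_. H (0, 0)) (\<lambda>s. L (s, 0))"
      using pin(1)[of 0] L(3,4) H(3,5) by (auto simp: is_lift_def pathstart_def)
    moreover have "is_lift n e0 (\<lambda>_. H (0, 0)) (\<lambda>_. e0)" using e0 by (simp add: is_lift_def)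
    ultimately show ?thesis using lift_unique[OF n _ _ s] by metis
  qed
  moreover have "L (s, 1) = L (0, 1)" if s: "s \<in> {0..1}" for s
  proof -
    have "is_lift n (L (0, 1)) (\<lambda>_. H (0, 1)) (\<lambda>s. L (s, 1))"
      using pin(1)[of 1] L(3) H(3,5) by (auto simp: is_lift_def pathfinish_def)
    moreover have "is_lift n (L (0, 1)) (\<lambda>_. H (0, 1)) (\<lambda>_. L (0, 1))" using L(2,3) by (auto simp: is_lift_def)
    ultimately show ?thesis using lift_unique[OF n _ _ s] by metis
  qed
  moreover have "L (0, t) = \<epsilon> t" if t: "t \<in> {0..1}" for t
  proof (rule lift_unique[OF n _ g t])
    show "is_lift n e0 g (\<lambda>t. L (0, t))" using pin(2)[of 0] L(3,4) H(3) by (auto simp: is_lift_def)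
  qed
  moreover have "L (1, t) = \<eta> t" if t: "t \<in> {0..1}" for t
  proof (rule lift_unique[OF n _ h t])
    show "is_lift n e0 h (\<lambda>t. L (1, t))" using pin(2)[of 1] L(3) H(4) calculation(1)[of 1] by (auto simp: is_lift_def)
  qed
  ultimately show ?thesis
    unfolding homotopic_paths using L(1,2) g
    by (intro exI[of _ L]) (auto simp: pathstart_def pathfinish_def is_lift_def)
qed

lemma multiplier_homotopic:
  assumes "homotopic_paths (cover n) \<epsilon> \<eta>" shows "multiplier n lam \<epsilon> = multiplier n lam \<eta>"
  unfolding multiplier_def
proof (intro arg_cong[where f = exp] arg_cong2[where f = times] refl logsum_cong)
  fix h assume h: "h \<in> units n"
  have "homotopic_paths (- {0}) (h \<circ> \<epsilon>) (h \<circ> \<eta>)"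
    using units_cover[OF h] by (intro homotopic_paths_continuous_image[OF assms] continuous_units[OF h]) auto
  then show "winding_number (h \<circ> \<epsilon>) 0 = winding_number (h \<circ> \<eta>) 0" by (rule winding_number_homotopic_paths)
qed

lemma multiplier_join:
  assumes "path_in (cover n) \<epsilon>" "path_in (cover n) \<eta>" "pathfinish \<epsilon> = pathstart \<eta>"
  shows "multiplier n lam (\<epsilon> +++ \<eta>) = multiplier n lam \<epsilon> * multiplier n lam \<eta>"
proof -
  have "logsum n lam (\<lambda>h. winding_number (h \<circ> (\<epsilon> +++ \<eta>)) 0) = logsum n lam (\<lambda>h. winding_number (h \<circ> \<epsilon>) 0 + winding_number (h \<circ> \<eta>) 0)"
  proof (rule logsum_cong)
    fix h assume h: "h \<in> units n"
    show "winding_number (h \<circ> (\<epsilon> +++ \<eta>)) 0 = winding_number (h \<circ> \<epsilon>) 0 + winding_number (h \<circ> \<eta>) 0"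
      unfolding path_compose_join
      using path_unit[OF assms(1) h] path_unit[OF assms(2) h] assms(3)
      by (intro winding_number_join) (auto simp: pathstart_compose pathfinish_compose)
  qed
  then show ?thesis by (simp add: multiplier_def logsum_add exp_add distrib_left)
qed

text \<open>The parameters cancel between the two sheets. What is left is the quotient of the end
  values of (1 - p) (1 - q) / (p - q): it is 1 for a closed lift and -1 for a lift that ends on the
  other sheet. This is the source of determinant 1.\<close>

lemma multiplier_swap:
  assumes n: "n \<ge> 2" and e: "path_in (cover n) \<epsilon>"
  shows "multiplier n lam \<epsilon> * multiplier n lam (swap_sheet \<circ> \<epsilon>) =
     ((1 - \<epsilon> 1 0) * (1 - \<epsilon> 1 1) / (\<epsilon> 1 0 - \<epsilon> 1 1)) / ((1 - \<epsilon> 0 0) * (1 - \<epsilon> 0 1) / (\<epsilon> 0 0 - \<epsilon> 0 1))"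
proof -
  define N where "N h = winding_number (h \<circ> \<epsilon>) 0" for h :: "(nat \<Rightarrow> complex) \<Rightarrow> complex"
  \<comment> \<open>Under the exchange of p and q the unit p - q becomes its negative, and p - q - z
    becomes the negative of p - q + z; a constant factor does not affect winding numbers.\<close>
  have neg: "winding_number ((\<lambda>e. - h e) \<circ> \<epsilon>) 0 = N h" if h: "h \<in> units n" for h
    using winding_number_rotate[OF path_unit(1,2)[OF e h], of "-1"] by (simp add: o_def N_def)
  let ?S = "\<lambda>h. winding_number (h \<circ> (swap_sheet \<circ> \<epsilon>)) 0"
  have sw: "?S h = winding_number ((\<lambda>e. h (swap_sheet e)) \<circ> \<epsilon>) 0" for h by (simp add: o_def)
  have S: "?S (\<lambda>e. 1 - e 0) = N (\<lambda>e. 1 - e 1)" "?S (\<lambda>e. 1 - e 1) = N (\<lambda>e. 1 - e 0)" "?S (\<lambda>e. e 0) = N (\<lambda>e. e 1)" "?S (\<lambda>e. e 1) = N (\<lambda>e. e 0)"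
    unfolding sw by (simp_all add: swap_sheet_def N_def)
  have S2: "?S (\<lambda>e. e 0 - e 1) = N (\<lambda>e. e 0 - e 1)"
    using neg[of "\<lambda>e. e 0 - e 1"] unfolding sw by (simp add: swap_sheet_def units_def)
  have S3: "?S (\<lambda>e. e 0 - e 1 - e (i + 1)) = N (\<lambda>e. e 0 - e 1 + e (i + 1))" "?S (\<lambda>e. e 0 - e 1 + e (i + 1)) = N (\<lambda>e. e 0 - e 1 - e (i + 1))"
    if "i \<in> {1..n-2}" for i
  proof -
    have "(\<lambda>e. e 0 - e 1 - e (i + 1)) \<in> units n" "(\<lambda>e. e 0 - e 1 + e (i + 1)) \<in> units n"
      using that unfolding units_def by blast+
    note eq = neg[OF this(1)] neg[OF this(2)]
    have "(\<lambda>e. swap_sheet e 0 - swap_sheet e 1 - swap_sheet e (i + 1)) = (\<lambda>e. - (e 0 - e 1 + e (i + 1)))"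
      "(\<lambda>e. swap_sheet e 0 - swap_sheet e 1 + swap_sheet e (i + 1)) = (\<lambda>e. - (e 0 - e 1 - e (i + 1)))"
      using that by (auto simp: swap_sheet_def fun_eq_iff)
    then show "?S (\<lambda>e. e 0 - e 1 - e (i + 1)) = N (\<lambda>e. e 0 - e 1 + e (i + 1))" "?S (\<lambda>e. e 0 - e 1 + e (i + 1)) = N (\<lambda>e. e 0 - e 1 - e (i + 1))"
      unfolding sw using eq by simp_all
  qed
  have "logsum n lam N + logsum n lam ?S = N (\<lambda>e. 1 - e 0) + N (\<lambda>e. 1 - e 1) - N (\<lambda>e. e 0 - e 1)"
  proof -
    have "(\<Sum>i\<in>{1..n-2}. lam (i + 1) / 2 * (?S (\<lambda>e. e 0 - e 1 - e (i + 1)) - ?S (\<lambda>e. e 0 - e 1 + e (i + 1)))) =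
       (\<Sum>i\<in>{1..n-2}. lam (i + 1) / 2 * (N (\<lambda>e. e 0 - e 1 + e (i + 1)) - N (\<lambda>e. e 0 - e 1 - e (i + 1))))"
      by (rule sum.cong[OF refl]) (simp only: S3)
    also have "\<dots> = - (\<Sum>i\<in>{1..n-2}. lam (i + 1) / 2 * (N (\<lambda>e. e 0 - e 1 - e (i + 1)) - N (\<lambda>e. e 0 - e 1 + e (i + 1))))"
      by (simp add: sum_negf[symmetric] algebra_simps)
    finally show ?thesis
      unfolding logsum_def S S2 by (simp add: field_simps)
  qed
  then have "multiplier n lam \<epsilon> * multiplier n lam (swap_sheet \<circ> \<epsilon>) =
     exp (2 * of_real pi * \<i> * N (\<lambda>e. 1 - e 0) + 2 * of_real pi * \<i> * N (\<lambda>e. 1 - e 1) - 2 * of_real pi * \<i> * N (\<lambda>e. e 0 - e 1))"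
    by (simp add: multiplier_def N_def [abs_def] exp_add[symmetric] distrib_left[symmetric] right_diff_distrib[symmetric])
  also have "\<dots> = ((1 - \<epsilon> 1 0) / (1 - \<epsilon> 0 0)) * ((1 - \<epsilon> 1 1) / (1 - \<epsilon> 0 1)) / ((\<epsilon> 1 0 - \<epsilon> 1 1) / (\<epsilon> 0 0 - \<epsilon> 0 1))"
  proof -
    have "exp (2 * of_real pi * \<i> * N h) = h (\<epsilon> 1) / h (\<epsilon> 0)" if "h \<in> units n" for h
      using winding_number_exp_ratio[of "h \<circ> \<epsilon>", OF path_unit(1,3)[OF e that]] by (simp add: N_def pathstart_def pathfinish_def)
    then show ?thesis by (simp add: exp_add exp_diff units_def)
  qed
  finally show ?thesis by simp
qed

lemma multiplier_swap_closed:
  assumes "n \<ge> 2" "path_in (cover n) \<epsilon>"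
  shows "\<epsilon> 1 = \<epsilon> 0 \<Longrightarrow> multiplier n lam \<epsilon> * multiplier n lam (swap_sheet \<circ> \<epsilon>) = 1"
    and "\<epsilon> 1 = swap_sheet (\<epsilon> 0) \<Longrightarrow> multiplier n lam \<epsilon> * multiplier n lam (swap_sheet \<circ> \<epsilon>) = - 1"
proof -
  have "\<epsilon> 0 \<in> cover n" using path_in_D[OF assms(2), of 0] by simp
  then show "\<epsilon> 1 = \<epsilon> 0 \<Longrightarrow> multiplier n lam \<epsilon> * multiplier n lam (swap_sheet \<circ> \<epsilon>) = 1"
   "\<epsilon> 1 = swap_sheet (\<epsilon> 0) \<Longrightarrow> multiplier n lam \<epsilon> * multiplier n lam (swap_sheet \<circ> \<epsilon>) = - 1"
    unfolding multiplier_swap[OF assms] by (auto simp: cover_def swap_sheet_def divide_simps)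
qed

lemma matrix_inv_eq:
  assumes "(A :: complex^2^2) ** B = mat 1" shows "matrix_inv A = B"
proof -
  have "det A * det B = 1" using assms by (metis det_mul det_I)
  then have "det A \<noteq> 0" by auto
  from matrix_inv_mult(1)[OF this] have "matrix_inv A = matrix_inv A ** (A ** B)" unfolding assms by simp
  then show ?thesis using matrix_inv_mult(1)[OF \<open>det A \<noteq> 0\<close>] by (simp add: matrix_mul_assoc)
qed

section \<open>The monodromy in terms of the double cover\<close>

definition base_frame :: "(nat \<Rightarrow> complex) \<Rightarrow> complex \<Rightarrow> complex^2^2" where
  "base_frame e k = mat2 (slope e) (k * slope (swap_sheet e)) 1 k"

text \<open>The inverse of the transport in the basis \<open>base_frame\<close>. Inverses of
  multipliers have been eliminated: the product of the two multipliers is 1 for a closed lift and -1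
  otherwise.\<close>

definition sheet_rep :: "nat \<Rightarrow> (nat \<Rightarrow> complex) \<Rightarrow> (nat \<Rightarrow> complex) \<Rightarrow> complex \<Rightarrow> (real \<Rightarrow> nat \<Rightarrow> complex) \<Rightarrow> complex^2^2" where
  "sheet_rep n lam e k \<epsilon> =
     (if \<epsilon> 1 = e then mat2 (multiplier n lam (swap_sheet \<circ> \<epsilon>)) 0 0 (multiplier n lam \<epsilon>)
      else mat2 0 (- k * multiplier n lam (swap_sheet \<circ> \<epsilon>)) (- multiplier n lam \<epsilon> / k) 0)"

definition loop_rep :: "nat \<Rightarrow> (nat \<Rightarrow> complex) \<Rightarrow> (nat \<Rightarrow> complex) \<Rightarrow> complex \<Rightarrow> (real \<Rightarrow> cproj) set \<Rightarrow> complex^2^2" where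
  "loop_rep n lam e k G = matrix_inv (base_frame e k) ** monodromy n lam G ** base_frame e k"

lemma det_base_frame: "e \<in> cover n \<Longrightarrow> k \<noteq> 0 \<Longrightarrow> det (base_frame e k) \<noteq> 0"
  using slope_swap_ne[of e n] by (simp add: det_mat base_frame_def)

lemma lift_end:
  assumes "n \<ge> 2" "e \<in> cover n" "is_lift n e g \<epsilon>" "g 1 = g 0"
  shows "\<epsilon> 1 = e \<or> \<epsilon> 1 = swap_sheet e"
proof (rule cover_fibre[OF assms(1,2)])
  show "\<epsilon> 1 \<in> cover n" using assms(3) path_in_D[of "cover n" \<epsilon> 1] by (simp add: is_lift_def)
  have "cover_proj n (\<epsilon> 0) = g 0" "cover_proj n (\<epsilon> 1) = g 1" "\<epsilon> 0 = e" using assms(3) by (auto simp: is_lift_def)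
  then show "cover_proj n e = cover_proj n (\<epsilon> 1)" using assms(4) by simp
qed

lemma sheet_rep_homotopic:
  assumes "n \<ge> 2" "homotopic_paths (cover n) \<epsilon> \<eta>"
  shows "sheet_rep n lam e k \<epsilon> = sheet_rep n lam e k \<eta>"
proof -
  have "homotopic_paths (cover n) (swap_sheet \<circ> \<epsilon>) (swap_sheet \<circ> \<eta>)"
    using swap_in_cover[OF assms(1)] by (intro homotopic_paths_continuous_image[OF assms(2)] continuous_swap_sheet) auto
  moreover have "\<epsilon> 1 = \<eta> 1" using homotopic_paths_imp_pathfinish[OF assms(2)] by (simp add: pathfinish_def)
  ultimately show ?thesis
    using multiplier_homotopic[OF assms(2)] multiplier_homotopic by (simp add: sheet_rep_def)
qed

text \<open>A flat frame along the loop starts as \<open>base_frame\<close> and ends as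
  \<open>base_frame\<close> times a matrix \<open>D\<close>. It is diagonal if the lift closes, and
  antidiagonal if the sheets, and with them the columns, have been exchanged.\<close>

lemma transport_of_lift:
  assumes n: "n \<ge> 2" and g: "g \<in> loops_at (divisor_complement n) b" and e: "e \<in> cover n" and l: "is_lift n e g \<epsilon>" and k: "k \<noteq> 0"
  shows "parallel_transport n lam g P \<longleftrightarrow> P = matrix_inv (base_frame e k ** sheet_rep n lam e k \<epsilon> ** matrix_inv (base_frame e k))"
    and "matrix_inv (matrix_inv (base_frame e k ** sheet_rep n lam e k \<epsilon> ** matrix_inv (base_frame e k))) =
       base_frame e k ** sheet_rep n lam e k \<epsilon> ** matrix_inv (base_frame e k)"
    and "det (sheet_rep n lam e k \<epsilon>) = 1"
proof -
  have l': "path_in (cover n) \<epsilon>" "\<epsilon> 0 = e" "\<And>t. t \<in> {0..1} \<Longrightarrow> cover_proj n (\<epsilon> t) = g t"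
    using l by (auto simp: is_lift_def)
  have gp: "path_in (divisor_complement n) g" "g 1 = g 0" using g by (auto simp: loops_at_iff pathstart_def pathfinish_def)
  let ?B = "base_frame e k" and ?m1 = "multiplier n lam \<epsilon>" and ?m2 = "multiplier n lam (swap_sheet \<circ> \<epsilon>)"
  define D where "D = (if \<epsilon> 1 = e then mat2 ?m1 0 0 ?m2 else mat2 0 (k * ?m2) (?m1 / k) 0)"
  let ?R = "sheet_rep n lam e k \<epsilon>"
  have e1: "\<epsilon> 1 = e \<or> \<epsilon> 1 = swap_sheet e" by (rule lift_end[OF n e l gp(2)])
  have mm: "\<epsilon> 1 = e \<Longrightarrow> ?m1 * ?m2 = 1" "\<epsilon> 1 \<noteq> e \<Longrightarrow> ?m1 * ?m2 = - 1"
    using multiplier_swap_closed[OF n l'(1)] l'(2) e1 by auto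
  have DR: "?R ** D = mat 1"
    using mm k by (auto simp: D_def sheet_rep_def mat2_mult mat_eq_iff mult.commute)
  show "det ?R = 1" using mm k by (auto simp: sheet_rep_def det_mat mult.commute)
  obtain F where F: "flat_along n lam g F" "\<And>t. t \<in> {0..1} \<Longrightarrow> det (F t) \<noteq> 0"
    "F 0 = mat2 (slope (\<epsilon> 0)) (k * slope (swap_sheet (\<epsilon> 0))) 1 k"
    "F 1 = mat2 (?m1 * slope (\<epsilon> 1)) (k * ?m2 * slope (swap_sheet (\<epsilon> 1))) ?m1 (k * ?m2)"
    using flat_along_frame[OF n l'(1,3) gp(1) k] by metis
  have F0: "F 0 = ?B" using F(3) l'(2) by (simp add: base_frame_def)
  have F1: "F 1 = ?B ** D" using F(4) e1 k by (auto simp: base_frame_def D_def mat2_mult mat_eq_iff)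
  have BB: "?B ** matrix_inv ?B = mat 1" "matrix_inv ?B ** ?B = mat 1" using matrix_inv_mult[OF det_base_frame[OF e k]] by auto
  let ?Q = "?B ** ?R ** matrix_inv ?B" and ?P = "?B ** D ** matrix_inv ?B"
  have "?Q ** ?P = ?B ** (?R ** ((matrix_inv ?B ** ?B) ** D)) ** matrix_inv ?B"
    by (simp only: matrix_mul_assoc)
  also have "\<dots> = mat 1" using BB DR by simp
  finally have QP: "?Q ** ?P = mat 1" .
  then have inv: "matrix_inv ?Q = ?P" by (rule matrix_inv_eq)
  have "?P ** ?Q = mat 1" using QP matrix_left_right_inverse by blast
  then show "matrix_inv (matrix_inv ?Q) = ?Q" unfolding inv by (rule matrix_inv_eq)
  show "parallel_transport n lam g P \<longleftrightarrow> P = matrix_inv ?Q"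
    unfolding inv using parallel_transport_iff[OF n gp(1) F(1,2)] F0 F1 by simp
qed

text \<open>The description in \<open>monodromy\<close> is definite because homotopic loops have
  homotopic lifts and so the same \<open>sheet_rep\<close>.\<close>

lemma monodromy_of_lift:
  assumes n: "n \<ge> 2" and g: "g \<in> loops_at (divisor_complement n) b" and e: "e \<in> cover n" and l: "is_lift n e g \<epsilon>" and k: "k \<noteq> 0"
  shows "monodromy n lam (loop_class (divisor_complement n) g) = base_frame e k ** sheet_rep n lam e k \<epsilon> ** matrix_inv (base_frame e k)"
  unfolding monodromy_def
proof (rule the_equality)
  let ?Q = "base_frame e k ** sheet_rep n lam e k \<epsilon> ** matrix_inv (base_frame e k)"
  have "g \<in> loop_class (divisor_complement n) g" using g by (auto simp: loops_at_iff intro: loop_class_self)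
  then show "\<exists>g\<in>loop_class (divisor_complement n) g. \<exists>P. parallel_transport n lam g P \<and> ?Q = matrix_inv P"
    using transport_of_lift[OF n g e l k] by metis
  fix M assume "\<exists>g\<in>loop_class (divisor_complement n) g. \<exists>P. parallel_transport n lam g P \<and> M = matrix_inv P"
  then obtain h P where h: "homotopic_paths (divisor_complement n) g h" "parallel_transport n lam h P" "M = matrix_inv P"
    by (auto simp: loop_class_def)
  have hl: "h \<in> loops_at (divisor_complement n) b"
    using g homotopic_paths_path_in[OF h(1)] homotopic_paths_imp_pathstart[OF h(1)] homotopic_paths_imp_pathfinish[OF h(1)]
    by (simp add: loops_at_iff)
  have "cover_proj n e = h 0"
  proof -
    have "cover_proj n (\<epsilon> 0) = g 0" "\<epsilon> 0 = e" using l by (auto simp: is_lift_def)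
    then show ?thesis using homotopic_paths_imp_pathstart[OF h(1)] by (simp add: pathstart_def)
  qed
  then obtain \<eta> where \<eta>: "is_lift n e h \<eta>"
    using lift_exists[OF n _ e, of h] hl by (auto simp: loops_at_iff)
  have "sheet_rep n lam e k \<epsilon> = sheet_rep n lam e k \<eta>"
    by (rule sheet_rep_homotopic[OF n homotopic_lifts[OF n h(1) l \<eta>]])
  then show "M = ?Q"
    using transport_of_lift[OF n hl e \<eta> k] h(2,3) by metis
qed

lemma loop_rep_of_lift:
  assumes n: "n \<ge> 2" and g: "g \<in> loops_at (divisor_complement n) b" and e: "e \<in> cover n" and l: "is_lift n e g \<epsilon>" and k: "k \<noteq> 0"
  shows "loop_rep n lam e k (loop_class (divisor_complement n) g) = sheet_rep n lam e k \<epsilon>"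
proof -
  let ?B = "base_frame e k" and ?R = "sheet_rep n lam e k \<epsilon>"
  have "loop_rep n lam e k (loop_class (divisor_complement n) g) = (matrix_inv ?B ** ?B) ** ?R ** (matrix_inv ?B ** ?B)"
    unfolding loop_rep_def monodromy_of_lift[OF assms] by (simp only: matrix_mul_assoc)
  also have "\<dots> = ?R" using matrix_inv_mult(1)[OF det_base_frame[OF e k]] by simp
  finally show ?thesis .
qed

text \<open>If the first lift ends on the other sheet, the second loop has to be lifted from there,
  that is by the swapped lift. This interchanges its two multipliers, as multiplication by an
  antidiagonal matrix demands.\<close>

lemma sheet_rep_join:
  assumes n: "n \<ge> 2" and e: "e \<in> cover n" and k: "k \<noteq> 0"
    and g: "g \<in> loops_at (divisor_complement n) b" "is_lift n e g \<epsilon>" and h: "h \<in> loops_at (divisor_complement n) b" "is_lift n e h \<eta>"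
  shows "\<exists>\<zeta>. is_lift n e (g +++ h) \<zeta> \<and> sheet_rep n lam e k \<zeta> = sheet_rep n lam e k \<epsilon> ** sheet_rep n lam e k \<eta>"
proof -
  have loops: "g 1 = g 0" "h 1 = h 0" using g h by (auto simp: loops_at_iff pathstart_def pathfinish_def)
  have ee: "\<epsilon> 1 = e \<or> \<epsilon> 1 = swap_sheet e" and he: "\<eta> 1 = e \<or> \<eta> 1 = swap_sheet e"
    using lift_end[OF n e] g h loops by blast+
  have pin: "path_in (cover n) \<epsilon>" "path_in (cover n) \<eta>" "\<epsilon> 0 = e" "\<eta> 0 = e" and
    pr: "\<And>t. t \<in> {0..1} \<Longrightarrow> cover_proj n (\<epsilon> t) = g t" "\<And>t. t \<in> {0..1} \<Longrightarrow> cover_proj n (\<eta> t) = h t"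
    using g h by (auto simp: is_lift_def)
  note pins = path_in_swap[OF n pin(1)] path_in_swap[OF n pin(2)]
  note ne = swap_ne[OF e]
  have sswap: "swap_sheet \<circ> (swap_sheet \<circ> \<epsilon>') = \<epsilon>'" for \<epsilon>' :: "real \<Rightarrow> nat \<Rightarrow> complex" by (simp add: fun_eq_iff)
  have lift: "is_lift n e (g +++ h) (\<epsilon> +++ \<eta>')"
    if "path_in (cover n) \<eta>'" "\<eta>' 0 = \<epsilon> 1" "\<And>t. t \<in> {0..1} \<Longrightarrow> cover_proj n (\<eta>' t) = h t" for \<eta>'
    unfolding is_lift_def
  proof (intro conjI ballI)
    show "path_in (cover n) (\<epsilon> +++ \<eta>')" using that pin by (simp add: pathfinish_def pathstart_def)
    show "(\<epsilon> +++ \<eta>') 0 = e" using pin by (simp add: joinpaths_def)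
    fix t :: real assume "t \<in> {0..1}"
    then show "cover_proj n ((\<epsilon> +++ \<eta>') t) = (g +++ h) t"
      using pr(1)[of "2 * t"] that(3)[of "2 * t - 1"] by (simp add: joinpaths_def)
  qed
  show ?thesis
  proof (cases "\<epsilon> 1 = e")
    case True
    have m: "multiplier n lam (\<epsilon> +++ \<eta>) = multiplier n lam \<epsilon> * multiplier n lam \<eta>"
      "multiplier n lam (swap_sheet \<circ> (\<epsilon> +++ \<eta>)) = multiplier n lam (swap_sheet \<circ> \<epsilon>) * multiplier n lam (swap_sheet \<circ> \<eta>)"
      unfolding path_compose_join
      by (rule multiplier_join; use pin pins True in \<open>simp add: pathfinish_def pathstart_def\<close>)+
    have "(\<epsilon> +++ \<eta>) 1 = \<eta> 1" by (simp add: joinpaths_def)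
    then have "sheet_rep n lam e k (\<epsilon> +++ \<eta>) = sheet_rep n lam e k \<epsilon> ** sheet_rep n lam e k \<eta>"
      unfolding sheet_rep_def m using True he ne k by (auto simp: mat2_mult mult_ac)
    then show ?thesis using lift[of \<eta>] pin pr True by auto
  next
    case False
    then have e1: "\<epsilon> 1 = swap_sheet e" using ee by blast
    have m: "multiplier n lam (\<epsilon> +++ (swap_sheet \<circ> \<eta>)) = multiplier n lam \<epsilon> * multiplier n lam (swap_sheet \<circ> \<eta>)"
      "multiplier n lam (swap_sheet \<circ> (\<epsilon> +++ (swap_sheet \<circ> \<eta>))) = multiplier n lam (swap_sheet \<circ> \<epsilon>) * multiplier n lam \<eta>"
      unfolding path_compose_join sswap
      by (rule multiplier_join; use pin pins e1 in \<open>simp add: pathfinish_def pathstart_def\<close>)+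
    have "(\<epsilon> +++ (swap_sheet \<circ> \<eta>)) 1 = swap_sheet (\<eta> 1)" by (simp add: joinpaths_def)
    then have "sheet_rep n lam e k (\<epsilon> +++ (swap_sheet \<circ> \<eta>)) = sheet_rep n lam e k \<epsilon> ** sheet_rep n lam e k \<eta>"
      unfolding sheet_rep_def m using False he ne k by (auto simp: mat2_mult mult_ac)
    then show ?thesis using lift[of "swap_sheet \<circ> \<eta>"] pin pins pr e1 by auto
  qed
qed

text \<open>The double cover serves as the finite cover: the projection of a loop in it has a closed
  lift, hence a diagonal matrix. The conjugating matrix is the inverse of
  \<open>base_frame\<close>.\<close>

lemma loop_rep_properties:
  fixes lam :: "nat \<Rightarrow> complex"
  assumes n: "n \<ge> 2" and e: "e \<in> cover n" and k: "k \<noteq> 0"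
  defines "X \<equiv> divisor_complement n" and "b \<equiv> cover_proj n e" and "\<rho> \<equiv> loop_rep n lam e k"
  shows "\<rho> \<in> hom (fundamental_group X b) SL2"
    and "conjugate_on (carrier (fundamental_group X b)) (monodromy n lam) \<rho>"
    and "virtually_abelian X b \<rho>"
    and "\<rho> ` carrier (fundamental_group X b) \<subseteq> D_infinity"
proof -
  have lift: "\<exists>\<epsilon>. is_lift n e g \<epsilon>" if "g \<in> loops_at X b" for g
    using lift_exists[OF n _ e, of g] that by (auto simp: loops_at_iff X_def b_def pathstart_def)
  have rep: "\<rho> (loop_class X g) = sheet_rep n lam e k \<epsilon>" and det: "det (sheet_rep n lam e k \<epsilon>) = 1"
    if "g \<in> loops_at X b" "is_lift n e g \<epsilon>" for g \<epsilon>
    using loop_rep_of_lift[OF n _ e that(2) k, of b lam] transport_of_lift(3)[OF n _ e that(2) k, of b lam] that(1)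
    unfolding X_def \<rho>_def by blast+
  show "\<rho> \<in> hom (fundamental_group X b) SL2"
  proof (rule homI)
    fix G assume "G \<in> carrier (fundamental_group X b)"
    then obtain g where g: "G = loop_class X g" "g \<in> loops_at X b" by (auto simp: fundamental_group_carrier)
    obtain \<epsilon> where \<epsilon>: "is_lift n e g \<epsilon>" using lift[OF g(2)] by blast
    show "\<rho> G \<in> carrier SL2" using rep[OF g(2) \<epsilon>] det[OF g(2) \<epsilon>] g(1) by (simp add: SL2_def)
    fix H assume "H \<in> carrier (fundamental_group X b)"
    then obtain h where h: "H = loop_class X h" "h \<in> loops_at X b" by (auto simp: fundamental_group_carrier)
    obtain \<eta> where \<eta>: "is_lift n e h \<eta>" using lift[OF h(2)] by blast
    obtain \<zeta> where \<zeta>: "is_lift n e (g +++ h) \<zeta>" "sheet_rep n lam e k \<zeta> = sheet_rep n lam e k \<epsilon> ** sheet_rep n lam e k \<eta>"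
      using sheet_rep_join[OF n e k g(2)[unfolded X_def] \<epsilon> h(2)[unfolded X_def] \<eta>] by blast
    show "\<rho> (G \<otimes>\<^bsub>fundamental_group X b\<^esub> H) = \<rho> G \<otimes>\<^bsub>SL2\<^esub> \<rho> H"
      unfolding g(1) h(1) fundamental_group_mult_class[OF g(2) h(2)] rep[OF loops_at_join[OF g(2) h(2)] \<zeta>(1)] \<zeta>(2)
        rep[OF g(2) \<epsilon>] rep[OF h(2) \<eta>] by (simp add: SL2_def)
  qed
  show "conjugate_on (carrier (fundamental_group X b)) (monodromy n lam) \<rho>"
    unfolding conjugate_on_def
  proof (intro exI conjI ballI)
    have "matrix_inv (base_frame e k) ** base_frame e k = mat 1" "base_frame e k ** matrix_inv (base_frame e k) = mat 1"
      using matrix_inv_mult[OF det_base_frame[OF e k]] by auto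
    moreover from this(1) have "matrix_inv (matrix_inv (base_frame e k)) = base_frame e k" by (rule matrix_inv_eq)
    ultimately show "invertible (matrix_inv (base_frame e k))"
      "\<And>G. \<rho> G = matrix_inv (base_frame e k) ** monodromy n lam G ** matrix_inv (matrix_inv (base_frame e k))"
      by (auto simp: invertible_def \<rho>_def loop_rep_def)
  qed
  show "virtually_abelian X b \<rho>"
    unfolding virtually_abelian_def
  proof (intro exI conjI ballI)
    show "covering_space (cover n) (cover_proj n) X" unfolding X_def by (rule covering_space_cover[OF n])
    show "path_connected (cover n)" by (rule path_connected_cover)
    show "finite {y \<in> cover n. cover_proj n y = x}" if "x \<in> X" for x
    proof (cases "\<exists>y\<in>cover n. cover_proj n y = x")
      case True
      then obtain y where y: "y \<in> cover n" "cover_proj n y = x" by blast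
      then have "{y \<in> cover n. cover_proj n y = x} \<subseteq> {y, swap_sheet y}"
        using cover_fibre[OF n y(1)] y(2) by blast
      then show ?thesis by (rule finite_subset) simp
    next
      case False
      then have "{y \<in> cover n. cover_proj n y = x} = {}" by blast
      then show ?thesis by (simp only: finite.emptyI)
    qed
    show "e \<in> cover n" "cover_proj n e = b" using e by (simp_all add: b_def)
    have diag: "\<exists>p q. \<rho> (loop_class X (cover_proj n \<circ> g)) = mat2 p 0 0 q" if g: "g \<in> loops_at (cover n) e" for g
    proof -
      have gp: "path_in (cover n) g" "g 0 = e" "g 1 = e" using g by (auto simp: loops_at_iff pathstart_def pathfinish_def)
      have "path_in X (cover_proj n \<circ> g)"
        using cover_proj_in[OF n] unfolding X_def by (intro path_in_compose[OF gp(1)] continuous_cover_proj) auto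
      then have l: "cover_proj n \<circ> g \<in> loops_at X b" using gp by (simp add: loops_at_iff pathstart_def pathfinish_def b_def)
      have "is_lift n e (cover_proj n \<circ> g) g" using gp by (simp add: is_lift_def)
      then show ?thesis using rep[OF l] gp(3) by (auto simp: sheet_rep_def)
    qed
    fix g h assume gh: "g \<in> loops_at (cover n) e" "h \<in> loops_at (cover n) e"
    show "\<rho> (loop_class X (cover_proj n \<circ> g)) ** \<rho> (loop_class X (cover_proj n \<circ> h)) =
           \<rho> (loop_class X (cover_proj n \<circ> h)) ** \<rho> (loop_class X (cover_proj n \<circ> g))"
      using diag[OF gh(1)] diag[OF gh(2)] by (auto simp: mat2_mult mult.commute)
  qed
  show "\<rho> ` carrier (fundamental_group X b) \<subseteq> D_infinity"
  proof clarify
    fix G assume "G \<in> carrier (fundamental_group X b)"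
    then obtain g where g: "G = loop_class X g" "g \<in> loops_at X b" by (auto simp: fundamental_group_carrier)
    obtain \<epsilon> where \<epsilon>: "is_lift n e g \<epsilon>" using lift[OF g(2)] by blast
    define p where "p = multiplier n lam (swap_sheet \<circ> \<epsilon>)"
    define q where "q = multiplier n lam \<epsilon>"
    have pq: "p \<noteq> 0" "q \<noteq> 0" by (simp_all add: p_def q_def multiplier_def)
    have R: "\<rho> G = (if \<epsilon> 1 = e then mat2 p 0 0 q else mat2 0 (- k * p) (- q / k) 0)" "det (\<rho> G) = 1"
      using rep[OF g(2) \<epsilon>] det[OF g(2) \<epsilon>] g(1) by (simp_all add: sheet_rep_def p_def q_def)
    show "\<rho> G \<in> D_infinity"
      unfolding D_infinity_def
    proof (rule generate.incl)
      show "\<rho> G \<in> {mat2 0 \<alpha> (- inverse \<alpha>) 0 |\<alpha>. \<alpha> \<noteq> 0} \<union> {mat2 \<beta> 0 0 (inverse \<beta>) |\<beta>. \<beta> \<noteq> 0}"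
      proof (cases "\<epsilon> 1 = e")
        case True
        then have "p * q = 1" using R by (simp add: det_mat)
        then have "q = inverse p" by (metis inverse_unique)
        then show ?thesis using R(1) True pq by auto
      next
        case False
        then have "- (p * q) = 1" using R k by (simp add: det_mat)
        then have "- q / k = - inverse (- k * p)" using pq k by (simp add: field_simps)
        then have "\<rho> G = mat2 0 (- k * p) (- inverse (- k * p)) 0" "- k * p \<noteq> 0" using R(1) False pq k by auto
        then show ?thesis by blast
      qed
    qed
  qed
qed

section \<open>The fibres of the cut plane\<close>

definition plane_coords :: "(nat \<Rightarrow> complex) \<Rightarrow> (nat \<Rightarrow> complex) \<Rightarrow> (nat \<Rightarrow> complex) \<Rightarrow> complex \<Rightarrow> complex \<Rightarrow> nat \<Rightarrow> complex" where
  "plane_coords A B C x y k = (if k = 0 then x else if k = 1 then y else A (k - 1) * x + B (k - 1) * y + C (k - 1))"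

lemma plane_point_coords: "plane_point n A B C x y = affine_point n (plane_coords A B C x y)"
  unfolding plane_point_def by (rule affine_point_cong) (simp add: plane_coords_def)

lemma conic_affine: "conic x y 1 = (y - 1 - x)\<^sup>2 - 4 * x"
  by (simp add: conic_def power2_eq_square algebra_simps)

lemma aff_conic_plane: "aff_conic (plane_coords A B C x y) = (y - 1 - x)\<^sup>2 - 4 * x"
  by (simp add: aff_conic_def plane_coords_def conic_affine)

lemma punctured_fibre_iff:
  assumes "n \<ge> 2"
  shows "y \<in> punctured_fibre n A B C x \<longleftrightarrow> x \<noteq> 0 \<and> y \<noteq> 0 \<and> (y - 1 - x)\<^sup>2 \<noteq> 4 * x \<and>
    (\<forall>i\<in>{1..n-2}. conic x y 1 \<noteq> (A i * x + B i * y + C i)\<^sup>2)"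
proof -
  have "plane_coords A B C x y (i + 1) = A i * x + B i * y + C i" if "i \<in> {1..n-2}" for i
    using that by (simp add: plane_coords_def)
  then have "(\<forall>i\<in>{1..n-2}. aff_conic (plane_coords A B C x y) - (plane_coords A B C x y (i + 1))\<^sup>2 \<noteq> 0) \<longleftrightarrow>
     (\<forall>i\<in>{1..n-2}. conic x y 1 \<noteq> (A i * x + B i * y + C i)\<^sup>2)"
    by (intro ball_cong refl) (simp only: aff_conic_plane conic_affine right_minus_eq)
  then show ?thesis
    unfolding punctured_fibre_def mem_Collect_eq plane_point_coords affine_in_complement[OF assms] good_coords_def aff_conic_plane
    by (simp add: plane_coords_def)
qed

lemma continuous_on_plane_coords:
  assumes "continuous_on S f" "continuous_on S g"
  shows "continuous_on S (\<lambda>t. plane_coords A B C (f t) (g t))"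
proof (rule continuous_on_coordinatewise_then_product)
  fix k show "continuous_on S (\<lambda>t. plane_coords A B C (f t) (g t) k)"
    unfolding plane_coords_def using assms by (cases "k = 0"; cases "k = 1") (auto intro!: continuous_intros)
qed

lemma continuous_on_plane_point:
  assumes "continuous_on S f" "continuous_on S g"
  shows "continuous_on S (\<lambda>t. plane_point n A B C (f t) (g t))"
  unfolding plane_point_coords by (intro continuous_on_affine_point continuous_on_plane_coords assms)

lemma path_in_plane_point:
  assumes "path f" "path g" "\<And>t. 0 \<le> t \<Longrightarrow> t \<le> 1 \<Longrightarrow> g t \<in> punctured_fibre n A B C (f t)"
  shows "path_in (divisor_complement n) (\<lambda>t. plane_point n A B C (f t) (g t))"
  using assms by (intro path_inI continuous_on_plane_point) (auto simp: path_def punctured_fibre_def)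

text \<open>The root s of z satisfies (s - 1) (s + 1) = z - 1, and s + 1 has real part above
  1.\<close>

lemma root_near_one_bound:
  assumes "norm (z - 1) < 1" shows "norm (exp (Ln z / 2) - 1) \<le> norm (z - 1)"
proof -
  let ?s = "exp (Ln z / 2)"
  have "(?s - 1) * (?s + 1) = z - 1" using sqrt_near_one(1)[OF assms] square_minus_square[of ?s 1] by simp
  then have "norm (?s - 1) * norm (?s + 1) = norm (z - 1)" by (metis norm_mult)
  moreover have "1 \<le> norm (?s + 1)" using sqrt_near_one(2)[OF assms] abs_Re_le_cmod[of "?s + 1"] by auto
  ultimately show ?thesis by (metis mult_left_mono mult.right_neutral norm_ge_zero)
qed

text \<open>As x tends to 0 the equation of the i-th quadric in the fibre becomes (y - 1)^2 = (B i y
  + C i)^2, with roots \<open>Yp i\<close> and \<open>Ym i\<close>; the two points of Q_0 tend to 1.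
  The list behind \<open>P\<close> arranges these limits as the product relation suggests, and
  \<open>S0\<close> is the complement of discs of radius \<open>r\<close> about them. The bound r^2
  / 400 for |x| keeps the square root of x below r / 20. The section of the projection is y = b max
  (1, |x|).\<close>

locale cut_data =
  fixes n :: nat and A B C :: "nat \<Rightarrow> complex" and r \<epsilon> :: real and b :: complex and Yp Ym :: "nat \<Rightarrow> complex" and P S0
  assumes n: "n \<ge> 2"
    and AB: "i \<in> {1..n-2} \<Longrightarrow> norm (A i) < 1 / 4" "i \<in> {1..n-2} \<Longrightarrow> norm (B i) < 1 / 4"
  defines "Yp \<equiv> \<lambda>i. (1 - C i) / (1 + B i)" and "Ym \<equiv> \<lambda>i. (1 + C i) / (1 - B i)"
    and "P \<equiv> set ([0] @ map Yp [1..<n-1] @ [1] @ map Ym [1..<n-1])"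
    and "S0 \<equiv> {y. \<forall>c\<in>P. r \<le> dist c y}"
  assumes dist: "distinct ([0] @ map Yp [1..<n-1] @ [1] @ map Ym [1..<n-1])"
    and r: "0 < r" "r < 1"
    and sep: "c \<in> P \<Longrightarrow> c' \<in> P \<Longrightarrow> c \<noteq> c' \<Longrightarrow> 8 * r < dist c c'"
    and \<epsilon>: "0 < \<epsilon>" "\<epsilon> \<le> r\<^sup>2 / 400"
    and roots: "norm x < \<epsilon> \<Longrightarrow> i \<in> {1..n-2} \<Longrightarrow> conic x y 1 = (A i * x + B i * y + C i)\<^sup>2 \<Longrightarrow>
       dist (Yp i) y < r \<or> dist (Ym i) y < r"
    and bS: "b \<in> S0"
    and sec: "x \<noteq> 0 \<Longrightarrow> b * of_real (max 1 (norm x)) \<in> punctured_fibre n A B C x"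
begin

abbreviation "X \<equiv> divisor_complement n"
abbreviation "fib x \<equiv> punctured_fibre n A B C x"

lemma P_mem: "0 \<in> P" "1 \<in> P" "i \<in> {1..n-2} \<Longrightarrow> Yp i \<in> P" "i \<in> {1..n-2} \<Longrightarrow> Ym i \<in> P"
  using n by (auto simp: P_def)

lemma P_ne: "i \<in> {1..n-2} \<Longrightarrow> Yp i \<noteq> 1 \<and> Ym i \<noteq> 1 \<and> Yp i \<noteq> 0 \<and> Ym i \<noteq> 0"
  using dist n by (auto simp: image_iff)

lemma B_ne: "i \<in> {1..n-2} \<Longrightarrow> 1 + B i \<noteq> 0 \<and> 1 - B i \<noteq> 0 \<and> 3 / 4 \<le> norm (1 + B i) \<and> 3 / 4 \<le> norm (1 - B i)"
  using AB(2)[of i] norm_triangle_ineq2[of 1 "- B i"] norm_triangle_ineq2[of 1 "B i"] by auto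

lemma S0_D: "y \<in> S0 \<Longrightarrow> c \<in> P \<Longrightarrow> r \<le> norm (y - c)"
  by (simp add: S0_def dist_norm norm_minus_commute)

lemma fib_out:
  assumes "0 < norm x" "norm x < \<epsilon>" "y \<notin> fib x"
  shows "y = 0 \<or> (y - 1 - x)\<^sup>2 = 4 * x \<or> (\<exists>i\<in>{1..n-2}. dist (Yp i) y < r \<or> dist (Ym i) y < r)"
proof -
  have "y = 0 \<or> (y - 1 - x)\<^sup>2 = 4 * x \<or> (\<exists>i\<in>{1..n-2}. conic x y 1 = (A i * x + B i * y + C i)\<^sup>2)"
    using assms(1,3) by (auto simp: punctured_fibre_iff[OF n])
  then show ?thesis using roots[OF assms(2)] by blast
qed

lemma eps_small: "\<epsilon> < r / 400" "\<epsilon> < 1 / 400"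
proof -
  have "r\<^sup>2 < r * 1" unfolding power2_eq_square using r by (intro mult_strict_left_mono) auto
  then show "\<epsilon> < r / 400" "\<epsilon> < 1 / 400" using \<epsilon> r by auto
qed

lemma sqrt_small:
  fixes s x :: complex
  assumes "s\<^sup>2 = x" "norm x < \<epsilon>" shows "norm s < r / 20" "norm x \<le> norm s / 20"
proof -
  have ns: "norm s ^ 2 = norm x" using assms(1) by (metis norm_power)
  then have "norm s ^ 2 < (r / 20)\<^sup>2" using assms \<epsilon>(2) by (simp add: power_divide)
  then show s: "norm s < r / 20" using r by (meson less_eq_real_def power_less_imp_less_base divide_nonneg_nonneg zero_le_numeral)
  have "norm x = norm s * norm s" using ns by (simp add: power2_eq_square)
  also have "\<dots> \<le> norm s * (1 / 20)" using s r by (intro mult_left_mono) auto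
  finally show "norm x \<le> norm s / 20" by simp
qed

lemma conic_zero_near:
  fixes x y :: complex
  assumes "norm x < \<epsilon>" "(y - 1 - x)\<^sup>2 = 4 * x" shows "norm (y - 1) < r"
proof -
  have "((y - 1 - x) / 2)\<^sup>2 = x" using assms(2) by (simp add: power_divide)
  from sqrt_small(1)[OF this assms(1)] have "norm (y - 1 - x) < r / 10" by (simp add: norm_divide)
  then show ?thesis using norm_triangle_ineq[of "y - 1 - x" x] assms(1) eps_small r by simp
qed

lemma S0_fib: "0 < norm x \<Longrightarrow> norm x < \<epsilon> \<Longrightarrow> S0 \<subseteq> fib x"
proof
  fix y assume x: "0 < norm x" "norm x < \<epsilon>" and y: "y \<in> S0"
  show "y \<in> fib x"
  proof (rule ccontr)
    assume "y \<notin> fib x"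
    with fib_out[OF x] consider "y = 0" | "(y - 1 - x)\<^sup>2 = 4 * x" | i where "i \<in> {1..n-2}" "dist (Yp i) y < r \<or> dist (Ym i) y < r" by blast
    then show False
    proof cases
      case 1 then show False using S0_D[OF y P_mem(1)] r by simp
    next
      case 2 then show False using conic_zero_near[OF x(2) 2] S0_D[OF y P_mem(2)] by simp
    next
      case 3 then show False using S0_D[OF y P_mem(3)[OF 3(1)]] S0_D[OF y P_mem(4)[OF 3(1)]] by (auto simp: dist_norm norm_minus_commute)
    qed
  qed
qed

text \<open>Limit points are more than 8 r apart and every puncture is within r of a limit of its
  own component, so within distance 4 r of \<open>c\<close> only the components that tend to
  \<open>c\<close> have to be avoided.\<close>

lemma near_puncture:
  assumes x: "0 < norm x" "norm x < \<epsilon>" and c: "c \<in> P" and y: "norm (y - c) \<le> 4 * r"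
    and "y = 0 \<Longrightarrow> c \<noteq> 0" "(y - 1 - x)\<^sup>2 = 4 * x \<Longrightarrow> c \<noteq> 1"
    "\<And>i. i \<in> {1..n-2} \<Longrightarrow> c = Yp i \<or> c = Ym i \<Longrightarrow> conic x y 1 \<noteq> (A i * x + B i * y + C i)\<^sup>2"
  shows "y \<in> fib x"
proof (rule ccontr)
  have far: "c' = c" if "c' \<in> P" "norm (y - c') < r" for c'
  proof (rule ccontr)
    assume "c' \<noteq> c"
    then have "8 * r < dist c' c" using sep[OF that(1) c] by blast
    moreover have "dist c' c \<le> norm (y - c') + norm (y - c)" using norm_triangle_ineq4[of "y - c" "y - c'"] by (simp add: dist_norm norm_minus_commute)
    ultimately show False using y that r by simp
  qed
  assume "y \<notin> fib x"
  then consider "y = 0" | "(y - 1 - x)\<^sup>2 = 4 * x" | i where "i \<in> {1..n-2}" "conic x y 1 = (A i * x + B i * y + C i)\<^sup>2"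
    using x by (auto simp: punctured_fibre_iff[OF n])
  then show False
  proof cases
    case 1 then show False using far[OF P_mem(1)] assms(5) r by simp
  next
    case 2 then show False using far[OF P_mem(2)] conic_zero_near[OF x(2) 2] assms(6) by simp
  next
    case 3
    from roots[OF x(2) 3] show False
      using far[OF P_mem(3)[OF 3(1)]] far[OF P_mem(4)[OF 3(1)]] assms(7)[OF 3(1)] 3(2)
      by (auto simp: dist_norm norm_minus_commute)
  qed
qed

section \<open>The sheet over the complement of the discs\<close>

text \<open>The conic is (y - 1 - x)^2 - 4 x. Off the disc about 1 the first term dominates, so y -
  1 - x times this principal root is a global square root there: over \<open>S0\<close> the double
  cover splits, and loops in \<open>S0\<close> lift to loops.\<close>

definition root_factor :: "complex \<Rightarrow> complex \<Rightarrow> complex" where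
  "root_factor x y = exp (Ln (1 - 4 * x / (y - 1 - x)\<^sup>2) / 2)"

definition outer_sheet :: "complex \<Rightarrow> complex \<Rightarrow> nat \<Rightarrow> complex" where
  "outer_sheet x y = sheet n (plane_coords A B C x y) ((y - 1 - x) * root_factor x y)"

lemma outer_bounds:
  assumes "norm x < \<epsilon>" "y \<in> S0"
  shows "r / 2 \<le> norm (y - 1 - x)" "norm (4 * x / (y - 1 - x)\<^sup>2) < 1" "norm (root_factor x y - 1) \<le> norm (4 * x / (y - 1 - x)\<^sup>2)"
    "(root_factor x y)\<^sup>2 = 1 - 4 * x / (y - 1 - x)\<^sup>2" "Re (root_factor x y) > 0"
    "norm ((y - 1 - x) * (root_factor x y - 1)) \<le> 8 * norm x / r"
proof -
  show t: "r / 2 \<le> norm (y - 1 - x)"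
    using S0_D[OF assms(2) P_mem(2)] norm_triangle_ineq2[of "y - 1" x] assms(1) eps_small r by simp
  have t2: "(r / 2)\<^sup>2 \<le> norm (y - 1 - x) ^ 2" using t r by (intro power_mono) auto
  have "norm (4 * x / (y - 1 - x)\<^sup>2) \<le> 4 * norm x / (r / 2)\<^sup>2"
    unfolding norm_divide norm_mult norm_power using t2 r by (intro frac_le) auto
  also have "\<dots> < 1"
  proof -
    have "16 * norm x < r\<^sup>2" using assms(1) \<epsilon>(2) norm_ge_zero[of x] by linarith
    then show ?thesis using r by (simp add: power_divide divide_simps)
  qed
  finally show l: "norm (4 * x / (y - 1 - x)\<^sup>2) < 1" .
  have l': "norm ((1 - 4 * x / (y - 1 - x)\<^sup>2) - 1) < 1" using l by simp
  show R: "norm (root_factor x y - 1) \<le> norm (4 * x / (y - 1 - x)\<^sup>2)"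
    using root_near_one_bound[OF l'] by (simp add: root_factor_def)
  show "(root_factor x y)\<^sup>2 = 1 - 4 * x / (y - 1 - x)\<^sup>2" "Re (root_factor x y) > 0"
    using sqrt_near_one(1,2)[OF l'] by (simp_all add: root_factor_def)
  have pos: "norm (y - 1 - x) > 0" using t r by linarith
  have "norm ((y - 1 - x) * (root_factor x y - 1)) \<le> norm (y - 1 - x) * norm (4 * x / (y - 1 - x)\<^sup>2)"
    unfolding norm_mult using R by (intro mult_left_mono) auto
  also have "\<dots> = 4 * norm x / norm (y - 1 - x)"
    using pos by (simp add: norm_divide norm_mult norm_power power2_eq_square)
  also have "\<dots> \<le> 4 * norm x / (r / 2)" using t r by (intro divide_left_mono) (auto intro!: mult_pos_pos pos)
  finally show "norm ((y - 1 - x) * (root_factor x y - 1)) \<le> 8 * norm x / r" by simp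
qed

lemma outer_sheet:
  assumes "0 < norm x" "norm x < \<epsilon>" "y \<in> S0"
  shows "outer_sheet x y \<in> cover n" "cover_proj n (outer_sheet x y) = plane_point n A B C x y"
proof -
  have "y \<in> fib x" using S0_fib assms by auto
  then have good: "good_coords n (plane_coords A B C x y)"
    by (simp add: punctured_fibre_def plane_point_coords affine_in_complement[OF n])
  have "y - 1 - x \<noteq> 0" using outer_bounds(1)[OF assms(2,3)] r by auto
  then have "((y - 1 - x) * root_factor x y)\<^sup>2 = aff_conic (plane_coords A B C x y)"
    using outer_bounds(4)[OF assms(2,3)] by (simp add: power_mult_distrib aff_conic_plane right_diff_distrib)
  from sheet_in_cover[OF n good this] show "outer_sheet x y \<in> cover n" "cover_proj n (outer_sheet x y) = plane_point n A B C x y"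
    by (simp_all add: outer_sheet_def plane_point_coords)
qed

lemma path_in_outer_sheet:
  assumes f: "path f" "path g" "\<And>t. 0 \<le> t \<Longrightarrow> t \<le> 1 \<Longrightarrow> 0 < norm (f t) \<and> norm (f t) < \<epsilon> \<and> g t \<in> S0"
  shows "path_in (cover n) (\<lambda>t. outer_sheet (f t) (g t))" "path (\<lambda>t. root_factor (f t) (g t))"
proof -
  have fg: "continuous_on {0..1} f" "continuous_on {0..1} g" using f by (auto simp: path_def)
  have nz: "g t - 1 - f t \<noteq> 0" if "0 \<le> t" "t \<le> 1" for t
    using outer_bounds(1)[of "f t" "g t"] f(3)[OF that] r by auto
  have np: "1 - 4 * f t / (g t - 1 - f t)\<^sup>2 \<notin> \<real>\<^sub>\<le>\<^sub>0" if "0 \<le> t" "t \<le> 1" for t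
    using outer_bounds(2)[of "f t" "g t"] f(3)[OF that] by (intro not_nonpos_near_one) simp
  show R: "path (\<lambda>t. root_factor (f t) (g t))"
    unfolding path_def root_factor_def using nz np fg by (intro continuous_intros) auto
  show "path_in (cover n) (\<lambda>t. outer_sheet (f t) (g t))"
  proof (rule path_inI)
    show "continuous_on {0..1} (\<lambda>t. outer_sheet (f t) (g t))"
      unfolding outer_sheet_def
      by (intro continuous_sheet continuous_on_plane_coords fg continuous_on_mult continuous_on_diff continuous_on_const R[unfolded path_def])
    show "outer_sheet (f t) (g t) \<in> cover n" if "0 \<le> t" "t \<le> 1" for t
      using outer_sheet(1) f(3)[OF that] by auto
  qed
qed

text \<open>On this sheet every unit is, up to a factor close to \<open>1\<close>, an explicit function of \<open>x\<close> and \<open>y\<close>.\<close>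

lemma multiplier_outer_sheet:
  assumes f: "path f" "path g" "\<And>t. 0 \<le> t \<Longrightarrow> t \<le> 1 \<Longrightarrow> 0 < norm (f t) \<and> norm (f t) < \<epsilon> \<and> g t \<in> S0"
    and loops: "f 1 = f 0" "g 1 = g 0"
  shows "multiplier n lam (\<lambda>t. outer_sheet (f t) (g t)) = exp (2 * of_real pi * \<i> *
     ((1 - lam 0) / 2 * winding_number g 0 - winding_number g 1 / 2 + lam 1 / 2 * (winding_number f 0 - 2 * winding_number g 1) +
      (\<Sum>i\<in>{1..n-2}. lam (i + 1) / 2 * (winding_number g (Ym i) - winding_number g (Yp i)))))"
proof -
  let ?e = "\<lambda>t. outer_sheet (f t) (g t)"
  note pe = path_in_outer_sheet[OF f]
  define N where "N h = winding_number (h \<circ> ?e) 0" for h :: "(nat \<Rightarrow> complex) \<Rightarrow> complex"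
  have fg: "continuous_on {0..1} f" "continuous_on {0..1} g" "continuous_on {0..1} (\<lambda>t. root_factor (f t) (g t))"
    using f pe(2) by (auto simp: path_def)
  have cl: "?e 1 = ?e 0" using loops by simp
  have hp: "path (h \<circ> ?e)" "\<And>t. 0 \<le> t \<Longrightarrow> t \<le> 1 \<Longrightarrow> (h \<circ> ?e) t \<noteq> 0" "pathfinish (h \<circ> ?e) = pathstart (h \<circ> ?e)" if "h \<in> units n" for h
    using path_unit[OF pe(1) that] cl by (auto simp: pathstart_def pathfinish_def)
  have u0: "(\<lambda>e. e 0) \<in> units n" and u1: "(\<lambda>e. e 1) \<in> units n" and v0: "(\<lambda>e. 1 - e 0) \<in> units n" and v1: "(\<lambda>e. 1 - e 1) \<in> units n"
    unfolding units_def by blast+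
  note un = hp[of "\<lambda>e. 1 - e 0"] hp[of "\<lambda>e. 1 - e 1"] hp[of "\<lambda>e. e 0 - e 1"] hp[of "\<lambda>e. e 0"] hp[of "\<lambda>e. e 1"]
  have ob: "norm (f t) < \<epsilon>" "g t \<in> S0" "f t \<noteq> 0" if "0 \<le> t" "t \<le> 1" for t using f(3)[OF that] by auto
  have W: "?e t 0 - ?e t 1 = (g t - 1 - f t) * root_factor (f t) (g t)" for t by (simp add: outer_sheet_def)
  \<comment> \<open>With T = y - 1 - x and R the root factor, which is near 1: p = - T (1 - R) / 2
    is small and q = - T (1 + R) / 2 is close to - T.\<close>
  have E0: "?e t 0 = - (g t - 1 - f t) * (1 - root_factor (f t) (g t)) / 2" for t
    by (simp add: outer_sheet_def sheet_def plane_coords_def field_simps)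
  have E1: "?e t 1 = - (g t - 1 - f t) * (1 + root_factor (f t) (g t)) / 2" for t
    by (simp add: outer_sheet_def sheet_def plane_coords_def field_simps)
  have prod: "?e t 0 * ?e t 1 = f t" "(1 - ?e t 0) * (1 - ?e t 1) = g t" if "0 \<le> t" "t \<le> 1" for t
  proof -
    have "y1 = y2" if "cover_proj n e = affine_point n u" "y1 = cover_coords e k" "y2 = u k" "k < n" for y1 y2 e u k
      using affine_point_eqD[of n "cover_coords e" u k] that by (simp add: cover_proj_def)
    then have "cover_coords (?e t) k = plane_coords A B C (f t) (g t) k" if "k < n" for k
      using outer_sheet(2)[of "f t" "g t"] f(3)[OF \<open>0 \<le> t\<close> \<open>t \<le> 1\<close>] that by (auto simp: plane_point_coords)
    from this[of 0] this[of 1] show "?e t 0 * ?e t 1 = f t" "(1 - ?e t 0) * (1 - ?e t 1) = g t"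
      using n by (auto simp: cover_coords_def plane_coords_def)
  qed
  have gc: "winding_number (\<lambda>t. g t - c) 0 = winding_number g c" for c
    using winding_number_offset[of g c] by simp
  have t1: "winding_number (\<lambda>t. g t - 1 - f t) 0 = winding_number g 1"
    unfolding gc[symmetric]
  proof (rule winding_number_near)
    fix t :: real assume t: "0 \<le> t" "t \<le> 1"
    then show "norm (g t - 1 - f t - (g t - 1)) < norm (g t - 1)"
      using S0_D[OF ob(2)[OF t] P_mem(2)] ob(1)[OF t] eps_small r by simp
  qed (use fg loops in \<open>auto simp: path_def pathstart_def pathfinish_def intro!: continuous_intros\<close>)
  have nz1: "g t - 1 - f t \<noteq> 0" if "0 \<le> t" "t \<le> 1" for t using outer_bounds(1)[OF ob(1,2)[OF that]] r by auto
  have Rre: "Re (root_factor (f t) (g t)) > 0" if "0 \<le> t" "t \<le> 1" for t using outer_bounds(5)[OF ob(1,2)[OF that]] .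
  then have Rnz: "root_factor (f t) (g t) \<noteq> 0" "1 + root_factor (f t) (g t) \<noteq> 0" if "0 \<le> t" "t \<le> 1" for t
    using that by (force simp: complex_eq_iff)+
  have rh: "winding_number (\<lambda>t. root_factor (f t) (g t)) 0 = 0" "winding_number (\<lambda>t. 1 + root_factor (f t) (g t)) 0 = 0"
    using Rre fg(3) loops by (auto intro!: winding_number_right_half_plane continuous_intros simp: path_def pathstart_def pathfinish_def add_pos_pos)
  have Nw: "N (\<lambda>e. e 0 - e 1) = winding_number g 1"
  proof -
    have "N (\<lambda>e. e 0 - e 1) = winding_number (\<lambda>t. (g t - 1 - f t) * root_factor (f t) (g t)) 0"
      unfolding N_def o_def W ..
    also have "\<dots> = winding_number (\<lambda>t. g t - 1 - f t) 0 + winding_number (\<lambda>t. root_factor (f t) (g t)) 0"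
      using fg nz1 Rnz by (intro winding_number_mult) (auto simp: path_def intro!: continuous_intros)
    finally show ?thesis using t1 rh by simp
  qed
  have N1: "N (\<lambda>e. e 1) = winding_number g 1"
  proof -
    have "N (\<lambda>e. e 1) = winding_number (\<lambda>t. (- 1 / 2) * ((g t - 1 - f t) * (1 + root_factor (f t) (g t)))) 0"
      unfolding N_def o_def E1 by (rule winding_number_cong) (simp add: field_simps)
    also have "\<dots> = winding_number (\<lambda>t. (g t - 1 - f t) * (1 + root_factor (f t) (g t))) 0"
      using fg nz1 Rnz by (intro winding_number_rotate) (auto simp: path_def path_image_def intro!: continuous_intros)
    also have "\<dots> = winding_number (\<lambda>t. g t - 1 - f t) 0 + winding_number (\<lambda>t. 1 + root_factor (f t) (g t)) 0"
      using fg nz1 Rnz by (intro winding_number_mult) (auto simp: path_def intro!: continuous_intros)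
    finally show ?thesis using t1 rh by simp
  qed
  \<comment> \<open>Since p q = x, the winding number of p is that of x minus that of q.\<close>
  have N0: "N (\<lambda>e. e 0) = winding_number f 0 - winding_number g 1"
  proof -
    have "winding_number f 0 = winding_number (\<lambda>t. ((\<lambda>e. e 0) \<circ> ?e) t * ((\<lambda>e. e 1) \<circ> ?e) t) 0"
      by (rule winding_number_cong) (simp only: o_def prod)
    also have "\<dots> = N (\<lambda>e. e 0) + N (\<lambda>e. e 1)"
      unfolding N_def by (rule winding_number_mult[OF hp(1)[OF u0] hp(1)[OF u1] hp(2)[OF u0] hp(2)[OF u1]])
    finally show ?thesis using N1 by simp
  qed
  have N10: "N (\<lambda>e. 1 - e 0) = 0"
    unfolding N_def
  proof (rule winding_number_right_half_plane)
    fix t :: real assume t: "0 \<le> t" "t \<le> 1"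
    have "norm (?e t 0) = norm ((g t - 1 - f t) * (root_factor (f t) (g t) - 1)) / 2"
      unfolding E0 by (simp add: norm_mult norm_divide norm_minus_commute)
    also have "\<dots> \<le> 8 * norm (f t) / r / 2" using outer_bounds(6)[OF ob(1,2)[OF t]] by simp
    also have "\<dots> < 1" using ob(1)[OF t] eps_small r by (simp add: divide_simps)
    finally show "Re (((\<lambda>e. 1 - e 0) \<circ> ?e) t) > 0" using abs_Re_le_cmod[of "?e t 0"] by simp
  qed (use un in \<open>auto simp: units_def\<close>)
  have N11: "N (\<lambda>e. 1 - e 1) = winding_number g 0"
  proof -
    have "winding_number g 0 = winding_number (\<lambda>t. ((\<lambda>e. 1 - e 0) \<circ> ?e) t * ((\<lambda>e. 1 - e 1) \<circ> ?e) t) 0"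
      by (rule winding_number_cong) (simp only: o_def prod)
    also have "\<dots> = N (\<lambda>e. 1 - e 0) + N (\<lambda>e. 1 - e 1)"
      unfolding N_def by (rule winding_number_mult[OF hp(1)[OF v0] hp(1)[OF v1] hp(2)[OF v0] hp(2)[OF v1]])
    finally show ?thesis using N10 by simp
  qed
  have Nz: "N (\<lambda>e. e 0 - e 1 - e (i + 1)) = winding_number g (Ym i)" "N (\<lambda>e. e 0 - e 1 + e (i + 1)) = winding_number g (Yp i)"
    if i: "i \<in> {1..n-2}" for i
  proof -
    have ez: "?e t (i + 1) = A i * f t + B i * g t + C i" for t
      using i n by (auto simp: outer_sheet_def sheet_def plane_coords_def)
    \<comment> \<open>On this sheet p - q is close to y - 1 and z_i to B i y + C i, so the two
      remaining units are close to d (y - Y) with Y a limit point. The error is below r / 40,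
      whereas d (y - Y) has absolute value at least 3 r / 4.\<close>
    have wz: "h \<in> units n \<Longrightarrow> d \<noteq> 0 \<Longrightarrow> 3 / 4 \<le> norm d \<Longrightarrow> Y \<in> P \<Longrightarrow>
      (\<And>t. norm ((h \<circ> ?e) t - d * (g t - Y)) \<le> norm (f t) + norm ((g t - 1 - f t) * (root_factor (f t) (g t) - 1)) + norm (f t)) \<Longrightarrow>
       N h = winding_number g Y" for h d Y
    proof -
      assume h: "h \<in> units n" and d: "d \<noteq> 0" "3 / 4 \<le> norm d" and Y: "Y \<in> P"
        and bd: "\<And>t. norm ((h \<circ> ?e) t - d * (g t - Y)) \<le> norm (f t) + norm ((g t - 1 - f t) * (root_factor (f t) (g t) - 1)) + norm (f t)"
      have Yn: "g t - Y \<noteq> 0" if "0 \<le> t" "t \<le> 1" for t using S0_D[OF ob(2)[OF that] Y] r by auto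
      have "N h = winding_number (\<lambda>t. d * (g t - Y)) 0"
        unfolding N_def
      proof (rule winding_number_near)
        fix t :: real assume t: "0 \<le> t" "t \<le> 1"
        have "norm ((h \<circ> ?e) t - d * (g t - Y)) \<le> norm (f t) + 8 * norm (f t) / r + norm (f t)"
          using bd[of t] outer_bounds(6)[OF ob(1,2)[OF t]] by linarith
        also have "\<dots> \<le> 10 * norm (f t) / r" using r by (simp add: divide_simps) (metis mult_right_mono mult.commute mult_1 norm_ge_zero less_imp_le)
        also have "\<dots> < 10 * (r\<^sup>2 / 400) / r" using ob(1)[OF t] \<epsilon>(2) r by (intro divide_strict_right_mono) auto
        also have "\<dots> \<le> 3 / 4 * r" using r by (simp add: power2_eq_square)
        also have "\<dots> \<le> norm d * norm (g t - Y)" using d(2) S0_D[OF ob(2)[OF t] Y] r by (intro mult_mono) auto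
        finally show "norm ((h \<circ> ?e) t - d * (g t - Y)) < norm (d * (g t - Y))" by (simp add: norm_mult)
      qed (use hp[OF h] fg loops in \<open>auto simp: path_def pathstart_def pathfinish_def intro!: continuous_intros\<close>)
      also have "\<dots> = winding_number (\<lambda>t. g t - Y) 0"
        using fg Yn d by (intro winding_number_rotate) (auto simp: path_def path_image_def intro!: continuous_intros)
      finally show "N h = winding_number g Y" unfolding gc .
    qed
    have small: "norm (A i * f t) \<le> norm (f t)" for t
      using AB(1)[OF i] mult_right_mono[of "norm (A i)" 1 "norm (f t)"] by (simp add: norm_mult)
    have m: "(1 - B i) * Ym i = 1 + C i" and p: "(1 + B i) * Yp i = 1 - C i" using B_ne[OF i] by (simp_all add: Ym_def Yp_def)
    have u: "(\<lambda>e. e 0 - e 1 - e (i + 1)) \<in> units n" "(\<lambda>e. e 0 - e 1 + e (i + 1)) \<in> units n"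
      using i unfolding units_def by blast+
    show "N (\<lambda>e. e 0 - e 1 - e (i + 1)) = winding_number g (Ym i)"
    proof (rule wz[OF u(1), of "1 - B i"])
      fix t
      have "((\<lambda>e. e 0 - e 1 - e (i + 1)) \<circ> ?e) t - (1 - B i) * (g t - Ym i) =
        - f t + (g t - 1 - f t) * (root_factor (f t) (g t) - 1) - A i * f t"
        unfolding o_def W ez right_diff_distrib m by (simp add: algebra_simps)
      also have "norm \<dots> \<le> norm (f t) + norm ((g t - 1 - f t) * (root_factor (f t) (g t) - 1)) + norm (A i * f t)"
        by (rule order.trans[OF norm_triangle_ineq4]) (use norm_triangle_ineq[of "- f t"] in auto)
      finally show "norm (((\<lambda>e. e 0 - e 1 - e (i + 1)) \<circ> ?e) t - (1 - B i) * (g t - Ym i)) \<le>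
         norm (f t) + norm ((g t - 1 - f t) * (root_factor (f t) (g t) - 1)) + norm (f t)"
        using small[of t] by linarith
    qed (use B_ne[OF i] P_mem(4)[OF i] in auto)
    show "N (\<lambda>e. e 0 - e 1 + e (i + 1)) = winding_number g (Yp i)"
    proof (rule wz[OF u(2), of "1 + B i"])
      fix t
      have "((\<lambda>e. e 0 - e 1 + e (i + 1)) \<circ> ?e) t - (1 + B i) * (g t - Yp i) =
        - f t + (g t - 1 - f t) * (root_factor (f t) (g t) - 1) + A i * f t"
        unfolding o_def W ez right_diff_distrib p by (simp add: algebra_simps)
      also have "norm \<dots> \<le> norm (f t) + norm ((g t - 1 - f t) * (root_factor (f t) (g t) - 1)) + norm (A i * f t)"
        by (rule order.trans[OF norm_triangle_ineq]) (use norm_triangle_ineq[of "- f t"] in auto)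
      finally show "norm (((\<lambda>e. e 0 - e 1 + e (i + 1)) \<circ> ?e) t - (1 + B i) * (g t - Yp i)) \<le>
         norm (f t) + norm ((g t - 1 - f t) * (root_factor (f t) (g t) - 1)) + norm (f t)"
        using small[of t] by linarith
    qed (use B_ne[OF i] P_mem(3)[OF i] in auto)
  qed
  have "logsum n lam N = (1 - lam 0) / 2 * winding_number g 0 - winding_number g 1 / 2 + lam 1 / 2 * (winding_number f 0 - 2 * winding_number g 1) +
      (\<Sum>i\<in>{1..n-2}. lam (i + 1) / 2 * (winding_number g (Ym i) - winding_number g (Yp i)))"
  proof -
    have "(\<Sum>i\<in>{1..n-2}. lam (i + 1) / 2 * (N (\<lambda>e. e 0 - e 1 - e (i + 1)) - N (\<lambda>e. e 0 - e 1 + e (i + 1)))) =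
      (\<Sum>i\<in>{1..n-2}. lam (i + 1) / 2 * (winding_number g (Ym i) - winding_number g (Yp i)))"
      by (rule sum.cong[OF refl]) (simp only: Nz)
    then show ?thesis unfolding logsum_def N10 N11 N0 N1 Nw by simp
  qed
  then show ?thesis by (simp add: multiplier_def N_def [abs_def])
qed

end

section \<open>Loops around punctures\<close>

lemma polar_rotate: "of_real (norm z) * cis (Arg z - \<theta>) = z * cis (- \<theta>)"
proof -
  have "cis (Arg z - \<theta>) = cis (Arg z) * cis (- \<theta>)" by (simp add: cis_mult)
  then show ?thesis using rcis_cmod_Arg[of z] by (simp add: rcis_def flip: mult.assoc)
qed

definition around :: "complex set \<Rightarrow> complex \<Rightarrow> complex \<Rightarrow> (real \<Rightarrow> complex) set \<Rightarrow> bool" where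
  "around S b p G \<longleftrightarrow> (\<exists>g. loop_around S b p g \<and> G = loop_class S g)"

lemma circ_of_real: "circ p (of_real \<rho>) = (\<lambda>\<tau>. p + of_real \<rho> * cis (- 2 * pi * \<tau>))"
  by (rule ext) (simp add: circ_def)

lemma loop_around_iff:
  "loop_around S b p g \<longleftrightarrow> (\<exists>\<rho>>0. \<exists>q. cball p \<rho> - {p} \<subseteq> S \<and> path_in S q \<and> pathstart q = b \<and>
     pathfinish q = p + of_real \<rho> \<and> g = lasso q (circ p (of_real \<rho>)))"
  by (simp add: loop_around_def path_in_def lasso_def circ_of_real conj_ac)

lemma path_in_circ_punctured:
  "0 < \<rho> \<Longrightarrow> cball p \<rho> - {p} \<subseteq> S \<Longrightarrow> norm e = \<rho> \<Longrightarrow> path_in S (circ p e)"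
  by (rule path_in_circ) (auto simp: dist_norm norm_minus_commute)

lemma loop_around_loop: "loop_around S b p g \<Longrightarrow> g \<in> loops_at S b"
  by (auto simp: loop_around_iff loops_at_iff path_in_circ_punctured)

lemma around_conj:
  assumes "around S b p G" "K \<in> carrier (fundamental_group S b)" "b \<in> S"
  shows "around S b p (K \<otimes>\<^bsub>fundamental_group S b\<^esub> G \<otimes>\<^bsub>fundamental_group S b\<^esub> inv\<^bsub>fundamental_group S b\<^esub> K)"
proof -
  obtain \<rho> q where \<rho>: "\<rho> > 0" "cball p \<rho> - {p} \<subseteq> S" "path_in S q" "pathstart q = b" "pathfinish q = p + of_real \<rho>"
    "G = loop_class S (lasso q (circ p (of_real \<rho>)))"
    using assms(1) by (auto simp: around_def loop_around_iff)
  obtain k where k: "K = loop_class S k" "k \<in> loops_at S b" using assms(2) by (auto simp: fundamental_group_carrier)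
  have "K \<otimes>\<^bsub>fundamental_group S b\<^esub> G \<otimes>\<^bsub>fundamental_group S b\<^esub> inv\<^bsub>fundamental_group S b\<^esub> K = loop_class S (lasso (k +++ q) (circ p (of_real \<rho>)))"
    unfolding k(1) \<rho>(6) using \<rho> k(2) assms(3) by (intro lasso_conj) (auto intro: path_in_circ_punctured)
  moreover have "loop_around S b p (lasso (k +++ q) (circ p (of_real \<rho>)))"
    unfolding loop_around_iff using \<rho> k(2) by (intro exI[of _ \<rho>] conjI exI[of _ "k +++ q"]) (auto simp: loops_at_iff)
  ultimately show ?thesis unfolding around_def by blast
qed

text \<open>\<open>loop_around\<close> asks for a circle centred at the puncture and starting in the
  positive real direction. The homotopy slides the centre from \<open>u\<close> to \<open>p\<close>
  and turns the starting direction from that of \<open>e\<close> to the real one.\<close>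

lemma around_lasso:
  assumes q: "path_in S q" "pathstart q = b" "pathfinish q = u + e" and e: "e \<noteq> 0"
    and S: "\<And>\<sigma>. 0 \<le> \<sigma> \<Longrightarrow> \<sigma> \<le> 1 \<Longrightarrow> sphere (u + of_real \<sigma> * (p - u)) (norm e) \<subseteq> S" "cball p (norm e) - {p} \<subseteq> S"
  shows "around S b p (loop_class S (lasso q (circ u e)))"
proof -
  define H where "H z = u + of_real (fst z) * (p - u) + of_real (norm e) * cis ((1 - fst z) * Arg e - 2 * pi * snd z)" for z :: "real \<times> real"
  have H: "continuous_on ({0..1} \<times> {0..1}) H" unfolding H_def by (intro continuous_intros)
  have HS: "H ` ({0..1} \<times> {0..1}) \<subseteq> S"
  proof
    fix y assume "y \<in> H ` ({0..1} \<times> {0..1})"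
    then obtain \<sigma> t where s: "0 \<le> \<sigma>" "\<sigma> \<le> 1" "y = H (\<sigma>, t)" by auto
    then have "y \<in> sphere (u + of_real \<sigma> * (p - u)) (norm e)" by (simp add: H_def dist_norm norm_mult)
    then show "y \<in> S" using S(1)[OF s(1,2)] by blast
  qed
  have H0: "(\<lambda>t. H (0, t)) = circ u e" unfolding H_def circ_def using polar_rotate[of e] by (intro ext) simp
  have H1: "(\<lambda>t. H (1, t)) = circ p (of_real (norm e))" unfolding H_def circ_def by (intro ext) simp
  have per: "H (s, 0) = H (s, 1)" for s
    by (simp add: H_def complex_eq_iff sin_diff cos_diff)
  have start: "pathfinish q = H (0, 0)" using q(3) fun_cong[OF H0, of 0] by (simp add: circ_def)
  have pf: "pathfinish (\<lambda>s. H (s, 0)) = p + of_real (norm e)" "pathstart (\<lambda>s. H (s, 0)) = H (0, 0)"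
    by (simp_all add: pathfinish_def pathstart_def H_def)
  have mv: "loop_class S (lasso q (circ u e)) = loop_class S (lasso (q +++ (\<lambda>s. H (s, 0))) (circ p (of_real (norm e))))"
    using lasso_move_base[OF H HS per q(1) start] unfolding H0 H1 .
  have pq: "path_in S (q +++ (\<lambda>s. H (s, 0)))"
    using q(1) start path_in_square(1)[OF H HS, of 0] by (simp add: pf)
  have "loop_around S b p (lasso (q +++ (\<lambda>s. H (s, 0))) (circ p (of_real (norm e))))"
    unfolding loop_around_iff using S(2) e pq q(2)
    by (intro exI[of _ "norm e"] conjI exI[of _ "q +++ (\<lambda>s. H (s, 0))"]) (auto simp: pf)
  then show ?thesis unfolding around_def mv by blast
qed

section \<open>A circle around two punctures\<close>

text \<open>The model for the neighbourhood of 1 after the substitution y = 1 + x + s \<zeta> with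
  s^2 = x: the two points of Q_0 sit at \<zeta> = 2 and \<zeta> = -2.\<close>

definition two_holed :: "complex set" where "two_holed = {\<zeta>. norm \<zeta> \<le> 8 \<and> \<zeta>\<^sup>2 \<noteq> 4}"

definition half_circle :: "real \<Rightarrow> complex" where "half_circle t = 8 * cis (- pi * t)"

lemma two_holed_uminus: "path_in two_holed p \<Longrightarrow> path_in two_holed (uminus \<circ> p)"
  by (rule path_in_compose) (auto simp: two_holed_def intro!: continuous_intros)

lemma not_four: "\<zeta> \<noteq> 2 \<Longrightarrow> \<zeta> \<noteq> -2 \<Longrightarrow> (\<zeta>::complex)\<^sup>2 \<noteq> 4"
proof -
  have "\<zeta>\<^sup>2 - 4 = (\<zeta> - 2) * (\<zeta> + 2)" by (simp add: power2_eq_square algebra_simps)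
  then show "\<zeta> \<noteq> 2 \<Longrightarrow> \<zeta> \<noteq> -2 \<Longrightarrow> \<zeta>\<^sup>2 \<noteq> 4" by (auto simp: eq_neg_iff_add_eq_0)
qed

lemma path_in_half_circle: "path_in two_holed half_circle"
proof (rule path_inI)
  fix t :: real
  have n: "norm (half_circle t) = 8" by (simp add: half_circle_def norm_mult)
  then have "half_circle t \<noteq> z" if "norm z = 2" for z using that by auto
  then have "half_circle t \<noteq> 2" "half_circle t \<noteq> -2" by simp_all
  then show "half_circle t \<in> two_holed" using n not_four by (simp add: two_holed_def)
qed (simp add: half_circle_def continuous_intros)

lemma circ_split: "circ 0 8 = half_circle +++ (uminus \<circ> half_circle)"
proof
  fix t :: real
  have "cis (- 2 * pi * t) = - cis (- pi * (2 * t - 1))" by (simp add: complex_eq_iff algebra_simps)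
  then show "circ 0 8 t = (half_circle +++ (uminus \<circ> half_circle)) t"
    by (simp add: joinpaths_def half_circle_def circ_def algebra_simps)
qed

lemma half_circle_split:
  defines "q1 \<equiv> \<lambda>t. 8 * cis (- pi * t / 2)" and "q2 \<equiv> \<lambda>t. 8 * cis (pi / 2 - pi * t / 2)"
  shows "half_circle = q1 +++ (uminus \<circ> q2)"
proof
  fix t :: real
  have "cis (- pi * t) = - cis (pi / 2 - pi * (2 * t - 1) / 2)"
    by (simp add: complex_eq_iff sin_diff cos_diff diff_divide_distrib algebra_simps)
  then show "half_circle t = (q1 +++ (uminus \<circ> q2)) t"
    by (simp add: joinpaths_def half_circle_def q1_def q2_def)
qed

text \<open>Cut the disc along the imaginary diameter; in each half a loop is determined by its winding number.\<close>

lemma two_holed_circle: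
  "loop_class two_holed (circ 0 8) =
     class_prod two_holed (loop_class two_holed (lasso (linepath 8 3) (circ 2 1)))
       (loop_class two_holed (lasso (reversepath (uminus \<circ> half_circle) +++ linepath (-8) (-3)) (circ (-2) (-1))))"
proof -
  \<comment> \<open>The right half of the disc; q1, then the diameter d upwards, then q2 form its
    clockwise boundary. The left half is the image under \<zeta> \<mapsto> - \<zeta>.\<close>
  define K :: "complex set" where "K = {\<zeta>. norm \<zeta> \<le> 8 \<and> 0 \<le> Re \<zeta>}"
  define q1 q2 d :: "real \<Rightarrow> complex" where "q1 t = 8 * cis (- pi * t / 2)" and "q2 t = 8 * cis (pi / 2 - pi * t / 2)"
    and "d = linepath (- 8 * \<i>) (8 * \<i>)" for t
  have hs: "half_circle = q1 +++ (uminus \<circ> q2)"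
    using half_circle_split unfolding q1_def[abs_def] q2_def[abs_def] .
  have e: "pathstart q1 = 8" "pathfinish q1 = - 8 * \<i>" "pathstart q2 = 8 * \<i>" "pathfinish q2 = 8"
     "pathstart d = - 8 * \<i>" "pathfinish d = 8 * \<i>"
    by (auto simp: q1_def q2_def d_def pathstart_def pathfinish_def linepath_def complex_eq_iff)
  have K: "convex K" "closed K" "cball 2 1 \<subseteq> K"
  proof -
    have K2: "K = cball 0 8 \<inter> {\<zeta>. 0 \<le> Re \<zeta>}" by (auto simp: K_def)
    show "convex K" unfolding K2 by (intro convex_Int convex_cball convex_halfspace_Re_ge)
    show "closed K" unfolding K2 by (intro closed_Int closed_cball closed_halfspace_Re_ge)
    show "cball 2 1 \<subseteq> K"
    proof
      fix z :: complex assume "z \<in> cball 2 1"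
      then have "norm (z - 2) \<le> 1" by (simp add: dist_norm norm_minus_commute)
      then show "z \<in> K" using norm_triangle_ineq[of "z - 2" 2] abs_Re_le_cmod[of "z - 2"] by (auto simp: K_def)
    qed
  qed
  have sub: "K - ball 2 1 \<subseteq> two_holed"
  proof
    fix z assume z: "z \<in> K - ball 2 1"
    then have "z \<noteq> 2" "z \<noteq> -2" by (auto simp: K_def)
    then show "z \<in> two_holed" using not_four z by (simp add: K_def two_holed_def)
  qed
  have far: "norm (z - 2) \<ge> 1" if "norm z = 8 \<or> Re z = 0" for z :: complex
    using norm_triangle_ineq2[of z 2] abs_Re_le_cmod[of "z - 2"] norm_minus_commute[of z 2] that by auto
  have pK: "path_in (K - ball 2 1) q1" "path_in (K - ball 2 1) q2" "path_in (K - ball 2 1) d"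
  proof -
    have KI: "z \<in> K - ball 2 1" if "norm z \<le> 8" "0 \<le> Re z" "norm z = 8 \<or> Re z = 0" for z
      using far[of z] that by (auto simp: K_def dist_norm norm_minus_commute)
    have cs: "0 \<le> cos (pi * t / 2)" "0 \<le> cos (pi / 2 - pi * t / 2)" if "0 \<le> t" "t \<le> 1" for t
    proof -
      have "0 \<le> pi * t" "pi * t \<le> pi" using that mult_left_mono[of t 1 pi] by simp_all
      then have "- (pi / 2) \<le> pi * t / 2" "pi * t / 2 \<le> pi / 2" "- (pi / 2) \<le> pi / 2 - pi * t / 2" "pi / 2 - pi * t / 2 \<le> pi / 2" by linarith+
      then show "0 \<le> cos (pi * t / 2)" "0 \<le> cos (pi / 2 - pi * t / 2)" by (simp_all only: cos_ge_zero)
    qed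
    have "q1 t \<in> K - ball 2 1" "q2 t \<in> K - ball 2 1" if "0 \<le> t" "t \<le> 1" for t
    proof -
      show "q1 t \<in> K - ball 2 1" by (rule KI) (use cs(1)[OF that] in \<open>simp_all add: q1_def norm_mult\<close>)
      show "q2 t \<in> K - ball 2 1" by (rule KI) (use cs(2)[OF that] in \<open>simp_all add: q2_def norm_mult\<close>)
    qed
    then show "path_in (K - ball 2 1) q1" "path_in (K - ball 2 1) q2"
      by (intro path_inI; simp add: q1_def q2_def continuous_intros)+
    have "Re (d t) = 0" "norm (d t) \<le> 8" if "0 \<le> t" "t \<le> 1" for t
    proof -
      have "d t = \<i> * of_real (16 * t - 8)" by (simp add: d_def linepath_def complex_eq_iff)
      then show "Re (d t) = 0" "norm (d t) \<le> 8" using that by (simp_all add: norm_mult del: of_real_diff of_real_mult)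
    qed
    then have "d t \<in> K - ball 2 1" if "0 \<le> t" "t \<le> 1" for t using that by (intro KI) simp_all
    then show "path_in (K - ball 2 1) d" by (intro path_inI) (simp_all add: d_def continuous_intros)
  qed
  have pM: "path_in two_holed q1" "path_in two_holed q2" "path_in two_holed d"
    using pK sub by (auto intro: path_in_subset)
  note pM' = pM two_holed_uminus[OF pM(1)] two_holed_uminus[OF pM(2)] two_holed_uminus[OF pM(3)]
  have e': "pathstart (uminus \<circ> p) = - pathstart p" "pathfinish (uminus \<circ> p) = - pathfinish p" for p :: "real \<Rightarrow> complex"
    by (simp_all add: pathstart_def pathfinish_def)
  have lin: "path_in (K - ball 2 1) (linepath 8 3)" "path_in (K - ball 2 1) (circ 2 1)"
  proof -
    have "linepath 8 3 t \<in> K - ball 2 1" if "0 \<le> t" "t \<le> 1" for t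
    proof -
      have "linepath 8 3 t = complex_of_real (8 - 5 * t)" by (simp add: linepath_def complex_eq_iff)
      then show ?thesis using that by (auto simp: K_def dist_norm norm_complex_def complex_eq_iff)
    qed
    then show "path_in (K - ball 2 1) (linepath 8 3)" by (intro path_inI) (auto intro!: continuous_intros)
    show "path_in (K - ball 2 1) (circ 2 1)" using K(3) by (intro path_in_circ) auto
  qed
  have L: "path_in (K - ball 2 1) (lasso (linepath 8 3) (circ 2 1))" using lin by simp
  have n2: "2 \<notin> path_image p" if "path_in (K - ball 2 1) p \<or> path_in two_holed p" for p
  proof -
    have "2 \<notin> K - ball 2 1" "2 \<notin> two_holed" by (simp_all add: two_holed_def)
    then show ?thesis using that not_in_path_image by blast
  qed
  \<comment> \<open>In the left half-plane, which misses 2, the diameter is homotopic to the left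
    half of the circle.\<close>
  have wd: "winding_number d 2 = winding_number (uminus \<circ> q2) 2 + winding_number (uminus \<circ> q1) 2"
  proof -
    let ?L = "{z::complex. Re z \<le> 0}"
    have "path_in ?L (uminus \<circ> q)" if "path_in (K - ball 2 1) q" for q
      using that by (rule path_in_compose) (auto simp: K_def intro!: continuous_intros)
    moreover have "path_in ?L d" unfolding d_def by (rule path_in_linepath[of ?L]) (auto simp: convex_halfspace_Re_le)
    ultimately have "loop_class (- {2}) d = loop_class (- {2}) ((uminus \<circ> q2) +++ (uminus \<circ> q1))"
      using pK e by (intro loop_class_convex[where K = ?L]) (auto simp: convex_halfspace_Re_le e')
    moreover have "path_in (- {2}) d" using n2[of d] pK(3) by (auto simp: path_in_def)
    ultimately have "homotopic_paths (- {2}) d ((uminus \<circ> q2) +++ (uminus \<circ> q1))" by (simp add: loop_class_eq_iff)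
    from winding_number_homotopic_paths[OF this] show ?thesis
      using n2[of "uminus \<circ> q1"] n2[of "uminus \<circ> q2"] pM' e by (subst (asm) winding_number_join) (auto simp: e' path_in_path)
  qed
  have wL: "winding_number (lasso (linepath 8 3) (circ 2 1)) 2 = winding_number (q1 +++ (d +++ q2)) 2"
  proof -
    have "winding_number (lasso (linepath 8 3) (circ 2 1)) 2 = winding_number (circ 2 1) 2"
      using lin n2[of "linepath 8 3"] n2[of "circ 2 1"] by (intro winding_number_lasso) (auto simp: path_in_path simp del: path_image_linepath)
    also have "\<dots> = winding_number (circ 2 8) 2" by (simp add: winding_number_circ)
    \<comment> \<open>Both 0 and 2 lie inside the circle of radius 8, so moving the point does not
      change the winding number.\<close>
    also have "\<dots> = winding_number (circ 0 8) 2"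
    proof -
      have "winding_number (\<lambda>t. circ 0 8 t - 2) 0 = winding_number (circ 0 8) 0"
      proof -
        have "winding_number (\<lambda>t. circ 0 8 t - 2) 0 = winding_number (\<lambda>t. circ 0 8 t - 0) 0"
        proof (rule winding_number_near)
          fix t :: real show "norm (circ 0 8 t - 2 - (circ 0 8 t - 0)) < norm (circ 0 8 t - 0)"
            using norm_circ[of 0 8 t] by simp
        qed (use path_circ[of 0 8] in \<open>auto simp: pathstart_def pathfinish_def circ_def path_def intro!: continuous_intros\<close>)
        then show ?thesis by simp
      qed
      then show ?thesis using winding_number_offset[of "circ 0 8" 2] by (simp add: winding_number_circ)
    qed
    also have "\<dots> = winding_number q1 2 + (winding_number (uminus \<circ> q2) 2 + winding_number (uminus \<circ> q1) 2) + winding_number q2 2"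
    proof -
      have "uminus \<circ> half_circle = (uminus \<circ> q1) +++ q2" unfolding hs path_compose_join by (simp add: comp_assoc[symmetric])
      then have "circ 0 8 = (q1 +++ (uminus \<circ> q2)) +++ ((uminus \<circ> q1) +++ q2)" by (simp add: circ_split hs)
      then show ?thesis
        using n2[of "uminus \<circ> q1"] n2[of "uminus \<circ> q2"] n2[of q1] n2[of q2] pM' e
        by (simp add: winding_number_join path_in_path e' path_image_join)
    qed
    also have "\<dots> = winding_number (q1 +++ (d +++ q2)) 2"
      unfolding wd[symmetric] using n2[of d] n2[of q1] n2[of q2] pM e
      by (simp add: winding_number_join path_in_path path_image_join)
    finally show ?thesis .
  qed
  have "loop_class (K - ball 2 1) (lasso (linepath 8 3) (circ 2 1)) = loop_class (K - ball 2 1) (q1 +++ (d +++ q2))"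
    using K L pK e wL by (intro loop_class_punctured_convex) auto
  from loop_class_subset[OF this L sub]
  have R: "loop_class two_holed (lasso (linepath 8 3) (circ 2 1)) = loop_class two_holed (q1 +++ (d +++ q2))" .
  have linM: "path_in two_holed (linepath 8 3)" "path_in two_holed (circ 2 1)" using lin sub by (auto intro: path_in_subset)
  have rd: "uminus \<circ> d = reversepath d" by (rule ext) (simp add: d_def linepath_def reversepath_def algebra_simps)
  have u: "uminus \<circ> lasso p h = lasso (uminus \<circ> p) (uminus \<circ> h)" for p h :: "real \<Rightarrow> complex"
    by (simp add: lasso_def path_compose_join path_compose_reversepath)
  have uu: "uminus \<circ> linepath 8 3 = linepath (-8) (- 3 :: complex)" "uminus \<circ> circ 2 1 = circ (-2) (-1)"
    by (rule ext, simp add: linepath_def circ_def algebra_simps scaleR_conv_of_real)+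
  have "homotopic_paths two_holed (lasso (linepath 8 3) (circ 2 1)) (q1 +++ (d +++ q2))"
    using R linM by (subst loop_class_eq_iff[symmetric]) auto
  then have "homotopic_paths two_holed (uminus \<circ> lasso (linepath 8 3) (circ 2 1)) (uminus \<circ> (q1 +++ (d +++ q2)))"
    by (rule homotopic_paths_continuous_image) (auto simp: two_holed_def intro!: continuous_intros)
  then have L': "loop_class two_holed (lasso (linepath (-8) (-3)) (circ (-2) (-1))) = loop_class two_holed ((uminus \<circ> q1) +++ (reversepath d +++ (uminus \<circ> q2)))"
    unfolding u uu path_compose_join rd by (rule loop_class_eqI)
  have linM': "path_in two_holed (linepath (-8) (-3))" "path_in two_holed (circ (-2) (-1))"
    using two_holed_uminus[OF linM(1)] two_holed_uminus[OF linM(2)] by (simp_all add: uu)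
  have us: "uminus \<circ> half_circle = (uminus \<circ> q1) +++ q2" unfolding hs path_compose_join by (simp add: comp_assoc[symmetric])
  let ?c = "loop_class two_holed"
  let ?r = "reversepath (uminus \<circ> half_circle)"
  have r: "path_in two_holed ?r" "pathstart ?r = 8" "pathfinish ?r = -8"
    unfolding us using pM' e by (auto simp: e')
  have "?c (lasso (?r +++ linepath (-8) (-3)) (circ (-2) (-1))) = ?c (lasso ?r (lasso (linepath (-8) (-3)) (circ (-2) (-1))))"
    using r linM' by (intro lasso_join) auto
  also have "\<dots> = ?c (lasso ?r ((uminus \<circ> q1) +++ (reversepath d +++ (uminus \<circ> q2))))"
    using r linM' L' by (intro lasso_cong) auto
  finally have A: "?c (lasso (?r +++ linepath (-8) (-3)) (circ (-2) (-1))) = \<dots>" .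
  have rr: "reversepath ((uminus \<circ> q1) +++ q2) = reversepath q2 +++ reversepath (uminus \<circ> q1)"
    using e by (intro reversepath_joinpaths) (simp add: e')
  then have rr': "reversepath (reversepath q2 +++ reversepath (uminus \<circ> q1)) = (uminus \<circ> q1) +++ q2"
    by (metis reversepath_reversepath)
  \<comment> \<open>Written out, the right-hand side contains q2, the negative of q1 and the
    diameter each next to an inverse; what survives after cancelling is the full circle.\<close>
  show ?thesis
    unfolding A R unfolding circ_split unfolding us unfolding hs
    using pM' e by (simp add: lasso_class rr rr' loop_class_join e' class_prod_assoc)
qed

lemma lasso_cong_tail:
  assumes "loop_class S q = loop_class S q'" "path_in S q" "path_in S q'" "path_in S h" "pathfinish q = pathstart h" "pathfinish q' = pathstart h"
    "pathfinish h = pathstart h"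
  shows "loop_class S (lasso q h) = loop_class S (lasso q' h)"
  using assms loop_class_reversepath[OF assms(1,2)] by (simp add: lasso_class)

text \<open>The target set varies with \<sigma>, as the punctured fibre does while x runs round a
  circle; \<open>family_commute\<close> assembles such a family into a square in the complement of
  the divisor.\<close>

definition path_family :: "(real \<Rightarrow> complex set) \<Rightarrow> (real \<Rightarrow> real \<Rightarrow> complex) \<Rightarrow> bool" where
  "path_family F g \<longleftrightarrow> continuous_on ({0..1} \<times> {0..1}) (\<lambda>z. g (fst z) (snd z)) \<and>
     (\<forall>\<sigma>\<in>{0..1}. \<forall>t\<in>{0..1}. g \<sigma> t \<in> F \<sigma>)"

lemma path_family_join:
  assumes "path_family F p" "path_family F q" "\<And>\<sigma>. \<sigma> \<in> {0..1} \<Longrightarrow> pathfinish (p \<sigma>) = pathstart (q \<sigma>)"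
  shows "path_family F (\<lambda>\<sigma>. p \<sigma> +++ q \<sigma>)"
  using assms unfolding path_family_def
  by (intro conjI continuous_on_homotopic_join_lemma) (auto simp: joinpaths_def)

lemma path_family_reversepath:
  assumes "path_family F p" shows "path_family F (\<lambda>\<sigma>. reversepath (p \<sigma>))"
proof -
  have "continuous_on ({0..1} \<times> {0..1}) ((\<lambda>z. p (fst z) (snd z)) \<circ> (\<lambda>z. (fst z, 1 - snd z)))"
    using assms unfolding path_family_def
    by (intro continuous_on_compose) (auto intro!: continuous_intros elim!: continuous_on_subset)
  then show ?thesis using assms by (simp add: path_family_def reversepath_def o_def)
qed

lemma path_family_lasso:
  assumes "path_family F p" "path_family F q" "\<And>\<sigma>. \<sigma> \<in> {0..1} \<Longrightarrow> pathfinish (p \<sigma>) = pathstart (q \<sigma>)"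
    "\<And>\<sigma>. \<sigma> \<in> {0..1} \<Longrightarrow> pathfinish (q \<sigma>) = pathstart (q \<sigma>)"
  shows "path_family F (\<lambda>\<sigma>. lasso (p \<sigma>) (q \<sigma>))"
  unfolding lasso_def using assms by (intro path_family_join path_family_reversepath) auto

lemma path_family_slice: "path_family F p \<Longrightarrow> \<sigma> \<in> {0..1} \<Longrightarrow> path_in (F \<sigma>) (p \<sigma>)"
  unfolding path_family_def
proof (rule path_inI)
  assume c: "continuous_on ({0..1} \<times> {0..1}) (\<lambda>z. p (fst z) (snd z)) \<and> (\<forall>\<sigma>\<in>{0..1}. \<forall>t\<in>{0..1}. p \<sigma> t \<in> F \<sigma>)" and \<sigma>: "\<sigma> \<in> {0..1}"
  have "continuous_on {0..1} ((\<lambda>z. p (fst z) (snd z)) \<circ> (\<lambda>t. (\<sigma>, t)))"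
    using c \<sigma> by (intro continuous_on_compose) (auto intro!: continuous_intros elim!: continuous_on_subset)
  then show "continuous_on {0..1} (p \<sigma>)" by (simp add: o_def)
qed auto

lemma path_family_const: "path g \<Longrightarrow> (\<And>\<sigma> t. \<sigma> \<in> {0..1} \<Longrightarrow> t \<in> {0..1} \<Longrightarrow> g t \<in> F \<sigma>) \<Longrightarrow> path_family F (\<lambda>_. g)"
  unfolding path_family_def path_def
proof (intro conjI ballI)
  assume "continuous_on {0..1} g"
  then have "continuous_on ({0..1} \<times> {0..1}) (g \<circ> snd)"
    by (intro continuous_on_compose) (auto intro!: continuous_intros elim!: continuous_on_subset)
  then show "continuous_on ({0..1} \<times> {0..1}) (\<lambda>z. g (snd z))" by (simp add: o_def)
qed

section \<open>The fibre near 1, and loops that move with x\<close>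

context cut_data begin

lemma near_one:
  assumes "0 < norm x" "norm x < \<epsilon>" "norm x = m\<^sup>2" "0 \<le> m" "norm (y - 1) \<le> 4 * r" "2 * m < norm (y - 1 - x)"
  shows "y \<in> fib x"
proof (rule near_puncture[OF assms(1,2) P_mem(2) assms(5)])
  show "1 \<noteq> (1::complex)" if "(y - 1 - x)\<^sup>2 = 4 * x"
  proof -
    have "norm (y - 1 - x) ^ 2 = (2 * m)\<^sup>2" using arg_cong[OF that, of norm] assms(3) by (simp add: norm_power norm_mult power_mult_distrib)
    then have "norm (y - 1 - x) = 2 * m" by (rule power2_eq_imp_eq) (use assms(4) in simp_all)
    then show ?thesis using assms(6) by simp
  qed
  show "conic x y 1 \<noteq> (A i * x + B i * y + C i)\<^sup>2" if "i \<in> {1..n-2}" "1 = Yp i \<or> 1 = Ym i" for i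
    using P_ne[OF that(1)] that(2) by auto
qed simp

lemma sqrt_norm:
  fixes s x :: complex
  assumes "s\<^sup>2 = x" "0 < norm x" "norm x < \<epsilon>"
  shows "norm x = (norm s)\<^sup>2" "0 < norm s" "20 * norm s < r" "20 * norm x \<le> norm s"
  using assms(1,2) sqrt_small[OF assms(1,3)] by (auto simp flip: norm_power)

text \<open>A local coordinate \<zeta> about the midpoint 1 + x of the two points of Q_0, in units
  of the square root \<open>s\<close> of x.\<close>

definition frame :: "complex \<Rightarrow> complex \<Rightarrow> complex \<Rightarrow> complex" where "frame x s \<zeta> = 1 + x + s * \<zeta>"

lemma frame_fib:
  assumes "s\<^sup>2 = x" "0 < norm x" "norm x < \<epsilon>" "\<zeta> \<in> two_holed"
  shows "frame x s \<zeta> \<in> fib x"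
proof -
  note sn = sqrt_norm[OF assms(1-3)]
  have z: "norm \<zeta> \<le> 8" "\<zeta>\<^sup>2 \<noteq> 4" using assms(4) by (auto simp: two_holed_def)
  have "norm (frame x s \<zeta> - 1) \<le> norm x + norm (s * \<zeta>)" unfolding frame_def using norm_triangle_ineq[of x "s * \<zeta>"] by simp
  also have "norm (s * \<zeta>) \<le> norm s * 8" unfolding norm_mult using z(1) by (intro mult_left_mono) auto
  finally have b: "norm (frame x s \<zeta> - 1) \<le> 4 * r" using sn r by linarith
  show ?thesis
  proof (rule near_puncture[OF assms(2,3) P_mem(2) b])
    show "1 \<noteq> (1::complex)" if "(frame x s \<zeta> - 1 - x)\<^sup>2 = 4 * x"
    proof -
      have "x * \<zeta>\<^sup>2 = 4 * x" using that assms(1) by (simp add: frame_def power_mult_distrib)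
      then show ?thesis using z(2) assms(2) by simp
    qed
    show "conic x (frame x s \<zeta>) 1 \<noteq> (A i * x + B i * frame x s \<zeta> + C i)\<^sup>2" if "i \<in> {1..n-2}" "1 = Yp i \<or> 1 = Ym i" for i
      using P_ne[OF that(1)] that(2) by auto
  qed simp
qed

lemma path_in_frame:
  assumes "s\<^sup>2 = x" "0 < norm x" "norm x < \<epsilon>" "path_in two_holed p"
  shows "path_in (fib x) (frame x s \<circ> p)"
  using assms(4) by (rule path_in_compose) (use frame_fib[OF assms(1-3)] in \<open>auto simp: frame_def intro!: continuous_intros\<close>)

lemma frame_circ: "frame x s \<circ> circ c e = circ (1 + x + s * c) (s * e)"
  by (rule ext) (simp add: frame_def circ_def algebra_simps)

lemma plane_loop:
  assumes "g \<in> loops_at (fib x) y"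
  shows "plane_point n A B C x \<circ> g \<in> loops_at X (plane_point n A B C x y)"
proof -
  have "path_in X (plane_point n A B C x \<circ> g)"
    using assms unfolding loops_at_iff
    by (auto intro!: path_in_compose[of "fib x"] continuous_on_plane_point continuous_intros simp: punctured_fibre_def)
  then show ?thesis using assms by (auto simp: loops_at_iff pathstart_def pathfinish_def)
qed

lemma plane_class:
  assumes "loop_class (fib x) g = loop_class (fib x) h" "path_in (fib x) g"
  shows "loop_class X (plane_point n A B C x \<circ> g) = loop_class X (plane_point n A B C x \<circ> h)"
proof (rule loop_class_eqI, rule homotopic_paths_continuous_image)
  show "homotopic_paths (fib x) g h" using assms loop_class_eq_iff by blast
qed (auto intro!: continuous_on_plane_point continuous_intros simp: punctured_fibre_def)

definition gamma :: "complex \<Rightarrow> real \<Rightarrow> cproj" where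
  "gamma a \<sigma> = plane_point n A B C (a * cis (2 * pi * \<sigma>)) b"

text \<open>In the square with x = a cis (2 pi \<sigma>) in one direction and the loop g \<sigma> in
  the other, the two sides along which x moves are both \<open>gamma a\<close>. A constant family
  yields commutation, a family that leads from one loop to another yields a conjugation.\<close>

lemma family_commute:
  assumes "path_family (\<lambda>\<sigma>. fib (a * cis (2 * pi * \<sigma>))) g" "\<And>\<sigma>. g \<sigma> 0 = b \<and> g \<sigma> 1 = b"
  shows "loop_class X (gamma a +++ (plane_point n A B C a \<circ> g 1)) = loop_class X ((plane_point n A B C a \<circ> g 0) +++ gamma a)"
proof (rule loop_class_eqI)
  define H where "H z = plane_point n A B C (a * cis (2 * pi * fst z)) (g (fst z) (snd z))" for z
  have "continuous_on ({0..1} \<times> {0..1}) H"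
    unfolding H_def using assms(1) by (intro continuous_on_plane_point continuous_intros) (auto simp: path_family_def)
  moreover have "H ` ({0..1} \<times> {0..1}) \<subseteq> X"
    using assms(1) by (auto simp: H_def path_family_def punctured_fibre_def)
  ultimately have h: "homotopic_paths X ((\<lambda>s. H (s, 0)) +++ (\<lambda>t. H (1, t))) ((\<lambda>t. H (0, t)) +++ (\<lambda>s. H (s, 1)))"
    by (rule square_homotopy)
  have H1: "(\<lambda>t. H (1, t)) = plane_point n A B C a \<circ> g 1" "(\<lambda>t. H (0, t)) = plane_point n A B C a \<circ> g 0"
    by (auto simp: H_def)
  have H0: "(\<lambda>s. H (s, 0)) = gamma a" "(\<lambda>s. H (s, 1)) = gamma a"
    using assms(2) by (auto simp: H_def gamma_def)
  show "homotopic_paths X (gamma a +++ (plane_point n A B C a \<circ> g 1)) ((plane_point n A B C a \<circ> g 0) +++ gamma a)"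
    using h unfolding H0 H1 .
qed

lemma outer_loop_commutes:
  assumes "0 < norm a" "norm a < \<epsilon>" "g \<in> loops_at S0 b"
  shows "loop_class X (gamma a +++ (plane_point n A B C a \<circ> g)) = loop_class X ((plane_point n A B C a \<circ> g) +++ gamma a)"
proof (rule family_commute[of a "\<lambda>_. g"])
  show "path_family (\<lambda>\<sigma>. fib (a * cis (2 * pi * \<sigma>))) (\<lambda>_. g)"
  proof (rule path_family_const)
    fix \<sigma> t :: real assume "t \<in> {0..1}"
    then have "g t \<in> S0" using assms(3) by (auto simp: loops_at_iff dest: path_in_D)
    then show "g t \<in> fib (a * cis (2 * pi * \<sigma>))" using S0_fib[of "a * cis (2 * pi * \<sigma>)"] assms(1,2) by (auto simp: norm_mult)
  qed (use assms(3) in \<open>auto simp: loops_at_iff path_in_path\<close>)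
qed (use assms(3) in \<open>auto simp: loops_at_iff pathstart_def pathfinish_def\<close>)

lemma gamma_loop:
  assumes "0 < norm a" "norm a < \<epsilon>" shows "gamma a \<in> loops_at X (plane_point n A B C a b)"
proof -
  have "path_in X (gamma a)"
    unfolding gamma_def
  proof (rule path_in_plane_point)
    fix t :: real show "b \<in> fib (a * cis (2 * pi * t))"
      using S0_fib[of "a * cis (2 * pi * t)"] bS assms by (auto simp: norm_mult)
  qed (auto simp: path_def intro!: continuous_intros)
  then show ?thesis by (simp add: loops_at_iff gamma_def pathstart_def pathfinish_def)
qed

end

section \<open>The two punctures near 1 and their exchange\<close>

locale branch_loops = cut_data +
  fixes a s e :: complex and q :: "real \<Rightarrow> complex"
  assumes a: "0 < norm a" "norm a < \<epsilon>" and s: "s\<^sup>2 = a"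
    and q: "path_in S0 q" "pathstart q = b" "pathfinish q = 1 + e" and e: "norm e = r"
begin

definition radius :: "real \<Rightarrow> real" where "radius \<sigma> = (1 - \<sigma>) * r + 8 * \<sigma> * norm s"

text \<open>Interpolates between the circle of radius r about 1 that starts at 1 + e and the circle
  of radius 8 |s| about 1 + a that starts at 1 + a + 8 s, the rim of the model
  \<open>two_holed\<close>. It avoids the punctures of every fibre with |x| = |a|, so that
  \<open>tail\<close> can be used while x moves.\<close>

definition collar :: "real \<Rightarrow> real \<Rightarrow> complex" where
  "collar \<sigma> t = 1 + of_real \<sigma> * a + of_real (radius \<sigma>) * cis ((1 - \<sigma>) * Arg e + \<sigma> * Arg s - 2 * pi * t)"

definition tail :: "real \<Rightarrow> complex" where "tail = q +++ (\<lambda>\<sigma>. collar \<sigma> 0)"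

lemmas s_norm = sqrt_norm[OF s a]

lemma near_one_a: "norm x = norm a \<Longrightarrow> norm (y - 1) \<le> 4 * r \<Longrightarrow> 2 * norm s < norm (y - 1 - x) \<Longrightarrow> y \<in> fib x"
  using near_one[of x "norm s" y] a s_norm by simp

lemma collar_fib:
  assumes "norm x = norm a" "0 \<le> \<sigma>" "\<sigma> \<le> 1"
  shows "collar \<sigma> t \<in> fib x"
proof (rule near_one_a[OF assms(1)])
  have "0 \<le> r - 8 * norm s" using s_norm(3) norm_ge_zero[of s] by linarith
  then have "0 \<le> (1 - \<sigma>) * (r - 8 * norm s)" "0 \<le> \<sigma> * (r - 8 * norm s)" using assms by (intro mult_nonneg_nonneg; simp)+
  then have R: "8 * norm s \<le> radius \<sigma>" "radius \<sigma> \<le> r" by (simp_all add: radius_def algebra_simps)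
  have c: "norm (collar \<sigma> t - (1 + of_real \<sigma> * a)) = radius \<sigma>" using R(1) by (simp add: collar_def norm_mult) (use norm_ge_zero[of s] in linarith)
  have sa: "norm (of_real \<sigma> * a) \<le> norm a" using assms mult_right_mono[of \<sigma> 1 "norm a"] by (simp add: norm_mult)
  show "norm (collar \<sigma> t - 1) \<le> 4 * r"
    using norm_triangle_ineq[of "collar \<sigma> t - (1 + of_real \<sigma> * a)" "of_real \<sigma> * a"] c sa R s_norm r by simp
  have "norm (of_real \<sigma> * a - x) \<le> 2 * norm a" using norm_triangle_ineq4[of "of_real \<sigma> * a" x] sa assms(1) by simp
  moreover have "collar \<sigma> t - (1 + of_real \<sigma> * a) = (collar \<sigma> t - 1 - x) - (of_real \<sigma> * a - x)" by simp
  then have "radius \<sigma> \<le> norm (collar \<sigma> t - 1 - x) + norm (of_real \<sigma> * a - x)" using norm_triangle_ineq4 c by metis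
  ultimately show "2 * norm s < norm (collar \<sigma> t - 1 - x)" using R s_norm by linarith
qed

lemma collar_ends: "collar 0 = circ 1 e" "collar 1 = circ (1 + a) (8 * s)"
proof -
  show "collar 0 = circ 1 e" using polar_rotate[of e] e by (intro ext) (simp add: collar_def circ_def radius_def)
  show "collar 1 = circ (1 + a) (8 * s)" using polar_rotate[of s] by (intro ext) (simp add: collar_def circ_def radius_def mult.assoc)
qed

lemma q_fib: "norm x = norm a \<Longrightarrow> path_in (fib x) q"
  using path_in_subset[OF q(1) S0_fib, of x] a by simp

lemma tail_ends [simp]: "pathstart tail = b" "pathfinish tail = 1 + a + 8 * s"
proof -
  have "pathfinish (\<lambda>\<sigma>. collar \<sigma> 0) = 1 + a + 8 * s" by (simp add: pathfinish_def collar_ends(2) circ_def)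
  then show "pathstart tail = b" "pathfinish tail = 1 + a + 8 * s" using q by (simp_all add: tail_def)
qed

lemma tail_fib: assumes "norm x = norm a" shows "path_in (fib x) tail"
proof -
  have "path_in (fib x) (\<lambda>\<sigma>. collar \<sigma> 0)"
  proof (rule path_inI)
    show "continuous_on {0..1} (\<lambda>\<sigma>. collar \<sigma> 0)" unfolding collar_def radius_def by (intro continuous_intros)
  qed (rule collar_fib[OF assms])
  moreover have "pathfinish q = pathstart (\<lambda>\<sigma>. collar \<sigma> 0)" using q(3) collar_ends(1) by (simp add: pathstart_def circ_def)
  ultimately show ?thesis using q_fib[OF assms] by (simp add: tail_def)
qed

abbreviation "F \<equiv> frame a s"
abbreviation "back_arc \<equiv> reversepath (uminus \<circ> half_circle)"

text \<open>The sign looks reversed because y_0^- is (1 + sqrt a)^2, which equals 1 + a + 2 s once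
  \<open>s\<close> is the principal root.\<close>

definition minus_loop :: "real \<Rightarrow> complex" where
  "minus_loop = lasso (tail +++ (F \<circ> linepath 8 3)) (circ (1 + a + 2 * s) s)"

definition plus_loop :: "real \<Rightarrow> complex" where
  "plus_loop = lasso (tail +++ (F \<circ> (back_arc +++ linepath (-8) (-3)))) (circ (1 + a - 2 * s) (- s))"

lemma two_holed_segments:
  "path_in two_holed (linepath 8 3)" "path_in two_holed (linepath (-8) (-3))"
  "path_in two_holed (circ 2 1)" "path_in two_holed (circ (-2) (-1))"
  "path_in two_holed back_arc" "pathstart back_arc = 8" "pathfinish back_arc = -8"
proof -
  have un: "uminus \<circ> linepath 8 3 = linepath (-8) (- 3 :: complex)" "uminus \<circ> circ 2 1 = circ (-2) (-1)"
    by (rule ext, simp add: linepath_def circ_def algebra_simps scaleR_conv_of_real)+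
  have "linepath 8 3 t \<in> two_holed" if "0 \<le> t" "t \<le> 1" for t
  proof -
    have l: "linepath 8 3 t = complex_of_real (8 - 5 * t)" by (simp add: linepath_def complex_eq_iff)
    have "8 - 5 * t \<noteq> 2" "8 - 5 * t \<noteq> - 2" using that by auto
    then have "complex_of_real (8 - 5 * t) \<noteq> 2" "complex_of_real (8 - 5 * t) \<noteq> - 2" by (simp_all add: complex_eq_iff)
    from not_four[OF this] have "(linepath 8 3 t :: complex) ^ 2 \<noteq> 4" unfolding l .
    moreover have "norm (complex_of_real (8 - 5 * t)) \<le> 8" unfolding norm_of_real using that by linarith
    ultimately show ?thesis unfolding two_holed_def l by blast
  qed
  then show l: "path_in two_holed (linepath 8 3)" by (intro path_inI) (auto intro!: continuous_intros)
  show c: "path_in two_holed (circ 2 1)"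
  proof (rule path_in_circ)
    show "sphere 2 (norm (1::complex)) \<subseteq> two_holed"
    proof
      fix z :: complex assume "z \<in> sphere 2 (norm (1::complex))"
      then have z: "norm (z - 2) = 1" by (simp add: dist_norm norm_minus_commute)
      then have "z \<noteq> 2" "z \<noteq> -2" "norm z \<le> 8" using norm_triangle_ineq[of "z - 2" 2] by auto
      then show "z \<in> two_holed" using not_four by (simp add: two_holed_def)
    qed
  qed
  show "path_in two_holed (linepath (-8) (-3))" "path_in two_holed (circ (-2) (-1))"
    using two_holed_uminus[OF l] two_holed_uminus[OF c] by (simp_all add: un)
  show "path_in two_holed back_arc" using two_holed_uminus[OF path_in_half_circle] by simp
  show "pathstart back_arc = 8" "pathfinish back_arc = -8"
    by (simp_all add: reversepath_def pathstart_def pathfinish_def half_circle_def complex_eq_iff)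
qed

lemmas F_segments = two_holed_segments(1-5)[THEN path_in_frame[OF s a]]

lemma F_simps: "F \<circ> circ 2 1 = circ (1 + a + 2 * s) s" "F \<circ> circ (-2) (-1) = circ (1 + a - 2 * s) (- s)"
   "F \<circ> circ 0 8 = circ (1 + a) (8 * s)" "F 8 = 1 + a + 8 * s" "F (-8) = 1 + a - 8 * s"
   "F 3 = 1 + a + 3 * s" "F (-3) = 1 + a - 3 * s"
  by (simp_all add: frame_circ frame_def algebra_simps)

lemma branch_loops_in:
  "path_in (fib a) (tail +++ (F \<circ> linepath 8 3))" "path_in (fib a) (circ (1 + a + 2 * s) s)"
  "path_in (fib a) (tail +++ (F \<circ> (back_arc +++ linepath (-8) (-3))))" "path_in (fib a) (circ (1 + a - 2 * s) (- s))"
  "minus_loop \<in> loops_at (fib a) b" "plus_loop \<in> loops_at (fib a) b"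
proof -
  note [simp] = pathstart_compose pathfinish_compose path_compose_join
  show 1: "path_in (fib a) (tail +++ (F \<circ> linepath 8 3))" "path_in (fib a) (circ (1 + a + 2 * s) s)"
  "path_in (fib a) (tail +++ (F \<circ> (back_arc +++ linepath (-8) (-3))))" "path_in (fib a) (circ (1 + a - 2 * s) (- s))"
    using F_segments tail_fib[of a] two_holed_segments(6,7) by (simp_all add: F_simps)
  show "minus_loop \<in> loops_at (fib a) b" "plus_loop \<in> loops_at (fib a) b"
    using 1 two_holed_segments(6,7) by (simp_all add: loops_at_iff minus_loop_def plus_loop_def F_simps)
qed

text \<open>The circle about 1 shrinks along the collar to the rim of the model, where
  \<open>two_holed_circle\<close> applies. This splits the single loop around the limit point 1 into
  loops around the two punctures that tend to it.\<close>

lemma circle_splits: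
  "loop_class (fib a) (lasso q (circ 1 e)) = class_prod (fib a) (loop_class (fib a) minus_loop) (loop_class (fib a) plus_loop)"
proof -
  note [simp] = pathstart_compose pathfinish_compose path_compose_join
  let ?c = "loop_class (fib a)"
  define H where "H z = collar (fst z) (snd z)" for z
  have H: "continuous_on ({0..1} \<times> {0..1}) H" unfolding H_def collar_def radius_def by (intro continuous_intros)
  have HS: "H ` ({0..1} \<times> {0..1}) \<subseteq> fib a" using collar_fib[of a] by (auto simp: H_def)
  have per: "H (\<sigma>, 0) = H (\<sigma>, 1)" for \<sigma> by (simp add: H_def collar_def complex_eq_iff sin_diff cos_diff)
  have start: "pathfinish q = H (0, 0)" using q(3) collar_ends(1) by (simp add: H_def circ_def)
  have "?c (lasso q (circ 1 e)) = ?c (lasso tail (F \<circ> circ 0 8))"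
    using lasso_move_base[OF H HS per q_fib[OF refl] start] by (simp add: H_def collar_ends F_simps(3) tail_def)
  define L1 where "L1 = lasso (linepath 8 3) (circ 2 1)"
  define L2 where "L2 = lasso (back_arc +++ linepath (-8) (-3)) (circ (-2) (-1))"
  have Lin: "path_in two_holed L1" "path_in two_holed L2" and Le: "pathstart L1 = 8" "pathfinish L1 = 8" "pathstart L2 = 8" "pathfinish L2 = 8"
    using two_holed_segments by (auto simp: L1_def L2_def)
  have c8: "path_in two_holed (circ 0 8)"
  proof -
    have "path_in two_holed (half_circle +++ (uminus \<circ> half_circle))"
      using path_in_half_circle two_holed_uminus[OF path_in_half_circle]
      by (subst path_in_join) (auto simp: half_circle_def pathstart_def pathfinish_def complex_eq_iff)
    then show ?thesis by (simp add: circ_split)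
  qed
  have "loop_class two_holed (circ 0 8) = loop_class two_holed (L1 +++ L2)"
    using two_holed_circle Lin Le by (simp add: loop_class_join L1_def L2_def)
  then have "homotopic_paths two_holed (circ 0 8) (L1 +++ L2)" using c8 loop_class_eq_iff by blast
  then have "homotopic_paths (fib a) (F \<circ> circ 0 8) (F \<circ> (L1 +++ L2))"
    by (rule homotopic_paths_continuous_image) (use frame_fib[OF s a] in \<open>auto simp: frame_def intro!: continuous_intros\<close>)
  then have FL: "?c (F \<circ> circ 0 8) = ?c ((F \<circ> L1) +++ (F \<circ> L2))" using loop_class_eqI by fastforce
  have FLin: "path_in (fib a) (F \<circ> L1)" "path_in (fib a) (F \<circ> L2)" "path_in (fib a) (F \<circ> circ 0 8)"
    using Lin c8 path_in_frame[OF s a] by auto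
  have lc: "F \<circ> lasso p h = lasso (F \<circ> p) (F \<circ> h)" for p h
    by (simp add: lasso_def path_compose_reversepath)
  have M: "?c minus_loop = ?c (lasso tail (F \<circ> L1))"
    unfolding minus_loop_def L1_def lc F_simps(1)
    by (rule lasso_join) (use F_segments tail_fib[of a] in \<open>simp_all add: F_simps\<close>)
  have P: "?c plus_loop = ?c (lasso tail (F \<circ> L2))"
    unfolding plus_loop_def L2_def lc F_simps(2)
    by (rule lasso_join) (use F_segments tail_fib[of a] two_holed_segments(6,7) in \<open>simp_all add: F_simps\<close>)
  have "?c (lasso q (circ 1 e)) = ?c (lasso tail (F \<circ> circ 0 8))" by fact
  also have "\<dots> = ?c (lasso tail ((F \<circ> L1) +++ (F \<circ> L2)))"
    using FLin FL tail_fib[of a] by (intro lasso_cong) (simp_all add: F_simps)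
  also have "\<dots> = class_prod (fib a) (?c minus_loop) (?c plus_loop)"
    unfolding M P using FLin Le tail_fib[of a]
    by (simp add: lasso_class loop_class_join F_simps class_prod_assoc)
  finally show ?thesis .
qed

lemma punctured_disc_fib:
  assumes "t\<^sup>2 = a" "0 < norm (y - (1 + a + 2 * t))" "norm (y - (1 + a + 2 * t)) \<le> norm t"
  shows "y \<in> fib a"
proof -
  define \<zeta> where "\<zeta> = (y - 1 - a) / t"
  have t: "t \<noteq> 0" using assms by auto
  have tz: "t * \<zeta> = y - 1 - a" using t by (simp add: \<zeta>_def)
  then have y: "y = frame a t \<zeta>" by (simp add: frame_def)
  have "y - (1 + a + 2 * t) = t * (\<zeta> - 2)" using tz by (simp add: right_diff_distrib)
  then have "\<zeta> \<noteq> 2" "norm t * norm (\<zeta> - 2) \<le> norm t * 1" using assms(2,3) by (auto simp: norm_mult)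
  then have z: "norm (\<zeta> - 2) \<le> 1" using t by (subst (asm) mult_le_cancel_left_pos) auto
  then have "\<zeta> \<noteq> -2" "norm \<zeta> \<le> 8" using norm_triangle_ineq[of "\<zeta> - 2" 2] by auto
  then have "\<zeta> \<in> two_holed" using not_four \<open>\<zeta> \<noteq> 2\<close> by (simp add: two_holed_def)
  then show ?thesis unfolding y by (rule frame_fib[OF assms(1) a])
qed

lemma branch_loops_around:
  "around (fib a) b (1 + a + 2 * s) (loop_class (fib a) minus_loop)"
  "around (fib a) b (1 + a - 2 * s) (loop_class (fib a) plus_loop)"
proof -
  note [simp] = pathstart_compose pathfinish_compose path_compose_join
  have s0: "s \<noteq> 0" using s a by auto
  show "around (fib a) b (1 + a + 2 * s) (loop_class (fib a) minus_loop)"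
    unfolding minus_loop_def
  proof (rule around_lasso[OF branch_loops_in(1)])
    have D: "y \<in> fib a" if "dist (1 + a + 2 * s) y \<le> norm s" "y \<noteq> 1 + a + 2 * s" for y
      using that by (intro punctured_disc_fib[OF s]) (auto simp: dist_norm norm_minus_commute)
    show "cball (1 + a + 2 * s) (norm s) - {1 + a + 2 * s} \<subseteq> fib a" by (intro subsetI D) simp_all
    show "sphere (1 + a + 2 * s + of_real \<sigma> * (1 + a + 2 * s - (1 + a + 2 * s))) (norm s) \<subseteq> fib a" for \<sigma>
      by (intro subsetI D) (use s0 in \<open>simp, force simp: dist_norm\<close>)
  qed (use s0 in \<open>simp_all add: F_simps\<close>)
  have s': "(- s)\<^sup>2 = a" using s by simp
  show "around (fib a) b (1 + a - 2 * s) (loop_class (fib a) plus_loop)"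
    unfolding plus_loop_def
  proof (rule around_lasso[OF branch_loops_in(3)])
    have D: "y \<in> fib a" if "dist (1 + a - 2 * s) y \<le> norm s" "y \<noteq> 1 + a - 2 * s" for y
      using that by (intro punctured_disc_fib[OF s']) (auto simp: dist_norm norm_minus_commute)
    show "cball (1 + a - 2 * s) (norm (- s)) - {1 + a - 2 * s} \<subseteq> fib a" by (intro subsetI D) simp_all
    show "sphere (1 + a - 2 * s + of_real \<sigma> * (1 + a - 2 * s - (1 + a - 2 * s))) (norm (- s)) \<subseteq> fib a" for \<sigma>
      by (intro subsetI D) (use s0 in \<open>simp, force simp: dist_norm\<close>)
  qed (use s0 two_holed_segments in \<open>simp_all add: F_simps\<close>)
qed

text \<open>While \<open>x\<close> runs once around \<open>0\<close>, its square root makes half a turn, which interchanges the two points.\<close>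

lemma branch_loops_exchange:
  "loop_class X (gamma a +++ (plane_point n A B C a \<circ> plus_loop)) = loop_class X ((plane_point n A B C a \<circ> minus_loop) +++ gamma a)"
proof -
  note [simp] = pathstart_compose pathfinish_compose path_compose_join
  define x z where "x \<sigma> = a * cis (2 * pi * \<sigma>)" and "z \<sigma> = s * cis (pi * \<sigma>)" for \<sigma> :: real
  \<comment> \<open>Connects the end of \<open>tail\<close>, which does not move, with the point 1 +
    x + 8 z at the rim of the frame as it stands at time \<sigma>.\<close>
  define \<tau> where "\<tau> \<sigma> t = 1 + x (\<sigma> * t) + 8 * z (\<sigma> * t)" for \<sigma> t
  define lin where "lin \<sigma> t = frame (x \<sigma>) (z \<sigma>) (linepath 8 3 t)" for \<sigma> t
  define tl where "tl \<sigma> = (tail +++ \<tau> \<sigma>) +++ lin \<sigma>" for \<sigma>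
  define g where "g \<sigma> = lasso (tl \<sigma>) (circ (1 + x \<sigma> + 2 * z \<sigma>) (z \<sigma>))" for \<sigma>
  have nx: "norm (x \<sigma>) = norm a" "norm (z \<sigma>) = norm s" for \<sigma> by (simp_all add: x_def z_def norm_mult)
  have z2: "(z \<sigma>)\<^sup>2 = x \<sigma>" for \<sigma>
  proof -
    have "(cis (pi * \<sigma>))\<^sup>2 = cis (2 * pi * \<sigma>)" by (simp add: power2_eq_square cis_mult mult.assoc)
    then show ?thesis by (simp add: x_def z_def power_mult_distrib s)
  qed
  note fx = frame_fib[OF z2 , unfolded nx, OF a]
  have ta: "path_family (\<lambda>\<sigma>. fib (x \<sigma>)) (\<lambda>_. tail)"
    using tail_fib nx by (intro path_family_const) (auto intro: path_in_path path_in_D)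
  have tau: "path_family (\<lambda>\<sigma>. fib (x \<sigma>)) \<tau>"
    unfolding path_family_def
  proof (intro conjI ballI)
    show "continuous_on ({0..1} \<times> {0..1}) (\<lambda>y. \<tau> (fst y) (snd y))" unfolding \<tau>_def x_def z_def by (intro continuous_intros)
    fix \<sigma> t
    show "\<tau> \<sigma> t \<in> fib (x \<sigma>)"
    proof (rule near_one_a[OF nx(1)])
      show "norm (\<tau> \<sigma> t - 1) \<le> 4 * r"
        using norm_triangle_ineq[of "x (\<sigma> * t)" "8 * z (\<sigma> * t)"] s_norm r by (simp add: \<tau>_def nx norm_mult)
      have "8 * z (\<sigma> * t) = (\<tau> \<sigma> t - 1 - x \<sigma>) - (x (\<sigma> * t) - x \<sigma>)" by (simp add: \<tau>_def)
      then have "norm (8 * z (\<sigma> * t)) \<le> norm (\<tau> \<sigma> t - 1 - x \<sigma>) + norm (x (\<sigma> * t) - x \<sigma>)" using norm_triangle_ineq4 by metis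
      then have "8 * norm s \<le> norm (\<tau> \<sigma> t - 1 - x \<sigma>) + norm (x (\<sigma> * t) - x \<sigma>)" by (simp add: nx norm_mult)
      moreover have "norm (x (\<sigma> * t) - x \<sigma>) \<le> 2 * norm a" using norm_triangle_ineq4[of "x (\<sigma> * t)" "x \<sigma>"] by (simp add: nx)
      ultimately show "2 * norm s < norm (\<tau> \<sigma> t - 1 - x \<sigma>)" using s_norm(2,4) by linarith
    qed
  qed
  have lins: "path_family (\<lambda>\<sigma>. fib (x \<sigma>)) lin"
    unfolding path_family_def
  proof (intro conjI ballI)
    show "continuous_on ({0..1} \<times> {0..1}) (\<lambda>y. lin (fst y) (snd y))" unfolding lin_def frame_def x_def z_def linepath_def by (intro continuous_intros)
    fix \<sigma> t :: real assume "t \<in> {0..1}"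
    then show "lin \<sigma> t \<in> fib (x \<sigma>)" unfolding lin_def using fx path_in_D[OF two_holed_segments(1)] by blast
  qed
  have cf: "frame (x \<sigma>) (z \<sigma>) (circ 2 1 t) = circ (1 + x \<sigma> + 2 * z \<sigma>) (z \<sigma>) t" for \<sigma> t
    by (simp add: frame_def circ_def algebra_simps)
  have circs: "path_family (\<lambda>\<sigma>. fib (x \<sigma>)) (\<lambda>\<sigma>. circ (1 + x \<sigma> + 2 * z \<sigma>) (z \<sigma>))"
    unfolding path_family_def
  proof (intro conjI ballI)
    show "continuous_on ({0..1} \<times> {0..1}) (\<lambda>y. circ (1 + x (fst y) + 2 * z (fst y)) (z (fst y)) (snd y))" unfolding circ_def x_def z_def by (intro continuous_intros)
    fix \<sigma> t :: real assume "t \<in> {0..1}"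
    then show "circ (1 + x \<sigma> + 2 * z \<sigma>) (z \<sigma>) t \<in> fib (x \<sigma>)" unfolding cf[symmetric] using fx path_in_D[OF two_holed_segments(3)] by blast
  qed
  have x0: "x 0 = a" "z 0 = s" "x 1 = a" "z 1 = - s" by (simp_all add: x_def z_def complex_eq_iff)
  have e1: "pathstart (\<tau> \<sigma>) = 1 + a + 8 * s" "pathfinish (\<tau> \<sigma>) = 1 + x \<sigma> + 8 * z \<sigma>"
    "pathstart (lin \<sigma>) = 1 + x \<sigma> + 8 * z \<sigma>" "pathfinish (lin \<sigma>) = 1 + x \<sigma> + 3 * z \<sigma>" for \<sigma>
    by (simp_all add: \<tau>_def lin_def frame_def pathstart_def pathfinish_def linepath_def x0 algebra_simps scaleR_conv_of_real)
  have tls: "path_family (\<lambda>\<sigma>. fib (x \<sigma>)) tl"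
    unfolding tl_def using ta tau lins e1 by (intro path_family_join) auto
  have te: "pathstart (tl \<sigma>) = b" "pathfinish (tl \<sigma>) = 1 + x \<sigma> + 3 * z \<sigma>" for \<sigma> by (simp_all add: tl_def e1)
  have gf: "path_family (\<lambda>\<sigma>. fib (x \<sigma>)) g"
    unfolding g_def using tls circs by (intro path_family_lasso) (auto simp: te)
  have gb: "pathstart (g \<sigma>) = b" "pathfinish (g \<sigma>) = b" for \<sigma> by (simp_all add: g_def tl_def)
  have comm: "loop_class X (gamma a +++ (plane_point n A B C a \<circ> g 1)) = loop_class X ((plane_point n A B C a \<circ> g 0) +++ gamma a)"
    using gf gb by (intro family_commute) (auto simp: x_def pathstart_def pathfinish_def)
  have t0: "path_in (fib a) (tl 0)" "path_in (fib a) (tl 1)" "path_in (fib a) (\<tau> 1)"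
    using path_family_slice[OF tls, of 0] path_family_slice[OF tls, of 1] path_family_slice[OF tau, of 1] by (simp_all add: x0)
  have l0: "lin 0 = F \<circ> linepath 8 3" and l1: "lin 1 = F \<circ> linepath (-8) (-3)"
    by (auto simp: lin_def x0 frame_def linepath_def fun_eq_iff algebra_simps scaleR_conv_of_real)
  have "1 + a + 8 * s \<in> fib a" using path_in_D[OF tail_fib[OF refl], of 1] tail_ends(2) by (simp add: pathfinish_def)
  moreover have "\<tau> 0 = (\<lambda>_. pathfinish tail)" by (simp add: \<tau>_def x0 fun_eq_iff)
  ultimately have "loop_class (fib a) (tl 0) = loop_class (fib a) (tail +++ (F \<circ> linepath 8 3))"
    using F_segments(1) tail_fib[of a] by (simp add: tl_def l0 loop_class_join F_simps)
  then have G0: "loop_class (fib a) (g 0) = loop_class (fib a) minus_loop"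
    unfolding g_def minus_loop_def x0 using t0 branch_loops_in by (intro lasso_cong_tail) (auto simp: tl_def e1 x0 F_simps)
  \<comment> \<open>\<open>\<tau> 1\<close> is 1 + x t + 8 z t and the back arc of the model is 1 +
    a + 8 z t. They differ by at most 2 |a|, far less than the distance of order |s| to the
    punctures.\<close>
  have "homotopic_paths (fib a) (\<tau> 1) (F \<circ> back_arc)"
  proof (rule homotopic_paths_linear)
    show "path (\<tau> 1)" "path (F \<circ> back_arc)" using t0(3) F_segments(5) by (auto intro: path_in_path)
    show "pathstart (F \<circ> back_arc) = pathstart (\<tau> 1)" "pathfinish (F \<circ> back_arc) = pathfinish (\<tau> 1)"
      using two_holed_segments(6,7) by (simp_all add: e1 F_simps x0)
    fix t :: real
    have ba: "back_arc t = 8 * cis (pi * t)" by (simp add: reversepath_def half_circle_def complex_eq_iff algebra_simps)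
    show "closed_segment (\<tau> 1 t) ((F \<circ> back_arc) t) \<subseteq> fib a"
    proof
      fix y assume y: "y \<in> closed_segment (\<tau> 1 t) ((F \<circ> back_arc) t)"
      define w where "w = 1 + a + 8 * z t"
      have "norm (\<tau> 1 t - w) = norm (x t - a)" by (simp add: \<tau>_def w_def)
      also have "\<dots> \<le> 2 * norm a" using norm_triangle_ineq4[of "x t" a] by (simp add: nx)
      finally have "\<tau> 1 t \<in> cball w (2 * norm a)" by (simp add: dist_norm norm_minus_commute)
      moreover have "(F \<circ> back_arc) t = w" using ba by (simp add: w_def frame_def z_def mult.left_commute)
      then have "(F \<circ> back_arc) t \<in> cball w (2 * norm a)" by simp
      ultimately have "y \<in> cball w (2 * norm a)" using closed_segment_subset[OF _ _ convex_cball] y by blast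
      then have yw: "norm (y - w) \<le> 2 * norm a" by (simp add: dist_norm norm_minus_commute)
      show "y \<in> fib a"
      proof (rule near_one_a[OF refl])
        have "y - 1 = (y - w) + a + 8 * z t" by (simp add: w_def)
        then have "norm (y - 1) \<le> norm (y - w) + norm a + norm (8 * z t)" by (metis norm_triangle_ineq norm_triangle_mono order_refl)
        then show "norm (y - 1) \<le> 4 * r" using yw s_norm r by (simp add: nx norm_mult)
        have "8 * z t = (y - 1 - a) - (y - w)" by (simp add: w_def)
        then have "norm (8 * z t) \<le> norm (y - 1 - a) + norm (y - w)" by (metis norm_triangle_ineq4)
        then have "8 * norm s \<le> norm (y - 1 - a) + norm (y - w)" by (simp add: nx norm_mult)
        then show "2 * norm s < norm (y - 1 - a)" using yw s_norm(2,4) by linarith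
      qed
    qed
  qed
  then have "loop_class (fib a) (\<tau> 1) = loop_class (fib a) (F \<circ> back_arc)" by (rule loop_class_eqI)
  then have "loop_class (fib a) (tl 1) = loop_class (fib a) (tail +++ (F \<circ> (back_arc +++ linepath (-8) (-3))))"
    using F_segments tail_fib[of a] t0(3) two_holed_segments(6,7)
    by (simp add: tl_def l1 loop_class_join F_simps e1 x0 class_prod_assoc)
  then have G1: "loop_class (fib a) (g 1) = loop_class (fib a) plus_loop"
    unfolding g_def plus_loop_def x0 using t0 branch_loops_in two_holed_segments(6,7)
    by (simp, intro lasso_cong_tail) (auto simp: tl_def e1 x0 F_simps)
  have gin: "path_in (fib a) (g 0)" "path_in (fib a) (g 1)"
    using path_family_slice[OF gf, of 0] path_family_slice[OF gf, of 1] by (simp_all add: x0)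
  have pp: "plane_point n A B C a \<circ> h \<in> loops_at X (plane_point n A B C a b)" if "h \<in> {g 0, g 1, plus_loop, minus_loop}" for h
    using that gin gb branch_loops_in(5,6) by (intro plane_loop) (auto simp: loops_at_iff)
  have gl: "gamma a \<in> loops_at X (plane_point n A B C a b)" by (rule gamma_loop[OF a])
  from comm show ?thesis
    using plane_class[OF G0 gin(1)] plane_class[OF G1 gin(2)] pp gl
    by (simp add: loop_class_join loops_at_iff)
qed

end

section \<open>The standard loops\<close>

lemma (in group) foldr_mult_start:
  "set xs \<subseteq> carrier G \<Longrightarrow> w \<in> carrier G \<Longrightarrow> foldr (\<otimes>) xs w = foldr (\<otimes>) xs \<one> \<otimes> w"
  by (induction xs) (auto simp: m_assoc foldr_mult_closed)

lemma (in group) foldr_mult_conj: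
  assumes "k \<in> carrier G" "w \<in> carrier G" "\<And>i. i \<in> set is \<Longrightarrow> f i \<in> carrier G"
  shows "foldr (\<otimes>) (map (\<lambda>i. k \<otimes> f i \<otimes> inv k) is) (k \<otimes> w) = k \<otimes> foldr (\<otimes>) (map f is) w"
  using assms(3)
proof (induction "is")
  case (Cons i "is")
  have c: "foldr (\<otimes>) (map f is) w \<in> carrier G"
  proof -
    have "set (map f is) \<subseteq> carrier G" using Cons.prems by auto
    from foldr_mult_start[OF this assms(2)] foldr_mult_closed[OF this] show ?thesis using assms(2) by simp
  qed
  have "k \<otimes> f i \<otimes> inv k \<otimes> (k \<otimes> foldr (\<otimes>) (map f is) w) = k \<otimes> (f i \<otimes> (inv k \<otimes> (k \<otimes> foldr (\<otimes>) (map f is) w)))"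
    using c assms(1) Cons.prems by (simp add: m_assoc)
  also have "inv k \<otimes> (k \<otimes> foldr (\<otimes>) (map f is) w) = foldr (\<otimes>) (map f is) w"
    using c assms(1) by (simp flip: m_assoc)
  finally show ?case using Cons by simp
qed simp

lemma winding_number_lasso_in:
  assumes "path_in S q" "path_in S h" "pathfinish q = pathstart h" "pathfinish h = pathstart h" "z \<notin> S"
  shows "winding_number (lasso q h) z = winding_number h z"
  using assms(3,4) not_in_path_image[OF assms(1,5)] not_in_path_image[OF assms(2,5)] path_in_path[OF assms(1)] path_in_path[OF assms(2)]
  by (intro winding_number_lasso)

lemma winding_number_const: "c \<noteq> z \<Longrightarrow> winding_number (\<lambda>t. c) z = 0"
  using winding_number_trivial[of z c] unfolding linepath_refl by simp

text \<open>\<open>Q c\<close> and \<open>E c\<close> are the tails and complex radii of a system of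
  lassos that is already in the required order, \<open>ginf\<close> is the outer loop, and
  \<open>yp i\<close>, \<open>ym i\<close> are the actual punctures near the limits. Beyond
  \<open>Bd\<close> there are no discs, so the outer loop can be deformed there.\<close>

locale loop_setup = branch_loops +
  fixes yp ym :: "nat \<Rightarrow> complex" and Q E ginf Bd
  assumes s_eq: "s = csqrt a" and QE1: "Q 1 = q" "E 1 = e"
    and QE: "c \<in> P \<Longrightarrow> path_in S0 (Q c)" "c \<in> P \<Longrightarrow> pathstart (Q c) = b"
      "c \<in> P \<Longrightarrow> pathfinish (Q c) = c + E c" "c \<in> P \<Longrightarrow> norm (E c) = r"
    and ginf: "ginf \<in> loops_at S0 b" "path_image ginf \<subseteq> {y. Bd \<le> norm y}" "winding_number ginf 0 = 1"
    and Bd: "0 < Bd" "Bd \<le> norm b" "{y. Bd \<le> norm y} \<subseteq> S0"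
    and product: "foldr (mult (fundamental_group S0 b)) (map (\<lambda>c. loop_class S0 (lasso (Q c) (circ c (E c))))
       ([0] @ map Yp [1..<n-1] @ [1] @ map Ym [1..<n-1])) (one (fundamental_group S0 b))
         \<otimes>\<^bsub>fundamental_group S0 b\<^esub> loop_class S0 ginf = one (fundamental_group S0 b)"
    and points: "i \<in> {1..n-2} \<Longrightarrow> {yp i, ym i} = {y. conic a y 1 - (A i * a + B i * y + C i)\<^sup>2 = 0}"
      "i \<in> {1..n-2} \<Longrightarrow> norm (yp i - Yp i) < r" "i \<in> {1..n-2} \<Longrightarrow> norm (ym i - Ym i) < r"
    and args: "i \<in> {1..n-2} \<Longrightarrow> 0 < Arg ((yp i - (a + 1)) / ((1 - csqrt a)\<^sup>2 - (a + 1)))"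
      "i \<in> {1..n-2} \<Longrightarrow> Arg ((yp i - (a + 1)) / ((1 - csqrt a)\<^sup>2 - (a + 1))) < pi"
      "i \<in> {1..n-2} \<Longrightarrow> j \<in> {1..n-2} \<Longrightarrow> i < j \<Longrightarrow>
         Arg ((yp i - (a + 1)) / ((1 - csqrt a)\<^sup>2 - (a + 1))) < Arg ((yp j - (a + 1)) / ((1 - csqrt a)\<^sup>2 - (a + 1)))"
begin

definition outer_loop :: "complex \<Rightarrow> real \<Rightarrow> complex" where "outer_loop c = lasso (Q c) (circ c (E c))"

lemma r_circ: "c \<in> P \<Longrightarrow> path_in S0 (circ c (E c))"
proof (rule path_in_circ)
  assume c: "c \<in> P"
  show "sphere c (norm (E c)) \<subseteq> S0"
  proof
    fix y assume "y \<in> sphere c (norm (E c))"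
    then have y: "dist c y = r" using QE(4)[OF c] by simp
    have "r \<le> dist c' y" if "c' \<in> P" for c'
    proof (cases "c' = c")
      case False
      then show ?thesis using sep[OF that c] dist_triangle[of c' c y] y r by (simp add: dist_commute)
    qed (simp add: y)
    then show "y \<in> S0" by (simp add: S0_def)
  qed
qed

lemma outer_loop: "c \<in> P \<Longrightarrow> outer_loop c \<in> loops_at S0 b"
  using QE r_circ by (simp add: outer_loop_def loops_at_iff)

lemma outer_loop_winding:
  assumes "c \<in> P" "c' \<in> P" shows "winding_number (outer_loop c) c' = (if c' = c then - 1 else 0)"
proof -
  have "c' \<notin> S0" using assms(2) r by (force simp: S0_def)
  then have "winding_number (outer_loop c) c' = winding_number (circ c (E c)) c'"
    unfolding outer_loop_def using QE[OF assms(1)] r_circ[OF assms(1)]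
    \<open>c' \<notin> S0\<close> by (intro winding_number_lasso_in[of S0]) auto
  moreover have "E c \<noteq> 0" using QE(4)[OF assms(1)] r by auto
  moreover have "norm (E c) < dist c' c" if "c' \<noteq> c" using sep[OF assms(2,1) that] QE(4)[OF assms(1)] r by simp
  ultimately show ?thesis by (simp add: winding_number_circ winding_number_circ_outside)
qed

lemma S0_sub: "S0 \<subseteq> fib a" using S0_fib[OF a] .

lemma b_fib: "b \<in> fib a" using S0_sub bS by blast

lemma outer_loop_fib: "c \<in> P \<Longrightarrow> outer_loop c \<in> loops_at (fib a) b"
  using outer_loop[of c] S0_sub by (auto simp: loops_at_iff intro: path_in_subset)

abbreviation "fl g \<equiv> loop_class (fib a) g"
abbreviation "pi_fib \<equiv> fundamental_group (fib a) b"
abbreviation "pi_X \<equiv> fundamental_group X (plane_point n A B C a b)"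
abbreviation "pp \<equiv> plane_point n A B C a"

lemma group_fib: "group pi_fib" by (rule group_fundamental_group[OF b_fib])

lemma product_fib:
  "foldr (mult pi_fib) (map (\<lambda>c. fl (outer_loop c)) ([0] @ map Yp [1..<n-1] @ [1] @ map Ym [1..<n-1])) (one pi_fib)
     \<otimes>\<^bsub>pi_fib\<^esub> fl ginf = one pi_fib"
proof -
  interpret G: group "fundamental_group S0 b" by (rule group_fundamental_group[OF bS])
  let ?i = "induced S0 (fib a) (\<lambda>y. y)"
  let ?ds = "[0] @ map Yp [1..<n-1] @ [1] @ map Ym [1..<n-1]"
  let ?xs = "map (\<lambda>c. loop_class S0 (lasso (Q c) (circ c (E c)))) ?ds"
  have hom: "?i \<in> hom (fundamental_group S0 b) pi_fib"
    using induced_hom[of S0 "\<lambda>y. y" "fib a" b] S0_sub by simp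
  have ds: "set ?ds = P" by (simp add: P_def)
  have ic: "?i (loop_class S0 g) = fl g" if "g \<in> loops_at S0 b" for g
    using induced_class[of S0 "\<lambda>y. y" "fib a" g] S0_sub that by (simp add: loops_at_iff o_def)
  have xs: "set ?xs \<subseteq> carrier (fundamental_group S0 b)"
    using outer_loop ds unfolding fundamental_group_carrier outer_loop_def by (metis (no_types, lifting) image_mono image_subsetI imageI list.set_map)
  let ?f = "foldr (mult (fundamental_group S0 b)) ?xs (one (fundamental_group S0 b))"
  have mp: "map ?i ?xs = map (\<lambda>c. fl (outer_loop c)) ?ds"
    unfolding map_map
  proof (rule map_cong[OF refl])
    fix c assume "c \<in> set ?ds"
    then show "(?i \<circ> (\<lambda>c. loop_class S0 (lasso (Q c) (circ c (E c))))) c = fl (outer_loop c)"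
      unfolding ds using ic outer_loop by (simp add: outer_loop_def)
  qed
  have "?i ?f = foldr (mult pi_fib) (map ?i ?xs) (one pi_fib)"
    by (rule hom_foldr_mult[OF G.group_axioms group_fib hom xs])
  then have "foldr (mult pi_fib) (map (\<lambda>c. fl (outer_loop c)) ?ds) (one pi_fib) \<otimes>\<^bsub>pi_fib\<^esub> fl ginf = ?i ?f \<otimes>\<^bsub>pi_fib\<^esub> ?i (loop_class S0 ginf)"
    unfolding mp ic[OF ginf(1)] by (simp only:)
  also have "\<dots> = ?i (?f \<otimes>\<^bsub>fundamental_group S0 b\<^esub> loop_class S0 ginf)"
    using hom G.foldr_mult_closed[OF xs] ginf(1) by (intro hom_mult[symmetric]) (auto simp: fundamental_group_carrier)
  also have "\<dots> = one pi_fib"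
    unfolding product using ic[of "\<lambda>_. b"] bS by (simp add: fundamental_group_one loops_at_iff)
  finally show ?thesis .
qed

text \<open>The puncture \<open>p\<close> lies inside the disc about its limit \<open>c\<close>, so
  the circle about \<open>c\<close> slides to one about \<open>p\<close> without meeting another
  puncture. The point 1 is excluded, as its disc contains two punctures.\<close>

lemma puncture_loop:
  assumes c: "c \<in> P" and p: "norm (p - c) < r" and ne: "p \<noteq> 0 \<Longrightarrow> c \<noteq> 0" "c \<noteq> 1"
    and only: "\<And>y i. i \<in> {1..n-2} \<Longrightarrow> c = Yp i \<or> c = Ym i \<Longrightarrow> norm (y - c) \<le> 4 * r \<Longrightarrow> conic a y 1 = (A i * a + B i * y + C i)\<^sup>2 \<Longrightarrow> y = p"
  shows "around (fib a) b p (fl (outer_loop c))"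
proof -
  have D: "y \<in> fib a" if "norm (y - c) \<le> 4 * r" "y \<noteq> p" for y
    using that only ne by (intro near_puncture[OF a c]) auto
  show ?thesis unfolding outer_loop_def
  proof (rule around_lasso)
    show "path_in (fib a) (Q c)" using QE(1)[OF c] S0_sub by (rule path_in_subset)
    show "cball p (norm (E c)) - {p} \<subseteq> fib a"
    proof
      fix y assume "y \<in> cball p (norm (E c)) - {p}"
      then show "y \<in> fib a" using QE(4)[OF c] p r norm_triangle_ineq[of "y - p" "p - c"]
        by (intro D) (auto simp: dist_norm norm_minus_commute)
    qed
    fix \<sigma> :: real assume s: "0 \<le> \<sigma>" "\<sigma> \<le> 1"
    have 1: "norm (of_real \<sigma> * (p - c)) \<le> norm (p - c)" using s mult_right_mono[of \<sigma> 1 "norm (p - c)"] by (simp add: norm_mult)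
    have "of_real \<sigma> * (p - c) - (p - c) = - (of_real (1 - \<sigma>) * (p - c))" by (simp add: algebra_simps)
    then have "norm (of_real \<sigma> * (p - c) - (p - c)) = \<bar>1 - \<sigma>\<bar> * norm (p - c)" by (simp add: norm_mult del: of_real_diff)
    then have 2: "norm (of_real \<sigma> * (p - c) - (p - c)) \<le> norm (p - c)" using s mult_right_mono[of "\<bar>1 - \<sigma>\<bar>" 1 "norm (p - c)"] by simp
    show "sphere (c + of_real \<sigma> * (p - c)) (norm (E c)) \<subseteq> fib a"
    proof
      fix y assume "y \<in> sphere (c + of_real \<sigma> * (p - c)) (norm (E c))"
      then have y: "norm (y - c - of_real \<sigma> * (p - c)) = r" using QE(4)[OF c] by (simp add: dist_norm norm_minus_commute algebra_simps)
      then have "norm (y - c) \<le> 4 * r" using norm_triangle_ineq[of "y - c - of_real \<sigma> * (p - c)" "of_real \<sigma> * (p - c)"] 1 p r by simp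
      moreover have "y \<noteq> p" using y 2 p norm_minus_commute[of "p - c" "of_real \<sigma> * (p - c)"] by auto
      ultimately show "y \<in> fib a" by (rule D)
    qed
  qed (use QE[OF c] r in auto)
qed

lemma index_unique:
  assumes "i \<in> {1..n-2}" "j \<in> {1..n-2}"
  shows "Yp i = Yp j \<Longrightarrow> i = j" "Ym i = Ym j \<Longrightarrow> i = j" "Yp i \<noteq> Ym j"
proof -
  have "inj_on Yp {1..<n-1}" "inj_on Ym {1..<n-1}" "Yp ` {1..<n-1} \<inter> Ym ` {1..<n-1} = {}"
    using dist by (auto simp: distinct_map)
  moreover have "i \<in> {1..<n-1}" "j \<in> {1..<n-1}" using assms by auto
  ultimately show "Yp i = Yp j \<Longrightarrow> i = j" "Ym i = Ym j \<Longrightarrow> i = j" "Yp i \<noteq> Ym j"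
    by (meson inj_onD, meson inj_onD, metis disjoint_iff imageI)
qed

lemma root_cases:
  assumes "i \<in> {1..n-2}" "conic a y 1 = (A i * a + B i * y + C i)\<^sup>2"
  shows "y = yp i \<or> y = ym i"
proof -
  have "y \<in> {yp i, ym i}" unfolding points(1)[OF assms(1)] using assms(2) by simp
  then show ?thesis by simp
qed

lemma outer_around:
  "around (fib a) b 0 (fl (outer_loop 0))"
  "i \<in> {1..n-2} \<Longrightarrow> around (fib a) b (yp i) (fl (outer_loop (Yp i)))"
  "i \<in> {1..n-2} \<Longrightarrow> around (fib a) b (ym i) (fl (outer_loop (Ym i)))"
proof -
  show "around (fib a) b 0 (fl (outer_loop 0))"
    using P_ne r by (intro puncture_loop[OF P_mem(1)]) (auto simp: eq_commute[of 0])
  assume i: "i \<in> {1..n-2}"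
  have far: "8 * r < norm (Yp i - Ym i)" using sep[OF P_mem(3)[OF i] P_mem(4)[OF i]] index_unique(3)[OF i i] by (simp add: dist_norm)
  show "around (fib a) b (yp i) (fl (outer_loop (Yp i)))"
  proof (rule puncture_loop[OF P_mem(3)[OF i]])
    fix y j assume j: "j \<in> {1..n-2}" "Yp i = Yp j \<or> Yp i = Ym j" and y: "norm (y - Yp i) \<le> 4 * r" "conic a y 1 = (A j * a + B j * y + C j)\<^sup>2"
    then have "j = i" using index_unique i by blast
    then have "y = yp i \<or> y = ym i" using root_cases y(2) i by simp
    moreover have "y \<noteq> ym i"
      using y(1) points(3)[OF i] far r norm_triangle_ineq4[of "ym i - Ym i" "ym i - Yp i"] by auto
    ultimately show "y = yp i" by blast
  qed (use P_ne[OF i] points[OF i] in auto)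
  show "around (fib a) b (ym i) (fl (outer_loop (Ym i)))"
  proof (rule puncture_loop[OF P_mem(4)[OF i]])
    fix y j assume j: "j \<in> {1..n-2}" "Ym i = Yp j \<or> Ym i = Ym j" and y: "norm (y - Ym i) \<le> 4 * r" "conic a y 1 = (A j * a + B j * y + C j)\<^sup>2"
    then have "j = i" using index_unique i by metis
    then have "y = yp i \<or> y = ym i" using root_cases y(2) i by simp
    moreover have "y \<noteq> yp i"
      using y(1) points(2)[OF i] far r norm_triangle_ineq4[of "yp i - Ym i" "yp i - Yp i"] by auto
    ultimately show "y = ym i" by blast
  qed (use P_ne[OF i] points[OF i] in auto)
qed

text \<open>\<open>loop_around_infinity\<close> prescribes a round circle reached by a tail. With
  radius |b| the tail is an arc from \<open>b\<close> to the positive real axis, and outside the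
  disc of radius \<open>Bd\<close> the winding number decides the class.\<close>

lemma infinity_loop: "\<exists>g. loop_around_infinity (fib a) b g \<and> g \<in> loops_at (fib a) b \<and> fl g = fl ginf"
proof -
  let ?O = "{y::complex. Bd \<le> norm y}"
  define tl where "tl t = of_real (norm b) * cis ((1 - t) * Arg b)" for t
  define h where "h \<tau> = of_real (norm b) * cis (2 * pi * \<tau>)" for \<tau>
  define g where "g = lasso tl h"
  have O: "?O \<subseteq> fib a" using Bd(3) S0_sub by blast
  have nb: "0 < norm b" using Bd by linarith
  have tl: "path_in ?O tl" "pathstart tl = b" "pathfinish tl = of_real (norm b)"
    using Bd(2) rcis_cmod_Arg[of b]
    by (auto intro!: path_inI continuous_intros simp: tl_def norm_mult pathstart_def pathfinish_def rcis_def)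
  have h: "path_in ?O h" "pathstart h = of_real (norm b)" "pathfinish h = of_real (norm b)"
    using Bd(2) by (auto intro!: path_inI continuous_intros simp: h_def norm_mult pathstart_def pathfinish_def)
  have g: "path_in ?O g" "pathstart g = b" "pathfinish g = b" using tl h by (simp_all add: g_def)
  have "winding_number h 0 = 1"
  proof -
    have "h \<tau> = exp (of_real (ln (norm b)) + \<i> * of_real (2 * pi * \<tau>))" for \<tau>
      using nb by (simp add: h_def exp_add cis_conv_exp exp_of_real)
    then have "winding_number h 0 = ((of_real (ln (norm b)) + \<i> * of_real (2 * pi * 1)) - (of_real (ln (norm b)) + \<i> * of_real (2 * pi * 0))) / (2 * of_real pi * \<i>)"
      by (intro winding_number_of_log) (auto intro!: continuous_intros)
    then show ?thesis by simp
  qed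
  moreover have "0 \<notin> ?O" using Bd(1) by simp
  ultimately have w: "winding_number g 0 = 1"
    unfolding g_def using tl h by (subst winding_number_lasso_in[of ?O]) auto
  have gi: "path_in ?O ginf" "pathstart ginf = b" "pathfinish ginf = b"
    using ginf(1,2) by (auto simp: loops_at_iff path_in_def)
  have "loop_class ?O g = loop_class ?O ginf"
    using Bd(1) g gi w ginf(3) by (intro loop_class_near_infinity) auto
  from loop_class_subset[OF this g(1) O] have eq: "fl g = fl ginf" .
  have "loop_around_infinity (fib a) b g"
    unfolding loop_around_infinity_def
  proof (intro exI[of _ "norm b"] conjI exI[of _ tl])
    show "- ball 0 (norm b) \<subseteq> fib a" using O Bd(2) by (force simp: subset_eq)
    show "path tl" "path_image tl \<subseteq> fib a" using tl(1) O by (auto simp: path_in_def)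
    show "g = tl +++ (\<lambda>\<tau>. of_real (norm b) * cis (2 * pi * \<tau>)) +++ reversepath tl"
      by (simp add: g_def lasso_def h_def[abs_def])
  qed (use nb tl in auto)
  then show ?thesis using eq g path_in_subset[OF g(1) O] by (auto simp: loops_at_iff)
qed

lemma standard_loops_exist:
  obtains S where "base_y S = b" "standard_loops n A B C a S"
    "fibre_class n A B C a (loop_zero S) = loop_class X (pp \<circ> outer_loop 0)"
    "\<And>i. i \<in> {1..n-2} \<Longrightarrow> fibre_class n A B C a (loop_plus S i) = loop_class X (pp \<circ> outer_loop (Yp i))"
    "fibre_class n A B C a (loop_plus S 0) = loop_class X (pp \<circ> plus_loop)"
    "gamma0_class n A B C a S = loop_class X (gamma a)"
proof -
  interpret G: group pi_fib by (rule group_fib)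
  have bX: "plane_point n A B C a b \<in> X" using b_fib by (simp add: punctured_fibre_def)
  interpret GX: group pi_X by (rule group_fundamental_group[OF bX])
  let ?M = "fl minus_loop" and ?Y = "fl plus_loop" and ?I = "[1..<n-1]"
  have MY: "?M \<in> carrier pi_fib" "?Y \<in> carrier pi_fib" using branch_loops_in(5,6) by (auto simp: fundamental_group_carrier)
  have lc: "fl (outer_loop c) \<in> carrier pi_fib" if "c \<in> P" for c using outer_loop_fib[OF that] by (auto simp: fundamental_group_carrier)
  have I: "set ?I = {1..n-2}" using n by auto
  obtain g0 where g0: "loop_around (fib a) b 0 g0" "fl g0 = fl (outer_loop 0)" using outer_around(1) unfolding around_def by metis
  have "\<forall>i\<in>{1..n-2}. \<exists>g. loop_around (fib a) b (yp i) g \<and> fl g = fl (outer_loop (Yp i))"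
    using outer_around(2) unfolding around_def by metis
  then obtain gp where gp: "\<And>i. i \<in> {1..n-2} \<Longrightarrow> loop_around (fib a) b (yp i) (gp i) \<and> fl (gp i) = fl (outer_loop (Yp i))" by metis
  \<comment> \<open>In the system of lassos the product M Y of the loops around the two points near
    1 precedes the product Z of those around the \<open>ym i\<close>. The relation wants Y after the
    latter, so they are conjugated by Y: Y Z = (Y Z Y^-1) Y.\<close>
  have "\<exists>g. loop_around (fib a) b (ym i) g \<and> fl g = ?Y \<otimes>\<^bsub>pi_fib\<^esub> fl (outer_loop (Ym i)) \<otimes>\<^bsub>pi_fib\<^esub> inv\<^bsub>pi_fib\<^esub> ?Y" if "i \<in> {1..n-2}" for i
    using around_conj[OF outer_around(3)[OF that] MY(2) b_fib] unfolding around_def by metis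
  then obtain gm where gm: "\<And>i. i \<in> {1..n-2} \<Longrightarrow> loop_around (fib a) b (ym i) (gm i) \<and>
     fl (gm i) = ?Y \<otimes>\<^bsub>pi_fib\<^esub> fl (outer_loop (Ym i)) \<otimes>\<^bsub>pi_fib\<^esub> inv\<^bsub>pi_fib\<^esub> ?Y" by metis
  obtain gp0 gm0 where g00: "loop_around (fib a) b (1 + a - 2 * s) gp0" "fl gp0 = ?Y" "loop_around (fib a) b (1 + a + 2 * s) gm0" "fl gm0 = ?M"
    using branch_loops_around unfolding around_def by metis
  obtain gi where gi: "loop_around_infinity (fib a) b gi" "gi \<in> loops_at (fib a) b" "fl gi = fl ginf" using infinity_loop by blast
  define S where "S = \<lparr>base_y = b, y_plus = (\<lambda>i. if i = 0 then (1 - csqrt a)\<^sup>2 else yp i), y_minus = (\<lambda>i. if i = 0 then (1 + csqrt a)\<^sup>2 else ym i),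
     fibre_section = (\<lambda>x. b * of_real (max 1 (norm x))), loop_zero = g0, loop_plus = (\<lambda>i. if i = 0 then gp0 else gp i),
     loop_minus = (\<lambda>i. if i = 0 then gm0 else gm i), loop_infinity = gi\<rparr>"
  have sq: "1 + a - 2 * s = (1 - csqrt a)\<^sup>2" "1 + a + 2 * s = (1 + csqrt a)\<^sup>2"
    using s by (simp_all add: s_eq power2_eq_square algebra_simps)
  have fc: "fibre_class n A B C a g = loop_class X (pp \<circ> h)" if "loop_around (fib a) b p g" "fl g = fl h" for g h p
    unfolding fibre_class_def using plane_class[OF that(2)] loop_around_loop[OF that(1)] by (simp add: loops_at_iff)
  have gam: "gamma0_class n A B C a S = loop_class X (gamma a)"
  proof -
    \<comment> \<open>On the circle |x| = |a| the section is constant, so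
      \<open>gamma0_class\<close> is the class of \<open>gamma a\<close>.\<close>
    have "max 1 (norm a) = 1" using a(2) eps_small by simp
    then show ?thesis unfolding gamma0_class_def gamma_def[abs_def] S_def by (simp add: norm_mult)
  qed
  have vals: "fibre_class n A B C a (loop_zero S) = loop_class X (pp \<circ> outer_loop 0)"
    "\<And>i. i \<in> {1..n-2} \<Longrightarrow> fibre_class n A B C a (loop_plus S i) = loop_class X (pp \<circ> outer_loop (Yp i))"
    "fibre_class n A B C a (loop_plus S 0) = loop_class X (pp \<circ> plus_loop)"
    "fibre_class n A B C a (loop_minus S 0) = loop_class X (pp \<circ> minus_loop)"
  proof -
    fix i assume i: "i \<in> {1..n-2}"
    then have "loop_plus S i = gp i" by (simp add: S_def)
    then show "fibre_class n A B C a (loop_plus S i) = loop_class X (pp \<circ> outer_loop (Yp i))"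
      using fc gp[OF i] by metis
  qed (use fc[OF g0] fc[OF g00(1,2)] fc[OF g00(3,4)] in \<open>simp_all add: S_def\<close>)
  have "labelled_points n A B C a S"
    unfolding labelled_points_def y_arg_def using points(1) args by (auto simp: S_def)
  moreover have "loops_around_points n A B C a S"
    unfolding loops_around_points_def Let_def
  proof (intro conjI ballI)
    show "base_y S \<in> fib a" "loop_around (fib a) (base_y S) 0 (loop_zero S)" "loop_around_infinity (fib a) (base_y S) (loop_infinity S)"
      using b_fib g0 gi by (simp_all add: S_def)
    show "loop_around (fib a) (base_y S) (y_plus S i) (loop_plus S i)" "loop_around (fib a) (base_y S) (y_minus S i) (loop_minus S i)"
      if ii: "i \<in> {0..n-2}" for i
    proof -
      consider "i = 0" | "i \<in> {1..n-2}" using ii by (cases "i = 0") auto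
      then have "loop_around (fib a) b (y_plus S i) (loop_plus S i) \<and> loop_around (fib a) b (y_minus S i) (loop_minus S i)"
      proof cases
        case 1
        then show ?thesis using g00(1,3) unfolding sq by (simp add: S_def)
      next
        case 2
        then have "y_plus S i = yp i" "y_minus S i = ym i" "loop_plus S i = gp i" "loop_minus S i = gm i" by (simp_all add: S_def)
        then show ?thesis using gp[OF 2] gm[OF 2] by presburger
      qed
      moreover have "base_y S = b" by (simp add: S_def)
      ultimately show "loop_around (fib a) (base_y S) (y_plus S i) (loop_plus S i)" "loop_around (fib a) (base_y S) (y_minus S i) (loop_minus S i)"
        by simp_all
    qed
    let ?Li = "fl ginf" and ?L = "\<lambda>c. fl (outer_loop c)"
    have Li: "?Li \<in> carrier pi_fib" using gi(2,3) by (metis fundamental_group_carrier imageI)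
    have maps: "map fl (map (loop_plus S) ?I) = map (\<lambda>i. ?L (Yp i)) ?I"
      "map fl (map (loop_minus S) ?I) = map (\<lambda>i. ?Y \<otimes>\<^bsub>pi_fib\<^esub> ?L (Ym i) \<otimes>\<^bsub>pi_fib\<^esub> inv\<^bsub>pi_fib\<^esub> ?Y) ?I"
      unfolding map_map by (rule map_cong[OF refl], use gp gm in \<open>auto simp: S_def\<close>)+
    let ?Z = "foldr (mult pi_fib) (map (\<lambda>i. ?L (Ym i)) ?I)"
    have Zc: "set (map (\<lambda>i. ?L (Ym i)) ?I) \<subseteq> carrier pi_fib" "set (map (\<lambda>i. ?L (Yp i)) ?I) \<subseteq> carrier pi_fib"
      using lc P_mem(3,4) I by auto
    have L1: "?L 1 = ?M \<otimes>\<^bsub>pi_fib\<^esub> ?Y"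
      using circle_splits MY QE1 by (simp add: outer_loop_def fundamental_group_mult)
    have Zi: "?Z ?Li \<in> carrier pi_fib" using G.foldr_mult_start[OF Zc(1) Li] G.foldr_mult_closed[OF Zc(1)] Li by simp
    have cj: "foldr (mult pi_fib) (map (\<lambda>i. ?Y \<otimes>\<^bsub>pi_fib\<^esub> ?L (Ym i) \<otimes>\<^bsub>pi_fib\<^esub> inv\<^bsub>pi_fib\<^esub> ?Y) ?I) (?Y \<otimes>\<^bsub>pi_fib\<^esub> ?Li) = ?Y \<otimes>\<^bsub>pi_fib\<^esub> ?Z ?Li"
      by (rule G.foldr_mult_conj[OF MY(2) Li]) (use lc P_mem(4) I in blast)
    have "foldr (mult pi_fib) (map fl ([loop_zero S] @ map (loop_plus S) ?I @ [loop_minus S 0] @ map (loop_minus S) ?I @ [loop_plus S 0, loop_infinity S])) (one pi_fib)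
      = ?L 0 \<otimes>\<^bsub>pi_fib\<^esub> foldr (mult pi_fib) (map (\<lambda>i. ?L (Yp i)) ?I) (?M \<otimes>\<^bsub>pi_fib\<^esub> (?Y \<otimes>\<^bsub>pi_fib\<^esub> ?Z ?Li))"
      unfolding map_append maps foldr_append
      using Li g0(2) g00 gi(3) by (simp add: S_def cj del: One_nat_def)
    also have "?M \<otimes>\<^bsub>pi_fib\<^esub> (?Y \<otimes>\<^bsub>pi_fib\<^esub> ?Z ?Li) = ?L 1 \<otimes>\<^bsub>pi_fib\<^esub> ?Z ?Li" using MY Zi by (simp add: L1 G.m_assoc)
    also have "?L 0 \<otimes>\<^bsub>pi_fib\<^esub> foldr (mult pi_fib) (map (\<lambda>i. ?L (Yp i)) ?I) (?L 1 \<otimes>\<^bsub>pi_fib\<^esub> ?Z ?Li) =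
       foldr (mult pi_fib) (map ?L ([0] @ map Yp ?I @ [1] @ map Ym ?I)) ?Li"
      by (simp add: o_def)
    also have "\<dots> = foldr (mult pi_fib) (map ?L ([0] @ map Yp ?I @ [1] @ map Ym ?I)) (one pi_fib) \<otimes>\<^bsub>pi_fib\<^esub> ?Li"
      by (rule G.foldr_mult_start[OF _ Li]) (use lc P_def in force)
    also have "\<dots> = one pi_fib" by (rule product_fib)
    finally show "foldr (mult (fundamental_group (fib a) (base_y S))) (map (loop_class (fib a)) ([loop_zero S] @ map (loop_plus S) ?I @ [loop_minus S 0] @ map (loop_minus S) ?I @ [loop_plus S 0, loop_infinity S])) (one (fundamental_group (fib a) (base_y S))) = one (fundamental_group (fib a) (base_y S))"
      by (simp add: S_def)
  qed
  moreover have "gamma0_relations n A B C a S"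
    unfolding gamma0_relations_def Let_def gam vals
  proof (intro conjI allI impI ballI)
    have bp: "base_point n A B C a S = pp b" by (simp add: base_point_def S_def)
    show "continuous_on (- {0}) (fibre_section S)" unfolding S_def by (auto intro!: continuous_intros)
    show "fibre_section S x \<in> fib x" if "x \<noteq> 0" for x using sec[OF that] by (simp add: S_def)
    show "fibre_section S a = base_y S" using a(2) eps_small by (simp add: S_def)
    have gl: "gamma a \<in> loops_at X (pp b)" by (rule gamma_loop[OF a])
    have comm: "loop_class X (gamma a) \<otimes>\<^bsub>fundamental_group X (base_point n A B C a S)\<^esub> loop_class X (pp \<circ> outer_loop c) =
       loop_class X (pp \<circ> outer_loop c) \<otimes>\<^bsub>fundamental_group X (base_point n A B C a S)\<^esub> loop_class X (gamma a)" if "c \<in> P" for c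
      unfolding bp using gl plane_loop[OF outer_loop_fib[OF that]] outer_loop_commutes[OF a outer_loop[OF that]]
      by (simp add: fundamental_group_mult_class)
    show "loop_class X (gamma a) \<otimes>\<^bsub>fundamental_group X (base_point n A B C a S)\<^esub> loop_class X (pp \<circ> outer_loop 0) =
       loop_class X (pp \<circ> outer_loop 0) \<otimes>\<^bsub>fundamental_group X (base_point n A B C a S)\<^esub> loop_class X (gamma a)"
      by (rule comm[OF P_mem(1)])
    show "loop_class X (gamma a) \<otimes>\<^bsub>fundamental_group X (base_point n A B C a S)\<^esub> fibre_class n A B C a (loop_plus S i) =
       fibre_class n A B C a (loop_plus S i) \<otimes>\<^bsub>fundamental_group X (base_point n A B C a S)\<^esub> loop_class X (gamma a)" if "i \<in> {1..n-2}" for i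
      unfolding vals(2)[OF that] by (rule comm[OF P_mem(3)[OF that]])
    note pl = plane_loop[OF branch_loops_in(6)] plane_loop[OF branch_loops_in(5)]
    have cg: "loop_class X (gamma a) \<in> carrier pi_X" "loop_class X (pp \<circ> minus_loop) \<in> carrier pi_X"
      using gl pl by (auto simp: fundamental_group_carrier)
    have "loop_class X (gamma a) \<otimes>\<^bsub>pi_X\<^esub> loop_class X (pp \<circ> plus_loop) = loop_class X (pp \<circ> minus_loop) \<otimes>\<^bsub>pi_X\<^esub> loop_class X (gamma a)"
      using gl pl branch_loops_exchange by (simp add: fundamental_group_mult_class)
    then have "loop_class X (gamma a) \<otimes>\<^bsub>pi_X\<^esub> loop_class X (pp \<circ> plus_loop) \<otimes>\<^bsub>pi_X\<^esub> inv\<^bsub>pi_X\<^esub> loop_class X (gamma a) = loop_class X (pp \<circ> minus_loop)"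
      using cg by (simp add: GX.m_assoc)
    then show "loop_class X (gamma a) \<otimes>\<^bsub>fundamental_group X (base_point n A B C a S)\<^esub> loop_class X (pp \<circ> plus_loop) \<otimes>\<^bsub>fundamental_group X (base_point n A B C a S)\<^esub>
        inv\<^bsub>fundamental_group X (base_point n A B C a S)\<^esub> loop_class X (gamma a) = loop_class X (pp \<circ> minus_loop)"
      unfolding bp .
  qed
  ultimately have "standard_loops n A B C a S" by (simp add: standard_loops_def)
  moreover have "base_y S = b" by (simp add: S_def)
  ultimately show thesis using that[OF _ _ vals(1-3) gam] by blast
qed

section \<open>The values of the representation\<close>

definition base_sheet :: "nat \<Rightarrow> complex" where "base_sheet = outer_sheet a b"

lemma base_sheet: "base_sheet \<in> cover n" "cover_proj n base_sheet = pp b"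
  using outer_sheet[OF a bS] by (simp_all add: base_sheet_def)

text \<open>A loop that stays over \<open>S0\<close> has the closed lift \<open>outer_sheet\<close>,
  so its matrix is diagonal, and the multiplier of the other sheet is the inverse of the
  first.\<close>

lemma outer_rep:
  fixes lam :: "nat \<Rightarrow> complex"
  assumes f: "path f" "path g" "\<And>t. 0 \<le> t \<Longrightarrow> t \<le> 1 \<Longrightarrow> 0 < norm (f t) \<and> norm (f t) < \<epsilon> \<and> g t \<in> S0"
    and ends: "f 0 = a" "f 1 = a" "g 0 = b" "g 1 = b" and k: "k \<noteq> 0"
  defines "m \<equiv> exp (2 * of_real pi * \<i> *
     ((1 - lam 0) / 2 * winding_number g 0 - winding_number g 1 / 2 + lam 1 / 2 * (winding_number f 0 - 2 * winding_number g 1) +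
      (\<Sum>i\<in>{1..n-2}. lam (i + 1) / 2 * (winding_number g (Ym i) - winding_number g (Yp i)))))"
  shows "loop_rep n lam base_sheet k (loop_class X (\<lambda>t. plane_point n A B C (f t) (g t))) = mat2 (inverse m) 0 0 m"
proof -
  let ?e = "\<lambda>t. outer_sheet (f t) (g t)" and ?g = "\<lambda>t. plane_point n A B C (f t) (g t)"
  have pe: "path_in (cover n) ?e" by (rule path_in_outer_sheet[OF f])
  have m: "multiplier n lam ?e = m" unfolding m_def using ends by (intro multiplier_outer_sheet[OF f]) auto
  have inv: "multiplier n lam (swap_sheet \<circ> ?e) = inverse m"
    using multiplier_swap_closed(1)[OF n pe, of lam] ends m by (simp add: inverse_unique)
  have "path_in X ?g" using f S0_fib by (intro path_in_plane_point) (auto simp: subset_eq)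
  then have g: "?g \<in> loops_at X (pp b)" using ends by (simp add: loops_at_iff pathstart_def pathfinish_def)
  have "is_lift n base_sheet ?g ?e"
    unfolding is_lift_def base_sheet_def using pe ends outer_sheet(2) f(3) by auto
  from loop_rep_of_lift[OF n g base_sheet(1) this k] show ?thesis
    using ends m inv by (simp add: sheet_rep_def base_sheet_def)
qed

lemma outer_loop_rep:
  assumes "c \<in> P" "k \<noteq> 0"
  shows "loop_rep n lam base_sheet k (loop_class X (pp \<circ> outer_loop c)) =
    (let m = exp (2 * of_real pi * \<i> * ((1 - lam 0) / 2 * winding_number (outer_loop c) 0 - winding_number (outer_loop c) 1 / 2
       - lam 1 * winding_number (outer_loop c) 1 +
      (\<Sum>i\<in>{1..n-2}. lam (i + 1) / 2 * (winding_number (outer_loop c) (Ym i) - winding_number (outer_loop c) (Yp i)))))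
     in mat2 (inverse m) 0 0 m)"
proof -
  have ol: "path_in S0 (outer_loop c)" "outer_loop c 0 = b" "outer_loop c 1 = b"
    using outer_loop[OF assms(1)] by (auto simp: loops_at_iff pathstart_def pathfinish_def)
  have f: "path (\<lambda>t::real. a)" by (simp add: path_def)
  have w: "winding_number (\<lambda>t::real. a) 0 = 0"
    using a by (intro winding_number_const) auto
  show ?thesis
    using outer_rep[OF f path_in_path[OF ol(1)] _ refl refl ol(2,3) assms(2), of lam] a path_in_D[OF ol(1)]
    by (simp add: w o_def Let_def)
qed

lemma zero_rep:
  assumes "k \<noteq> 0"
  shows "loop_rep n lam base_sheet k (loop_class X (pp \<circ> outer_loop 0)) =
    mat2 (- exp (- (of_real pi * \<i> * lam 0))) 0 0 (- exp (of_real pi * \<i> * lam 0))"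
proof -
  have sum: "(\<Sum>i\<in>{1..n-2}. lam (i + 1) / 2 * (winding_number (outer_loop 0) (Ym i) - winding_number (outer_loop 0) (Yp i))) = 0"
    using P_ne P_mem by (intro sum.neutral) (simp add: outer_loop_winding)
  have w: "winding_number (outer_loop 0) 0 = - 1" "winding_number (outer_loop 0) 1 = 0"
    using P_mem by (simp_all add: outer_loop_winding)
  \<comment> \<open>A clockwise turn of y around 0 turns the unit 1 - q, whose exponent is (1 - lam
    0) / 2; the constant half in it accounts for the sign -1.\<close>
  have "2 * of_real pi * \<i> * ((1 - lam 0) / 2 * (- 1) - 0 / 2 - lam 1 * 0 + 0) = of_real pi * \<i> * lam 0 - of_real pi * \<i>"
    by (simp add: algebra_simps diff_divide_distrib)
  then have ex: "exp (2 * of_real pi * \<i> * ((1 - lam 0) / 2 * (- 1) - 0 / 2 - lam 1 * 0 + 0)) = - exp (of_real pi * \<i> * lam 0)"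
    by (simp only: exp_diff) simp
  show ?thesis
    unfolding outer_loop_rep[OF P_mem(1) assms] sum w ex by (simp add: Let_def exp_minus)
qed

text \<open>Around \<open>Yp i\<close> only the unit p - q + z_i turns, clockwise and with exponent
  - lam (i + 1) / 2; the two signs cancel.\<close>

lemma plus_rep:
  assumes "k \<noteq> 0" "i \<in> {1..n-2}"
  shows "loop_rep n lam base_sheet k (loop_class X (pp \<circ> outer_loop (Yp i))) =
    mat2 (exp (- (of_real pi * \<i> * lam (i + 1)))) 0 0 (exp (of_real pi * \<i> * lam (i + 1)))"
proof -
  have "(\<Sum>j\<in>{1..n-2}. lam (j + 1) / 2 * (winding_number (outer_loop (Yp i)) (Ym j) - winding_number (outer_loop (Yp i)) (Yp j))) =
      (\<Sum>j\<in>{1..n-2}. if j = i then lam (i + 1) / 2 else 0)"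
  proof (rule sum.cong[OF refl])
    fix j assume j: "j \<in> {1..n-2}"
    have "Ym j \<noteq> Yp i" "Yp j = Yp i \<longleftrightarrow> j = i" using index_unique[OF assms(2) j] index_unique[OF j assms(2)] by auto
    then show "lam (j + 1) / 2 * (winding_number (outer_loop (Yp i)) (Ym j) - winding_number (outer_loop (Yp i)) (Yp j)) = (if j = i then lam (i + 1) / 2 else 0)"
      using P_mem(3)[OF assms(2)] P_mem(3)[OF j] P_mem(4)[OF j] by (simp add: outer_loop_winding)
  qed
  also have "\<dots> = lam (i + 1) / 2" using assms(2) by simp
  finally have sum: "(\<Sum>j\<in>{1..n-2}. lam (j + 1) / 2 * (winding_number (outer_loop (Yp i)) (Ym j) - winding_number (outer_loop (Yp i)) (Yp j))) = lam (i + 1) / 2" .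
  have w: "winding_number (outer_loop (Yp i)) 0 = 0" "winding_number (outer_loop (Yp i)) 1 = 0"
    using outer_loop_winding[OF P_mem(3)[OF assms(2)] P_mem(1)] outer_loop_winding[OF P_mem(3)[OF assms(2)] P_mem(2)] P_ne[OF assms(2)] by metis+
  show ?thesis
    unfolding outer_loop_rep[OF P_mem(3)[OF assms(2)] assms(1)] sum w by (simp add: Let_def exp_minus mult.assoc mult.left_commute)
qed

text \<open>While x runs round 0 with y fixed at \<open>b\<close>, only the unit p turns, with
  exponent lam 1 / 2.\<close>

lemma gamma_rep:
  assumes "k \<noteq> 0"
  shows "loop_rep n lam base_sheet k (loop_class X (gamma a)) =
    mat2 (exp (- (of_real pi * \<i> * lam 1))) 0 0 (exp (of_real pi * \<i> * lam 1))"
proof -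
  define f where "f t = a * cis (2 * pi * t)" for t
  have f: "path f" "\<And>t. norm (f t) = norm a" "f 0 = a" "f 1 = a"
    by (auto simp: f_def path_def norm_mult intro!: continuous_intros)
  have w: "winding_number f 0 = 1"
  proof -
    have "f \<tau> = exp (Ln a + \<i> * of_real (2 * pi * \<tau>))" for \<tau>
      using a by (auto simp: f_def exp_add cis_conv_exp)
    then have "winding_number f 0 = ((Ln a + \<i> * of_real (2 * pi * 1)) - (Ln a + \<i> * of_real (2 * pi * 0))) / (2 * of_real pi * \<i>)"
      by (intro winding_number_of_log) (auto intro!: continuous_intros)
    then show ?thesis by simp
  qed
  have z: "winding_number (\<lambda>t::real. b) c = 0" if "c \<in> P" for c
  proof -
    have "b \<noteq> c" using bS that r by (auto simp: S0_def)
    then show ?thesis by (rule winding_number_const)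
  qed
  have sum: "(\<Sum>i\<in>{1..n-2}. lam (i + 1) / 2 * (winding_number (\<lambda>t::real. b) (Ym i) - winding_number (\<lambda>t::real. b) (Yp i))) = 0"
    using P_mem z by (intro sum.neutral) simp
  have g: "gamma a = (\<lambda>t. plane_point n A B C (f t) b)" by (simp add: gamma_def f_def fun_eq_iff)
  have R: "loop_rep n lam base_sheet k (loop_class X (\<lambda>t. plane_point n A B C (f t) b)) =
    (let m = exp (2 * of_real pi * \<i> * ((1 - lam 0) / 2 * winding_number (\<lambda>t::real. b) 0 - winding_number (\<lambda>t::real. b) 1 / 2
       + lam 1 / 2 * (winding_number f 0 - 2 * winding_number (\<lambda>t::real. b) 1) +
      (\<Sum>i\<in>{1..n-2}. lam (i + 1) / 2 * (winding_number (\<lambda>t::real. b) (Ym i) - winding_number (\<lambda>t::real. b) (Yp i)))))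
     in mat2 (inverse m) 0 0 m)"
    unfolding Let_def by (rule outer_rep) (use f a bS assms in \<open>auto simp: path_def\<close>)
  show ?thesis
    unfolding g R sum w z[OF P_mem(1)] z[OF P_mem(2)] by (simp add: Let_def exp_minus mult.assoc mult.left_commute)
qed

text \<open>If the lift were closed, the winding number of p - q would be an integer and that of its
  square even. But (p - q)^2 = (y - (1 + a + 2 s)) (y - (1 + a - 2 s)), and \<open>plus_loop\<close>
  turns once around one of the two points and not around the other.\<close>

lemma branch_rep: "\<exists>k. k \<noteq> 0 \<and> loop_rep n lam base_sheet k (loop_class X (pp \<circ> plus_loop)) = mat2 0 1 (- 1) 0"
proof -
  note pl = branch_loops_in(6)[unfolded loops_at_iff]
  have lX: "pp \<circ> plus_loop \<in> loops_at X (pp b)" by (rule plane_loop[OF branch_loops_in(6)])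
  have "(pp \<circ> plus_loop) 0 = pp b" using pl by (simp add: pathstart_def)
  then obtain \<eta> where \<eta>: "is_lift n base_sheet (pp \<circ> plus_loop) \<eta>"
    using lift_exists[OF n _ base_sheet(1), of "pp \<circ> plus_loop"] lX base_sheet(2) by (auto simp: loops_at_iff)
  then have pe: "path_in (cover n) \<eta>" "\<eta> 0 = base_sheet" "\<And>t. t \<in> {0..1} \<Longrightarrow> cover_proj n (\<eta> t) = pp (plus_loop t)" by (auto simp: is_lift_def)
  have "\<eta> 1 = base_sheet \<or> \<eta> 1 = swap_sheet base_sheet"
    using lift_end[OF n base_sheet(1) \<eta>] lX by (auto simp: loops_at_iff pathstart_def pathfinish_def)
  moreover have "\<eta> 1 \<noteq> base_sheet"
  proof
    assume closed: "\<eta> 1 = base_sheet"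
    let ?h = "\<lambda>e :: nat \<Rightarrow> complex. e 0 - e 1"
    have u: "?h \<in> units n" unfolding units_def by blast
    note hp = path_unit[OF pe(1) u]
    have "pathfinish (?h \<circ> \<eta>) = pathstart (?h \<circ> \<eta>)" using closed pe(2) by (simp add: pathstart_def pathfinish_def)
    from integer_winding_number[OF hp(1) this hp(2)] obtain N where N: "winding_number (?h \<circ> \<eta>) 0 = of_int N" by (auto elim: Ints_cases)
    have sq: "(?h \<circ> \<eta>) t * (?h \<circ> \<eta>) t = (plus_loop t - (1 + a + 2 * s)) * (plus_loop t - (1 + a - 2 * s))" if t: "t \<in> {0..1}" for t
    proof -
      have "cover_coords (\<eta> t) k = plane_coords A B C a (plus_loop t) k" if "k < n" for k
        using affine_point_eqD[of n "cover_coords (\<eta> t)" "plane_coords A B C a (plus_loop t)" k] pe(3)[OF t] that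
        by (simp add: cover_proj_def plane_point_coords)
      from this[of 0] this[of 1] have "\<eta> t 0 * \<eta> t 1 = a" "(1 - \<eta> t 0) * (1 - \<eta> t 1) = plus_loop t"
        using n by (auto simp: cover_coords_def plane_coords_def)
      then have p: "\<eta> t 0 * \<eta> t 1 = a" and sm: "\<eta> t 0 + \<eta> t 1 = 1 + a - plus_loop t" by (auto simp: algebra_simps)
      have "(?h \<circ> \<eta>) t * (?h \<circ> \<eta>) t = (\<eta> t 0 + \<eta> t 1)\<^sup>2 - 4 * (\<eta> t 0 * \<eta> t 1)" by (simp add: power2_eq_square algebra_simps)
      also have "\<dots> = (plus_loop t - 1 - a)\<^sup>2 - 4 * s\<^sup>2" unfolding p sm s by (simp add: power2_eq_square algebra_simps)
      finally show ?thesis by (simp add: power2_eq_square algebra_simps)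
    qed
    have nf: "1 + a + 2 * s \<notin> fib a" "1 + a - 2 * s \<notin> fib a"
      using s by (auto simp: punctured_fibre_iff[OF n] power_mult_distrib)
    have nz: "plus_loop t - (1 + a + 2 * s) \<noteq> 0" "plus_loop t - (1 + a - 2 * s) \<noteq> 0" if "0 \<le> t" "t \<le> 1" for t
      using path_in_D[of "fib a" plus_loop t] pl nf that by auto
    have wp: "winding_number plus_loop p = winding_number (circ (1 + a - 2 * s) (- s)) p" if "p \<notin> fib a" for p
      unfolding plus_loop_def
      by (rule winding_number_lasso_in[of "fib a"]) (use that branch_loops_in(3,4) two_holed_segments(6,7) in \<open>auto simp: F_simps pathfinish_compose path_compose_join\<close>)
    have "2 * of_int N = winding_number (\<lambda>t. (?h \<circ> \<eta>) t * (?h \<circ> \<eta>) t) 0"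
    proof -
      have "winding_number (\<lambda>t. (?h \<circ> \<eta>) t * (?h \<circ> \<eta>) t) 0 = winding_number (?h \<circ> \<eta>) 0 + winding_number (?h \<circ> \<eta>) 0"
        by (rule winding_number_mult[OF hp(1) hp(1) hp(3) hp(3)])
      then show ?thesis unfolding N by simp
    qed
    also have "\<dots> = winding_number (\<lambda>t. (plus_loop t - (1 + a + 2 * s)) * (plus_loop t - (1 + a - 2 * s))) 0"
      by (rule winding_number_cong) (use sq in auto)
    also have "\<dots> = winding_number (\<lambda>t. plus_loop t - (1 + a + 2 * s)) 0 + winding_number (\<lambda>t. plus_loop t - (1 + a - 2 * s)) 0"
      using nz pl by (intro winding_number_mult) (auto simp: path_def path_in_def intro!: continuous_intros)
    also have "\<dots> = winding_number plus_loop (1 + a + 2 * s) + winding_number plus_loop (1 + a - 2 * s)"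
      by (simp only: winding_number_offset[symmetric])
    also have "\<dots> = winding_number (circ (1 + a - 2 * s) (- s)) (1 + a + 2 * s) + winding_number (circ (1 + a - 2 * s) (- s)) (1 + a - 2 * s)"
      by (simp only: wp[OF nf(1)] wp[OF nf(2)])
    also have "winding_number (circ (1 + a - 2 * s) (- s)) (1 + a + 2 * s) = 0"
    proof (rule winding_number_circ_outside)
      have "dist (1 + a + 2 * s) (1 + a - 2 * s) = norm (4 * s)" unfolding dist_norm by (rule arg_cong[of _ _ norm]) simp
      then show "norm (- s) < dist (1 + a + 2 * s) (1 + a - 2 * s)" using s_norm(2) by (simp add: norm_mult)
    qed
    also have "winding_number (circ (1 + a - 2 * s) (- s)) (1 + a - 2 * s) = -1"
      using s_norm(2) by (intro winding_number_circ) simp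
    finally have "of_int (2 * N) = (of_int (- 1) :: complex)" using nf by simp
    then have "2 * N = - 1" by (simp only: of_int_eq_iff)
    then show False by presburger
  qed
  ultimately have sw: "\<eta> 1 = swap_sheet base_sheet" "\<eta> 1 \<noteq> base_sheet" by auto
  let ?m = "multiplier n lam \<eta>" and ?m' = "multiplier n lam (swap_sheet \<circ> \<eta>)"
  have mm: "?m * ?m' = - 1" using multiplier_swap_closed(2)[OF n pe(1)] sw pe(2) by simp
  then have nz: "?m \<noteq> 0" "?m' \<noteq> 0" by auto
  \<comment> \<open>The antidiagonal entries are \<open>- k * ?m'\<close> and
    \<open>- ?m / k\<close>, where the product of the multipliers is -1; this ratio of the columns
    makes them 1 and -1.\<close>
  define k where "k = - 1 / ?m'"
  have k: "k \<noteq> 0" "- k * ?m' = 1" "- ?m / k = - 1" using nz mm by (auto simp: k_def divide_simps)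
  have "loop_rep n lam base_sheet k (loop_class X (pp \<circ> plus_loop)) = mat2 0 1 (- 1) 0"
    unfolding loop_rep_of_lift[OF n lX base_sheet(1) \<eta> k(1)] sheet_rep_def using sw(2) k by simp
  then show ?thesis using k(1) by blast
qed

end

context loop_setup begin

lemma standard_loops_representation:
  "\<exists>S. standard_loops n A B C a S \<and> (\<forall>lam. \<exists>\<rho>. explicit_representation n A B C a S lam \<rho> \<and>
     conjugate_on (carrier (fundamental_group X (base_point n A B C a S))) (monodromy n lam) \<rho> \<and>
     virtually_abelian X (base_point n A B C a S) \<rho> \<and>
     \<rho> ` carrier (fundamental_group X (base_point n A B C a S)) \<subseteq> D_infinity)"
proof -
  obtain S where S: "base_y S = b" "standard_loops n A B C a S"
    "fibre_class n A B C a (loop_zero S) = loop_class X (pp \<circ> outer_loop 0)"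
    "\<And>i. i \<in> {1..n-2} \<Longrightarrow> fibre_class n A B C a (loop_plus S i) = loop_class X (pp \<circ> outer_loop (Yp i))"
    "fibre_class n A B C a (loop_plus S 0) = loop_class X (pp \<circ> plus_loop)"
    "gamma0_class n A B C a S = loop_class X (gamma a)"
    using standard_loops_exist by blast
  have bp: "base_point n A B C a S = cover_proj n base_sheet" by (simp add: base_point_def S(1) base_sheet)
  show ?thesis
  proof (intro exI[of _ S] conjI allI S(2))
    fix lam :: "nat \<Rightarrow> complex"
    obtain k where k: "k \<noteq> 0" "loop_rep n lam base_sheet k (loop_class X (pp \<circ> plus_loop)) = mat2 0 1 (- 1) 0"
      using branch_rep by blast
    note props = loop_rep_properties[OF n base_sheet(1) k(1), of lam, folded bp]
    have "explicit_representation n A B C a S lam (loop_rep n lam base_sheet k)"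
      unfolding explicit_representation_def S(3,5,6) using props(1) zero_rep[OF k(1)] gamma_rep[OF k(1)] k(2) plus_rep[OF k(1)] S(4)
      by (metis (no_types, lifting))
    then show "\<exists>\<rho>. explicit_representation n A B C a S lam \<rho> \<and>
     conjugate_on (carrier (fundamental_group X (base_point n A B C a S))) (monodromy n lam) \<rho> \<and>
     virtually_abelian X (base_point n A B C a S) \<rho> \<and>
     \<rho> ` carrier (fundamental_group X (base_point n A B C a S)) \<subseteq> D_infinity"
      using props(2-4) by blast
  qed
qed

end

text \<open>Hurwitz moves preserve both the total product and the property of being a lasso of
  radius \<open>r\<close> about \<open>c\<close>; tails and starting points are chosen
  afterwards.\<close>

lemma reordered_lassos:
  assumes "b \<in> S" "\<And>c. c \<in> set cs \<Longrightarrow> lasso_class S b c r (l c)" "distinct cs" "distinct ds" "set ds = set cs"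
  shows "\<exists>Q E. (\<forall>c\<in>set cs. path_in S (Q c) \<and> pathstart (Q c) = b \<and> pathfinish (Q c) = c + E c \<and> norm (E c) = r) \<and>
    foldr (mult (fundamental_group S b)) (map (\<lambda>c. loop_class S (lasso (Q c) (circ c (E c)))) ds) (one (fundamental_group S b)) =
    foldr (mult (fundamental_group S b)) (map l cs) (one (fundamental_group S b))"
proof -
  interpret group "fundamental_group S b" by (rule group_fundamental_group[OF assms(1)])
  have "\<exists>g. (\<forall>c\<in>set cs. lasso_class S b c r (g c)) \<and> foldr (mult (fundamental_group S b)) (map g ds) (one (fundamental_group S b)) =
    foldr (mult (fundamental_group S b)) (map l cs) (one (fundamental_group S b))"
    using assms by (intro hurwitz_reorder[where P = "\<lambda>c. lasso_class S b c r"]) (auto intro: lasso_class_conj lasso_class_carrier)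
  then obtain g where g: "\<And>c. c \<in> set cs \<Longrightarrow> lasso_class S b c r (g c)" and e: "foldr (mult (fundamental_group S b)) (map g ds) (one (fundamental_group S b)) =
    foldr (mult (fundamental_group S b)) (map l cs) (one (fundamental_group S b))" by blast
  have "\<forall>c\<in>set cs. \<exists>q e. path_in S q \<and> pathstart q = b \<and> pathfinish q = c + e \<and> norm e = r \<and> g c = loop_class S (lasso q (circ c e))"
    using g unfolding lasso_class_def by blast
  then obtain Q E where QE: "\<forall>c\<in>set cs. path_in S (Q c) \<and> pathstart (Q c) = b \<and> pathfinish (Q c) = c + E c \<and> norm (E c) = r \<and> g c = loop_class S (lasso (Q c) (circ c (E c)))"
    by metis
  then have "map (\<lambda>c. loop_class S (lasso (Q c) (circ c (E c)))) ds = map g ds" using assms(5) by auto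
  then show ?thesis using QE e by (metis (no_types, lifting))
qed

section \<open>Choice of the constants\<close>

lemma finite_common_radius:
  fixes \<zeta> :: "'i \<Rightarrow> real"
  assumes "finite I" "\<And>i. i \<in> I \<Longrightarrow> 0 < \<zeta> i"
  shows "\<exists>\<eta>>0. \<forall>i\<in>I. \<eta> \<le> \<zeta> i"
  using assms by (intro exI[of _ "Min (insert 1 (\<zeta> ` I))"]) auto

text \<open>Arguments strictly between 0 and pi mean a positive imaginary part, where
  \<open>Arg\<close> is continuous. Adding 0 and pi to the finite set of arguments turns both the
  bounds and the strict order into gaps of size g; moving each argument by less than g / 2 preserves
  them.\<close>

lemma Arg_stable:
  fixes u :: "nat \<Rightarrow> complex"
  assumes "finite I" "\<And>i. i \<in> I \<Longrightarrow> 0 < Arg (u i) \<and> Arg (u i) < pi"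
    and mono: "\<And>i j. i \<in> I \<Longrightarrow> j \<in> I \<Longrightarrow> i < j \<Longrightarrow> Arg (u i) < Arg (u j)"
  shows "\<exists>\<zeta>>0. \<forall>w. (\<forall>i\<in>I. norm (w i - u i) < \<zeta>) \<longrightarrow> (\<forall>i\<in>I. 0 < Arg (w i) \<and> Arg (w i) < pi) \<and>
     (\<forall>i\<in>I. \<forall>j\<in>I. i < j \<longrightarrow> Arg (w i) < Arg (w j))"
proof -
  obtain g where g: "g > 0" "\<And>x y. x \<in> {0, pi} \<union> Arg ` u ` I \<Longrightarrow> y \<in> {0, pi} \<union> Arg ` u ` I \<Longrightarrow> x \<noteq> y \<Longrightarrow> g < dist x y"
  proof -
    have "finite ({0, pi} \<union> Arg ` u ` I)" using assms(1) by simp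
    from finite_separated[OF this] show thesis using that by blast
  qed
  have "\<exists>\<zeta>>0. \<forall>w. norm (w - u i) < \<zeta> \<longrightarrow> \<bar>Arg w - Arg (u i)\<bar> < g / 2" if "i \<in> I" for i
  proof -
    have "Im (u i) > 0" using assms(2)[OF that] by (simp add: Arg_lt_pi)
    then have "u i \<notin> \<real>\<^sub>\<le>\<^sub>0" by (auto simp: complex_nonpos_Reals_iff)
    then have "isCont Arg (u i)" by (rule continuous_at_Arg)
    then show ?thesis using g(1) unfolding continuous_at_eps_delta dist_norm by (metis half_gt_zero real_norm_def)
  qed
  then obtain \<zeta> where z: "\<And>i. i \<in> I \<Longrightarrow> 0 < \<zeta> i" "\<And>i w. i \<in> I \<Longrightarrow> norm (w - u i) < \<zeta> i \<Longrightarrow> \<bar>Arg w - Arg (u i)\<bar> < g / 2"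
    by metis
  obtain \<eta> where eta: "\<eta> > 0" "\<And>i. i \<in> I \<Longrightarrow> \<eta> \<le> \<zeta> i" using finite_common_radius[of I \<zeta>] assms(1) z(1) by blast
  show ?thesis
  proof (intro exI[of _ \<eta>] conjI allI impI ballI eta(1))
    fix w assume "\<forall>i\<in>I. norm (w i - u i) < \<eta>"
    then have w: "\<bar>Arg (w i) - Arg (u i)\<bar> < g / 2" if "i \<in> I" for i using z(2)[OF that] eta(2)[OF that] that by force
    fix i assume i: "i \<in> I"
    have "g < dist (Arg (u i)) 0" "g < dist (Arg (u i)) pi" using i assms(2)[OF i] by (intro g(2); auto)+
    then show "0 < Arg (w i)" "Arg (w i) < pi" using w[OF i] assms(2)[OF i] g(1) unfolding dist_real_def by linarith+
    fix j assume j: "j \<in> I" "i < j"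
    have "g < dist (Arg (u i)) (Arg (u j))" using i j mono[OF i j] by (intro g(2)) auto
    then show "Arg (w i) < Arg (w j)" using w[OF i] w[OF j(1)] mono[OF i j] unfolding dist_real_def by linarith
  qed
qed

section \<open>Estimates for the punctures in a fibre with small x\<close>

lemma quadratic_roots:
  fixes \<alpha> \<beta> \<gamma> :: complex
  assumes "\<alpha> \<noteq> 0"
  shows "\<exists>y1 y2. \<forall>y. \<alpha> * y\<^sup>2 + \<beta> * y + \<gamma> = \<alpha> * (y - y1) * (y - y2)"
proof -
  define d where "d = csqrt (\<beta>\<^sup>2 - 4 * \<alpha> * \<gamma>)"
  have d: "d * d = \<beta> * \<beta> - 4 * \<alpha> * \<gamma>" by (simp add: d_def flip: power2_eq_square)
  define y1 y2 where "y1 = (- \<beta> + d) / (2 * \<alpha>)" and "y2 = (- \<beta> - d) / (2 * \<alpha>)"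
  have "\<alpha> * (y1 + y2) = - \<beta>" using assms by (simp add: y1_def y2_def field_simps)
  moreover have "\<alpha> * (y1 * y2) = \<gamma>"
  proof -
    have "\<alpha> * (y1 * y2) = (\<beta> * \<beta> - d * d) / (4 * \<alpha>)" using assms by (simp add: y1_def y2_def field_simps)
    then show ?thesis using assms by (simp add: d)
  qed
  moreover have "\<alpha> * (y - y1) * (y - y2) = \<alpha> * y\<^sup>2 - \<alpha> * (y1 + y2) * y + \<alpha> * (y1 * y2)" for y
    by (simp add: power2_eq_square algebra_simps)
  ultimately have "\<alpha> * y\<^sup>2 + \<beta> * y + \<gamma> = \<alpha> * (y - y1) * (y - y2)" for y by simp
  then show ?thesis by blast
qed

text \<open>One quadric at a time; the estimates depend on \<open>C\<close> only through the bound
  \<open>K\<close>, which makes them uniform in the index.\<close>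

locale near_degenerate =
  fixes A B C :: complex and K :: real
  assumes AB: "norm A < 1 / 4" "norm B < 1 / 4" and K: "norm C \<le> K"
begin

definition "Yp = (1 - C) / (1 + B)"
definition "Ym = (1 + C) / (1 - B)"

lemma lead: "1 + B \<noteq> 0" "1 - B \<noteq> 0" "3 / 4 \<le> norm (1 + B)" "3 / 4 \<le> norm (1 - B)" "1 / 2 \<le> norm (1 - B\<^sup>2)"
proof -
  show b: "1 + B \<noteq> 0" "1 - B \<noteq> 0" "3 / 4 \<le> norm (1 + B)" "3 / 4 \<le> norm (1 - B)"
    using AB(2) norm_triangle_ineq2[of 1 "- B"] norm_triangle_ineq2[of 1 B] by auto
  have "1 - B\<^sup>2 = (1 + B) * (1 - B)" by (simp add: power2_eq_square algebra_simps)
  moreover have "3 / 4 * (3 / 4) \<le> norm (1 + B) * norm (1 - B)" using b by (intro mult_mono) auto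
  ultimately show "1 / 2 \<le> norm (1 - B\<^sup>2)" by (simp add: norm_mult)
qed

lemma K_nonneg: "0 \<le> K" using K norm_ge_zero[of C] by linarith

lemma Y_bound: "norm Yp \<le> 4 / 3 + 4 / 3 * K" "norm Ym \<le> 4 / 3 + 4 / 3 * K"
proof -
  have "norm (1 - C) \<le> 1 + K" "norm (1 + C) \<le> 1 + K" using norm_triangle_ineq4[of 1 C] norm_triangle_ineq[of 1 C] K by auto
  moreover have "p / q \<le> 4 / 3 + 4 / 3 * K" if "p \<le> 1 + K" "3 / 4 \<le> q" for p q :: real
  proof -
    have "p / q \<le> (1 + K) / q" using that by (intro divide_right_mono) auto
    also have "\<dots> \<le> (1 + K) / (3 / 4)" using that K_nonneg by (intro divide_left_mono) auto
    finally show ?thesis by (simp add: field_simps)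
  qed
  ultimately show "norm Yp \<le> 4 / 3 + 4 / 3 * K" "norm Ym \<le> 4 / 3 + 4 / 3 * K"
    using lead(3,4) by (simp_all add: Yp_def Ym_def norm_divide)
qed

text \<open>At x = 0 the equation factors exactly as (1 - B^2) (y - Yp) (y - Ym). The difference is
  x times a factor that grows at most linearly in y.\<close>

lemma error_bound:
  assumes "norm x \<le> 1"
  shows "norm (conic x y 1 - (A * x + B * y + C)\<^sup>2 - (1 - B\<^sup>2) * (y - Yp) * (y - Ym)) \<le> norm x * (8 + 3 * norm y + K)"
proof -
  let ?w = "B * y + C"
  have p: "(1 + B) * Yp = 1 - C" "(1 - B) * Ym = 1 + C" using lead by (simp_all add: Yp_def Ym_def)
  have "(1 - B\<^sup>2) * (y - Yp) * (y - Ym) = ((1 + B) * y - (1 + B) * Yp) * ((1 - B) * y - (1 - B) * Ym)"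
    by (simp add: power2_eq_square algebra_simps)
  also have "\<dots> = (y - 1)\<^sup>2 - ?w\<^sup>2" unfolding p by (simp add: power2_eq_square algebra_simps)
  finally have "conic x y 1 - (A * x + B * y + C)\<^sup>2 - (1 - B\<^sup>2) * (y - Yp) * (y - Ym) = x * (x - 2 * (y - 1) - 4 - 2 * A * ?w - A * A * x)"
    unfolding conic_affine by (simp add: power2_eq_square algebra_simps)
  moreover have "norm (x - 2 * (y - 1) - 4 - 2 * A * ?w - A * A * x) \<le> 8 + 3 * norm y + K"
  proof -
    have w: "norm ?w \<le> norm y / 4 + K"
      using norm_triangle_ineq[of "B * y" C] K AB(2) mult_right_mono[of "norm B" "1 / 4" "norm y"] by (simp add: norm_mult)
    have "norm A * norm ?w \<le> 1 / 4 * (norm y / 4 + K)" using AB(1) w by (intro mult_mono) auto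
    then have "norm A * norm ?w \<le> norm y / 16 + K / 4" by simp
    moreover have "norm A * norm A \<le> 1 / 4 * 1" using AB(1) by (intro mult_mono) auto
    then have "norm A * norm A * norm x \<le> 1 / 4 * 1" using assms by (intro mult_mono) auto
    moreover have "norm (x - 2 * (y - 1) - 4 - 2 * A * ?w - A * A * x) \<le> norm x + norm (2 * (y - 1)) + 4 + norm (2 * A * ?w) + norm (A * A * x)"
      by (intro order.trans[OF norm_triangle_ineq4] add_mono order_refl) simp
    moreover have "norm (2 * (y - 1)) \<le> 2 * norm y + 2" unfolding norm_mult using norm_triangle_ineq4[of y 1] by simp
    moreover have "norm (2 * A * ?w) = 2 * (norm A * norm ?w)" "norm (A * A * x) = norm A * norm A * norm x" by (simp_all add: norm_mult)
    ultimately show ?thesis using assms K_nonneg norm_ge_zero[of y] by linarith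
  qed
  ultimately show ?thesis by (simp add: norm_mult mult_left_mono)
qed

text \<open>If y had distance at least r from both limits, the product would have size at least r |y
  - Yp| / 2, more than the error permits. The error grows with |y|, which is why one of the
  distances is kept in the estimate.\<close>

lemma root_close:
  assumes r: "0 < r" "r < 1" and x: "norm x < r\<^sup>2 / (400 * (1 + K))" and y: "conic x y 1 = (A * x + B * y + C)\<^sup>2"
  shows "norm (y - Yp) < r \<or> norm (y - Ym) < r"
proof (rule ccontr)
  assume "\<not> ?thesis"
  then have D: "r \<le> norm (y - Yp)" "r \<le> norm (y - Ym)" by auto
  let ?D = "norm (y - Yp)"
  have r2: "r\<^sup>2 \<le> r" using r by (simp add: power2_eq_square)
  have xK: "norm x * (400 * (1 + K)) < r\<^sup>2" using x K_nonneg by (simp add: pos_less_divide_eq)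
  have x1: "norm x * 400 + 400 * (norm x * K) < r\<^sup>2" using xK by (simp add: algebra_simps)
  have nn: "0 \<le> norm x * K" using K_nonneg by simp
  have "norm x \<le> 1" using x1 nn r2 r by linarith
  from error_bound[OF this, of y] have "norm (1 - B\<^sup>2) * (?D * norm (y - Ym)) \<le> norm x * (8 + 3 * norm y + K)"
    using y by (simp add: norm_mult mult.assoc)
  moreover have "1 / 2 * (?D * r) \<le> norm (1 - B\<^sup>2) * (?D * norm (y - Ym))"
    using lead(5) D r by (intro mult_mono) auto
  moreover have "norm y \<le> ?D + 4 / 3 + 4 / 3 * K" using norm_triangle_ineq[of "y - Yp" Yp] Y_bound(1) by simp
  then have "norm x * (8 + 3 * norm y + K) \<le> norm x * (12 + 5 * K + 3 * ?D)"
    using K_nonneg by (intro mult_left_mono) auto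
  moreover have "norm x * (12 + 5 * K + 3 * ?D) = 12 * norm x + 5 * (norm x * K) + 3 * (norm x * ?D)" by (simp add: algebra_simps)
  moreover have "norm x \<le> r / 400" using x1 nn r2 by linarith
  then have "norm x * ?D \<le> r / 400 * ?D" by (intro mult_right_mono) auto
  then have "norm x * ?D \<le> (?D * r) / 400" by (simp add: mult.commute)
  moreover have "r\<^sup>2 \<le> ?D * r" using D r by (simp add: power2_eq_square)
  moreover have "0 < r\<^sup>2" using r by simp
  ultimately show False using x1 nn norm_ge_zero[of x] by linarith
qed

text \<open>Each root is near some limit. That both are near the same one is refuted at the other
  limit: there the quadratic has size at most r^2 by the error bound, but at least 49 r^2 / 2 by its
  factorisation, since the limits are 8 r apart.\<close>

lemma roots_labelled:
  assumes r: "0 < r" "r < 1" and x: "norm x < r\<^sup>2 / (400 * (1 + K))" and sep: "8 * r < norm (Yp - Ym)"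
  shows "\<exists>yp ym. {yp, ym} = {y. conic x y 1 - (A * x + B * y + C)\<^sup>2 = 0} \<and> norm (yp - Yp) < r \<and> norm (ym - Ym) < r"
proof -
  define q where "q y = conic x y 1 - (A * x + B * y + C)\<^sup>2" for y
  have "1 - B\<^sup>2 \<noteq> 0" using lead(5) by auto
  moreover have "q y = (1 - B\<^sup>2) * y\<^sup>2 + (- 2 * (1 + x) - 2 * B * (A * x + C)) * y + ((1 + x)\<^sup>2 - 4 * x - (A * x + C)\<^sup>2)" for y
    unfolding q_def conic_affine by (simp add: power2_eq_square algebra_simps)
  ultimately obtain y1 y2 where q: "\<And>y. q y = (1 - B\<^sup>2) * (y - y1) * (y - y2)" using quadratic_roots by metis
  have set: "{y1, y2} = {y. q y = 0}" using \<open>1 - B\<^sup>2 \<noteq> 0\<close> by (auto simp: q)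
  have close: "norm (y - Yp) < r \<or> norm (y - Ym) < r" if "y \<in> {y1, y2}" for y
  proof -
    have "q y = 0" using that set by blast
    then show ?thesis using root_close[OF r x] by (simp add: q_def)
  qed
  have r2: "r\<^sup>2 \<le> r" using r by (simp add: power2_eq_square)
  have xK: "norm x * (400 * (1 + K)) < r\<^sup>2" using x K_nonneg by (simp add: pos_less_divide_eq)
  have x1: "norm x * 400 + 400 * (norm x * K) < r\<^sup>2" using xK by (simp add: algebra_simps)
  have nn: "0 \<le> norm x * K" using K_nonneg by simp
  have xle: "norm x \<le> 1" using x1 nn r2 r by linarith
  have both: False if Y: "Y = Yp \<and> Y' = Ym \<or> Y = Ym \<and> Y' = Yp" and near: "norm (y1 - Y) < r" "norm (y2 - Y) < r" for Y Y'
  proof -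
    have z: "(1 - B\<^sup>2) * (Y' - Yp) * (Y' - Ym) = 0" using Y by auto
    have "norm (q Y') \<le> norm x * (8 + 3 * norm Y' + K)" using error_bound[OF xle, of Y'] by (simp only: q_def z diff_0_right)
    also have "\<dots> \<le> norm x * (12 + 5 * K)" using Y Y_bound by (intro mult_left_mono) auto
    also have "\<dots> = 12 * norm x + 5 * (norm x * K)" by (simp add: algebra_simps)
    also have "\<dots> \<le> r\<^sup>2" using x1 nn norm_ge_zero[of x] by linarith
    finally have "norm (1 - B\<^sup>2) * (norm (Y' - y1) * norm (Y' - y2)) \<le> r\<^sup>2" by (simp add: q norm_mult mult.assoc)
    moreover have f: "8 * r < norm (Y' - Y)" using Y sep by (auto simp: norm_minus_commute)
    have "7 * r \<le> norm (Y' - y1)" "7 * r \<le> norm (Y' - y2)"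
      using near f norm_triangle_ineq[of "Y' - y1" "y1 - Y"] norm_triangle_ineq[of "Y' - y2" "y2 - Y"] by auto
    then have "1 / 2 * (7 * r * (7 * r)) \<le> norm (1 - B\<^sup>2) * (norm (Y' - y1) * norm (Y' - y2))"
      using lead(5) r by (intro mult_mono) auto
    moreover have "0 < r\<^sup>2" using r by simp
    ultimately show False by (simp add: power2_eq_square)
  qed
  have "norm (y1 - Yp) < r \<and> norm (y2 - Ym) < r \<or> norm (y2 - Yp) < r \<and> norm (y1 - Ym) < r"
    using close[of y1] close[of y2] both[of Yp Ym] both[of Ym Yp] by auto
  then show ?thesis using set unfolding q_def by (metis insert_commute)
qed

end

text \<open>Along the section |y| is at least 10 max (1, |x|) and at least 4 K, so y dominates: the
  conic is at least 0.6 |y|^2 in absolute value, the square of z_i at most 0.36 |y|^2.\<close>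

lemma section_in_fibre:
  assumes n: "n \<ge> 2" and AB: "\<And>i. i \<in> {1..n-2} \<Longrightarrow> norm (A i) < 1 / 4 \<and> norm (B i) < 1 / 4 \<and> norm (C i) \<le> K"
    and b: "10 + 4 * K \<le> norm b" and K: "0 \<le> K" and x: "x \<noteq> 0"
  shows "b * of_real (max 1 (norm x)) \<in> punctured_fibre n A B C x"
proof -
  define m where "m = max 1 (norm x)"
  define y where "y = b * of_real m"
  have m: "1 \<le> m" "norm x \<le> m" by (auto simp: m_def)
  have ny: "norm y = norm b * m" using m by (simp add: y_def norm_mult)
  have "(10 + 4 * K) * m \<le> norm y" unfolding ny using b m by (intro mult_right_mono) auto
  moreover have "K \<le> K * m" using m K mult_left_mono[of 1 m K] by simp
  moreover have "0 \<le> K * m" using m K by simp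
  ultimately have y10: "10 * m \<le> norm y" "4 * K \<le> norm y" "1 \<le> norm y" using m by (auto simp: algebra_simps)
  have t: "8 / 10 * norm y \<le> norm (y - 1 - x)"
    using norm_triangle_ineq2[of y "1 + x"] norm_triangle_ineq[of 1 x] m y10 by (simp add: algebra_simps)
  have t2: "64 / 100 * (norm y * norm y) \<le> norm ((y - 1 - x)\<^sup>2)"
    unfolding power2_eq_square norm_mult using mult_mono[OF t t] by simp
  have mm: "m \<le> norm y * norm y / 100"
  proof -
    have "10 * m * (10 * m) \<le> norm y * norm y" using y10 m by (intro mult_mono) auto
    moreover have "m * 1 \<le> m * m" using m by (intro mult_left_mono) auto
    ultimately show ?thesis by simp
  qed
  have "0 < norm y" using y10 by linarith
  then have pos: "0 < norm y * norm y" by simp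
  have c: "60 / 100 * (norm y * norm y) \<le> norm (conic x y 1)"
    using norm_triangle_ineq2[of "(y - 1 - x)\<^sup>2" "4 * x"] t2 mm m unfolding conic_affine by (simp add: norm_mult)
  have "(y - 1 - x)\<^sup>2 \<noteq> 4 * x" using c pos unfolding conic_affine by auto
  moreover have "conic x y 1 \<noteq> (A i * x + B i * y + C i)\<^sup>2" if i: "i \<in> {1..n-2}" for i
  proof
    assume e: "conic x y 1 = (A i * x + B i * y + C i)\<^sup>2"
    have "norm (A i) * norm x \<le> 1 / 4 * m" "norm (B i) * norm y \<le> 1 / 4 * norm y"
      using AB[OF i] m by (intro mult_mono; auto)+
    then have z: "norm (A i * x + B i * y + C i) \<le> 6 / 10 * norm y"
      using AB[OF i] y10 m norm_triangle_ineq[of "A i * x + B i * y" "C i"] norm_triangle_ineq[of "A i * x" "B i * y"]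
      by (simp add: norm_mult)
    have "norm (conic x y 1) \<le> 6 / 10 * norm y * (6 / 10 * norm y)"
      unfolding e power2_eq_square norm_mult using y10 by (intro mult_mono z) auto
    then show False using c pos by simp
  qed
  moreover have "y \<noteq> 0" using y10 by auto
  ultimately show ?thesis using x unfolding punctured_fibre_iff[OF n] y_def m_def by blast
qed

lemma csqrt_polar: "z \<noteq> 0 \<Longrightarrow> csqrt z = of_real (sqrt (norm z)) * cis (Arg z / 2)"
proof -
  assume z: "z \<noteq> 0"
  have "csqrt z = exp (of_real (ln (norm z) / 2) + \<i> * of_real (Arg z / 2))"
    unfolding csqrt_exp_Ln[OF z] Ln_Arg[OF z] by (simp add: add_divide_distrib)
  also have "\<dots> = of_real (exp (ln (norm z) / 2)) * cis (Arg z / 2)" by (simp only: exp_add cis_conv_exp exp_of_real)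
  also have "exp (ln (norm z) / 2) = sqrt (norm z)"
  proof (rule real_sqrt_unique[symmetric])
    show "(exp (ln (norm z) / 2))\<^sup>2 = norm z" using z by (simp flip: exp_double)
  qed simp
  finally show ?thesis .
qed

text \<open>The denominator is -2 sqrt a, so up to a positive factor the ratio is 1 + a - y turned
  by minus half the argument of a.\<close>

lemma Arg_ratio:
  assumes "a \<noteq> 0"
  shows "Arg ((y - (a + 1)) / ((1 - csqrt a)\<^sup>2 - (a + 1))) = Arg ((1 + a - y) * cis (- Arg a / 2))"
proof -
  have den: "(1 - csqrt a)\<^sup>2 - (a + 1) = - (2 * csqrt a)" by (simp add: power2_diff)
  have "(y - (a + 1)) / ((1 - csqrt a)\<^sup>2 - (a + 1)) = (1 + a - y) / (2 * csqrt a)"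
    unfolding den by (simp add: divide_simps)
  also have "\<dots> = of_real (1 / (2 * sqrt (norm a))) * ((1 + a - y) * cis (- Arg a / 2))"
    using assms by (simp add: csqrt_polar field_simps cis_mult flip: cis_inverse)
  finally show ?thesis using assms by (simp only:) (rule Arg_times_of_real, simp)
qed

lemma norm_cis_minus_one: "norm (cis t - 1) \<le> \<bar>t\<bar>"
  unfolding cis_conv_exp dist_exp_i_1 using abs_sin_x_le_abs_x[of "t / 2"] by simp

text \<open>The hypotheses concern 1 - Yp i and Ym i - 1, written as (C i + B i) / (1 + B i) and (C
  i + B i) / (1 - B i). They put the first family of limits below and the second above the real axis
  and make all limit points distinct; the arguments of 1 - Yp i also give the numbering of the
  punctures y_i^+.\<close>

lemma constants_exist:
  fixes n :: nat and A B C :: "nat \<Rightarrow> complex"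
  assumes n: "n \<ge> 2" and AB: "\<And>i. i \<in> {1..n-2} \<Longrightarrow> norm (A i) < 1 / 4" "\<And>i. i \<in> {1..n-2} \<Longrightarrow> norm (B i) < 1 / 4"
    and up: "\<And>i. i \<in> {1..n-2} \<Longrightarrow> 0 < Arg ((C i + B i) / (1 + B i)) \<and> Arg ((C i + B i) / (1 + B i)) < pi"
      "\<And>i j. i \<in> {1..n-2} \<Longrightarrow> j \<in> {1..n-2} \<Longrightarrow> i < j \<Longrightarrow> Arg ((C i + B i) / (1 + B i)) < Arg ((C j + B j) / (1 + B j))"
    and um: "\<And>i. i \<in> {1..n-2} \<Longrightarrow> 0 < Arg ((C i + B i) / (1 - B i)) \<and> Arg ((C i + B i) / (1 - B i)) < pi"
      "\<And>i j. i \<in> {1..n-2} \<Longrightarrow> j \<in> {1..n-2} \<Longrightarrow> i < j \<Longrightarrow> Arg ((C i + B i) / (1 - B i)) < Arg ((C j + B j) / (1 - B j))"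
  shows "\<exists>\<epsilon>>0. \<forall>a. 0 < norm a \<and> norm a < \<epsilon> \<and> - \<epsilon> < Arg a \<and> Arg a < 0 \<longrightarrow>
     (\<exists>r b s e q yp ym Q E g Bd. loop_setup n A B C r \<epsilon> b a s e q yp ym Q E g Bd)"
proof -
  let ?I = "{1..n-2}"
  let ?Yp = "\<lambda>i. (1 - C i) / (1 + B i)" and ?Ym = "\<lambda>i. (1 + C i) / (1 - B i)"
  let ?up = "\<lambda>i. (C i + B i) / (1 + B i)" and ?um = "\<lambda>i. (C i + B i) / (1 - B i)"
  let ?ds = "[0] @ map ?Yp [1..<n-1] @ [1] @ map ?Ym [1..<n-1]"
  let ?P = "set ?ds"
  define K where "K = (\<Sum>i\<in>?I. norm (C i))"
  have CK: "norm (C i) \<le> K" if "i \<in> ?I" for i unfolding K_def by (rule member_le_sum) (use that in auto)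
  have K: "0 \<le> K" by (simp add: K_def sum_nonneg)
  have nd: "near_degenerate (A i) (B i) (C i) K" if "i \<in> ?I" for i
    using AB CK that by unfold_locales auto
  note Y_eq = near_degenerate.Yp_def[OF nd] near_degenerate.Ym_def[OF nd]
  note lead = near_degenerate.lead[OF nd]
  have YU: "?Yp i = 1 - ?up i" "?Ym i = 1 + ?um i" if "i \<in> ?I" for i
    using lead(1,2)[OF that] by (simp_all add: field_simps)
  have Im: "0 < Im (?up i)" "0 < Im (?um i)" if "i \<in> ?I" for i
    using up(1)[OF that] um(1)[OF that] unfolding Arg_lt_pi by blast+
  have inI: "i \<in> ?I" if "i \<in> set [1..<n-1]" for i using that by auto
  have ImY: "Im (?Yp i) < 0" "0 < Im (?Ym i)" if "i \<in> ?I" for i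
    unfolding YU[OF that] using Im[OF that] by (simp_all only: minus_complex.sel plus_complex.sel one_complex.sel)
  have "inj_on ?Yp ?I"
  proof (rule linorder_inj_onI)
    fix i j assume "i < j" "i \<in> ?I" "j \<in> ?I"
    then show "?Yp i \<noteq> ?Yp j" using up(2)[of i j] unfolding YU[OF \<open>i \<in> ?I\<close>] YU[OF \<open>j \<in> ?I\<close>] by auto
  qed auto
  moreover have "inj_on ?Ym ?I"
  proof (rule linorder_inj_onI)
    fix i j assume "i < j" "i \<in> ?I" "j \<in> ?I"
    then show "?Ym i \<noteq> ?Ym j" using um(2)[of i j] unfolding YU[OF \<open>i \<in> ?I\<close>] YU[OF \<open>j \<in> ?I\<close>] by auto
  qed auto
  moreover have "?Yp i \<noteq> ?Ym j" "?Yp i \<noteq> 0" "?Yp i \<noteq> 1" "?Ym i \<noteq> 0" "?Ym i \<noteq> 1" if "i \<in> ?I" "j \<in> ?I" for i j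
    using ImY[OF that(1)] ImY[OF that(2)] by (metis less_asym, metis less_irrefl zero_complex.sel(2), metis less_irrefl one_complex.sel(2),
       metis less_irrefl zero_complex.sel(2), metis less_irrefl one_complex.sel(2))
  moreover have sI: "set [1..<n-1] = ?I" using n by auto
  ultimately have distinct: "distinct ?ds"
    by (simp only: distinct_append distinct_map sI set_map set_append list.set distinct.simps distinct_upt) (auto simp: image_iff)
  have "finite ?P" "?P \<noteq> {}" by auto
  from planar_system[OF this] obtain r0 where r0: "0 < r0" and plane: "\<And>r B. 0 < r \<Longrightarrow> r < r0 \<Longrightarrow> \<exists>b cs l g. let S = {y. \<forall>c\<in>?P. r \<le> dist c y}; G = fundamental_group S b in
     B \<le> norm b \<and> b \<in> S \<and> set cs = ?P \<and> distinct cs \<and> (\<forall>c\<in>?P. lasso_class S b c r (l c)) \<and> g \<in> loops_at S b \<and>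
     path_image g \<subseteq> {y. B \<le> norm y} \<and> winding_number g 0 = 1 \<and>
     foldr (mult G) (map l cs) (one G) \<otimes>\<^bsub>G\<^esub> loop_class S g = one G"
    by blast
  obtain g0 where g0: "0 < g0" "\<And>c c'. c \<in> ?P \<Longrightarrow> c' \<in> ?P \<Longrightarrow> c \<noteq> c' \<Longrightarrow> g0 < dist c c'"
    using finite_separated[OF \<open>finite ?P\<close>] by blast
  obtain \<zeta> where \<zeta>: "0 < \<zeta>" "\<forall>w. (\<forall>i\<in>?I. norm (w i - ?up i) < \<zeta>) \<longrightarrow> (\<forall>i\<in>?I. 0 < Arg (w i) \<and> Arg (w i) < pi) \<and>
     (\<forall>i\<in>?I. \<forall>j\<in>?I. i < j \<longrightarrow> Arg (w i) < Arg (w j))"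
    using Arg_stable[of ?I ?up, OF finite_atLeastAtMost up] by blast
  \<comment> \<open>Bounded by r0 for the system of loops, by g0 / 8 for the separation of the limit
    points, and by \<zeta> / 4 so that replacing limits by actual punctures preserves the order of
    the arguments.\<close>
  define r where "r = min (min (r0 / 2) (1 / 2)) (min (g0 / 8) (\<zeta> / 4))"
  have r: "0 < r" "r < r0" "r < 1" "8 * r \<le> g0" "4 * r \<le> \<zeta>" using r0 g0(1) \<zeta>(1) by (auto simp: r_def)
  let ?S = "{y. \<forall>c\<in>?P. r \<le> dist c y}"
  \<comment> \<open>The lower bound for |b| under which \<open>section_in_fibre\<close> holds; it
    also exceeds |c| + r for every limit point c.\<close>
  define Bd where "Bd = 10 + 4 * K"
  obtain b cs l g where b: "Bd \<le> norm b" "b \<in> ?S" and cs: "set cs = ?P" "distinct cs" and l: "\<And>c. c \<in> ?P \<Longrightarrow> lasso_class ?S b c r (l c)"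
    and g: "g \<in> loops_at ?S b" "path_image g \<subseteq> {y. Bd \<le> norm y}" "winding_number g 0 = 1"
    and prod: "foldr (mult (fundamental_group ?S b)) (map l cs) (one (fundamental_group ?S b)) \<otimes>\<^bsub>fundamental_group ?S b\<^esub> loop_class ?S g = one (fundamental_group ?S b)"
    using plane[OF r(1,2), of Bd] unfolding Let_def by blast
  obtain Q E where QE: "\<And>c. c \<in> ?P \<Longrightarrow> path_in ?S (Q c) \<and> pathstart (Q c) = b \<and> pathfinish (Q c) = c + E c \<and> norm (E c) = r"
    and prod': "foldr (mult (fundamental_group ?S b)) (map (\<lambda>c. loop_class ?S (lasso (Q c) (circ c (E c)))) ?ds) (one (fundamental_group ?S b)) =
       foldr (mult (fundamental_group ?S b)) (map l cs) (one (fundamental_group ?S b))"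
    using reordered_lassos[of b ?S cs r l ?ds] b(2) l cs distinct by (metis (no_types, lifting))
  \<comment> \<open>The bound that \<open>root_close\<close> asks for; it lies below the r^2 / 400
    of \<open>cut_data\<close>.\<close>
  define \<epsilon> where "\<epsilon> = r\<^sup>2 / (400 * (1 + K))"
  have "r\<^sup>2 / (400 * (1 + K)) \<le> r\<^sup>2 / 400" by (rule divide_left_mono) (use K in simp_all)
  then have \<epsilon>: "0 < \<epsilon>" "\<epsilon> \<le> r\<^sup>2 / 400" using r(1) K by (simp_all add: \<epsilon>_def)
  have sep: "8 * r < dist c c'" if "c \<in> ?P" "c' \<in> ?P" "c \<noteq> c'" for c c' using g0(2)[OF that] r(4) by linarith
  have YP: "?Yp i \<in> ?P" "?Ym i \<in> ?P" if "i \<in> ?I" for i using that sI by auto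
  have cut: "cut_data n A B C r \<epsilon> b"
  proof (unfold_locales; (intro n AB distinct r \<epsilon> sep b(2); assumption)?)
    show "dist (?Yp i) y < r \<or> dist (?Ym i) y < r" if "norm x < \<epsilon>" "i \<in> ?I" "conic x y 1 = (A i * x + B i * y + C i)\<^sup>2" for x i y
      using near_degenerate.root_close[OF nd[OF that(2)] r(1,3) that(1)[unfolded \<epsilon>_def] that(3)]
      unfolding Y_eq[OF that(2)] by (simp add: dist_norm norm_minus_commute)
    show "b * of_real (max 1 (norm x)) \<in> punctured_fibre n A B C x" if "x \<noteq> 0" for x
      using AB CK b(1) K n that by (intro section_in_fibre[where K = K]) (auto simp: Bd_def)
  qed
  have far: "{y::complex. Bd \<le> norm y} \<subseteq> ?S"
  proof
    fix y :: complex assume "y \<in> {y. Bd \<le> norm y}"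
    then have y: "10 + 4 * K \<le> norm y" by (simp add: Bd_def)
    have "norm c \<le> 4 / 3 + 4 / 3 * K" if c: "c \<in> ?P" for c
    proof -
      consider "c = 0" | "c = 1" | i where "i \<in> ?I" "c = ?Yp i" | i where "i \<in> ?I" "c = ?Ym i"
        using c unfolding set_append set_map sI by auto
      then show ?thesis
      proof cases
        case 3 then show ?thesis using near_degenerate.Y_bound(1)[OF nd[OF 3(1)]] unfolding Y_eq[OF 3(1)] by simp
      next
        case 4 then show ?thesis using near_degenerate.Y_bound(2)[OF nd[OF 4(1)]] unfolding Y_eq[OF 4(1)] by simp
      qed (use K in auto)
    qed
    then have "r \<le> dist c y" if "c \<in> ?P" for c
      using that y r(3) K norm_triangle_ineq2[of y c] by (fastforce simp: dist_norm norm_minus_commute)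
    then show "y \<in> ?S" by blast
  qed
  show ?thesis
  proof (rule exI[of _ \<epsilon>], intro conjI allI impI \<epsilon>(1))
    fix a :: complex assume "0 < norm a \<and> norm a < \<epsilon> \<and> - \<epsilon> < Arg a \<and> Arg a < 0"
    then have a: "0 < norm a" "norm a < \<epsilon>" "\<bar>Arg a\<bar> < \<epsilon>" "a \<noteq> 0" by auto
    define roots where "roots i p \<longleftrightarrow> {fst p, snd p} = {y. conic a y 1 - (A i * a + B i * y + C i)\<^sup>2 = 0} \<and>
      norm (fst p - ?Yp i) < r \<and> norm (snd p - ?Ym i) < r" for i p
    have "\<exists>p. roots i p" if i: "i \<in> ?I" for i
    proof -
      have "?Yp i \<noteq> ?Ym i" using ImY[OF i] by (metis less_asym)
      then have "8 * r < norm (?Yp i - ?Ym i)" using sep[OF YP[OF i]] by (simp add: dist_norm)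
      then show ?thesis
        using near_degenerate.roots_labelled[OF nd[OF i] r(1,3) a(2)[unfolded \<epsilon>_def]] unfolding Y_eq[OF i] roots_def by auto
    qed
    then have "\<forall>i\<in>?I. \<exists>p. roots i p" by blast
    from bchoice[OF this] obtain pr where pr: "\<And>i. i \<in> ?I \<Longrightarrow> roots i (pr i)" by blast
    define yp ym where "yp i = fst (pr i)" and "ym i = snd (pr i)" for i
    have pts: "\<And>i. i \<in> ?I \<Longrightarrow> {yp i, ym i} = {y. conic a y 1 - (A i * a + B i * y + C i)\<^sup>2 = 0}"
       "\<And>i. i \<in> ?I \<Longrightarrow> norm (yp i - ?Yp i) < r" "\<And>i. i \<in> ?I \<Longrightarrow> norm (ym i - ?Ym i) < r"
      using pr unfolding roots_def yp_def ym_def by blast+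
    \<comment> \<open>By \<open>Arg_ratio\<close> these numbers have the arguments that are to be
      ordered. They are close to 1 - Yp i because a, its argument and the distance of
      \<open>yp i\<close> from its limit are small.\<close>
    define w where "w i = (1 + a - yp i) * cis (- Arg a / 2)" for i
    have "norm (w i - ?up i) < \<zeta>" if i: "i \<in> ?I" for i
    proof -
      let ?v = "1 + a - yp i"
      have "norm (?v - ?up i) \<le> norm a + norm (yp i - ?Yp i)"
      proof -
        have "?v - ?up i = a - (yp i - ?Yp i)" unfolding YU(1)[OF i] by simp
        then show ?thesis using norm_triangle_ineq4[of a "yp i - ?Yp i"] by (simp only:)
      qed
      then have v: "norm (?v - ?up i) \<le> \<epsilon> + r" using a(2) pts(2)[OF i] by simp
      have "norm (?up i) \<le> 1 + norm (?Yp i)" using norm_triangle_ineq4[of 1 "?Yp i"] YU(1)[OF i] by simp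
      then have "norm (?up i) \<le> 7 / 3 + 4 / 3 * K"
        using near_degenerate.Y_bound(1)[OF nd[OF i]] unfolding Y_eq[OF i] by linarith
      moreover have e1: "\<epsilon> < 1" using \<epsilon>(2) r power_le_one[of r 2] by simp
      ultimately have nv: "norm ?v \<le> 5 * (1 + K)" using norm_triangle_ineq[of "?v - ?up i" "?up i"] v r K by simp
      have "norm (cis (- Arg a / 2) - 1) \<le> \<epsilon>" using norm_cis_minus_one[of "- Arg a / 2"] a(3) by simp
      then have "norm ?v * norm (cis (- Arg a / 2) - 1) \<le> 5 * (1 + K) * \<epsilon>" using nv K by (intro mult_mono) auto
      also have "\<dots> = r\<^sup>2 / 80" using K by (simp add: \<epsilon>_def field_simps)
      finally have rot: "norm (?v * (cis (- Arg a / 2) - 1)) \<le> r\<^sup>2 / 80" by (simp add: norm_mult)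
      have r2: "r\<^sup>2 \<le> r" using r by (simp add: power2_eq_square)
      have "w i - ?up i = ?v * (cis (- Arg a / 2) - 1) + (?v - ?up i)" by (simp add: w_def algebra_simps)
      then have "norm (w i - ?up i) \<le> r\<^sup>2 / 80 + (\<epsilon> + r)" using norm_triangle_ineq rot v by (smt (verit))
      then show ?thesis using r2 \<epsilon>(2) r by linarith
    qed
    from \<zeta>(2)[THEN spec, THEN mp, OF ballI[OF this]] have args: "\<And>i. i \<in> ?I \<Longrightarrow> 0 < Arg (w i)" "\<And>i. i \<in> ?I \<Longrightarrow> Arg (w i) < pi"
      "\<And>i j. i \<in> ?I \<Longrightarrow> j \<in> ?I \<Longrightarrow> i < j \<Longrightarrow> Arg (w i) < Arg (w j)" by blast+
    have ratio: "Arg ((yp i - (a + 1)) / ((1 - csqrt a)\<^sup>2 - (a + 1))) = Arg (w i)" for i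
      unfolding w_def by (rule Arg_ratio[OF a(4)])
    have P1: "1 \<in> ?P" by simp
    have "branch_loops n A B C r \<epsilon> b a (csqrt a) (E 1) (Q 1)"
      by (intro branch_loops.intro cut branch_loops_axioms.intro a(1,2)) (use QE[OF P1] in auto)
    then have "loop_setup n A B C r \<epsilon> b a (csqrt a) (E 1) (Q 1) yp ym Q E g Bd"
    proof (intro loop_setup.intro loop_setup_axioms.intro refl)
      show "0 < Bd" using K by (simp add: Bd_def)
      show "foldr (mult (fundamental_group ?S b)) (map (\<lambda>c. loop_class ?S (lasso (Q c) (circ c (E c)))) ?ds) (one (fundamental_group ?S b)) \<otimes>\<^bsub>fundamental_group ?S b\<^esub> loop_class ?S g = one (fundamental_group ?S b)"
        unfolding prod' by (rule prod)
      show "g \<in> loops_at ?S b" "path_image g \<subseteq> {y. Bd \<le> norm y}" "winding_number g 0 = 1" "Bd \<le> norm b" "{y. Bd \<le> norm y} \<subseteq> ?S"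
        by (fact g b(1) far)+
      show "path_in ?S (Q c)" "pathstart (Q c) = b" "pathfinish (Q c) = c + E c" "norm (E c) = r" if "c \<in> ?P" for c
        using QE[OF that] by blast+
    qed (simp_all only: ratio args pts)
    then show "\<exists>r b s e q yp ym Q E g Bd. loop_setup n A B C r \<epsilon> b a s e q yp ym Q E g Bd" by blast
  qed
qed

section \<open>From the normalised constants to small coefficients of the hyperplanes\<close>

theorem theorem1p3:
  fixes n :: nat and C :: "nat \<Rightarrow> complex"
  assumes "n \<ge> 2"
    and "normalised_constants n C"
  shows
    "\<exists>\<delta>>0. \<forall>A B :: nat \<Rightarrow> complex.
       (\<forall>i\<in>{1..n-2}. 0 < norm (A i) \<and> norm (A i) < \<delta> \<and> 0 < norm (B i) \<and> norm (B i) < \<delta>) \<longrightarrow>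
       (\<exists>\<epsilon>>0. \<forall>a :: complex. 0 < norm a \<and> norm a < \<epsilon> \<and> - \<epsilon> < Arg a \<and> Arg a < 0 \<longrightarrow>
          (\<exists>S. standard_loops n A B C a S \<and>
             generically n (\<lambda>lam.
               \<exists>\<rho>. explicit_representation n A B C a S lam \<rho> \<and>
                   conjugate_on
                     (carrier (fundamental_group (divisor_complement n) (base_point n A B C a S)))
                     (monodromy n lam) \<rho> \<and>
                   virtually_abelian (divisor_complement n) (base_point n A B C a S) \<rho> \<and>
                   \<rho> ` carrier (fundamental_group (divisor_complement n) (base_point n A B C a S))
                     \<subseteq> D_infinity)))"
proof -
  let ?I = "{1..n-2}"
  define K where "K = (\<Sum>i\<in>?I. norm (C i))"
  have CK: "norm (C i) \<le> K" if "i \<in> ?I" for i unfolding K_def by (rule member_le_sum) (use that in auto)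
  have K: "0 \<le> K" by (simp add: K_def sum_nonneg)
  obtain \<zeta> where \<zeta>: "0 < \<zeta>" "\<forall>w. (\<forall>i\<in>?I. norm (w i - C i) < \<zeta>) \<longrightarrow> (\<forall>i\<in>?I. 0 < Arg (w i) \<and> Arg (w i) < pi) \<and>
     (\<forall>i\<in>?I. \<forall>j\<in>?I. i < j \<longrightarrow> Arg (w i) < Arg (w j))"
  proof -
    have "0 < Arg (C i) \<and> Arg (C i) < pi" "j \<in> ?I \<Longrightarrow> i < j \<Longrightarrow> Arg (C i) < Arg (C j)" if "i \<in> ?I" for i j
      using assms(2) that unfolding normalised_constants_def by blast+
    from Arg_stable[of ?I C, OF finite_atLeastAtMost this] show thesis using that by blast
  qed
  \<comment> \<open>For \<sigma> = \<beta> or \<sigma> = - \<beta> the difference (c + \<beta>) / (1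
    + \<sigma>) - c equals (\<beta> - \<sigma> c) / (1 + \<sigma>), at most 4/3 |\<beta>| (1 + K);
    the 2 in the denominator absorbs the 4/3.\<close>
  define \<delta> where "\<delta> = min (1 / 4) (\<zeta> / (2 * (1 + K)))"
  have close: "norm ((c + \<beta>) / (1 + \<sigma>) - c) < \<zeta>"
    if "norm c \<le> K" "norm \<beta> < \<delta>" "\<sigma> = \<beta> \<or> \<sigma> = - \<beta>" for c \<beta> \<sigma> :: complex
  proof -
    have ns: "norm \<sigma> = norm \<beta>" using that(3) by auto
    have d: "norm \<beta> < 1 / 4" "norm \<beta> * (1 + K) < \<zeta> / 2" using that(2) K by (auto simp: \<delta>_def pos_less_divide_eq field_simps)
    have s: "3 / 4 \<le> norm (1 + \<sigma>)" using norm_triangle_ineq2[of 1 "- \<sigma>"] ns d by simp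
    then have "1 + \<sigma> \<noteq> 0" by auto
    then have "(c + \<beta>) / (1 + \<sigma>) - c = (\<beta> - \<sigma> * c) / (1 + \<sigma>)" by (simp add: field_simps)
    then have "norm ((c + \<beta>) / (1 + \<sigma>) - c) = norm (\<beta> - \<sigma> * c) / norm (1 + \<sigma>)" by (simp only: norm_divide)
    moreover have "norm (\<beta> - \<sigma> * c) \<le> norm \<beta> * (1 + K)"
      using norm_triangle_ineq4[of \<beta> "\<sigma> * c"] ns mult_left_mono[OF that(1), of "norm \<beta>"] by (simp add: norm_mult algebra_simps)
    moreover have "norm (\<beta> - \<sigma> * c) / norm (1 + \<sigma>) \<le> 4 / 3 * norm (\<beta> - \<sigma> * c)"
    proof -
      have "norm (\<beta> - \<sigma> * c) / norm (1 + \<sigma>) \<le> norm (\<beta> - \<sigma> * c) / (3 / 4)"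
        using s by (intro divide_left_mono) auto
      then show ?thesis by simp
    qed
    ultimately show ?thesis using d(2) \<zeta>(1) by linarith
  qed
  show ?thesis
  proof (rule exI[of _ \<delta>], intro conjI allI impI)
    show "0 < \<delta>" using \<zeta>(1) K by (simp add: \<delta>_def)
    fix A B :: "nat \<Rightarrow> complex"
    assume *: "\<forall>i\<in>?I. 0 < norm (A i) \<and> norm (A i) < \<delta> \<and> 0 < norm (B i) \<and> norm (B i) < \<delta>"
    have AB: "norm (A i) < 1 / 4" "norm (B i) < 1 / 4" if "i \<in> ?I" for i using * that by (auto simp: \<delta>_def)
    have "norm ((C i + B i) / (1 + B i) - C i) < \<zeta>" "norm ((C i + B i) / (1 - B i) - C i) < \<zeta>" if "i \<in> ?I" for i
      using close[OF CK[OF that], of "B i" "B i"] close[OF CK[OF that], of "B i" "- B i"] * that by auto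
    note cl = \<zeta>(2)[THEN spec, of "\<lambda>i. (C i + B i) / (1 + B i)", THEN mp, OF ballI[OF this(1)]]
      \<zeta>(2)[THEN spec, of "\<lambda>i. (C i + B i) / (1 - B i)", THEN mp, OF ballI[OF this(2)]]
    obtain \<epsilon> where \<epsilon>: "\<epsilon> > 0" "\<And>a. 0 < norm a \<and> norm a < \<epsilon> \<and> - \<epsilon> < Arg a \<and> Arg a < 0 \<Longrightarrow>
       \<exists>r b s e q yp ym Q E g Bd. loop_setup n A B C r \<epsilon> b a s e q yp ym Q E g Bd"
      using constants_exist[of n A B C] assms(1) AB cl by blast
    \<comment> \<open>The witness polynomial is the constant 1.\<close>
    have gen: "generically n R" if "\<And>lam. R lam" for R
      unfolding generically_def using that by (intro bexI[of _ "\<lambda>_. 1"]) (auto intro: polynomial_functions.const)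
    show "\<exists>\<epsilon>>0. \<forall>a :: complex. 0 < norm a \<and> norm a < \<epsilon> \<and> - \<epsilon> < Arg a \<and> Arg a < 0 \<longrightarrow>
          (\<exists>S. standard_loops n A B C a S \<and>
             generically n (\<lambda>lam.
               \<exists>\<rho>. explicit_representation n A B C a S lam \<rho> \<and>
                   conjugate_on
                     (carrier (fundamental_group (divisor_complement n) (base_point n A B C a S)))
                     (monodromy n lam) \<rho> \<and>
                   virtually_abelian (divisor_complement n) (base_point n A B C a S) \<rho> \<and>
                   \<rho> ` carrier (fundamental_group (divisor_complement n) (base_point n A B C a S))
                     \<subseteq> D_infinity))"
    proof (rule exI[of _ \<epsilon>], intro conjI allI impI \<epsilon>(1))
      fix a assume "0 < norm a \<and> norm a < \<epsilon> \<and> - \<epsilon> < Arg a \<and> Arg a < 0"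
      from \<epsilon>(2)[OF this] obtain r b s e q yp ym Q E g Bd where "loop_setup n A B C r \<epsilon> b a s e q yp ym Q E g Bd" by blast
      from loop_setup.standard_loops_representation[OF this] show "\<exists>S. standard_loops n A B C a S \<and>
             generically n (\<lambda>lam.
               \<exists>\<rho>. explicit_representation n A B C a S lam \<rho> \<and>
                   conjugate_on
                     (carrier (fundamental_group (divisor_complement n) (base_point n A B C a S)))
                     (monodromy n lam) \<rho> \<and>
                   virtually_abelian (divisor_complement n) (base_point n A B C a S) \<rho> \<and>
                   \<rho> ` carrier (fundamental_group (divisor_complement n) (base_point n A B C a S))
                     \<subseteq> D_infinity)"
        using gen by (metis (no_types, lifting))
    qed
  qed
qed

end
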